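(* Let $X$ be a compact metrizable space and let $G$ be an abelian group with a Polish cover. Then there is a natural short exact sequence of (graded) abelian groups with a Polish cover $$0\rightarrow\mathrm{Ext}(\mathrm{H}^{\bullet+1}(X),G)\rightarrow\mathrm{H}_{\bullet}(X;G)\rightarrow\mathrm{Hom}(\mathrm{H}^{\bullet}(X),G)\rightarrow 0$$ which splits (unnaturally). Here $\mathrm{H}_\bullet(X;G)$ is Steenrod homology and $\mathrm{H}^\bullet(X)$ is integral Čech cohomology.
   Context: An abelian group with a Polish cover is a quotient $G=\hat G/N$ where $\hat G$ is an abelian Polish group and $N$ is a Polishable subgroup (a subgroup that is Polish in a topology making the inclusion continuous). Morphisms are group homomorphisms induced by Borel functions between the covers. These form a countably complete abelian category $\mathcal{M}$ (equivalent to the left heart $\mathrm{LH}(\mathbf{PAb})$ of abelian Polish groups), with products $\prod_i\hat G_i/\prod_i N_i$. $\mathrm{Hom}$ and $\mathrm{Ext}$. For $G$ in $\mathcal{M}$ and a countable set $I$, $\mathrm{Hom}(\mathbb{Z}^{(I)},G):=\prod_I G$ in $\mathcal{M}$, with the obvious (matrix) action of homomorphisms between free groups. For a countable abelian group $C$ with a resolution $0\to R\to F\to C\to0$ by countable free groups, $\mathrm{Hom}(C,G)$ and $\mathrm{Ext}(C,G)$ are the kernel and cokernel in $\mathcal{M}$ of $\mathrm{Hom}(F,G)\to\mathrm{Hom}(R,G)$. Steenrod homology. Choose an increasing cofinal (under refinement) sequence $(\mathcal U_m)_{m\in\omega}$ of finite open covers of $X$, and refinement maps $\mathcal U_{m+1}\to\mathcal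 U_m$. Let $N(\mathcal U_m)$ be the nerve, and $C^\bullet(N(\mathcal U_m))$ its complex of ordered integral simplicial cochains (dual of the free group on tuples $(v_0,\dots,v_n)$ with $\{v_0,\dots,v_n\}$ a simplex), a complex of finitely generated free abelian groups. For an inductive sequence of complexes $(A_{(\ell)},\eta)$, $\mathrm{hocolim}$ is the complex with degree-$n$ term $\bigoplus_\ell A^{n+1}_{(\ell)}\oplus\bigoplus_\ell A^n_{(\ell)}$ (writing $we_{\ell,\ell+1}$, $ze_\ell$ for elements of the summands) and $\delta(ze_\ell)=(\delta z)e_\ell$, $\delta(we_{\ell,\ell+1})=(\delta w)e_{\ell,\ell+1}+(-1)^n(we_\ell-\eta_{(\ell+1,\ell)}(w)e_{\ell+1})$. Put $C^\bullet(X)=\mathrm{hocolim}_m C^\bullet(N(\mathcal U_m))$, a complex of countable free abelian groups, which yields a functor from compact Polish spaces to the derived category (contravariant). $\mathrm{H}^\bullet(X)$ is the cohomology of $C^\bullet(X)$, and $\mathrm{H}_\bullet(X;G)$ is the homology in $\mathcal{M}$ of the complex $C_\bullet(X;G)$ with $C_n(X;G)=\mathrm{Hom}(C^n(X),G)$. Naturality is with respect to continuous maps of $X$. *)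

theory Defs
  imports "HOL-Analysis.Analysis" "HOL-Algebra.Free_Abelian_Groups"
begin

section \<open>Abelian groups with a Polish cover\<close>

text \<open>Abelian groups are HOL-Algebra groups, written multiplicatively.\<close>

definition polish_abelian_group :: "'g monoid \<Rightarrow> 'g topology \<Rightarrow> bool" where
  "polish_abelian_group G T \<longleftrightarrow>
     comm_group G \<and> topspace T = carrier G \<and>
     completely_metrizable_space T \<and> second_countable T \<and>
     continuous_map (prod_topology T T) T (\<lambda>(x, y). x \<otimes>\<^bsub>G\<^esub> y) \<and>
     continuous_map T T (\<lambda>x. inv\<^bsub>G\<^esub> x)"

definition borel_of :: "'g topology \<Rightarrow> 'g measure" where
  "borel_of T = sigma (topspace T) {U. openin T U}"

text \<open>
  A quotient of an abelian Polish group by a Polishable subgroup.  The Polish group topology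
  of the subgroup, which is unique, is carried as data; the subgroup itself is its underlying set.
\<close>

record 'g cover_group =
  cover :: "'g monoid"
  cover_top :: "'g topology"
  sub_top :: "'g topology"

abbreviation sub_set :: "'g cover_group \<Rightarrow> 'g set" where
  "sub_set A \<equiv> topspace (sub_top A)"

definition polish_cover_group :: "'g cover_group \<Rightarrow> bool" where
  "polish_cover_group A \<longleftrightarrow>
     polish_abelian_group (cover A) (cover_top A) \<and>
     subgroup (sub_set A) (cover A) \<and>
     polish_abelian_group ((cover A)\<lparr>carrier := sub_set A\<rparr>) (sub_top A) \<and>
     continuous_map (sub_top A) (cover_top A) (\<lambda>x. x)"

definition quot :: "'g cover_group \<Rightarrow> 'g set monoid" where
  "quot A = cover A Mod sub_set A"

abbreviation coset_of :: "'g cover_group \<Rightarrow> 'g \<Rightarrow> 'g set" where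
  "coset_of A x \<equiv> sub_set A #>\<^bsub>cover A\<^esub> x"

definition pc_mor :: "'g cover_group \<Rightarrow> 'h cover_group \<Rightarrow> ('g set \<Rightarrow> 'h set) set" where
  "pc_mor A B = {\<phi> \<in> hom (quot A) (quot B).
     \<exists>f \<in> measurable (borel_of (cover_top A)) (borel_of (cover_top B)).
       \<forall>x \<in> carrier (cover A). \<phi> (coset_of A x) = coset_of B (f x)}"

definition pc_iso :: "'g cover_group \<Rightarrow> 'h cover_group \<Rightarrow> ('g set \<Rightarrow> 'h set) set" where
  "pc_iso A B = {\<phi> \<in> pc_mor A B. \<exists>\<psi> \<in> pc_mor B A.
     (\<forall>c \<in> carrier (quot A). \<psi> (\<phi> c) = c) \<and> (\<forall>c \<in> carrier (quot B). \<phi> (\<psi> c) = c)}"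

text \<open>
  The kernel of \<open>p\<close> is the preimage of the subgroup under a Borel lift, in its Polish
  topology, modulo the subgroup of the domain; \<open>i\<close> is a kernel of \<open>p\<close> if it
  corestricts to an isomorphism onto it.  The cosets of \<open>K\<close> below are cosets of \<open>B\<close>.
\<close>

definition is_pc_kernel ::
  "'g cover_group \<Rightarrow> 'h cover_group \<Rightarrow> 'k cover_group \<Rightarrow> ('g set \<Rightarrow> 'h set) \<Rightarrow> ('h set \<Rightarrow> 'k set) \<Rightarrow> bool" where
  "is_pc_kernel A B C i p \<longleftrightarrow> (\<exists>K.
     polish_cover_group K \<and>
     cover K = (cover B)\<lparr>carrier := {x \<in> carrier (cover B). p (coset_of B x) = sub_set C}\<rparr> \<and>
     continuous_map (cover_top K) (cover_top B) (\<lambda>x. x) \<and>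
     sub_top K = sub_top B \<and>
     i \<in> pc_iso A K)"

text \<open>
  Dually, the cokernel of \<open>i\<close> has the cover of the codomain, modulo the union of the cosets in
  the image of \<open>i\<close>, in its Polish topology.
\<close>

definition is_pc_cokernel ::
  "'g cover_group \<Rightarrow> 'h cover_group \<Rightarrow> 'k cover_group \<Rightarrow> ('g set \<Rightarrow> 'h set) \<Rightarrow> ('h set \<Rightarrow> 'k set) \<Rightarrow> bool" where
  "is_pc_cokernel A B C i p \<longleftrightarrow> (\<exists>Q.
     polish_cover_group Q \<and>
     cover Q = cover B \<and> cover_top Q = cover_top B \<and>
     sub_set Q = \<Union> (i ` carrier (quot A)) \<and>
     (\<exists>\<theta> \<in> pc_iso Q C. \<forall>x \<in> carrier (cover B). p (coset_of B x) = \<theta> (coset_of Q x)))"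

definition pc_short_exact ::
  "'g cover_group \<Rightarrow> 'h cover_group \<Rightarrow> 'k cover_group \<Rightarrow> ('g set \<Rightarrow> 'h set) \<Rightarrow> ('h set \<Rightarrow> 'k set) \<Rightarrow> bool" where
  "pc_short_exact A B C i p \<longleftrightarrow>
     polish_cover_group A \<and> polish_cover_group B \<and> polish_cover_group C \<and>
     i \<in> pc_mor A B \<and> p \<in> pc_mor B C \<and>
     is_pc_kernel A B C i p \<and> is_pc_cokernel A B C i p"

definition pc_splits :: "'h cover_group \<Rightarrow> 'k cover_group \<Rightarrow> ('h set \<Rightarrow> 'k set) \<Rightarrow> bool" where
  "pc_splits B C p \<longleftrightarrow> (\<exists>s \<in> pc_mor C B. \<forall>c \<in> carrier (quot C). p (s c) = c)"

text \<open>
  Kernel and cokernel of the morphism induced by a continuous homomorphism \<open>d\<close> of the covers.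
  The first carries the coarsest topology making the inclusion into \<open>cover A\<close> and \<open>d\<close>, as a
  map to the Polish group \<open>sub_set B\<close>, continuous; in the second, the subgroup
  \<open>d(cover A) + sub_set B\<close> carries the quotient topology from \<open>cover A \<times> sub_set B\<close>.
\<close>

definition kernel_pc :: "'g cover_group \<Rightarrow> 'h cover_group \<Rightarrow> ('g \<Rightarrow> 'h) \<Rightarrow> 'g cover_group" where
  "kernel_pc A B d = (let K = {x \<in> carrier (cover A). d x \<in> sub_set B} in
     \<lparr> cover = (cover A)\<lparr>carrier := K\<rparr>,
       cover_top = pullback_topology K (\<lambda>x. (x, d x)) (prod_topology (cover_top A) (sub_top B)),
       sub_top = sub_top A \<rparr>)"

definition quotient_topology :: "'x topology \<Rightarrow> ('x \<Rightarrow> 'y) \<Rightarrow> 'y topology" where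
  "quotient_topology T q =
     topology (\<lambda>U. U \<subseteq> q ` topspace T \<and> openin T {x \<in> topspace T. q x \<in> U})"

definition coker_pc :: "'g cover_group \<Rightarrow> 'h cover_group \<Rightarrow> ('g \<Rightarrow> 'h) \<Rightarrow> 'h cover_group" where
  "coker_pc A B d =
     \<lparr> cover = cover B,
       cover_top = cover_top B,
       sub_top = quotient_topology (prod_topology (cover_top A) (sub_top B))
                   (\<lambda>(x, y). d x \<otimes>\<^bsub>cover B\<^esub> y) \<rparr>"

text \<open>
  The map \<open>G/M \<rightarrow> H/L\<close> induced by \<open>g : G \<rightarrow> H\<close>.  If \<open>g\<close> is a homomorphism with
  \<open>g(M) \<subseteq> L\<close>, then all cosets in the union coincide.
\<close>

definition quot_map :: "'h monoid \<Rightarrow> 'h set \<Rightarrow> ('g \<Rightarrow> 'h) \<Rightarrow> 'g set \<Rightarrow> 'h set" where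
  "quot_map H L g c = (\<Union>x\<in>c. L #>\<^bsub>H\<^esub> g x)"

abbreviation pc_map :: "'h cover_group \<Rightarrow> ('g \<Rightarrow> 'h) \<Rightarrow> 'g set \<Rightarrow> 'h set" where
  "pc_map B g \<equiv> quot_map (cover B) (sub_set B) g"


section \<open>Hom and Ext\<close>

definition hom_free :: "'i set \<Rightarrow> 'g cover_group \<Rightarrow> ('i \<Rightarrow> 'g) cover_group" where
  "hom_free I G =
     \<lparr> cover = product_group I (\<lambda>_. cover G),
       cover_top = product_topology (\<lambda>_. cover_top G) I,
       sub_top = product_topology (\<lambda>_. sub_top G) I \<rparr>"

text \<open>
  The homomorphism of covers \<open>Hom(\<int>\<^sup>(\<^sup>I\<^sup>),G) \<rightarrow> Hom(\<int>\<^sup>(\<^sup>J\<^sup>),G)\<close> given by the matrix of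
  \<open>f : \<int>\<^sup>(\<^sup>J\<^sup>) \<rightarrow> \<int>\<^sup>(\<^sup>I\<^sup>)\<close>.
\<close>

definition dual_map ::
  "'g cover_group \<Rightarrow> 'j set \<Rightarrow> (('j \<Rightarrow>\<^sub>0 int) \<Rightarrow> ('i \<Rightarrow>\<^sub>0 int)) \<Rightarrow> ('i \<Rightarrow> 'g) \<Rightarrow> ('j \<Rightarrow> 'g)" where
  "dual_map G J f x = (\<lambda>j\<in>J. finprod (cover G)
     (\<lambda>i. x i [^]\<^bsub>cover G\<^esub> Poly_Mapping.lookup (f (frag_of j)) i)
     (Poly_Mapping.keys (f (frag_of j))))"

record ('i, 'j, 'c) resolution =
  gens :: "'i set"
  rels :: "'j set"
  rel_map :: "('j \<Rightarrow>\<^sub>0 int) \<Rightarrow> ('i \<Rightarrow>\<^sub>0 int)"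
  augm :: "('i \<Rightarrow>\<^sub>0 int) \<Rightarrow> 'c"

definition free_resolution :: "'c monoid \<Rightarrow> ('i, 'j, 'c) resolution \<Rightarrow> bool" where
  "free_resolution C R \<longleftrightarrow>
     countable (gens R) \<and> countable (rels R) \<and>
     rel_map R \<in> hom (free_Abelian_group (rels R)) (free_Abelian_group (gens R)) \<and>
     augm R \<in> hom (free_Abelian_group (gens R)) C \<and>
     inj_on (rel_map R) (carrier (free_Abelian_group (rels R))) \<and>
     kernel (free_Abelian_group (gens R)) C (augm R) =
       rel_map R ` carrier (free_Abelian_group (rels R)) \<and>
     augm R ` carrier (free_Abelian_group (gens R)) = carrier C"

definition Hom_pc :: "('i, 'j, 'c) resolution \<Rightarrow> 'g cover_group \<Rightarrow> ('i \<Rightarrow> 'g) cover_group" where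
  "Hom_pc R G = kernel_pc (hom_free (gens R) G) (hom_free (rels R) G) (dual_map G (rels R) (rel_map R))"

definition Ext_pc :: "('i, 'j, 'c) resolution \<Rightarrow> 'g cover_group \<Rightarrow> ('j \<Rightarrow> 'g) cover_group" where
  "Ext_pc R G = coker_pc (hom_free (gens R) G) (hom_free (rels R) G) (dual_map G (rels R) (rel_map R))"

text \<open>\<open>(\<alpha>, \<beta>)\<close> lifts \<open>h : C \<rightarrow> D\<close> to resolutions \<open>R\<close> of \<open>C\<close> and \<open>S\<close> of \<open>D\<close>.\<close>

definition resolution_lift ::
  "('i, 'j, 'c) resolution \<Rightarrow> ('k, 'l, 'd) resolution \<Rightarrow> ('c \<Rightarrow> 'd) \<Rightarrow>
   (('i \<Rightarrow>\<^sub>0 int) \<Rightarrow> ('k \<Rightarrow>\<^sub>0 int)) \<Rightarrow> (('j \<Rightarrow>\<^sub>0 int) \<Rightarrow> ('l \<Rightarrow>\<^sub>0 int)) \<Rightarrow> bool" where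
  "resolution_lift R S h \<alpha> \<beta> \<longleftrightarrow>
     \<alpha> \<in> hom (free_Abelian_group (gens R)) (free_Abelian_group (gens S)) \<and>
     \<beta> \<in> hom (free_Abelian_group (rels R)) (free_Abelian_group (rels S)) \<and>
     (\<forall>x \<in> carrier (free_Abelian_group (gens R)). augm S (\<alpha> x) = h (augm R x)) \<and>
     (\<forall>y \<in> carrier (free_Abelian_group (rels R)). rel_map S (\<beta> y) = \<alpha> (rel_map R y))"

definition Hom_map ::
  "('k, 'l, 'd) resolution \<Rightarrow> ('i, 'j, 'c) resolution \<Rightarrow> 'g cover_group \<Rightarrow>
   (('i \<Rightarrow>\<^sub>0 int) \<Rightarrow> ('k \<Rightarrow>\<^sub>0 int)) \<Rightarrow> ('k \<Rightarrow> 'g) set \<Rightarrow> ('i \<Rightarrow> 'g) set" where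
  "Hom_map S R G \<alpha> = pc_map (Hom_pc R G) (dual_map G (gens R) \<alpha>)"

definition Ext_map ::
  "('k, 'l, 'd) resolution \<Rightarrow> ('i, 'j, 'c) resolution \<Rightarrow> 'g cover_group \<Rightarrow>
   (('j \<Rightarrow>\<^sub>0 int) \<Rightarrow> ('l \<Rightarrow>\<^sub>0 int)) \<Rightarrow> ('l \<Rightarrow> 'g) set \<Rightarrow> ('j \<Rightarrow> 'g) set" where
  "Ext_map S R G \<beta> = pc_map (Ext_pc R G) (dual_map G (rels R) \<beta>)"


section \<open>Complexes of free abelian groups and homotopy colimits\<close>

text \<open>Cochain complexes, graded by the integers; \<open>diff C n\<close> goes from degree \<open>n\<close> to \<open>n + 1\<close>.\<close>

record 'b free_complex =
  basis :: "int \<Rightarrow> 'b set"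
  diff :: "int \<Rightarrow> ('b \<Rightarrow>\<^sub>0 int) \<Rightarrow> ('b \<Rightarrow>\<^sub>0 int)"

definition cocycles :: "'b free_complex \<Rightarrow> int \<Rightarrow> ('b \<Rightarrow>\<^sub>0 int) set" where
  "cocycles C n = kernel (free_Abelian_group (basis C n)) (free_Abelian_group (basis C (n + 1))) (diff C n)"

definition coboundaries :: "'b free_complex \<Rightarrow> int \<Rightarrow> ('b \<Rightarrow>\<^sub>0 int) set" where
  "coboundaries C n = diff C (n - 1) ` carrier (free_Abelian_group (basis C (n - 1)))"

definition cohomology :: "'b free_complex \<Rightarrow> int \<Rightarrow> ('b \<Rightarrow>\<^sub>0 int) set monoid" where
  "cohomology C n = (free_Abelian_group (basis C n))\<lparr>carrier := cocycles C n\<rparr> Mod coboundaries C n"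

definition cohomology_map ::
  "'b free_complex \<Rightarrow> int \<Rightarrow> (('a \<Rightarrow>\<^sub>0 int) \<Rightarrow> ('b \<Rightarrow>\<^sub>0 int)) \<Rightarrow>
   ('a \<Rightarrow>\<^sub>0 int) set \<Rightarrow> ('b \<Rightarrow>\<^sub>0 int) set" where
  "cohomology_map C n \<Phi> = quot_map (free_Abelian_group (basis C n)) (coboundaries C n) \<Phi>"

definition chain_group_pc :: "'b free_complex \<Rightarrow> 'g cover_group \<Rightarrow> int \<Rightarrow> ('b \<Rightarrow> 'g) cover_group" where
  "chain_group_pc C G n = hom_free (basis C n) G"

definition boundary_pc :: "'b free_complex \<Rightarrow> 'g cover_group \<Rightarrow> int \<Rightarrow> ('b \<Rightarrow> 'g) \<Rightarrow> ('b \<Rightarrow> 'g)" where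
  "boundary_pc C G n = dual_map G (basis C (n - 1)) (diff C (n - 1))"

definition homology_pc :: "'b free_complex \<Rightarrow> 'g cover_group \<Rightarrow> int \<Rightarrow> ('b \<Rightarrow> 'g) cover_group" where
  "homology_pc C G n =
     coker_pc (chain_group_pc C G (n + 1))
       (kernel_pc (chain_group_pc C G n) (chain_group_pc C G (n - 1)) (boundary_pc C G n))
       (boundary_pc C G (n + 1))"

definition homology_map ::
  "'a free_complex \<Rightarrow> 'g cover_group \<Rightarrow> int \<Rightarrow> (('a \<Rightarrow>\<^sub>0 int) \<Rightarrow> ('b \<Rightarrow>\<^sub>0 int)) \<Rightarrow>
   ('b \<Rightarrow> 'g) set \<Rightarrow> ('a \<Rightarrow> 'g) set" where
  "homology_map D G n \<Phi> = pc_map (homology_pc D G n) (dual_map G (basis D n) \<Phi>)"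

text \<open>\<open>At l z\<close> and \<open>Between l w\<close> stand for \<open>z e\<^sub>l\<close> and \<open>w e\<^sub>l\<^sub>,\<^sub>l\<^sub>+\<^sub>1\<close>.\<close>

datatype 'b tel = At nat 'b | Between nat 'b

abbreviation at_elem :: "nat \<Rightarrow> ('b \<Rightarrow>\<^sub>0 int) \<Rightarrow> ('b tel \<Rightarrow>\<^sub>0 int)" where
  "at_elem l \<equiv> frag_extend (\<lambda>b. frag_of (At l b))"

abbreviation between_elem :: "nat \<Rightarrow> ('b \<Rightarrow>\<^sub>0 int) \<Rightarrow> ('b tel \<Rightarrow>\<^sub>0 int)" where
  "between_elem l \<equiv> frag_extend (\<lambda>b. frag_of (Between l b))"

definition sgn_pow :: "int \<Rightarrow> int" where
  "sgn_pow n = (if even n then 1 else -1)"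

definition hocolim ::
  "(nat \<Rightarrow> 'b free_complex) \<Rightarrow> (nat \<Rightarrow> int \<Rightarrow> ('b \<Rightarrow>\<^sub>0 int) \<Rightarrow> ('b \<Rightarrow>\<^sub>0 int)) \<Rightarrow> 'b tel free_complex" where
  "hocolim A \<eta> =
     \<lparr> basis = (\<lambda>n. (\<Union>l. Between l ` basis (A l) (n + 1)) \<union> (\<Union>l. At l ` basis (A l) n)),
       diff = (\<lambda>n. frag_extend (\<lambda>c. case c of
           At l z \<Rightarrow> at_elem l (diff (A l) n (frag_of z))
         | Between l w \<Rightarrow> between_elem l (diff (A l) (n + 1) (frag_of w)) +
             frag_cmul (sgn_pow n)
               (at_elem l (frag_of w) - at_elem (Suc l) (\<eta> l (n + 1) (frag_of w))))) \<rparr>"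


section \<open>Nerves and cochains of a compact metrizable space\<close>

definition nerve :: "'a set set \<Rightarrow> 'a set set set" where
  "nerve U = {\<sigma>. \<sigma> \<subseteq> U \<and> finite \<sigma> \<and> \<sigma> \<noteq> {} \<and> \<Inter>\<sigma> \<noteq> {}}"

definition ordered_simplices :: "'v set set \<Rightarrow> int \<Rightarrow> 'v list set" where
  "ordered_simplices K n = {s. set s \<in> K \<and> int (length s) = n + 1}"

text \<open>
  All complexes \<open>K\<close> below are finite, so that the integral \<open>n\<close>-cochains (the dual of the free
  abelian group on the ordered simplices) form the free abelian group on the dual basis, which is
  again indexed by \<open>ordered_simplices K n\<close>: the value of a cochain \<open>f\<close> at \<open>s\<close> is
  its coefficient \<open>Poly_Mapping.lookup f s\<close>.  The next definition turns a dual homomorphism, given by the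
  values of the image cochain, into a cochain.
\<close>

definition cochain_of :: "'v set set \<Rightarrow> int \<Rightarrow> ('v list \<Rightarrow> int) \<Rightarrow> ('v list \<Rightarrow>\<^sub>0 int)" where
  "cochain_of K n val = (\<Sum>s \<in> ordered_simplices K n. frag_cmul (val s) (frag_of s))"

definition cochain_complex :: "'v set set \<Rightarrow> 'v list free_complex" where
  "cochain_complex K =
     \<lparr> basis = ordered_simplices K,
       diff = (\<lambda>n f. cochain_of K (n + 1) (\<lambda>s.
         \<Sum>i<length s. (-1) ^ i * Poly_Mapping.lookup f (take i s @ drop (Suc i) s))) \<rparr>"

definition cochain_pullback ::
  "'v set set \<Rightarrow> int \<Rightarrow> ('v \<Rightarrow> 'w) \<Rightarrow> ('w list \<Rightarrow>\<^sub>0 int) \<Rightarrow> ('v list \<Rightarrow>\<^sub>0 int)" where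
  "cochain_pullback K n r f = cochain_of K n (\<lambda>s. Poly_Mapping.lookup f (map r s))"

text \<open>
  For contiguous vertex maps \<open>a\<close> and \<open>b\<close>, the dual of the prism operator
  \<open>(v\<^sub>0,\<dots>,v\<^sub>n) \<mapsto> \<Sum>\<^sub>i (-1)\<^sup>i (a v\<^sub>0,\<dots>,a v\<^sub>i,b v\<^sub>i,\<dots>,b v\<^sub>n)\<close>, from degree \<open>n + 1\<close> to
  \<open>n\<close>.  It satisfies \<open>\<delta>h + h\<delta> = b\<^sup>* - a\<^sup>*\<close>.
\<close>

definition cochain_prism ::
  "'v set set \<Rightarrow> int \<Rightarrow> ('v \<Rightarrow> 'w) \<Rightarrow> ('v \<Rightarrow> 'w) \<Rightarrow> ('w list \<Rightarrow>\<^sub>0 int) \<Rightarrow> ('v list \<Rightarrow>\<^sub>0 int)" where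
  "cochain_prism K n a b f = cochain_of K n (\<lambda>s.
     \<Sum>i<length s. (-1) ^ i * Poly_Mapping.lookup f (map a (take (Suc i) s) @ map b (drop i s)))"

text \<open>
  A space together with the choices on which its cochains and Hom and Ext depend: a sequence of
  finite open covers, refinement maps \<open>refine m\<close> from \<open>covers (m + 1)\<close> to \<open>covers m\<close>, and free
  resolutions of the cohomology groups.
\<close>

record ('a, 'i, 'j) presented_space =
  sp :: "'a topology"
  covers :: "nat \<Rightarrow> 'a set set"
  refine :: "nat \<Rightarrow> 'a set \<Rightarrow> 'a set"
  res :: "int \<Rightarrow> ('i, 'j, ('a set list tel \<Rightarrow>\<^sub>0 int) set) resolution"

definition finite_open_cover :: "'a topology \<Rightarrow> 'a set set \<Rightarrow> bool" where
  "finite_open_cover X U \<longleftrightarrow> finite U \<and> (\<forall>u\<in>U. openin X u) \<and> \<Union>U = topspace X"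

definition cochains :: "('a, 'i, 'j) presented_space \<Rightarrow> 'a set list tel free_complex" where
  "cochains X = hocolim (\<lambda>m. cochain_complex (nerve (covers X m)))
     (\<lambda>m n. cochain_pullback (nerve (covers X (Suc m))) n (refine X m))"

definition Cech_cohomology :: "('a, 'i, 'j) presented_space \<Rightarrow> int \<Rightarrow> ('a set list tel \<Rightarrow>\<^sub>0 int) set monoid" where
  "Cech_cohomology X n = cohomology (cochains X) n"

definition compact_metrizable_presented :: "('a, 'i, 'j) presented_space \<Rightarrow> bool" where
  "compact_metrizable_presented X \<longleftrightarrow>
     compact_space (sp X) \<and> metrizable_space (sp X) \<and>
     (\<forall>m. finite_open_cover (sp X) (covers X m)) \<and>
     (\<forall>m. \<forall>u \<in> covers X (Suc m). refine X m u \<in> covers X m \<and> u \<subseteq> refine X m u) \<and>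
     (\<forall>W. finite_open_cover (sp X) W \<longrightarrow> (\<exists>m. \<forall>u \<in> covers X m. \<exists>w\<in>W. u \<subseteq> w)) \<and>
     (\<forall>n. free_resolution (Cech_cohomology X n) (res X n))"

definition Steenrod_homology ::
  "('a, 'i, 'j) presented_space \<Rightarrow> 'g cover_group \<Rightarrow> int \<Rightarrow> ('a set list tel \<Rightarrow> 'g) cover_group" where
  "Steenrod_homology X G n = homology_pc (cochains X) G n"


section \<open>Functoriality of the cochains\<close>

text \<open>\<open>refine_by r l d\<close> is the composite refinement map from level \<open>l + d\<close> to level \<open>l\<close>.\<close>

primrec refine_by :: "(nat \<Rightarrow> 'v \<Rightarrow> 'v) \<Rightarrow> nat \<Rightarrow> nat \<Rightarrow> 'v \<Rightarrow> 'v" where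
  "refine_by r l 0 = (\<lambda>u. u)"
| "refine_by r l (Suc d) = (\<lambda>u. refine_by r l d (r (l + d) u))"

text \<open>
  A continuous \<open>f : X \<rightarrow> Y\<close> is represented on covers by refinements \<open>\<phi> m\<close> of \<open>f\<^sup>-\<^sup>1(covers Y m)\<close>
  by \<open>covers X (k m)\<close>.
\<close>

definition cover_map ::
  "('a, 'i, 'j) presented_space \<Rightarrow> ('b, 'k, 'l) presented_space \<Rightarrow> ('a \<Rightarrow> 'b) \<Rightarrow>
   (nat \<Rightarrow> nat) \<Rightarrow> (nat \<Rightarrow> 'a set \<Rightarrow> 'b set) \<Rightarrow> bool" where
  "cover_map X Y f k \<phi> \<longleftrightarrow>
     mono k \<and> (\<forall>m. \<forall>u \<in> covers X (k m). \<phi> m u \<in> covers Y m \<and> f ` u \<subseteq> \<phi> m u)"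

lemma ex_cover_map:
  assumes X: "compact_metrizable_presented X" and Y: "compact_metrizable_presented Y"
    and f: "continuous_map (sp X) (sp Y) f"
  shows "\<exists>k \<phi>. cover_map X Y f k \<phi>"
proof -
  have refX: "\<forall>m. \<forall>u \<in> covers X (Suc m). refine X m u \<in> covers X m \<and> u \<subseteq> refine X m u"
    using X unfolding compact_metrizable_presented_def by (elim conjE)
  have cofX: "\<forall>W. finite_open_cover (sp X) W \<longrightarrow> (\<exists>m. \<forall>u \<in> covers X m. \<exists>w\<in>W. u \<subseteq> w)"
    using X unfolding compact_metrizable_presented_def by (elim conjE)
  have step: "\<exists>u' \<in> covers X l. u \<subseteq> u'" if "u \<in> covers X (l + d)" for u l d
    using that
  proof (induction d arbitrary: u)
    case (Suc d)
    have "refine X (l + d) u \<in> covers X (l + d)" "u \<subseteq> refine X (l + d) u"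
      using refX Suc.prems by simp_all
    with Suc.IH show ?case by (meson order_trans)
  qed auto
  have "\<exists>i. \<forall>u \<in> covers X i. \<exists>v \<in> covers Y m. f ` u \<subseteq> v" for m
  proof -
    let ?W = "(\<lambda>v. {x \<in> topspace (sp X). f x \<in> v}) ` covers Y m"
    have V: "finite_open_cover (sp Y) (covers Y m)"
      using Y unfolding compact_metrizable_presented_def by (elim conjE) (rule spec)
    have "finite ?W"
      using V by (simp add: finite_open_cover_def)
    moreover have "\<forall>w \<in> ?W. openin (sp X) w"
      using V f by (auto simp: finite_open_cover_def intro: openin_continuous_map_preimage)
    moreover have "\<Union>?W = topspace (sp X)"
    proof -
      have "\<Union>(covers Y m) = topspace (sp Y)"
        using V by (simp add: finite_open_cover_def)
      moreover have "f x \<in> topspace (sp Y)" if "x \<in> topspace (sp X)" for x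
        using f that by (auto simp: continuous_map_def)
      ultimately have "\<exists>v \<in> covers Y m. f x \<in> v" if "x \<in> topspace (sp X)" for x
        using that by (metis UnionE)
      then show ?thesis by auto
    qed
    ultimately have "finite_open_cover (sp X) ?W"
      by (simp add: finite_open_cover_def)
    then obtain i where "\<forall>u \<in> covers X i. \<exists>w \<in> ?W. u \<subseteq> w"
      using cofX by meson
    then have "\<forall>u \<in> covers X i. \<exists>v \<in> covers Y m. u \<subseteq> {x \<in> topspace (sp X). f x \<in> v}"
      by simp
    moreover have "f ` u \<subseteq> v" if "u \<subseteq> {x \<in> topspace (sp X). f x \<in> v}" for u v
      using that by auto
    ultimately have "\<forall>u \<in> covers X i. \<exists>v \<in> covers Y m. f ` u \<subseteq> v"
      by meson
    then show ?thesis ..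
  qed
  then obtain i where i: "\<And>m u. u \<in> covers X (i m) \<Longrightarrow> \<exists>v \<in> covers Y m. f ` u \<subseteq> v"
    by metis
  define k where "k m = (\<Sum>j\<le>m. i j)" for m
  have "mono k"
    unfolding k_def by (intro monoI sum_mono2) auto
  moreover have "\<exists>v. v \<in> covers Y m \<and> f ` u \<subseteq> v" if "u \<in> covers X (k m)" for m u
  proof -
    have "i m \<le> k m"
      unfolding k_def by (simp add: member_le_sum)
    then have "u \<in> covers X (i m + (k m - i m))"
      using that by simp
    then obtain u' where u': "u' \<in> covers X (i m)" "u \<subseteq> u'"
      using step by blast
    then obtain v where "v \<in> covers Y m" "f ` u' \<subseteq> v"
      using i by blast
    with u' show ?thesis by (meson image_mono order_trans)
  qed
  then have "\<forall>m u. \<exists>v. u \<in> covers X (k m) \<longrightarrow> v \<in> covers Y m \<and> f ` u \<subseteq> v"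
    by blast
  then obtain \<phi> where "\<And>m u. u \<in> covers X (k m) \<Longrightarrow> \<phi> m u \<in> covers Y m \<and> f ` u \<subseteq> \<phi> m u"
    by metis
  ultimately show ?thesis
    unfolding cover_map_def by blast
qed

text \<open>
  The chain map from the cochains of \<open>Y\<close> to those of \<open>X\<close> given by such data.  The maps induced by
  the \<open>\<phi> m\<close> commute with the refinement maps only up to the prism homotopy between
  \<open>\<phi> m \<circ> refinement\<close> and \<open>refine Y m \<circ> \<phi> (m + 1)\<close>, so that on \<open>z e\<^sub>m\<close> and \<open>w e\<^sub>m\<^sub>,\<^sub>m\<^sub>+\<^sub>1\<close>
  in degree \<open>n\<close> the chain map is \<open>(\<phi>\<^sub>m\<^sup>* z) e\<^sub>k\<^sub>(\<^sub>m\<^sub>)\<close> and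
  \<open>\<Sum>\<^sub>j (\<phi>\<^sub>m\<^sup>* w) e\<^sub>j\<^sub>,\<^sub>j\<^sub>+\<^sub>1 + (-1)\<^sup>n\<^sup>+\<^sup>1 (h w) e\<^sub>k\<^sub>(\<^sub>m\<^sub>+\<^sub>1\<^sub>)\<close>, where \<open>j\<close> ranges over \<open>{k m..<k (m + 1)}\<close>
  and \<open>\<phi>\<^sub>m\<^sup>* w\<close> is pulled back further along the refinement maps.
\<close>

definition cochain_map ::
  "('a, 'i, 'j) presented_space \<Rightarrow> ('b, 'k, 'l) presented_space \<Rightarrow>
   (nat \<Rightarrow> nat) \<Rightarrow> (nat \<Rightarrow> 'a set \<Rightarrow> 'b set) \<Rightarrow>
   int \<Rightarrow> ('b set list tel \<Rightarrow>\<^sub>0 int) \<Rightarrow> ('a set list tel \<Rightarrow>\<^sub>0 int)" where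
  "cochain_map X Y k \<phi> n = frag_extend (\<lambda>c. case c of
       At m z \<Rightarrow> at_elem (k m) (cochain_pullback (nerve (covers X (k m))) n (\<phi> m) (frag_of z))
     | Between m w \<Rightarrow>
         (\<Sum>d < k (Suc m) - k m. between_elem (k m + d)
            (cochain_pullback (nerve (covers X (k m + d))) (n + 1)
               (\<lambda>u. \<phi> m (refine_by (refine X) (k m) d u)) (frag_of w))) +
         frag_cmul (sgn_pow (n + 1)) (at_elem (k (Suc m))
            (cochain_prism (nerve (covers X (k (Suc m)))) n
               (\<lambda>u. \<phi> m (refine_by (refine X) (k m) (k (Suc m) - k m) u))
               (\<lambda>u. refine Y m (\<phi> (Suc m) u)) (frag_of w))))"

end

theory Submission
  imports Defs
begin

text \<open>
  Subgroups of countable free abelian groups are free, so the cocycles are a direct summand of the cochains.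
  Hence a resolution of the cohomology can be compared with the cochains by matrices, in both
  directions, and all maps of the sequence, a retraction of the first and a section of the second
  are induced by dual matrices, which are continuous homomorphisms of the covers.  Exactness,
  splitting and naturality then are matrix identities modulo values in the subgroup.

  That the groups in question have Polish covers rests on the fact that the quotient of an abelian
  Polish group by a closed subgroup is Polish: such a group has a compatible invariant metric
  (Birkhoff and Kakutani), which is complete (Klee), and the quotient metric is again complete.
\<close>

section \<open>Quotients of abelian Polish groups\<close>

text \<open>Exactness for groups with a Polish cover asks for more than exactness on cosets: kernels
  and cokernels come with Polish topologies of their own, and the comparison with them must have an
  inverse with a Borel lift. A split sequence settles this at once, since the retraction and the
  section supply both inverses. So the splitting is not a corollary here but the means of proof. The
  resolutions are arbitrary, so that they agree with the resolution by cocycles and coboundaries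
  only up to homotopy; each homotopy turns into an error term which either is a boundary or has
  values in the subgroup. The splitting is unnatural because it rests on a retraction of the
  cochains onto the cocycles, chosen for each complex separately.\<close>

lemma sum_list_split_at:
  fixes xs :: "real list"
  assumes "xs \<noteq> []" "\<And>x. x \<in> set xs \<Longrightarrow> 0 \<le> x" "0 \<le> t" "t \<le> sum_list xs"
  shows "\<exists>a m b. xs = a @ m # b \<and> sum_list a \<le> t \<and> t \<le> sum_list a + m"
  using assms
proof (induction xs arbitrary: t)
  case (Cons x xs)
  show ?case
  proof (cases "t \<le> x")
    case True
    with Cons.prems show ?thesis
      by (intro exI[of _ "[]"] exI[of _ x] exI[of _ xs]) auto
  next
    case False
    with Cons.prems have "xs \<noteq> []" by auto
    with Cons.prems False Cons.IH[of "t - x"] obtain a m b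
      where "xs = a @ m # b" "sum_list a \<le> t - x" "t - x \<le> sum_list a + m"
      by auto
    then show ?thesis
      by (intro exI[of _ "x # a"] exI[of _ m] exI[of _ b]) auto
  qed
qed simp

section \<open>Birkhoff and Kakutani: a norm from a shrinking sequence of neighbourhoods\<close>

context comm_group
begin

text \<open>A chain lists pairs (k, x), read as a factor x taken from the neighbourhood V k at the
  price (1/2)^k. The level is stored with the factor because x lies in many V k at once. The norm
  below is the least price of a product.\<close>

definition chain_val :: "(nat \<times> 'a) list \<Rightarrow> 'a" where
  "chain_val ps = foldr (\<otimes>) (map snd ps) \<one>"

definition chain_weight :: "(nat \<times> 'a) list \<Rightarrow> real" where
  "chain_weight ps = sum_list (map (\<lambda>p. (1/2) ^ fst p) ps)"

lemma chain_val_closed: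
  "snd ` set ps \<subseteq> carrier G \<Longrightarrow> chain_val ps \<in> carrier G"
  by (induction ps) (auto simp: chain_val_def)

lemma chain_val_append:
  "snd ` set ps \<subseteq> carrier G \<Longrightarrow> snd ` set qs \<subseteq> carrier G \<Longrightarrow>
   chain_val (ps @ qs) = chain_val ps \<otimes> chain_val qs"
proof (induction ps)
  case Nil
  then show ?case using chain_val_closed[of qs] by (simp add: chain_val_def)
next
  case (Cons p ps)
  then show ?case
    using chain_val_closed[of qs] chain_val_closed[of ps]
    by (auto simp: chain_val_def m_assoc)
qed

lemma chain_weight_nonneg: "0 \<le> chain_weight ps"
  unfolding chain_weight_def by (rule sum_list_nonneg) auto

lemma chain_val_inv:
  "snd ` set ps \<subseteq> carrier G \<Longrightarrow>
   chain_val (map (map_prod id (\<lambda>x. inv x)) ps) = inv (chain_val ps)"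
proof (induction ps)
  case (Cons p ps)
  then show ?case
    using chain_val_closed[of ps]
    by (cases p) (auto simp: chain_val_def inv_mult)
qed (simp add: chain_val_def)

text \<open>Cut the chain at the entry where its running weight passes half of the total. The parts
  before and after weigh less than (1/2)^(n+1) and fall under the induction hypothesis; the entry
  itself weighs less than (1/2)^n and so has a level above n. All three factors lie in V (Suc
  n).\<close>

lemma chain_val_mem:
  assumes V: "\<And>n. V n \<subseteq> carrier G" "\<And>n. \<one> \<in> V n"
    and V3: "\<And>n x y z. x \<in> V (Suc n) \<Longrightarrow> y \<in> V (Suc n) \<Longrightarrow> z \<in> V (Suc n) \<Longrightarrow> x \<otimes> (y \<otimes> z) \<in> V n"
    and ps: "\<And>k x. (k, x) \<in> set ps \<Longrightarrow> x \<in> V k" "chain_weight ps < (1/2) ^ n"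
  shows "chain_val ps \<in> V n"
  using ps
proof (induction ps arbitrary: n rule: length_induct)
  case (1 ps)
  have anti: "V (n + k) \<subseteq> V n" for n k
  proof (induction k)
    case (Suc k)
    have "x \<in> V (n + k)" if "x \<in> V (Suc (n + k))" for x
    proof -
      have "x \<in> carrier G" using V(1) that by blast
      then show ?thesis using V3[OF that V(2) V(2)] by simp
    qed
    with Suc show ?case by auto
  qed simp
  show ?case
  proof (cases "ps = []")
    case True
    then show ?thesis using V by (simp add: chain_val_def)
  next
    case False
    let ?w = "\<lambda>p::nat \<times> 'a. (1/2::real) ^ fst p"
    have nn: "0 \<le> sum_list (map ?w ps)"
      by (rule sum_list_nonneg) auto
    have "\<exists>a m b. map ?w ps = a @ m # b \<and> sum_list a \<le> chain_weight ps / 2 \<and>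
        chain_weight ps / 2 \<le> sum_list a + m"
      by (rule sum_list_split_at) (use False nn in \<open>auto simp: chain_weight_def\<close>)
    then obtain a m b where ab: "map ?w ps = a @ m # b" "sum_list a \<le> chain_weight ps / 2"
        "chain_weight ps / 2 \<le> sum_list a + m"
      by blast
    then obtain as p bs where ps: "ps = as @ p # bs" "map ?w as = a" "?w p = m" "map ?w bs = b"
      by (auto simp: map_eq_append_conv map_eq_Cons_conv)
    have wt: "chain_weight ps = sum_list a + m + sum_list b"
      using ab by (simp add: chain_weight_def)
    have "chain_weight as < (1/2) ^ Suc n" "chain_weight bs < (1/2) ^ Suc n"
      using ab ps wt 1(3) by (auto simp: chain_weight_def)
    then have A: "chain_val as \<in> V (Suc n)" "chain_val bs \<in> V (Suc n)"
      using 1(1)[rule_format, of as "Suc n"] 1(1)[rule_format, of bs "Suc n"] 1(2) ps(1) by auto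
    have "sum_list a \<ge> 0" "sum_list b \<ge> 0"
      using ps chain_weight_nonneg[of as] chain_weight_nonneg[of bs] by (auto simp: chain_weight_def)
    with wt 1(3) have "m < (1/2) ^ n" by linarith
    with ps(3) have "(1/2::real) ^ fst p < (1/2) ^ n" by simp
    then have "n < fst p"
      by (subst (asm) power_strict_decreasing_iff) auto
    have pV: "snd p \<in> V (fst p)"
      using 1(2)[of "fst p" "snd p"] ps(1) by simp
    then have P: "snd p \<in> V (Suc n)"
      using anti[of "Suc n" "fst p - Suc n"] \<open>n < fst p\<close> by auto
    have "\<forall>q \<in> set ps. snd q \<in> carrier G"
      using 1(2) V(1) by (metis prod.collapse subsetD)
    then have sub: "snd ` set as \<subseteq> carrier G" "snd ` set bs \<subseteq> carrier G" "snd p \<in> carrier G"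
      using ps(1) by auto
    have "chain_val ps = chain_val as \<otimes> chain_val (p # bs)"
      using sub by (subst ps(1), subst chain_val_append) auto
    also have "chain_val (p # bs) = snd p \<otimes> chain_val bs"
      by (simp add: chain_val_def)
    finally show ?thesis
      using V3[OF A(1) P A(2)] by simp
  qed
qed

text \<open>The norm is the infimum of the weights of all chains with product x. Chains with one
  entry bound it from above on V n, \<open>chain_val_mem\<close> bounds it from below off V n, and
  concatenation of chains gives the triangle inequality. As V 0 is the whole group, no infimum is
  taken over the empty set.\<close>

lemma ex_invariant_norm:
  assumes V: "\<And>n. V n \<subseteq> carrier G" "\<And>n. \<one> \<in> V n" "V 0 = carrier G"
    and V3: "\<And>n x y z. x \<in> V (Suc n) \<Longrightarrow> y \<in> V (Suc n) \<Longrightarrow> z \<in> V (Suc n) \<Longrightarrow> x \<otimes> (y \<otimes> z) \<in> V n"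
    and Vinv: "\<And>n x. x \<in> V n \<Longrightarrow> inv x \<in> V n"
  shows "\<exists>N :: 'a \<Rightarrow> real. (\<forall>x \<in> carrier G. 0 \<le> N x) \<and> N \<one> = 0 \<and> (\<forall>x \<in> carrier G. N (inv x) = N x) \<and>
    (\<forall>x \<in> carrier G. \<forall>y \<in> carrier G. N (x \<otimes> y) \<le> N x + N y) \<and>
    (\<forall>n. \<forall>x \<in> V n. N x \<le> (1/2) ^ n) \<and>
    (\<forall>n. \<forall>x \<in> carrier G. N x < (1/2) ^ n \<longrightarrow> x \<in> V n)"
proof -
  define ok where "ok ps \<longleftrightarrow> (\<forall>(k, x) \<in> set ps. x \<in> V k)" for ps
  define W where "W x = {chain_weight ps |ps. ok ps \<and> chain_val ps = x}" for x
  define N where "N x = Inf (W x)" for x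
  have okc: "snd ` set ps \<subseteq> carrier G" if "ok ps" for ps
    using that V(1) unfolding ok_def by fastforce
  have single: "chain_val [(n, x)] = x" "chain_weight [(n, x)] = (1/2) ^ n" if "x \<in> carrier G" for n x
    using that by (auto simp: chain_val_def chain_weight_def)
  have ne: "W x \<noteq> {}" if "x \<in> carrier G" for x
  proof -
    have "ok [(0, x)]" using that V(3) by (simp add: ok_def)
    then have "chain_weight [(0, x)] \<in> W x"
      unfolding W_def using single[OF that, of 0] by blast
    then show ?thesis by blast
  qed
  have bdd: "bdd_below (W x)" for x
    using chain_weight_nonneg unfolding W_def by (intro bdd_belowI[of _ 0]) auto
  have le: "N x \<le> chain_weight ps" if "ok ps" "chain_val ps = x" for x ps
    unfolding N_def using that bdd by (intro cInf_lower) (auto simp: W_def)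
  have ex: "\<exists>ps. ok ps \<and> chain_val ps = x \<and> chain_weight ps < e" if "x \<in> carrier G" "N x < e" for x e
    using that cInf_less_iff[OF ne bdd, of x e] unfolding N_def W_def by auto
  have inv_le: "N (inv x) \<le> N x" if x: "x \<in> carrier G" for x
  proof (rule dense_ge)
    fix e assume "N x < e"
    then obtain ps where ps: "ok ps" "chain_val ps = x" "chain_weight ps < e"
      using ex x by blast
    let ?qs = "map (map_prod id (\<lambda>x. inv x)) ps"
    have "chain_val ?qs = inv x" "ok ?qs" "chain_weight ?qs = chain_weight ps"
      using ps chain_val_inv[OF okc[OF ps(1)]] Vinv
      by (auto simp: ok_def chain_weight_def o_def map_prod_def case_prod_unfold)
    then show "N (inv x) \<le> e" using le[of ?qs "inv x"] ps by linarith
  qed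
  show ?thesis
  proof (intro exI[of _ N] conjI ballI allI impI)
    show nn: "0 \<le> N x" if "x \<in> carrier G" for x
      unfolding N_def using ne[OF that] chain_weight_nonneg by (intro cInf_greatest) (auto simp: W_def)
    have "N \<one> \<le> 0"
      using le[of "[]" \<one>] by (simp add: ok_def chain_val_def chain_weight_def)
    then show "N \<one> = 0" using nn[of \<one>] by auto
    show "N (inv x) = N x" if "x \<in> carrier G" for x
      using inv_le[OF that] inv_le[of "inv x"] that by auto
    show "N (x \<otimes> y) \<le> N x + N y" if x: "x \<in> carrier G" and y: "y \<in> carrier G" for x y
    proof (rule field_le_epsilon)
      fix e :: real assume "0 < e"
      then obtain ps qs where ps: "ok ps" "chain_val ps = x" "chain_weight ps < N x + e/2"
        and qs: "ok qs" "chain_val qs = y" "chain_weight qs < N y + e/2"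
        using ex[OF x, of "N x + e/2"] ex[OF y, of "N y + e/2"] by auto
      have "chain_val (ps @ qs) = x \<otimes> y" "ok (ps @ qs)" "chain_weight (ps @ qs) = chain_weight ps + chain_weight qs"
        using ps qs chain_val_append[OF okc okc, of ps qs] by (auto simp: ok_def chain_weight_def)
      then show "N (x \<otimes> y) \<le> N x + N y + e" using le[of "ps @ qs" "x \<otimes> y"] ps qs by linarith
    qed
    show "N x \<le> (1/2) ^ n" if "x \<in> V n" for n x
    proof -
      have "x \<in> carrier G" using that V(1) by blast
      then show ?thesis using le[of "[(n, x)]" x] single[of x n] that by (simp add: ok_def)
    qed
    show "x \<in> V n" if x: "x \<in> carrier G" "N x < (1/2) ^ n" for n x
    proof -
      obtain ps where ps: "ok ps" "chain_val ps = x" "chain_weight ps < (1/2) ^ n"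
        using ex[OF x] by blast
      have "chain_val ps \<in> V n"
        by (rule chain_val_mem[where V=V]) (use V V3 ps(1,3) in \<open>auto simp: ok_def\<close>)
      then show ?thesis using ps(2) by simp
    qed
  qed
qed

end

section \<open>Invariant metrics on abelian Polish groups\<close>

locale normed_ab_group = comm_group G for G (structure) +
  fixes N :: "'a \<Rightarrow> real"
  assumes norm_nonneg: "x \<in> carrier G \<Longrightarrow> 0 \<le> N x"
    and norm_eq_0: "x \<in> carrier G \<Longrightarrow> N x = 0 \<longleftrightarrow> x = \<one>"
    and norm_inv: "x \<in> carrier G \<Longrightarrow> N (inv x) = N x"
    and norm_mult_le: "x \<in> carrier G \<Longrightarrow> y \<in> carrier G \<Longrightarrow> N (x \<otimes> y) \<le> N x + N y"
begin

text \<open>\<open>Metric_space\<close> asks for nonnegativity and symmetry at all arguments, hence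
  the value 0 off the carrier.\<close>

definition gdist :: "'a \<Rightarrow> 'a \<Rightarrow> real" where
  "gdist x y = (if x \<in> carrier G \<and> y \<in> carrier G then N (inv x \<otimes> y) else 0)"

lemma gdist_eq: "x \<in> carrier G \<Longrightarrow> y \<in> carrier G \<Longrightarrow> gdist x y = N (inv x \<otimes> y)"
  by (simp add: gdist_def)

sublocale metric: Metric_space "carrier G" gdist
proof
  show "0 \<le> gdist x y" for x y
    by (auto simp: gdist_def norm_nonneg)
  show "gdist x y = gdist y x" for x y
    using norm_inv[of "inv x \<otimes> y"] by (auto simp: gdist_def inv_mult m_comm)
  show "gdist x y = 0 \<longleftrightarrow> x = y" if "x \<in> carrier G" "y \<in> carrier G" for x y
    using that by (auto simp: gdist_def norm_eq_0 inv_solve_left')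
  show "gdist x z \<le> gdist x y + gdist y z"
    if x: "x \<in> carrier G" and y: "y \<in> carrier G" and z: "z \<in> carrier G" for x y z
  proof -
    have "inv x \<otimes> z = (inv x \<otimes> y) \<otimes> (inv y \<otimes> z)"
      using m_assoc[of y "inv y" z] x y z by (simp add: m_assoc)
    then show ?thesis using norm_mult_le[of "inv x \<otimes> y" "inv y \<otimes> z"] x y z by (simp add: gdist_eq)
  qed
qed

lemma gdist_translate:
  "a \<in> carrier G \<Longrightarrow> x \<in> carrier G \<Longrightarrow> y \<in> carrier G \<Longrightarrow> gdist (a \<otimes> x) (a \<otimes> y) = gdist x y"
proof -
  assume a: "a \<in> carrier G" "x \<in> carrier G" "y \<in> carrier G"
  have "inv (a \<otimes> x) \<otimes> (a \<otimes> y) = inv x \<otimes> ((inv a \<otimes> a) \<otimes> y)"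
    using a by (simp only: inv_mult_group m_assoc inv_closed m_closed)
  then show ?thesis using a by (simp add: gdist_eq)
qed

lemma gdist_inv:
  "x \<in> carrier G \<Longrightarrow> y \<in> carrier G \<Longrightarrow> gdist (inv x) (inv y) = gdist x y"
  using norm_inv[of "inv x \<otimes> y"] by (simp add: gdist_eq inv_mult)

end

lemma polish_abelian_group_comm: "polish_abelian_group G T \<Longrightarrow> comm_group G"
  and polish_abelian_group_topspace: "polish_abelian_group G T \<Longrightarrow> topspace T = carrier G"
  and polish_abelian_group_cm: "polish_abelian_group G T \<Longrightarrow> completely_metrizable_space T"
  and polish_abelian_group_sc: "polish_abelian_group G T \<Longrightarrow> second_countable T"
  and polish_abelian_group_mult:
    "polish_abelian_group G T \<Longrightarrow> continuous_map (prod_topology T T) T (\<lambda>(x, y). x \<otimes>\<^bsub>G\<^esub> y)"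
  and polish_abelian_group_inv: "polish_abelian_group G T \<Longrightarrow> continuous_map T T (\<lambda>x. inv\<^bsub>G\<^esub> x)"
  by (auto simp: polish_abelian_group_def)

lemma polish_abelian_group_mult_compose:
  assumes "polish_abelian_group G T" "continuous_map X T f" "continuous_map X T g"
  shows "continuous_map X T (\<lambda>x. f x \<otimes>\<^bsub>G\<^esub> g x)"
  using continuous_map_compose[OF continuous_map_paired[THEN iffD2, OF conjI, OF assms(2,3)]
      polish_abelian_group_mult[OF assms(1)]] by (simp add: o_def)

lemma polish_abelian_group_inv_compose:
  assumes "polish_abelian_group G T" "continuous_map X T f"
  shows "continuous_map X T (\<lambda>x. inv\<^bsub>G\<^esub> (f x))"
  using continuous_map_compose[OF assms(2) polish_abelian_group_inv[OF assms(1)]] by (simp add: o_def)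

text \<open>Three factors, because \<open>chain_val_mem\<close> cuts a chain into three. Continuity
  of the product is used twice, to pass from U to C and from C to D; then D D D is contained in D C,
  and this in C C. W is D made symmetric.\<close>

lemma polish_abelian_group_small_nhd:
  assumes P: "polish_abelian_group G T" and U: "openin T U" "\<one>\<^bsub>G\<^esub> \<in> U"
  obtains W where "openin T W" "\<one>\<^bsub>G\<^esub> \<in> W" "W \<subseteq> U"
    "\<And>x. x \<in> W \<Longrightarrow> inv\<^bsub>G\<^esub> x \<in> W"
    "\<And>x y z. x \<in> W \<Longrightarrow> y \<in> W \<Longrightarrow> z \<in> W \<Longrightarrow> x \<otimes>\<^bsub>G\<^esub> (y \<otimes>\<^bsub>G\<^esub> z) \<in> U"
proof -
  interpret comm_group G using P by (rule polish_abelian_group_comm)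
  note ts = polish_abelian_group_topspace[OF P]
  have half: "\<exists>C. openin T C \<and> \<one>\<^bsub>G\<^esub> \<in> C \<and> C \<subseteq> U \<and> (\<forall>x\<in>C. \<forall>y\<in>C. x \<otimes>\<^bsub>G\<^esub> y \<in> U)"
    if U: "openin T U" "\<one>\<^bsub>G\<^esub> \<in> U" for U
  proof -
    define P where "P = {p \<in> topspace (prod_topology T T). (case p of (x, y) \<Rightarrow> x \<otimes>\<^bsub>G\<^esub> y) \<in> U}"
    have Po: "openin (prod_topology T T) P"
      unfolding P_def using polish_abelian_group_mult[OF P] U(1) by (rule openin_continuous_map_preimage)
    have P1: "(\<one>\<^bsub>G\<^esub>, \<one>\<^bsub>G\<^esub>) \<in> P" using U ts by (auto simp: P_def)
    obtain A B where AB: "openin T A" "openin T B" "\<one>\<^bsub>G\<^esub> \<in> A" "\<one>\<^bsub>G\<^esub> \<in> B" "A \<times> B \<subseteq> P"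
      using openin_prod_topology_alt[THEN iffD1, rule_format, OF Po P1] by (elim exE conjE) (rule that)
    have xyU: "x \<otimes>\<^bsub>G\<^esub> y \<in> U" if "x \<in> A" "y \<in> B" for x y
    proof -
      have "(x, y) \<in> P" using AB(5) that by auto
      then show ?thesis by (simp add: P_def)
    qed
    show ?thesis
      by (intro exI[of _ "A \<inter> B \<inter> U"] conjI ballI openin_Int) (use U AB(1-4) xyU in simp_all)
  qed
  obtain C where C: "openin T C" "\<one>\<^bsub>G\<^esub> \<in> C" "C \<subseteq> U" "\<And>x y. x \<in> C \<Longrightarrow> y \<in> C \<Longrightarrow> x \<otimes>\<^bsub>G\<^esub> y \<in> U"
    using half[OF U] by blast
  obtain D where D: "openin T D" "\<one>\<^bsub>G\<^esub> \<in> D" "D \<subseteq> C" "\<And>x y. x \<in> D \<Longrightarrow> y \<in> D \<Longrightarrow> x \<otimes>\<^bsub>G\<^esub> y \<in> C"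
    using half[OF C(1,2)] by blast
  let ?W = "D \<inter> {x \<in> topspace T. inv\<^bsub>G\<^esub> x \<in> D}"
  show thesis
  proof
    show "openin T ?W"
      using D(1) openin_continuous_map_preimage[OF polish_abelian_group_inv[OF P] D(1)] by blast
    show "\<one>\<^bsub>G\<^esub> \<in> ?W" using D(2) ts by auto
    show "?W \<subseteq> U" using C D by auto
    show "inv\<^bsub>G\<^esub> x \<in> ?W" if "x \<in> ?W" for x using that ts by auto
    show "x \<otimes>\<^bsub>G\<^esub> (y \<otimes>\<^bsub>G\<^esub> z) \<in> U" if "x \<in> ?W" "y \<in> ?W" "z \<in> ?W" for x y z
      using that C D by auto
  qed
qed

lemma openin_translate:
  assumes P: "polish_abelian_group G T" and U: "openin T U" and a: "a \<in> carrier G"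
  shows "openin T {x \<in> topspace T. a \<otimes>\<^bsub>G\<^esub> x \<in> U}"
proof -
  have "continuous_map T T (\<lambda>x. a \<otimes>\<^bsub>G\<^esub> x)"
    by (rule polish_abelian_group_mult_compose[OF P])
       (use a polish_abelian_group_topspace[OF P] in auto)
  then show ?thesis using U by (rule openin_continuous_map_preimage)
qed

text \<open>The neighbourhoods V n are chosen recursively inside the balls of radius 1/n of some
  compatible metric, so that they form a base at the unit, and the balls of the norm are squeezed
  between them. Translations carry the comparison of the two topologies from the unit to any other
  point.\<close>

theorem polish_abelian_group_normable:
  fixes G :: "'a monoid"
  assumes P: "polish_abelian_group G T"
  obtains N where "normed_ab_group G N" 
    "Metric_space.mtopology (carrier G) (normed_ab_group.gdist G N) = T"
proof -
  interpret comm_group G using P by (rule polish_abelian_group_comm)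
  note ts = polish_abelian_group_topspace[OF P]
  obtain M d where M: "Metric_space M d" "T = Metric_space.mtopology M d"
    using polish_abelian_group_cm[OF P] unfolding completely_metrizable_space_def by blast
  interpret M: Metric_space M d by (rule M)
  have MG: "M = carrier G" using ts M(2) by simp
  have M1: "\<one>\<^bsub>G\<^esub> \<in> M" using MG by simp
  have mb: "openin T (M.mball \<one>\<^bsub>G\<^esub> r)" "0 < r \<Longrightarrow> \<one>\<^bsub>G\<^esub> \<in> M.mball \<one>\<^bsub>G\<^esub> r" for r
    unfolding M(2) using M1 by simp_all
  \<comment> \<open>Level 0 has to be the whole group, so that every element is the product of some
    chain.\<close>
  define good where "good n W \<longleftrightarrow> openin T W \<and> \<one>\<^bsub>G\<^esub> \<in> W \<and> (\<forall>x\<in>W. inv\<^bsub>G\<^esub> x \<in> W) \<and>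
      (n = 0 \<longrightarrow> W = carrier G) \<and> (n > 0 \<longrightarrow> W \<subseteq> M.mball \<one>\<^bsub>G\<^esub> (1 / n))" for n :: nat and W
  have "\<exists>V. \<forall>n. good n (V n) \<and>
     (\<forall>x y z. x \<in> V (Suc n) \<longrightarrow> y \<in> V (Suc n) \<longrightarrow> z \<in> V (Suc n) \<longrightarrow> x \<otimes>\<^bsub>G\<^esub> (y \<otimes>\<^bsub>G\<^esub> z) \<in> V n)"
  proof (rule dependent_nat_choice)
    show "\<exists>W. good 0 W"
      using openin_topspace[of T] by (intro exI[of _ "carrier G"]) (auto simp: good_def ts)
    fix U n assume U: "good n U"
    let ?U = "U \<inter> M.mball \<one>\<^bsub>G\<^esub> (1 / Suc n)"
    have "openin T ?U" "\<one>\<^bsub>G\<^esub> \<in> ?U"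
      using U mb[of "1 / Suc n"] by (auto simp: good_def)
    then obtain W where "openin T W" "\<one>\<^bsub>G\<^esub> \<in> W" "W \<subseteq> ?U" "\<And>x. x \<in> W \<Longrightarrow> inv\<^bsub>G\<^esub> x \<in> W"
      "\<And>x y z. x \<in> W \<Longrightarrow> y \<in> W \<Longrightarrow> z \<in> W \<Longrightarrow> x \<otimes>\<^bsub>G\<^esub> (y \<otimes>\<^bsub>G\<^esub> z) \<in> ?U"
      using polish_abelian_group_small_nhd[OF P, of ?U] by blast
    then show "\<exists>W. good (Suc n) W \<and> (\<forall>x y z. x \<in> W \<longrightarrow> y \<in> W \<longrightarrow> z \<in> W \<longrightarrow> x \<otimes>\<^bsub>G\<^esub> (y \<otimes>\<^bsub>G\<^esub> z) \<in> U)"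
      by (intro exI[of _ W]) (auto simp: good_def)
  qed
  then obtain V where V: "\<And>n. good n (V n)"
    and V3: "\<And>n x y z. x \<in> V (Suc n) \<Longrightarrow> y \<in> V (Suc n) \<Longrightarrow> z \<in> V (Suc n) \<Longrightarrow> x \<otimes>\<^bsub>G\<^esub> (y \<otimes>\<^bsub>G\<^esub> z) \<in> V n"
    by blast
  have Vo: "openin T (V n)" "\<one>\<^bsub>G\<^esub> \<in> V n" and Vb: "n > 0 \<Longrightarrow> V n \<subseteq> M.mball \<one>\<^bsub>G\<^esub> (1 / n)" for n
    using V[of n] by (auto simp: good_def)
  have VG: "V n \<subseteq> carrier G" for n
    using Vo(1)[of n] ts openin_subset by metis
  have V0: "V 0 = carrier G" and Vinv: "\<And>n x. x \<in> V n \<Longrightarrow> inv\<^bsub>G\<^esub> x \<in> V n"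
    using V by (auto simp: good_def)
  have "\<exists>N :: 'a \<Rightarrow> real. (\<forall>x \<in> carrier G. 0 \<le> N x) \<and> N \<one>\<^bsub>G\<^esub> = 0 \<and> (\<forall>x \<in> carrier G. N (inv\<^bsub>G\<^esub> x) = N x) \<and>
    (\<forall>x \<in> carrier G. \<forall>y \<in> carrier G. N (x \<otimes>\<^bsub>G\<^esub> y) \<le> N x + N y) \<and>
    (\<forall>n. \<forall>x \<in> V n. N x \<le> (1/2) ^ n) \<and>
    (\<forall>n. \<forall>x \<in> carrier G. N x < (1/2) ^ n \<longrightarrow> x \<in> V n)"
    by (rule ex_invariant_norm) (use VG Vo(2) V0 V3 Vinv in auto)
  then obtain N :: "'a \<Rightarrow> real" where N': "\<forall>x \<in> carrier G. 0 \<le> N x" "N \<one>\<^bsub>G\<^esub> = 0"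
    "\<forall>x \<in> carrier G. N (inv\<^bsub>G\<^esub> x) = N x"
    "\<forall>x \<in> carrier G. \<forall>y \<in> carrier G. N (x \<otimes>\<^bsub>G\<^esub> y) \<le> N x + N y"
    and NV': "\<forall>n. \<forall>x \<in> V n. N x \<le> (1/2) ^ n" "\<forall>n. \<forall>x \<in> carrier G. N x < (1/2) ^ n \<longrightarrow> x \<in> V n"
    by (elim exE conjE)
  note N = N'[rule_format] and NV = NV'[rule_format]
  have ball: "\<exists>n. V n \<subseteq> U" if U: "openin T U" "\<one>\<^bsub>G\<^esub> \<in> U" for U
  proof -
    obtain r where r: "r > 0" "M.mball \<one>\<^bsub>G\<^esub> r \<subseteq> U"
      using U unfolding M(2) M.openin_mtopology by blast
    obtain n where n: "inverse (of_nat (Suc n)) < r" using reals_Archimedean r(1) by blast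
    have "M.mball \<one>\<^bsub>G\<^esub> (1 / Suc n) \<subseteq> M.mball \<one>\<^bsub>G\<^esub> r"
      using n by (intro M.mball_subset_concentric) (simp add: inverse_eq_divide)
    then show ?thesis using Vb[of "Suc n"] r by (intro exI[of _ "Suc n"]) auto
  qed
  have N0: "x = \<one>\<^bsub>G\<^esub>" if x: "x \<in> carrier G" "N x = 0" for x
  proof (rule ccontr)
    assume ne: "x \<noteq> \<one>\<^bsub>G\<^esub>"
    \<comment> \<open>Norm 0 puts x into every V n, whereas some V n avoids x.\<close>
    have "Hausdorff_space T" unfolding M(2) by (rule M.Hausdorff_space_mtopology)
    then have "openin T (topspace T - {x})"
      using x ts by (intro openin_diff openin_topspace) (simp add: closedin_Hausdorff_sing_eq)
    then obtain n where "V n \<subseteq> topspace T - {x}" using ball[of "topspace T - {x}"] ne ts by auto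
    moreover have "x \<in> V n" using x NV(2) by simp
    ultimately show False by blast
  qed
  interpret N: normed_ab_group G N
    by unfold_locales (use N N0 in auto)
  have "openin N.metric.mtopology U \<longleftrightarrow> openin T U" for U
  proof
    assume U: "openin T U"
    show "openin N.metric.mtopology U"
      unfolding N.metric.openin_mtopology
    proof (intro conjI ballI allI impI)
      show UG: "U \<subseteq> carrier G" using U ts openin_subset by metis
      fix x assume x: "x \<in> U"
      then have xG: "x \<in> carrier G" using UG by auto
      obtain n where n: "V n \<subseteq> {y \<in> topspace T. x \<otimes>\<^bsub>G\<^esub> y \<in> U}"
        using ball[OF openin_translate[OF P U xG]] x xG ts by auto
      have "N.metric.mball x ((1/2)^n) \<subseteq> U"
      proof
        fix y assume "y \<in> N.metric.mball x ((1/2)^n)"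
        then have y: "y \<in> carrier G" "N (inv\<^bsub>G\<^esub> x \<otimes>\<^bsub>G\<^esub> y) < (1/2)^n"
          using xG by (auto simp: N.metric.in_mball N.gdist_eq)
        then have "x \<otimes>\<^bsub>G\<^esub> (inv\<^bsub>G\<^esub> x \<otimes>\<^bsub>G\<^esub> y) \<in> U"
          using NV(2)[of "inv\<^bsub>G\<^esub> x \<otimes>\<^bsub>G\<^esub> y" n] xG n by auto
        then show "y \<in> U" using xG y by (simp flip: m_assoc)
      qed
      then show "\<exists>r>0. N.metric.mball x r \<subseteq> U" by (intro exI[of _ "(1/2)^n"]) auto
    qed
  next
    assume U: "openin N.metric.mtopology U"
    then have UG: "U \<subseteq> carrier G" using openin_subset by fastforce
    show "openin T U"
    proof (subst openin_subopen, intro ballI)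
      fix x assume x: "x \<in> U"
      then have xG: "x \<in> carrier G" using UG by auto
      obtain r where r: "r > 0" "N.metric.mball x r \<subseteq> U"
        using U x N.metric.openin_mtopology by blast
      obtain n where n: "(1/2)^n < r" using real_arch_pow_inv[OF r(1), of "1/2"] by auto
      let ?W = "{y \<in> topspace T. inv\<^bsub>G\<^esub> x \<otimes>\<^bsub>G\<^esub> y \<in> V n}"
      have "openin T ?W" using openin_translate[OF P Vo(1)[of n]] xG by simp
      moreover have "x \<in> ?W" using xG ts Vo(2) by simp
      moreover have "?W \<subseteq> N.metric.mball x r"
        using le_less_trans[OF NV(1) n] xG ts by (auto simp: N.metric.in_mball N.gdist_eq)
      ultimately show "\<exists>W. openin T W \<and> x \<in> W \<and> W \<subseteq> U" using r(2) by blast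
    qed
  qed
  then have "N.metric.mtopology = T" by (simp add: topology_eq)
  with N.normed_ab_group_axioms show thesis by (rule that)
qed

section \<open>Baire category and completeness of invariant metrics\<close>

text \<open>Both sets are countable intersections of open sets, which are dense because they contain
  a dense set. The two families together are still countable, so the category theorem applies to all
  of them at once.\<close>

lemma gdelta_dense_inter:
  assumes X: "completely_metrizable_space X" "topspace X \<noteq> {}"
    and S: "gdelta_in X S" "X closure_of S = topspace X"
    and T: "gdelta_in X T" "X closure_of T = topspace X"
  shows "S \<inter> T \<noteq> {}"
proof -
  obtain M d where M: "Metric_space M d" "Metric_space.mcomplete M d" "X = Metric_space.mtopology M d"
    using X(1) unfolding completely_metrizable_space_def by blast
  interpret Metric_space M d by (rule M)
  obtain C :: "nat \<Rightarrow> _" where C: "\<And>n. openin X (C n)" "\<Inter>(range C) = S"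
    using S(1) unfolding gdelta_in_descending by blast
  obtain D :: "nat \<Rightarrow> _" where D: "\<And>n. openin X (D n)" "\<Inter>(range D) = T"
    using T(1) unfolding gdelta_in_descending by blast
  have dense: "X closure_of A = topspace X" if "B \<subseteq> A" "X closure_of B = topspace X" for A B
    using that closure_of_mono[of B A X] closure_of_subset_topspace[of X A] by auto
  have "mtopology closure_of \<Inter>(range C \<union> range D) = M"
  proof (rule metric_Baire_category[OF M(2)])
    fix W assume "W \<in> range C \<union> range D"
    then have "openin X W" "S \<subseteq> W \<or> T \<subseteq> W" using C D by auto
    then show "openin mtopology W \<and> mtopology closure_of W = M"
      using dense[of S W] dense[of T W] S(2) T(2) M(3) by auto
  qed auto
  then have "X closure_of (S \<inter> T) = topspace X"
    using C(2) D(2) M(3) by (simp add: Inf_union_distrib)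
  then show ?thesis using X(2) by (metis closure_of_empty)
qed

context normed_ab_group
begin

text \<open>
  Klee's argument: for a Cauchy sequence \<open>\<sigma>\<close>, both \<open>G\<close> and \<open>lim \<sigma> - G\<close> are dense
  \<open>G\<^sub>\<delta>\<close> subsets of the completion, hence meet.
\<close>

theorem mcomplete_if_completely_metrizable:
  assumes cm: "completely_metrizable_space metric.mtopology"
  shows "metric.mcomplete"
  unfolding metric.mcomplete_def
proof (intro allI impI)
  fix \<sigma> assume \<sigma>: "metric.MCauchy \<sigma>"
  then have \<sigma>G: "\<sigma> n \<in> carrier G" for n
    by (auto simp: metric.MCauchy_def)
  obtain f :: "'a \<Rightarrow> 'a \<Rightarrow> real" and m' where m': "mcomplete_of m'"
    and f: "f \<in> carrier G \<rightarrow> mspace m'" "mtopology_of m' closure_of (f ` carrier G) = mspace m'"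
    and fd: "\<And>x y. x \<in> carrier G \<Longrightarrow> y \<in> carrier G \<Longrightarrow> mdist m' (f x) (f y) = gdist x y"
    by (rule metric.metric_completion) (rule that)
  interpret M': Metric_space "mspace m'" "mdist m'" by (rule Metric_space_mspace_mdist)
  have mt: "mtopology_of m' = M'.mtopology" by (simp add: mtopology_of_def)
  have M'c: "M'.mcomplete" using m' by (simp add: mcomplete_of_def)
  \<comment> \<open>An isometric copy of the group carries its topology, hence is completely
    metrizable, hence is a G-delta set in the completion. This is where the hypothesis on the
    topology enters; it serves for f and for \<phi>.\<close>
  have gd: "gdelta_in M'.mtopology (g ` carrier G)"
    if "g \<in> carrier G \<rightarrow> mspace m'" "\<And>x y. x \<in> carrier G \<Longrightarrow> y \<in> carrier G \<Longrightarrow> mdist m' (g x) (g y) = gdist x y" for g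
  proof -
    interpret Metric_space12 "carrier G" gdist "mspace m'" "mdist m'" by unfold_locales
    have "embedding_map metric.mtopology M'.mtopology g"
      using that by (rule isometry_imp_embedding_map)
    then have "metric.mtopology homeomorphic_space subtopology M'.mtopology (g ` carrier G)"
      using embedding_map_imp_homeomorphic_space by fastforce
    then have "completely_metrizable_space (subtopology M'.mtopology (g ` carrier G))"
      using cm homeomorphic_completely_metrizable_space by blast
    then show ?thesis
      using that(1) by (intro completely_metrizable_space_imp_gdelta_in) (auto simp: M'.metrizable_space_mtopology)
  qed
  have td: "gdist (\<sigma> m \<otimes> inv x) (\<sigma> n \<otimes> inv x) = gdist (\<sigma> m) (\<sigma> n)" if "x \<in> carrier G" for x m n
    using gdist_translate[of "inv x" "\<sigma> m" "\<sigma> n"] that \<sigma>G by (simp add: m_comm)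
  have ex: "\<exists>l. limitin M'.mtopology (\<lambda>n. f (\<sigma> n \<otimes> inv x)) l sequentially" if x: "x \<in> carrier G" for x
  proof -
    have "M'.MCauchy (\<lambda>n. f (\<sigma> n \<otimes> inv x))"
      using \<sigma> f(1) x \<sigma>G by (auto simp: M'.MCauchy_def metric.MCauchy_def fd td)
    then show ?thesis using M'c unfolding M'.mcomplete_def by blast
  qed
  \<comment> \<open>The completion is a metric space without a product, so the point
    \<open>lim \<sigma> - x\<close> is reached as a limit of points of the group.\<close>
  define \<phi> where "\<phi> x = (SOME l. limitin M'.mtopology (\<lambda>n. f (\<sigma> n \<otimes> inv x)) l sequentially)" for x
  have lim: "limitin M'.mtopology (\<lambda>n. f (\<sigma> n \<otimes> inv x)) (\<phi> x) sequentially" if "x \<in> carrier G" for x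
    unfolding \<phi>_def using ex[OF that] by (rule someI_ex)
  have \<phi>M: "\<phi> x \<in> mspace m'" if "x \<in> carrier G" for x
    using lim[OF that] M'.limitin_mspace by blast
  have fM: "f x \<in> mspace m'" if "x \<in> carrier G" for x
    using f(1) that by blast
  have near: "\<exists>K. \<forall>n\<ge>K. mdist m' (f (\<sigma> n \<otimes> inv x)) (\<phi> x) < e" if "x \<in> carrier G" "0 < e" for x e
    using lim[OF that(1)] that(2) unfolding M'.limit_metric_sequentially by meson
  \<comment> \<open>The approximating points already have distance \<open>gdist x y\<close>,
    translations and inversion being isometries; what remains is to pass to the limit.\<close>
  have \<phi>d: "mdist m' (\<phi> x) (\<phi> y) = gdist x y" if x: "x \<in> carrier G" and y: "y \<in> carrier G" for x y
  proof -
    have "\<bar>mdist m' (\<phi> x) (\<phi> y) - gdist x y\<bar> \<le> e" if e: "0 < e" for e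
    proof -
      obtain K L where K: "\<And>n. n \<ge> K \<Longrightarrow> mdist m' (f (\<sigma> n \<otimes> inv x)) (\<phi> x) < e/2"
        and L: "\<And>n. n \<ge> L \<Longrightarrow> mdist m' (f (\<sigma> n \<otimes> inv y)) (\<phi> y) < e/2"
        using near[OF x, of "e/2"] near[OF y, of "e/2"] half_gt_zero[OF e] by metis
      define n where "n = max K L"
      let ?a = "f (\<sigma> n \<otimes> inv x)" and ?b = "f (\<sigma> n \<otimes> inv y)"
      have ab: "?a \<in> mspace m'" "?b \<in> mspace m'" using fM x y \<sigma>G by auto
      have "mdist m' ?a ?b = gdist x y"
        using fd[of "\<sigma> n \<otimes> inv x" "\<sigma> n \<otimes> inv y"] gdist_translate[of "\<sigma> n" "inv x" "inv y"] gdist_inv[of x y] x y \<sigma>G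
        by simp
      moreover have "mdist m' ?a (\<phi> x) < e/2" "mdist m' ?b (\<phi> y) < e/2"
        using K[of n] L[of n] by (auto simp: n_def)
      moreover have "mdist m' (\<phi> x) (\<phi> y) \<le> mdist m' (\<phi> x) ?a + mdist m' ?a (\<phi> y)"
        "mdist m' ?a (\<phi> y) \<le> mdist m' ?a ?b + mdist m' ?b (\<phi> y)"
        "mdist m' ?a ?b \<le> mdist m' ?a (\<phi> x) + mdist m' (\<phi> x) ?b"
        "mdist m' (\<phi> x) ?b \<le> mdist m' (\<phi> x) (\<phi> y) + mdist m' (\<phi> y) ?b"
        using ab \<phi>M x y by (auto intro!: mdist_triangle)
      ultimately show ?thesis using mdist_commute[of m' ?a "\<phi> x"] mdist_commute[of m' ?b "\<phi> y"] by linarith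
    qed
    then have "\<bar>mdist m' (\<phi> x) (\<phi> y) - gdist x y\<bar> \<le> 0 + e" if "0 < e" for e
      using that by simp
    then have "\<bar>mdist m' (\<phi> x) (\<phi> y) - gdist x y\<bar> \<le> 0"
      by (rule field_le_epsilon)
    then show ?thesis by simp
  qed
  have \<phi>dense: "M'.mtopology closure_of (\<phi> ` carrier G) = mspace m'"
  proof -
    have "\<exists>y \<in> \<phi> ` carrier G. mdist m' w y < e" if w: "w \<in> mspace m'" and e: "0 < e" for w e
    proof -
      have "w \<in> M'.mtopology closure_of (f ` carrier G)" using f(2) w mt by simp
      then obtain g where g: "g \<in> carrier G" "mdist m' w (f g) < e/3"
        using e unfolding M'.metric_closure_of by (auto simp: M'.in_mball dest!: spec[of _ "e/3"])
      obtain n where n: "\<And>k k'. k \<ge> n \<Longrightarrow> k' \<ge> n \<Longrightarrow> gdist (\<sigma> k) (\<sigma> k') < e/3"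
        using \<sigma> e unfolding metric.MCauchy_def by (meson divide_pos_pos zero_less_numeral)
      \<comment> \<open>Chosen so that \<phi> x is close to g: in additive notation,
        \<open>\<sigma> k - x\<close> is \<open>g + \<sigma> k - \<sigma> n\<close>, and \<sigma> is
        Cauchy.\<close>
      define x where "x = inv g \<otimes> \<sigma> n"
      have x: "x \<in> carrier G" using g \<sigma>G by (simp add: x_def)
      obtain K where K: "\<And>k. k \<ge> K \<Longrightarrow> mdist m' (f (\<sigma> k \<otimes> inv x)) (\<phi> x) < e/3"
        using near[OF x, of "e/3"] e by auto
      define k where "k = max K n"
      have "\<sigma> k \<otimes> inv x = (inv (\<sigma> n) \<otimes> g) \<otimes> \<sigma> k" "(inv (\<sigma> n) \<otimes> g) \<otimes> \<sigma> n = g"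
        using g \<sigma>G by (simp_all add: x_def inv_mult_group m_comm m_lcomm m_assoc)
      then have "gdist g (\<sigma> k \<otimes> inv x) = gdist (\<sigma> n) (\<sigma> k)"
        using gdist_translate[of "inv (\<sigma> n) \<otimes> g" "\<sigma> n" "\<sigma> k"] g \<sigma>G by simp
      then have "mdist m' (f g) (f (\<sigma> k \<otimes> inv x)) < e/3"
        using n[of n k] fd g x \<sigma>G by (simp add: k_def)
      moreover have "mdist m' (f (\<sigma> k \<otimes> inv x)) (\<phi> x) < e/3" using K by (simp add: k_def)
      moreover have "mdist m' w (\<phi> x) \<le> mdist m' w (f g) + mdist m' (f g) (\<phi> x)"
        "mdist m' (f g) (\<phi> x) \<le> mdist m' (f g) (f (\<sigma> k \<otimes> inv x)) + mdist m' (f (\<sigma> k \<otimes> inv x)) (\<phi> x)"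
        using w g x \<sigma>G fM \<phi>M by (auto intro!: mdist_triangle)
      ultimately have "mdist m' w (\<phi> x) < e" using g(2) by linarith
      then show ?thesis using x by blast
    qed
    then show ?thesis
      unfolding M'.metric_closure_of by (auto simp: M'.in_mball \<phi>M) 
  qed
  have "f ` carrier G \<inter> \<phi> ` carrier G \<noteq> {}"
  proof (rule gdelta_dense_inter)
    show "completely_metrizable_space M'.mtopology"
      using M'c by (rule M'.completely_metrizable_space_mtopology)
    show "topspace M'.mtopology \<noteq> {}" using fM[of \<one>] by auto
    show "gdelta_in M'.mtopology (f ` carrier G)" using f(1) fd by (rule gd)
    show "gdelta_in M'.mtopology (\<phi> ` carrier G)" using \<phi>d \<phi>M by (intro gd) auto
  qed (use f(2) \<phi>dense mt in auto)
  then obtain g h where gh: "g \<in> carrier G" "h \<in> carrier G" "f h = \<phi> g" by auto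
  \<comment> \<open>In additive notation \<open>f h\<close> is the limit of the points
    \<open>f (\<sigma> n - g)\<close>. As f is isometric, \<open>\<sigma> n - g\<close> tends to h
    in the group itself, and translation by g gives the limit of \<sigma>.\<close>
  have "limitin metric.mtopology \<sigma> (h \<otimes> g) sequentially"
    unfolding metric.limit_metric_sequentially
  proof (intro conjI allI impI)
    fix e :: real assume "0 < e"
    then obtain K where K: "\<And>n. n \<ge> K \<Longrightarrow> mdist m' (f (\<sigma> n \<otimes> inv g)) (f h) < e"
      using near[OF gh(1)] gh(3) by auto
    have "gdist (\<sigma> n) (h \<otimes> g) < e" if "n \<ge> K" for n
    proof -
      have "gdist (\<sigma> n \<otimes> inv g) h < e" using K[OF that] fd[of "\<sigma> n \<otimes> inv g" h] gh \<sigma>G by simp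
      moreover have "gdist (g \<otimes> (\<sigma> n \<otimes> inv g)) (g \<otimes> h) = gdist (\<sigma> n \<otimes> inv g) h"
        using gh \<sigma>G by (intro gdist_translate) auto
      moreover have "g \<otimes> (\<sigma> n \<otimes> inv g) = \<sigma> n"
        using gh \<sigma>G m_lcomm[of g "\<sigma> n" "inv g"] by simp
      ultimately show ?thesis using gh m_comm[of g h] by simp
    qed
    then show "\<exists>K. \<forall>n\<ge>K. \<sigma> n \<in> carrier G \<and> gdist (\<sigma> n) (h \<otimes> g) < e" using \<sigma>G by blast
  qed (use gh in simp)
  then show "\<exists>x. limitin metric.mtopology \<sigma> x sequentially" by blast
qed

end

lemma (in normed_ab_group) continuous_map_mult:
  "continuous_map (prod_topology metric.mtopology metric.mtopology) metric.mtopology (\<lambda>(x, y). x \<otimes> y)"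
  unfolding continuous_map_def
proof (intro conjI allI impI)
  fix U assume U: "openin metric.mtopology U"
  let ?P = "{p \<in> topspace (prod_topology metric.mtopology metric.mtopology). (case p of (x, y) \<Rightarrow> x \<otimes> y) \<in> U}"
  show "openin (prod_topology metric.mtopology metric.mtopology) ?P"
    unfolding openin_prod_topology_alt
  proof (intro allI impI)
    fix x y assume "(x, y) \<in> ?P"
    then have xy: "x \<in> carrier G" "y \<in> carrier G" "x \<otimes> y \<in> U" by auto
    obtain r where r: "0 < r" "metric.mball (x \<otimes> y) r \<subseteq> U"
      using U xy(3) unfolding metric.openin_mtopology by blast
    have "x' \<otimes> y' \<in> U" if "x' \<in> metric.mball x (r/2)" "y' \<in> metric.mball y (r/2)" for x' y'
    proof -
      have c: "x' \<in> carrier G" "y' \<in> carrier G" "gdist x x' < r/2" "gdist y y' < r/2"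
        using that by auto
      have "gdist (x \<otimes> y) (x' \<otimes> y') \<le> gdist (x \<otimes> y) (x \<otimes> y') + gdist (x \<otimes> y') (x' \<otimes> y')"
        using xy c by (intro metric.triangle) auto
      also have "\<dots> = gdist y y' + gdist x x'"
        using gdist_translate[of x y y'] gdist_translate[of y' x x'] xy c by (simp add: m_comm)
      finally have "x' \<otimes> y' \<in> metric.mball (x \<otimes> y) r"
        using xy c by (simp add: metric.in_mball)
      then show ?thesis using r by blast
    qed
    then show "\<exists>V W. openin metric.mtopology V \<and> openin metric.mtopology W \<and> x \<in> V \<and> y \<in> W \<and> V \<times> W \<subseteq> ?P"
      using xy r(1)
      by (intro exI[of _ "metric.mball x (r/2)"] exI[of _ "metric.mball y (r/2)"]) auto
  qed
qed auto

lemma (in normed_ab_group) continuous_map_inv: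
  "continuous_map metric.mtopology metric.mtopology (\<lambda>x. inv x)"
  unfolding metric.metric_continuous_map[OF metric.Metric_space_axioms]
  using gdist_inv by (auto simp: Pi_def)

lemma polish_abelian_group_metric:
  fixes G :: "'a monoid"
  assumes N: "normed_ab_group G N"
    and "Metric_space.mcomplete (carrier G) (normed_ab_group.gdist G N)"
    and "second_countable (Metric_space.mtopology (carrier G) (normed_ab_group.gdist G N))"
  shows "polish_abelian_group G (Metric_space.mtopology (carrier G) (normed_ab_group.gdist G N))"
proof -
  interpret normed_ab_group G N by (rule N)
  show ?thesis
    unfolding polish_abelian_group_def
    using assms continuous_map_mult continuous_map_inv metric.completely_metrizable_space_mtopology
    by (simp add: comm_group_axioms)
qed

section \<open>Quotient topologies and Polish quotients\<close>

lemma openin_quotient_topology: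
  "openin (quotient_topology T q) U \<longleftrightarrow> U \<subseteq> q ` topspace T \<and> openin T {x \<in> topspace T. q x \<in> U}"
proof -
  have "istopology (\<lambda>U. U \<subseteq> q ` topspace T \<and> openin T {x \<in> topspace T. q x \<in> U})"
    unfolding istopology_def
  proof (intro conjI allI impI; (elim conjE)?)
    fix S U assume "openin T {x \<in> topspace T. q x \<in> S}" "openin T {x \<in> topspace T. q x \<in> U}"
    then have "openin T ({x \<in> topspace T. q x \<in> S} \<inter> {x \<in> topspace T. q x \<in> U})" by (rule openin_Int)
    moreover have "{x \<in> topspace T. q x \<in> S} \<inter> {x \<in> topspace T. q x \<in> U} = {x \<in> topspace T. q x \<in> S \<inter> U}" by auto
    ultimately show "openin T {x \<in> topspace T. q x \<in> S \<inter> U}" by simp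
  next
    fix K assume K: "\<forall>S\<in>K. S \<subseteq> q ` topspace T \<and> openin T {x \<in> topspace T. q x \<in> S}"
    then have "openin T (\<Union>S\<in>K. {x \<in> topspace T. q x \<in> S})" by blast
    moreover have "(\<Union>S\<in>K. {x \<in> topspace T. q x \<in> S}) = {x \<in> topspace T. q x \<in> \<Union>K}" by auto
    ultimately show "openin T {x \<in> topspace T. q x \<in> \<Union>K}" by simp
  qed auto
  then show ?thesis by (simp add: quotient_topology_def)
qed

lemma topspace_quotient_topology: "topspace (quotient_topology T q) = q ` topspace T"
proof (rule antisym)
  show "topspace (quotient_topology T q) \<subseteq> q ` topspace T"
    using openin_quotient_topology[of T q "topspace (quotient_topology T q)"] by simp
  have "{x \<in> topspace T. q x \<in> q ` topspace T} = topspace T" by auto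
  then have "openin (quotient_topology T q) (q ` topspace T)"
    by (simp add: openin_quotient_topology)
  then show "q ` topspace T \<subseteq> topspace (quotient_topology T q)" by (rule openin_subset)
qed

lemma continuous_map_quotient_topology: "continuous_map T (quotient_topology T q) q"
  by (simp add: continuous_map_def topspace_quotient_topology openin_quotient_topology)

lemma continuous_map_from_quotient_topology:
  assumes "continuous_map T Y (\<lambda>x. f (q x))"
  shows "continuous_map (quotient_topology T q) Y f"
  unfolding continuous_map_def
proof (intro conjI allI impI)
  show "f \<in> topspace (quotient_topology T q) \<rightarrow> topspace Y"
    using assms by (auto simp: continuous_map_def topspace_quotient_topology)
  fix U assume "openin Y U"
  then have "openin T {x \<in> topspace T. f (q x) \<in> U}"
    using assms by (rule openin_continuous_map_preimage[rotated])
  moreover have "{x \<in> topspace T. q x \<in> {y \<in> topspace (quotient_topology T q). f y \<in> U}} = {x \<in> topspace T. f (q x) \<in> U}"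
    by (auto simp: topspace_quotient_topology)
  ultimately show "openin (quotient_topology T q) {y \<in> topspace (quotient_topology T q). f y \<in> U}"
    by (auto simp: openin_quotient_topology topspace_quotient_topology)
qed

text \<open>Bounds on consecutive steps can be lifted along a quotient map one step at a time, which
  is not so for the Cauchy property as a whole. This is how completeness will pass to
  quotients.\<close>

lemma (in Metric_space) MCauchy_fast_subsequence:
  assumes "MCauchy \<sigma>"
  obtains r :: "nat \<Rightarrow> nat" where "strict_mono r" "\<And>n. d (\<sigma> (r n)) (\<sigma> (r (Suc n))) < (1/2) ^ n"
proof -
  have "\<exists>K. \<forall>n m. K \<le> n \<longrightarrow> K \<le> m \<longrightarrow> d (\<sigma> n) (\<sigma> m) < (1/2) ^ k" for k :: nat
    using assms unfolding MCauchy_def by (meson half_gt_zero_iff zero_less_one zero_less_power)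
  then obtain K where K: "\<And>k n m. K k \<le> n \<Longrightarrow> K k \<le> m \<Longrightarrow> d (\<sigma> n) (\<sigma> m) < (1/2) ^ (k::nat)" by metis
  have "\<exists>r. \<forall>n. K n \<le> r n \<and> r n < r (Suc n)"
  proof (rule dependent_nat_choice)
    show "\<exists>y. K (Suc n) \<le> y \<and> x < y" for x n
      by (intro exI[of _ "max (K (Suc n)) (Suc x)"]) auto
  qed auto
  then obtain r where r: "\<And>n. K n \<le> r n" "\<And>n. r n < r (Suc n)" by blast
  show thesis
  proof
    show "strict_mono r" using r(2) by (simp add: strict_mono_Suc_iff)
    show "d (\<sigma> (r n)) (\<sigma> (r (Suc n))) < (1/2) ^ n" for n
      using K[of n "r n" "r (Suc n)"] r(1)[of n] r(2)[of n] by simp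
  qed
qed

text \<open>2 (1/2)^n is a tail of the geometric series; carrying the subtracted remainder along
  makes the induction on k go through.\<close>

lemma (in Metric_space) MCauchy_fast:
  assumes M: "\<And>n. x n \<in> M" and d: "\<And>n. d (x n) (x (Suc n)) < (1/2) ^ n"
  shows "MCauchy x"
proof -
  have bound: "d (x n) (x (n + k)) \<le> 2 * (1/2) ^ n - 2 * (1/2) ^ (n + k)" for n k
  proof (induction k)
    case (Suc k)
    have "d (x n) (x (n + Suc k)) \<le> d (x n) (x (n + k)) + d (x (n + k)) (x (Suc (n + k)))"
      using M triangle by simp
    with Suc d[of "n + k"] show ?case by simp
  qed (use M in simp)
  have small: "d (x n) (x m) < 2 * (1/2) ^ n" if "n \<le> m" for n m
  proof -
    have "(0::real) < 2 * (1/2) ^ (n + (m - n))" by simp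
    with bound[of n "m - n"] have "d (x n) (x (n + (m - n))) < 2 * (1/2) ^ n" by linarith
    then show ?thesis using that by simp
  qed
  show ?thesis
    unfolding MCauchy_def
  proof (intro conjI allI impI)
    fix e :: real assume "0 < e"
    then obtain K where K: "(1/2) ^ K < e / 4" using real_arch_pow_inv[of "e/4" "1/2"] by auto
    have "d (x n) (x m) < e" if "K \<le> n" "K \<le> m" for n m
    proof -
      have "d (x n) (x m) \<le> d (x n) (x K) + d (x K) (x m)" using M triangle by simp
      then show ?thesis using small[of K n] small[of K m] that K commute[of "x n" "x K"] by linarith
    qed
    then show "\<exists>N. \<forall>n n'. N \<le> n \<longrightarrow> N \<le> n' \<longrightarrow> d (x n) (x n') < e" by blast
  qed (use M in auto)
qed

text \<open>The norm of a class is the infimum of N over its fibre. It is definite because the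
  kernel is closed, and complete because a fast Cauchy sequence lifts step by step with the same
  bounds. The quotient is realized as the image of q inside H rather than by cosets, since the
  subgroup of a cokernel has to sit inside the cover.\<close>

theorem polish_abelian_group_quotient:
  fixes G :: "'a monoid" and H :: "'b monoid"
  assumes P: "polish_abelian_group G T" and H: "comm_group H" and q: "q \<in> hom G H"
    and closed: "closedin T {x \<in> carrier G. q x = \<one>\<^bsub>H\<^esub>}"
  shows "polish_abelian_group (H\<lparr>carrier := q ` carrier G\<rparr>) (quotient_topology T q)"
proof -
  obtain N where N: "normed_ab_group G N"
    and NT: "Metric_space.mtopology (carrier G) (normed_ab_group.gdist G N) = T"
    using P by (rule polish_abelian_group_normable)
  interpret N: normed_ab_group G N by (rule N)
  interpret H: comm_group H by (rule H)
  interpret q: group_hom G H q using q by unfold_locales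
  have ts: "topspace T = carrier G" using P by (rule polish_abelian_group_topspace)
  define Q where "Q = H\<lparr>carrier := q ` carrier G\<rparr>"
  have Qsimps: "carrier Q = q ` carrier G" "\<one>\<^bsub>Q\<^esub> = \<one>\<^bsub>H\<^esub>" "mult Q = mult H"
    by (simp_all add: Q_def)
  have sub: "subgroup (q ` carrier G) H" by (rule q.img_is_subgroup)
  have Qcomm: "comm_group Q"
    unfolding Q_def
    by (rule group.group_comm_groupI[OF H.subgroup_imp_group[OF sub]])
       (use subgroup.subset[OF sub] in \<open>auto intro!: H.m_comm\<close>)
  interpret Q: comm_group Q by (rule Qcomm)
  have Qinv: "inv\<^bsub>Q\<^esub> (q x) = q (inv\<^bsub>G\<^esub> x)" if "x \<in> carrier G" for x
    using that by (intro Q.inv_equality) (auto simp: Qsimps simp flip: q.hom_mult simp del: q.hom_inv)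
  define S where "S u = N ` {x \<in> carrier G. q x = u}" for u
  define M where "M u = Inf (S u)" for u
  have bdd: "bdd_below (S u)" for u
    unfolding S_def using N.norm_nonneg by (intro bdd_belowI[of _ 0]) auto
  have ne: "S (q x) \<noteq> {}" if "x \<in> carrier G" for x
    using that unfolding S_def by auto
  have M_le: "M (q x) \<le> N x" if "x \<in> carrier G" for x
    unfolding M_def using that bdd by (intro cInf_lower) (auto simp: S_def)
  have M_ex: "\<exists>y \<in> carrier G. q y = u \<and> N y < e" if "u \<in> carrier Q" "M u < e" for u e
  proof -
    have "S u \<noteq> {}" using ne that(1) by (auto simp: Qsimps)
    then show ?thesis using cInf_less_iff[OF _ bdd, of u e] that(2) unfolding M_def S_def by auto
  qed
  have M_nonneg: "0 \<le> M u" if "u \<in> carrier Q" for u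
    unfolding M_def using ne that N.norm_nonneg by (intro cInf_greatest) (auto simp: S_def Qsimps)
  have M_inv_le: "M (inv\<^bsub>Q\<^esub> u) \<le> M u" if u: "u \<in> carrier Q" for u
  proof (rule dense_ge)
    fix e assume "M u < e"
    then obtain y where y: "y \<in> carrier G" "q y = u" "N y < e" using M_ex[OF u] by blast
    then have "M (q (inv\<^bsub>G\<^esub> y)) \<le> N y" using M_le[of "inv\<^bsub>G\<^esub> y"] N.norm_inv[of y] by simp
    then show "M (inv\<^bsub>Q\<^esub> u) \<le> e" using y Qinv[of y] by simp
  qed
  interpret M: normed_ab_group Q M
  proof (unfold_locales)
    fix u assume u: "u \<in> carrier Q"
    show "0 \<le> M u" using u by (rule M_nonneg)
    show "M (inv\<^bsub>Q\<^esub> u) = M u"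
      using M_inv_le[OF u] M_inv_le[of "inv\<^bsub>Q\<^esub> u"] u by simp
    show "M u = 0 \<longleftrightarrow> u = \<one>\<^bsub>Q\<^esub>"
    proof
      assume "u = \<one>\<^bsub>Q\<^esub>"
      then have "M u \<le> 0" using M_le[of "\<one>\<^bsub>G\<^esub>"] N.norm_eq_0[of "\<one>\<^bsub>G\<^esub>"] by (simp add: Qsimps)
      then show "M u = 0" using M_nonneg[OF u] by simp
    next
      assume M0: "M u = 0"
      obtain x where x: "x \<in> carrier G" "q x = u" using u by (auto simp: Qsimps)
      let ?K = "{x \<in> carrier G. q x = \<one>\<^bsub>H\<^esub>}"
      \<comment> \<open>The fibre of x contains elements y of arbitrarily small norm, and the
        quotient of x by y lies in the kernel at distance N y from x.\<close>
      have "x \<in> N.metric.mtopology closure_of ?K"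
        unfolding N.metric.metric_closure_of
      proof (intro CollectI conjI allI impI)
        fix r :: real assume "0 < r"
        then obtain y where y: "y \<in> carrier G" "q y = u" "N y < r" using M_ex[OF u, of r] M0 by auto
        have "x \<otimes>\<^bsub>G\<^esub> inv\<^bsub>G\<^esub> y \<in> ?K" using x y q.hom_closed[OF x(1)] by simp
        moreover have "inv\<^bsub>G\<^esub> x \<otimes>\<^bsub>G\<^esub> (x \<otimes>\<^bsub>G\<^esub> inv\<^bsub>G\<^esub> y) = inv\<^bsub>G\<^esub> y"
          using x y by (simp flip: N.m_assoc)
        then have "x \<otimes>\<^bsub>G\<^esub> inv\<^bsub>G\<^esub> y \<in> N.metric.mball x r"
          using x y N.norm_inv[of y] by (simp add: N.metric.in_mball N.gdist_eq)
        ultimately show "\<exists>z \<in> ?K. z \<in> N.metric.mball x r" by blast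
      qed (use x in auto)
      then have "x \<in> ?K" using closed NT closure_of_closedin by metis
      then show "u = \<one>\<^bsub>Q\<^esub>" using x by (simp add: Qsimps)
    qed
    fix v assume v: "v \<in> carrier Q"
    show "M (u \<otimes>\<^bsub>Q\<^esub> v) \<le> M u + M v"
    proof (rule field_le_epsilon)
      fix e :: real assume e: "0 < e"
      obtain x where x: "x \<in> carrier G" "q x = u" "N x < M u + e/2"
        using M_ex[OF u, of "M u + e/2"] e by auto
      obtain y where y: "y \<in> carrier G" "q y = v" "N y < M v + e/2"
        using M_ex[OF v, of "M v + e/2"] e by auto
      have "M (u \<otimes>\<^bsub>Q\<^esub> v) \<le> N (x \<otimes>\<^bsub>G\<^esub> y)"
        using M_le[of "x \<otimes>\<^bsub>G\<^esub> y"] x y by (simp add: Qsimps)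
      also have "\<dots> \<le> N x + N y" using x y by (intro N.norm_mult_le)
      finally show "M (u \<otimes>\<^bsub>Q\<^esub> v) \<le> M u + M v + e" using x y by simp
    qed
  qed
  have qQ: "q x \<in> carrier Q" if "x \<in> carrier G" for x
    using that by (simp add: Qsimps)
  have dist_le: "M.gdist (q x) (q y) \<le> N.gdist x y" if "x \<in> carrier G" "y \<in> carrier G" for x y
    using that M_le[of "inv\<^bsub>G\<^esub> x \<otimes>\<^bsub>G\<^esub> y"] by (simp add: M.gdist_eq N.gdist_eq Qsimps Qinv)
  \<comment> \<open>A distance in the quotient is realized, up to a strict inequality, from any
    prescribed point x of the fibre: translate a small lift of the difference by x.\<close>
  have lift: "\<exists>y \<in> carrier G. q y = v \<and> N.gdist x y < e"
    if x: "x \<in> carrier G" and v: "v \<in> carrier Q" and e: "M.gdist (q x) v < e" for x v e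
  proof -
    have qx: "q x \<in> carrier Q" using x by (simp add: Qsimps)
    have "M (inv\<^bsub>Q\<^esub> (q x) \<otimes>\<^bsub>Q\<^esub> v) < e" using e qx v by (simp add: M.gdist_eq)
    then obtain z where z: "z \<in> carrier G" "q z = inv\<^bsub>Q\<^esub> (q x) \<otimes>\<^bsub>Q\<^esub> v" "N z < e"
      using M_ex[of "inv\<^bsub>Q\<^esub> (q x) \<otimes>\<^bsub>Q\<^esub> v" e] qx v by auto
    have "q (x \<otimes>\<^bsub>G\<^esub> z) = q x \<otimes>\<^bsub>Q\<^esub> (inv\<^bsub>Q\<^esub> (q x) \<otimes>\<^bsub>Q\<^esub> v)" using x z by (simp add: Qsimps)
    also have "\<dots> = v" using qx v by (simp flip: Q.m_assoc)
    finally have "q (x \<otimes>\<^bsub>G\<^esub> z) = v" .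
    moreover have "N.gdist x (x \<otimes>\<^bsub>G\<^esub> z) < e"
      using x z by (simp add: N.gdist_eq flip: N.m_assoc)
    ultimately show ?thesis using x z by (intro bexI[of _ "x \<otimes>\<^bsub>G\<^esub> z"]) auto
  qed
  have "openin M.metric.mtopology U \<longleftrightarrow> openin (quotient_topology T q) U" for U
  proof
    assume U: "openin (quotient_topology T q) U"
    then have UQ: "U \<subseteq> carrier Q" and Uo: "openin N.metric.mtopology {x \<in> carrier G. q x \<in> U}"
      by (simp_all add: openin_quotient_topology ts Qsimps NT)
    show "openin M.metric.mtopology U"
      unfolding M.metric.openin_mtopology
    proof (intro conjI ballI allI impI)
      show "U \<subseteq> carrier Q" by (rule UQ)
      fix u assume u: "u \<in> U"
      then obtain x where x: "x \<in> carrier G" "q x = u" using UQ by (auto simp: Qsimps)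
      have "x \<in> {x \<in> carrier G. q x \<in> U}" using x u by simp
      then obtain r where r: "0 < r" "N.metric.mball x r \<subseteq> {x \<in> carrier G. q x \<in> U}"
        using Uo unfolding N.metric.openin_mtopology by blast
      have "M.metric.mball u r \<subseteq> U"
      proof
        fix v assume v: "v \<in> M.metric.mball u r"
        then obtain y where y: "y \<in> carrier G" "q y = v" "N.gdist x y < r"
          using lift[OF x(1), of v r] x(2) by auto
        then have "y \<in> N.metric.mball x r" using x by simp
        then show "v \<in> U" using r(2) y by blast
      qed
      then show "\<exists>r>0. M.metric.mball u r \<subseteq> U" using r(1) by blast
    qed
  next
    assume U: "openin M.metric.mtopology U"
    then have UQ: "U \<subseteq> carrier Q" using openin_subset by fastforce
    have "openin N.metric.mtopology {x \<in> carrier G. q x \<in> U}"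
      unfolding N.metric.openin_mtopology
    proof (intro conjI ballI allI impI)
      fix x assume "x \<in> {x \<in> carrier G. q x \<in> U}"
      then have x: "x \<in> carrier G" "q x \<in> U" by auto
      obtain r where r: "0 < r" "M.metric.mball (q x) r \<subseteq> U"
        using U x(2) unfolding M.metric.openin_mtopology by blast
      have "N.metric.mball x r \<subseteq> {x \<in> carrier G. q x \<in> U}"
      proof
        fix y assume "y \<in> N.metric.mball x r"
        then have y: "y \<in> carrier G" "N.gdist x y < r" by auto
        then have "q y \<in> M.metric.mball (q x) r"
          using x dist_le[of x y] qQ by (simp add: M.metric.in_mball)
        then show "y \<in> {x \<in> carrier G. q x \<in> U}" using r(2) y by blast
      qed
      then show "\<exists>r>0. N.metric.mball x r \<subseteq> {x \<in> carrier G. q x \<in> U}" using r(1) by blast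
    qed auto
    then show "openin (quotient_topology T q) U"
      using UQ by (simp add: openin_quotient_topology ts Qsimps NT)
  qed
  then have MT: "M.metric.mtopology = quotient_topology T q" by (simp add: topology_eq)
  have "N.metric.mcomplete"
    using polish_abelian_group_cm[OF P] NT by (intro N.mcomplete_if_completely_metrizable) simp
  then have Nc: "\<exists>x. limitin N.metric.mtopology \<sigma> x sequentially" if "N.metric.MCauchy \<sigma>" for \<sigma>
    using that unfolding N.metric.mcomplete_def by blast
  have "M.metric.mcomplete"
    unfolding M.metric.mcomplete_def
  proof (intro allI impI)
    fix \<sigma> assume \<sigma>: "M.metric.MCauchy \<sigma>"
    then have \<sigma>Q: "\<sigma> n \<in> carrier Q" for n by (auto simp: M.metric.MCauchy_def)
    obtain r :: "nat \<Rightarrow> nat" where r: "strict_mono r" "\<And>n. M.gdist (\<sigma> (r n)) (\<sigma> (r (Suc n))) < (1/2) ^ n"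
      using M.metric.MCauchy_fast_subsequence[OF \<sigma>] by blast
    \<comment> \<open>Each lift is chosen close to the one before, so that the lifts form a Cauchy
      sequence themselves.\<close>
    have "\<exists>x. \<forall>n. (x n \<in> carrier G \<and> q (x n) = \<sigma> (r n)) \<and> N.gdist (x n) (x (Suc n)) < (1/2) ^ n"
    proof (rule dependent_nat_choice)
      show "\<exists>x. x \<in> carrier G \<and> q x = \<sigma> (r 0)" using \<sigma>Q[of "r 0"] by (auto simp: Qsimps)
      show "\<exists>y. (y \<in> carrier G \<and> q y = \<sigma> (r (Suc n))) \<and> N.gdist x y < (1/2) ^ n"
        if "x \<in> carrier G \<and> q x = \<sigma> (r n)" for x n
        using lift[of x "\<sigma> (r (Suc n))" "(1/2)^n"] that \<sigma>Q[of "r (Suc n)"] r(2)[of n] by auto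
    qed
    then obtain x where x: "\<And>n. x n \<in> carrier G" "\<And>n. q (x n) = \<sigma> (r n)"
      and xd: "\<And>n. N.gdist (x n) (x (Suc n)) < (1/2) ^ n" by blast
    obtain a where a: "limitin N.metric.mtopology x a sequentially"
      using Nc[OF N.metric.MCauchy_fast[OF x(1) xd]] by blast
    have aG: "a \<in> carrier G" using a N.metric.limitin_mspace by blast
    have "limitin M.metric.mtopology (\<sigma> \<circ> r) (q a) sequentially"
      unfolding M.metric.limit_metric_sequentially
    proof (intro conjI allI impI)
      fix e :: real assume "0 < e"
      then obtain K where "\<forall>n\<ge>K. x n \<in> carrier G \<and> N.gdist (x n) a < e"
        using a unfolding N.metric.limit_metric_sequentially by blast
      moreover have "M.gdist ((\<sigma> \<circ> r) n) (q a) \<le> N.gdist (x n) a" for n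
        using dist_le[OF x(1) aG, of n] x(2)[of n] by simp
      ultimately show "\<exists>K. \<forall>n\<ge>K. (\<sigma> \<circ> r) n \<in> carrier Q \<and> M.gdist ((\<sigma> \<circ> r) n) (q a) < e"
        using \<sigma>Q by (metis comp_apply le_less_trans)
    qed (use aG in \<open>simp add: Qsimps\<close>)
    then show "\<exists>x. limitin M.metric.mtopology \<sigma> x sequentially"
      using M.metric.MCauchy_convergent_subsequence[OF \<sigma> r(1)] by blast
  qed
  \<comment> \<open>By \<open>lift\<close>, q is open: the ball of radius r about x covers the ball
    of radius r about q x.\<close>
  moreover have "second_countable M.metric.mtopology"
  proof (rule second_countable_open_map_image)
    show "continuous_map T M.metric.mtopology q"
      unfolding MT by (rule continuous_map_quotient_topology)
    show "open_map T M.metric.mtopology q"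
      unfolding open_map_def
    proof (intro allI impI)
      fix U assume U: "openin T U"
      then have UG: "U \<subseteq> carrier G" using openin_subset ts by metis
      show "openin M.metric.mtopology (q ` U)"
        unfolding M.metric.openin_mtopology
      proof (intro conjI ballI allI impI)
        show "q ` U \<subseteq> carrier Q" using UG by (auto simp: Qsimps)
        fix u assume "u \<in> q ` U"
        then obtain x where x: "x \<in> U" "u = q x" by blast
        obtain r where r: "0 < r" "N.metric.mball x r \<subseteq> U"
          using U x(1) unfolding NT[symmetric] N.metric.openin_mtopology by blast
        have "M.metric.mball u r \<subseteq> q ` U"
        proof
          fix v assume "v \<in> M.metric.mball u r"
          then obtain y where y: "y \<in> carrier G" "q y = v" "N.gdist x y < r"
            using lift[of x v r] x UG by auto
          have "x \<in> carrier G" using x UG by blast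
          then have "y \<in> N.metric.mball x r" using y by (simp add: N.metric.in_mball)
          then show "v \<in> q ` U" using y(2) r(2) by blast
        qed
        then show "\<exists>r>0. M.metric.mball u r \<subseteq> q ` U" using r(1) by blast
      qed
    qed
    show "q ` topspace T = topspace M.metric.mtopology" unfolding M.metric.topspace_mtopology ts by (simp only: Qsimps(1))
    show "second_countable T" using P by (rule polish_abelian_group_sc)
  qed
  ultimately show ?thesis
    using polish_abelian_group_metric[OF M.normed_ab_group_axioms] MT unfolding Q_def by simp
qed

section \<open>Products of Polish groups\<close>

text \<open>The base consists of the cylinders over finite sets of pairs (i, V) with V in a
  countable base of X i. There are countably many such pairs, hence countably many finite sets of
  them.\<close>

lemma second_countable_product_topology:
  assumes I: "countable I" and X: "\<And>i. i \<in> I \<Longrightarrow> second_countable (X i)"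
  shows "second_countable (product_topology X I)"
proof -
  have "\<forall>i \<in> I. \<exists>B. countable B \<and> (\<forall>V \<in> B. openin (X i) V) \<and>
      (\<forall>U x. openin (X i) U \<and> x \<in> U \<longrightarrow> (\<exists>V \<in> B. x \<in> V \<and> V \<subseteq> U))"
    using X unfolding second_countable_def by auto
  then obtain B where B: "\<And>i. i \<in> I \<Longrightarrow> countable (B i)" "\<And>i V. i \<in> I \<Longrightarrow> V \<in> B i \<Longrightarrow> openin (X i) V"
    and Bb: "\<And>i U x. i \<in> I \<Longrightarrow> openin (X i) U \<Longrightarrow> x \<in> U \<Longrightarrow> \<exists>V \<in> B i. x \<in> V \<and> V \<subseteq> U"
    by metis
  define cyl where "cyl S = {x \<in> topspace (product_topology X I). \<forall>(i, V) \<in> S. x i \<in> V}" for S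
  define C where "C = cyl ` {S. finite S \<and> S \<subseteq> Sigma I B}"
  show ?thesis
    unfolding second_countable_def
  proof (intro exI conjI ballI allI impI)
    have "countable (Sigma I B)" using I B(1) by (rule countable_SIGMA)
    then show "countable C"
      unfolding C_def by (intro countable_image countable_Collect_finite_subset)
  next
    fix W assume "W \<in> C"
    then obtain S where S: "finite S" "S \<subseteq> Sigma I B" "W = cyl S" by (auto simp: C_def)
    \<comment> \<open>The factor \<open>topspace\<close> accounts for the empty S.\<close>
    have "cyl S = topspace (product_topology X I) \<inter>
        (\<Inter>p\<in>S. {x \<in> topspace (product_topology X I). x (fst p) \<in> snd p})"
      by (auto simp: cyl_def case_prod_unfold)
    moreover have "openin (product_topology X I) {x \<in> topspace (product_topology X I). x (fst p) \<in> snd p}" if "p \<in> S" for p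
      using that S(2) B(2) by (intro openin_continuous_map_preimage[OF continuous_map_product_projection]) auto
    ultimately show "openin (product_topology X I) W"
      using openin_INT[OF S(1), of "product_topology X I"] S(3) by (simp only: Int_commute)
  next
    fix U x assume Ux: "openin (product_topology X I) U \<and> x \<in> U"
    then have "\<exists>V. finite {i \<in> I. V i \<noteq> topspace (X i)} \<and> (\<forall>i \<in> I. openin (X i) (V i)) \<and>
        x \<in> Pi\<^sub>E I V \<and> Pi\<^sub>E I V \<subseteq> U"
      by (simp add: openin_product_topology_alt)
    then obtain V where V: "finite {i \<in> I. V i \<noteq> topspace (X i)}" "\<And>i. i \<in> I \<Longrightarrow> openin (X i) (V i)"
        "x \<in> Pi\<^sub>E I V" "Pi\<^sub>E I V \<subseteq> U"
      by metis
    let ?F = "{i \<in> I. V i \<noteq> topspace (X i)}"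
    have "\<forall>i \<in> ?F. \<exists>W. W \<in> B i \<and> x i \<in> W \<and> W \<subseteq> V i"
    proof
      fix i assume "i \<in> ?F"
      then have "i \<in> I" "openin (X i) (V i)" "x i \<in> V i" using V(2,3) by auto
      then show "\<exists>W. W \<in> B i \<and> x i \<in> W \<and> W \<subseteq> V i" using Bb by blast
    qed
    from bchoice[OF this] obtain W where "\<forall>i \<in> ?F. W i \<in> B i \<and> x i \<in> W i \<and> W i \<subseteq> V i" ..
    then have W: "\<And>i. i \<in> ?F \<Longrightarrow> W i \<in> B i" "\<And>i. i \<in> ?F \<Longrightarrow> x i \<in> W i"
        "\<And>i. i \<in> ?F \<Longrightarrow> W i \<subseteq> V i"
      by auto
    define S where "S = (\<lambda>i. (i, W i)) ` ?F"
    have c1: "cyl S \<in> C" using V(1) W(1) by (auto simp: C_def S_def)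
    have c2: "x \<in> cyl S"
    proof -
      have "x \<in> topspace (product_topology X I)"
        using Ux openin_subset by blast
      then show ?thesis using W(2) by (auto simp: cyl_def S_def)
    qed
    have c3: "cyl S \<subseteq> Pi\<^sub>E I V"
    proof
      fix y assume y: "y \<in> cyl S"
      then have ext: "y \<in> extensional I" and yt: "\<And>i. i \<in> I \<Longrightarrow> y i \<in> topspace (X i)"
        by (auto simp: cyl_def PiE_def)
      have yW: "y i \<in> W i" if "i \<in> ?F" for i
        using y that by (auto simp: cyl_def S_def)
      have "y i \<in> V i" if "i \<in> I" for i
        using yt[OF that] yW[of i] W(3)[of i] that by (cases "V i = topspace (X i)") auto
      then show "y \<in> Pi\<^sub>E I V" using ext by (auto simp: PiE_def)
    qed
    show "\<exists>W \<in> C. x \<in> W \<and> W \<subseteq> U"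
      by (intro bexI[OF _ c1] conjI c2 subset_trans[OF c3 V(4)])
  qed
qed

lemma second_countable_prod_topology:
  assumes "second_countable X" "second_countable Y"
  shows "second_countable (prod_topology X Y)"
proof -
  obtain B where B: "countable B" "\<And>V. V \<in> B \<Longrightarrow> openin X V"
      "\<And>U x. openin X U \<Longrightarrow> x \<in> U \<Longrightarrow> \<exists>V \<in> B. x \<in> V \<and> V \<subseteq> U"
    using assms(1) unfolding second_countable_def by metis
  obtain C where C: "countable C" "\<And>V. V \<in> C \<Longrightarrow> openin Y V"
      "\<And>U x. openin Y U \<Longrightarrow> x \<in> U \<Longrightarrow> \<exists>V \<in> C. x \<in> V \<and> V \<subseteq> U"
    using assms(2) unfolding second_countable_def by metis
  let ?D = "(\<lambda>(U, V). U \<times> V) ` (B \<times> C)"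
  show ?thesis
    unfolding second_countable_def
  proof (intro exI[of _ ?D] conjI ballI allI impI)
    show "countable ?D" using B(1) C(1) by auto
    show "openin (prod_topology X Y) V" if "V \<in> ?D" for V
      using that B(2) C(2) by (auto simp: openin_prod_Times_iff)
    fix U z assume Uz: "openin (prod_topology X Y) U \<and> z \<in> U"
    obtain V W where VW: "openin X V" "openin Y W" "fst z \<in> V" "snd z \<in> W" "V \<times> W \<subseteq> U"
      using openin_prod_topology_alt[THEN iffD1, rule_format, of X Y U "fst z" "snd z"] Uz by auto
    obtain V' W' where "V' \<in> B" "fst z \<in> V'" "V' \<subseteq> V" "W' \<in> C" "snd z \<in> W'" "W' \<subseteq> W"
      using B(3)[OF VW(1,3)] C(3)[OF VW(2,4)] by blast
    then show "\<exists>V \<in> ?D. z \<in> V \<and> V \<subseteq> U"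
      using VW(5) by (intro bexI[of _ "V' \<times> W'"]) (auto simp: mem_Times_iff)
  qed
qed

lemma comm_group_DirProd:
  assumes "comm_group G" "comm_group H"
  shows "comm_group (G \<times>\<times> H)"
proof -
  interpret G: comm_group G by fact
  interpret H: comm_group H by fact
  show ?thesis
    by (rule group.group_comm_groupI[OF DirProd_group]) (auto simp: G.m_comm H.m_comm)
qed

lemma polish_abelian_group_DirProd:
  assumes G: "polish_abelian_group G S" and H: "polish_abelian_group H T"
  shows "polish_abelian_group (G \<times>\<times> H) (prod_topology S T)"
proof -
  interpret G: comm_group G using G by (rule polish_abelian_group_comm)
  interpret H: comm_group H using H by (rule polish_abelian_group_comm)
  interpret GH: comm_group "G \<times>\<times> H"
    by (rule comm_group_DirProd) unfold_locales
  note ts = polish_abelian_group_topspace[OF G] polish_abelian_group_topspace[OF H]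
  have p: "continuous_map (prod_topology (prod_topology S T) (prod_topology S T)) S (\<lambda>p. fst (fst p))"
    "continuous_map (prod_topology (prod_topology S T) (prod_topology S T)) S (\<lambda>p. fst (snd p))"
    "continuous_map (prod_topology (prod_topology S T) (prod_topology S T)) T (\<lambda>p. snd (fst p))"
    "continuous_map (prod_topology (prod_topology S T) (prod_topology S T)) T (\<lambda>p. snd (snd p))"
    using continuous_map_compose[OF continuous_map_fst continuous_map_fst, of S T "prod_topology S T"]
      continuous_map_compose[OF continuous_map_snd continuous_map_fst, of "prod_topology S T" S T]
      continuous_map_compose[OF continuous_map_fst continuous_map_snd, of S T "prod_topology S T"]
      continuous_map_compose[OF continuous_map_snd continuous_map_snd, of "prod_topology S T" S T]
    by (simp_all add: o_def)
  have "continuous_map (prod_topology (prod_topology S T) (prod_topology S T)) (prod_topology S T)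
      (\<lambda>p. (fst (fst p) \<otimes>\<^bsub>G\<^esub> fst (snd p), snd (fst p) \<otimes>\<^bsub>H\<^esub> snd (snd p)))"
    using polish_abelian_group_mult_compose[OF G p(1,2)] polish_abelian_group_mult_compose[OF H p(3,4)]
    by (simp add: continuous_map_paired)
  moreover have "(\<lambda>(x, y). x \<otimes>\<^bsub>G \<times>\<times> H\<^esub> y) =
      (\<lambda>p. (fst (fst p) \<otimes>\<^bsub>G\<^esub> fst (snd p), snd (fst p) \<otimes>\<^bsub>H\<^esub> snd (snd p)))"
    by (auto simp: DirProd_def)
  moreover have "continuous_map (prod_topology S T) (prod_topology S T)
      (\<lambda>p. (inv\<^bsub>G\<^esub> (fst p), inv\<^bsub>H\<^esub> (snd p)))"
    using polish_abelian_group_inv_compose[OF G continuous_map_fst, of T]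
      polish_abelian_group_inv_compose[OF H continuous_map_snd, of S]
    by (simp add: continuous_map_paired)
  then have "continuous_map (prod_topology S T) (prod_topology S T) (\<lambda>x. inv\<^bsub>G \<times>\<times> H\<^esub> x)"
    by (rule continuous_map_eq) (auto simp: ts inv_DirProd)
  ultimately show ?thesis
    unfolding polish_abelian_group_def
    using GH.comm_group_axioms polish_abelian_group_cm[OF G] polish_abelian_group_cm[OF H]
      polish_abelian_group_sc[OF G] polish_abelian_group_sc[OF H]
    by (simp add: ts second_countable_prod_topology completely_metrizable_space_prod_topology)
qed

lemma polish_abelian_group_product:
  assumes I: "countable I" and G: "polish_abelian_group G T"
  shows "polish_abelian_group (product_group I (\<lambda>_. G)) (product_topology (\<lambda>_. T) I)"
proof -
  interpret G: comm_group G using G by (rule polish_abelian_group_comm)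
  note ts = polish_abelian_group_topspace[OF G]
  let ?P = "product_topology (\<lambda>_. T) I"
  have comm: "comm_group (product_group I (\<lambda>_. G))"
    by (rule group.group_comm_groupI) (auto simp: G.m_comm PiE_def Pi_def intro!: restrict_ext)
  have p: "continuous_map (prod_topology ?P ?P) T (\<lambda>p. fst p i)"
    "continuous_map (prod_topology ?P ?P) T (\<lambda>p. snd p i)" if "i \<in> I" for i
    using continuous_map_compose[OF continuous_map_fst continuous_map_product_projection[OF that, of "\<lambda>_. T"], of ?P]
      continuous_map_compose[OF continuous_map_snd continuous_map_product_projection[OF that, of "\<lambda>_. T"], of ?P]
    by (simp_all add: o_def)
  have p': "continuous_map ?P T (\<lambda>x. x i)" if "i \<in> I" for i
    using continuous_map_product_projection[OF that, of "\<lambda>_. T"] .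
  have "continuous_map (prod_topology ?P ?P) ?P (\<lambda>p. \<lambda>i\<in>I. fst p i \<otimes>\<^bsub>G\<^esub> snd p i)"
    unfolding continuous_map_componentwise
    by (auto intro!: continuous_map_eq[OF polish_abelian_group_mult_compose[OF G p]])
  moreover have "continuous_map ?P ?P (\<lambda>x. \<lambda>i\<in>I. inv\<^bsub>G\<^esub> (x i))"
    unfolding continuous_map_componentwise
    by (auto intro!: continuous_map_eq[OF polish_abelian_group_inv_compose[OF G p']])
  then have "continuous_map ?P ?P (\<lambda>x. inv\<^bsub>product_group I (\<lambda>_. G)\<^esub> x)"
    by (rule continuous_map_eq) (auto simp: ts intro!: inv_product_group[symmetric])
  moreover have "completely_metrizable_space ?P"
    unfolding completely_metrizable_space_product_topology
    using polish_abelian_group_cm[OF G] countable_subset[OF _ I] by (metis (no_types, lifting) mem_Collect_eq subsetI)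
  moreover have "second_countable ?P"
    using I polish_abelian_group_sc[OF G] by (intro second_countable_product_topology)
  ultimately show ?thesis
    unfolding polish_abelian_group_def
    using comm by (simp add: ts case_prod_unfold)
qed

section \<open>Morphisms and exact sequences of groups with a Polish cover\<close>

lemma polish_cover_groupD:
  assumes "polish_cover_group A"
  shows "polish_abelian_group (cover A) (cover_top A)" "subgroup (sub_set A) (cover A)"
    "polish_abelian_group ((cover A)\<lparr>carrier := sub_set A\<rparr>) (sub_top A)"
    "continuous_map (sub_top A) (cover_top A) (\<lambda>x. x)"
    "comm_group (cover A)" "topspace (cover_top A) = carrier (cover A)" "sub_set A \<subseteq> carrier (cover A)"
proof -
  show 1: "polish_abelian_group (cover A) (cover_top A)" and 2: "subgroup (sub_set A) (cover A)"
    and "polish_abelian_group ((cover A)\<lparr>carrier := sub_set A\<rparr>) (sub_top A)"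
    and "continuous_map (sub_top A) (cover_top A) (\<lambda>x. x)"
    using assms by (simp_all add: polish_cover_group_def)
  show "comm_group (cover A)" "topspace (cover_top A) = carrier (cover A)" "sub_set A \<subseteq> carrier (cover A)"
    using polish_abelian_group_comm[OF 1] polish_abelian_group_topspace[OF 1] subgroup.subset[OF 2] by simp_all
qed

lemma coset_of_eq_iff:
  assumes "polish_cover_group A" "x \<in> carrier (cover A)" "y \<in> carrier (cover A)"
  shows "coset_of A x = coset_of A y \<longleftrightarrow> x \<otimes>\<^bsub>cover A\<^esub> inv\<^bsub>cover A\<^esub> y \<in> sub_set A"
proof -
  interpret comm_group "cover A" using assms(1) by (rule polish_cover_groupD)
  note sub = polish_cover_groupD(2)[OF assms(1)]
  show ?thesis
  proof
    assume "coset_of A x = coset_of A y"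
    then have "x \<in> coset_of A y" using rcos_self[OF assms(2) sub] by simp
    then show "x \<otimes>\<^bsub>cover A\<^esub> inv\<^bsub>cover A\<^esub> y \<in> sub_set A"
      using subgroup.rcos_module_imp[OF sub is_group] assms by blast
  next
    assume "x \<otimes>\<^bsub>cover A\<^esub> inv\<^bsub>cover A\<^esub> y \<in> sub_set A"
    then have "x \<in> coset_of A y"
      using subgroup.rcos_module_rev[OF sub is_group] assms by blast
    then show "coset_of A x = coset_of A y"
      using repr_independence[OF _ assms(3) sub] by simp
  qed
qed

lemma carrier_quot: "carrier (quot A) = coset_of A ` carrier (cover A)"
  by (auto simp: quot_def FactGroup_def RCOSETS_def)

lemma coset_of_mem_quot: "x \<in> carrier (cover A) \<Longrightarrow> coset_of A x \<in> carrier (quot A)"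
  by (simp add: carrier_quot)

lemma coset_of_mult:
  assumes "polish_cover_group A" "x \<in> carrier (cover A)" "y \<in> carrier (cover A)"
  shows "coset_of A x \<otimes>\<^bsub>quot A\<^esub> coset_of A y = coset_of A (x \<otimes>\<^bsub>cover A\<^esub> y)"
proof -
  interpret comm_group "cover A" using assms(1) by (rule polish_cover_groupD)
  have "sub_set A \<lhd> cover A"
    using polish_cover_groupD(2)[OF assms(1)] by (rule subgroup_imp_normal)
  then show ?thesis
    using assms by (simp add: quot_def FactGroup_def normal.rcos_sum)
qed

text \<open>Every morphism in the proof is represented in this way; continuity of the map between
  the covers supplies the Borel lift which \<open>pc_mor\<close> demands.\<close>

definition cover_hom :: "'g cover_group \<Rightarrow> 'h cover_group \<Rightarrow> ('g \<Rightarrow> 'h) \<Rightarrow> bool" where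
  "cover_hom A B f \<longleftrightarrow> f \<in> hom (cover A) (cover B) \<and>
     continuous_map (cover_top A) (cover_top B) f \<and> f ` sub_set A \<subseteq> sub_set B"

text \<open>Members of one coset differ by the subgroup, so their images span the same coset and the
  union in \<open>quot_map\<close> collapses. All later identities between morphisms are reduced to
  representatives by this rule.\<close>

lemma pc_map_coset_of:
  assumes A: "polish_cover_group A" and B: "polish_cover_group B"
    and f: "f \<in> hom (cover A) (cover B)" "f ` sub_set A \<subseteq> sub_set B" and x: "x \<in> carrier (cover A)"
  shows "pc_map B f (coset_of A x) = coset_of B (f x)"
proof -
  interpret A: comm_group "cover A" using A by (rule polish_cover_groupD)
  interpret B: comm_group "cover B" using B by (rule polish_cover_groupD)
  interpret f: group_hom "cover A" "cover B" f by unfold_locales (rule f)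
  note sA = polish_cover_groupD(2)[OF A] and sB = polish_cover_groupD(2)[OF B]
  have sub: "sub_set A \<subseteq> carrier (cover A)" using A by (rule polish_cover_groupD)
  have "coset_of B (f y) = coset_of B (f x)" if "y \<in> coset_of A x" for y
  proof -
    have y: "y \<in> carrier (cover A)" using that sub x A.r_coset_subset_G by blast
    have "y \<otimes>\<^bsub>cover A\<^esub> inv\<^bsub>cover A\<^esub> x \<in> sub_set A"
      using subgroup.rcos_module_imp[OF sA A.is_group x that] .
    then have "f (y \<otimes>\<^bsub>cover A\<^esub> inv\<^bsub>cover A\<^esub> x) \<in> sub_set B" using f(2) by blast
    then show ?thesis using x y by (simp add: coset_of_eq_iff[OF B])
  qed
  moreover have "x \<in> coset_of A x" using x sA by (rule A.rcos_self)
  ultimately show ?thesis unfolding quot_map_def by blast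
qed

lemma continuous_map_measurable_borel_of:
  assumes "continuous_map S T f"
  shows "f \<in> measurable (borel_of S) (borel_of T)"
  unfolding borel_of_def
proof (rule measurable_measure_of)
  have sub': "{U. openin S U} \<subseteq> Pow (topspace S)"
    using openin_subset by blast
  note sp = space_measure_of[OF sub', of "\<lambda>_. 0"] and se = sets_measure_of[OF sub', of "\<lambda>_. 0"]
  show "{U. openin T U} \<subseteq> Pow (topspace T)" using openin_subset by blast
  show "f \<in> space (sigma (topspace S) {U. openin S U}) \<rightarrow> topspace T"
    unfolding sp using assms by (auto simp: continuous_map_def)
  fix U assume "U \<in> {U. openin T U}"
  then have "openin S {x \<in> topspace S. f x \<in> U}"
    using openin_continuous_map_preimage[OF assms] by blast
  moreover have "f -` U \<inter> topspace S = {x \<in> topspace S. f x \<in> U}" by auto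
  ultimately show "f -` U \<inter> space (sigma (topspace S) {U. openin S U}) \<in> sets (sigma (topspace S) {U. openin S U})"
    unfolding sp se by (auto intro: sigma_sets.Basic)
qed

lemma pc_map_mor:
  assumes A: "polish_cover_group A" and B: "polish_cover_group B" and f: "cover_hom A B f"
  shows "pc_map B f \<in> pc_mor A B"
proof -
  interpret A: comm_group "cover A" using A by (rule polish_cover_groupD)
  interpret B: comm_group "cover B" using B by (rule polish_cover_groupD)
  have fh: "f \<in> hom (cover A) (cover B)" "f ` sub_set A \<subseteq> sub_set B"
    using f by (auto simp: cover_hom_def)
  interpret f: group_hom "cover A" "cover B" f by unfold_locales (rule fh)
  note eq = pc_map_coset_of[OF A B fh]
  have "pc_map B f \<in> hom (quot A) (quot B)"
  proof (rule homI)
    fix c assume "c \<in> carrier (quot A)"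
    then show "pc_map B f c \<in> carrier (quot B)" by (auto simp: carrier_quot eq)
    fix d assume "d \<in> carrier (quot A)"
    with \<open>c \<in> carrier (quot A)\<close> show "pc_map B f (c \<otimes>\<^bsub>quot A\<^esub> d) = pc_map B f c \<otimes>\<^bsub>quot B\<^esub> pc_map B f d"
      by (auto simp: carrier_quot eq coset_of_mult[OF A] coset_of_mult[OF B])
  qed
  moreover have "f \<in> measurable (borel_of (cover_top A)) (borel_of (cover_top B))"
    using f by (intro continuous_map_measurable_borel_of) (simp add: cover_hom_def)
  ultimately show ?thesis unfolding pc_mor_def using eq by blast
qed

lemma pc_map_iso:
  assumes A: "polish_cover_group A" and B: "polish_cover_group B"
    and f: "cover_hom A B f" and g: "cover_hom B A g"
    and gf: "\<And>x. x \<in> carrier (cover A) \<Longrightarrow> coset_of A (g (f x)) = coset_of A x"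
    and fg: "\<And>y. y \<in> carrier (cover B) \<Longrightarrow> coset_of B (f (g y)) = coset_of B y"
  shows "pc_map B f \<in> pc_iso A B"
proof -
  have hf: "f \<in> hom (cover A) (cover B)" "f ` sub_set A \<subseteq> sub_set B"
    and hg: "g \<in> hom (cover B) (cover A)" "g ` sub_set B \<subseteq> sub_set A"
    using f g by (auto simp: cover_hom_def)
  have fc: "f x \<in> carrier (cover B)" if "x \<in> carrier (cover A)" for x
    using hf(1) that by (auto simp: hom_def)
  have gc: "g y \<in> carrier (cover A)" if "y \<in> carrier (cover B)" for y
    using hg(1) that by (auto simp: hom_def)
  show ?thesis
    unfolding pc_iso_def
  proof (intro CollectI conjI bexI[of _ "pc_map A g"] ballI)
    show "pc_map B f \<in> pc_mor A B" using A B f by (rule pc_map_mor)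
    show "pc_map A g \<in> pc_mor B A" using B A g by (rule pc_map_mor)
    show "pc_map A g (pc_map B f c) = c" if "c \<in> carrier (quot A)" for c
      using that by (auto simp: carrier_quot pc_map_coset_of[OF A B hf] pc_map_coset_of[OF B A hg] fc gf)
    show "pc_map B f (pc_map A g c) = c" if "c \<in> carrier (quot B)" for c
      using that by (auto simp: carrier_quot pc_map_coset_of[OF A B hf] pc_map_coset_of[OF B A hg] gc fg)
  qed
qed

section \<open>Polish covers on kernels, cokernels and powers\<close>

lemma kernel_pc_simps:
  "carrier (cover (kernel_pc A B d)) = {x \<in> carrier (cover A). d x \<in> sub_set B}"
  "mult (cover (kernel_pc A B d)) = mult (cover A)"
  "\<one>\<^bsub>cover (kernel_pc A B d)\<^esub> = \<one>\<^bsub>cover A\<^esub>"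
  "sub_top (kernel_pc A B d) = sub_top A"
  by (simp_all add: kernel_pc_def Let_def)

lemma continuous_map_into_kernel_pc:
  assumes "continuous_map X (cover_top A) f" "continuous_map X (sub_top B) (\<lambda>x. d (f x))"
    and "\<And>x. x \<in> topspace X \<Longrightarrow> f x \<in> carrier (cover A)"
  shows "continuous_map X (cover_top (kernel_pc A B d)) f"
proof -
  have 1: "continuous_map X (prod_topology (cover_top A) (sub_top B)) ((\<lambda>x. (x, d x)) \<circ> f)"
    using assms by (simp add: continuous_map_paired o_def)
  have 2: "topspace X \<subseteq> f -` {x \<in> carrier (cover A). d x \<in> sub_set B}"
    using assms by (auto simp: continuous_map_def)
  show ?thesis
    unfolding kernel_pc_def Let_def using continuous_map_pullback'[OF 1 2] by simp
qed

lemma continuous_map_from_kernel_pc: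
  shows "continuous_map (cover_top (kernel_pc A B d)) (cover_top A) (\<lambda>x. x)"
    and "continuous_map (cover_top (kernel_pc A B d)) (sub_top B) d"
proof -
  let ?K = "{x \<in> carrier (cover A). d x \<in> sub_set B}"
  have 1: "continuous_map (pullback_topology ?K (\<lambda>x. (x, d x)) (prod_topology (cover_top A) (sub_top B))) Z (g \<circ> (\<lambda>x. (x, d x)))"
    if "continuous_map (prod_topology (cover_top A) (sub_top B)) Z g" for g and Z :: "'z topology"
    using that by (rule continuous_map_pullback)
  show "continuous_map (cover_top (kernel_pc A B d)) (cover_top A) (\<lambda>x. x)"
    using 1[OF continuous_map_fst] by (simp add: kernel_pc_def Let_def o_def)
  have 2: "continuous_map (pullback_topology ?K (\<lambda>x. (x, d x)) (prod_topology (cover_top A) (sub_top B))) Z (g \<circ> (\<lambda>x. (x, d x)))"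
    if "continuous_map (prod_topology (cover_top A) (sub_top B)) Z g" for g and Z :: "'z topology"
    using that by (rule continuous_map_pullback)
  show "continuous_map (cover_top (kernel_pc A B d)) (sub_top B) d"
    using 2[OF continuous_map_snd] by (simp add: kernel_pc_def Let_def o_def)
qed

lemma inv_sub:
  assumes "comm_group G" "subgroup H G" "x \<in> H"
  shows "inv\<^bsub>G\<lparr>carrier := H\<rparr>\<^esub> x = inv\<^bsub>G\<^esub> x"
  using assms by (metis comm_group_def group.m_inv_consistent)

text \<open>By x \<mapsto> (x, d x) the kernel is homeomorphic to a subset Z of
  \<open>cover A\<close> times \<open>sub_set B\<close>, a product of Polish spaces. Z is closed,
  because the topology of the subgroup refines that of the Hausdorff cover of B. In the subspace
  topology of \<open>cover A\<close> the kernel would not be Polish in general.\<close>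

theorem polish_cover_group_kernel_pc:
  assumes A: "polish_cover_group A" and B: "polish_cover_group B"
    and d: "d \<in> hom (cover A) (cover B)" "continuous_map (cover_top A) (cover_top B) d"
      "continuous_map (sub_top A) (sub_top B) d"
  shows "polish_cover_group (kernel_pc A B d)"
proof -
  interpret A: comm_group "cover A" using A by (rule polish_cover_groupD)
  interpret B: comm_group "cover B" using B by (rule polish_cover_groupD)
  interpret d: group_hom "cover A" "cover B" d by unfold_locales (rule d)
  note A' = polish_cover_groupD[OF A] and B' = polish_cover_groupD[OF B]
  let ?K = "{x \<in> carrier (cover A). d x \<in> sub_set B}"
  let ?h = "\<lambda>x. (x, d x)"
  let ?P = "prod_topology (cover_top A) (sub_top B)"
  let ?T = "cover_top (kernel_pc A B d)"
  have T: "?T = pullback_topology ?K ?h ?P" by (simp add: kernel_pc_def Let_def)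
  have tsT: "topspace ?T = ?K"
    unfolding T topspace_pullback_topology by (auto simp: A'(6))
  have subK: "subgroup ?K (cover A)"
  proof (rule A.subgroupI)
    show "?K \<noteq> {}" using subgroup.one_closed[OF B'(2)] d.hom_one A.one_closed by (metis (mono_tags, lifting) empty_iff mem_Collect_eq)
  qed (auto simp: subgroup.m_inv_closed[OF B'(2)] subgroup.m_closed[OF B'(2)])
  let ?C = "(cover A)\<lparr>carrier := ?K\<rparr>"
  have cK: "cover (kernel_pc A B d) = ?C" by (simp add: kernel_pc_def Let_def)
  have Kcomm: "comm_group ?C"
    by (rule group.group_comm_groupI[OF A.subgroup_imp_group[OF subK]]) (auto simp: A.m_comm)
  have id: "continuous_map ?T (cover_top A) (\<lambda>x. x)" "continuous_map ?T (sub_top B) d"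
    by (rule continuous_map_from_kernel_pc)+
  define Z where "Z = {p \<in> topspace ?P. d (fst p) = snd p}"
  have Zclosed: "closedin ?P Z"
    unfolding Z_def
  proof (rule closedin_continuous_maps_eq)
    show "Hausdorff_space (cover_top B)"
      using polish_abelian_group_cm[OF B'(1)] by (simp add: completely_metrizable_imp_metrizable_space metrizable_imp_Hausdorff_space)
    show "continuous_map ?P (cover_top B) (\<lambda>p. d (fst p))"
      using continuous_map_compose[OF continuous_map_fst d(2)] by (simp add: o_def)
    show "continuous_map ?P (cover_top B) snd"
      using continuous_map_compose[OF continuous_map_snd B'(4), of "cover_top A"] by (simp add: o_def)
  qed
  have ZK: "p \<in> Z \<longleftrightarrow> fst p \<in> ?K \<and> p = ?h (fst p)" for p
    by (cases p) (auto simp: Z_def A'(6))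
  have "homeomorphic_maps ?T (subtopology ?P Z) ?h fst"
    unfolding homeomorphic_maps_def
  proof (intro conjI ballI)
    show "continuous_map ?T (subtopology ?P Z) ?h"
      using id by (auto simp: continuous_map_in_subtopology continuous_map_paired tsT ZK)
    show "continuous_map (subtopology ?P Z) ?T fst"
    proof (rule continuous_map_into_kernel_pc)
      show "continuous_map (subtopology ?P Z) (cover_top A) fst"
        by (rule continuous_map_from_subtopology[OF continuous_map_fst])
      have "continuous_map (subtopology ?P Z) (sub_top B) snd"
        by (rule continuous_map_from_subtopology[OF continuous_map_snd])
      then show "continuous_map (subtopology ?P Z) (sub_top B) (\<lambda>p. d (fst p))"
        by (rule continuous_map_eq) (auto simp: Z_def)
    qed (auto simp: A'(6))
  qed (auto simp: Z_def)
  then have homeo: "?T homeomorphic_space subtopology ?P Z"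
    unfolding homeomorphic_space_def by blast
  have cm: "completely_metrizable_space ?T"
    using homeomorphic_completely_metrizable_space[OF homeo]
      completely_metrizable_space_closedin[OF _ Zclosed]
      polish_abelian_group_cm[OF A'(1)] polish_abelian_group_cm[OF B'(3)]
    by (simp add: completely_metrizable_space_prod_topology)
  have sc: "second_countable ?T"
    using homeomorphic_space_second_countability[OF homeo] second_countable_subtopology
      second_countable_prod_topology[OF polish_abelian_group_sc[OF A'(1)] polish_abelian_group_sc[OF B'(3)]]
    by blast
  have mult: "continuous_map (prod_topology ?T ?T) ?T (\<lambda>p. fst p \<otimes>\<^bsub>cover A\<^esub> snd p)"
  proof (rule continuous_map_into_kernel_pc)
    have p: "continuous_map (prod_topology ?T ?T) (cover_top A) fst" "continuous_map (prod_topology ?T ?T) (cover_top A) snd"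
      using continuous_map_compose[OF continuous_map_fst id(1)] continuous_map_compose[OF continuous_map_snd id(1)]
      by (simp_all add: o_def)
    show "continuous_map (prod_topology ?T ?T) (cover_top A) (\<lambda>p. fst p \<otimes>\<^bsub>cover A\<^esub> snd p)"
      using p by (rule polish_abelian_group_mult_compose[OF A'(1)])
    have q: "continuous_map (prod_topology ?T ?T) (sub_top B) (\<lambda>p. d (fst p))"
      "continuous_map (prod_topology ?T ?T) (sub_top B) (\<lambda>p. d (snd p))"
      using continuous_map_compose[OF continuous_map_fst id(2)] continuous_map_compose[OF continuous_map_snd id(2)]
      by (simp_all add: o_def)
    show "continuous_map (prod_topology ?T ?T) (sub_top B) (\<lambda>p. d (fst p \<otimes>\<^bsub>cover A\<^esub> snd p))"
      by (rule continuous_map_eq[OF polish_abelian_group_mult_compose[OF B'(3) q]]) (auto simp: tsT)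
  qed (auto simp: tsT)
  have inv: "continuous_map ?T ?T (\<lambda>x. inv\<^bsub>cover A\<^esub> x)"
  proof (rule continuous_map_into_kernel_pc)
    show "continuous_map ?T (cover_top A) (\<lambda>x. inv\<^bsub>cover A\<^esub> x)"
      by (rule polish_abelian_group_inv_compose[OF A'(1) id(1)])
    show "continuous_map ?T (sub_top B) (\<lambda>x. d (inv\<^bsub>cover A\<^esub> x))"
      by (rule continuous_map_eq[OF polish_abelian_group_inv_compose[OF B'(3) id(2)]])
         (auto simp: tsT inv_sub[OF B'(5,2)])
  qed (auto simp: tsT)
  have 1: "polish_abelian_group ?C ?T"
    unfolding polish_abelian_group_def
    using Kcomm tsT cm sc mult continuous_map_eq[OF inv, of "\<lambda>x. inv\<^bsub>?C\<^esub> x"]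
    by (auto simp: case_prod_unfold inv_sub[OF A'(5) subK])
  have sAK: "sub_set A \<subseteq> ?K"
    using A'(7) d(3) by (auto simp: continuous_map_def)
  have 2: "subgroup (sub_set A) ?C"
    using A.subgroup_incl[OF A'(2) subK sAK] .
  have 3: "continuous_map (sub_top A) ?T (\<lambda>x. x)"
    using A'(4,7) d(3) by (intro continuous_map_into_kernel_pc) auto
  show ?thesis
    unfolding polish_cover_group_def cK kernel_pc_simps(4)
    using 1 2 3 A'(3) by simp
qed

lemma coker_pc_simps:
  "cover (coker_pc A B d) = cover B" "cover_top (coker_pc A B d) = cover_top B"
  by (simp_all add: coker_pc_def)

lemma sub_set_coker_pc:
  "sub_set (coker_pc A B d) =
   (\<lambda>(x, y). d x \<otimes>\<^bsub>cover B\<^esub> y) ` (topspace (cover_top A) \<times> sub_set B)"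
  by (simp add: coker_pc_def topspace_quotient_topology)

lemma continuous_map_from_sub_coker_pc:
  assumes "continuous_map (prod_topology (cover_top A) (sub_top B)) Z (\<lambda>(x, y). f (d x \<otimes>\<^bsub>cover B\<^esub> y))"
  shows "continuous_map (sub_top (coker_pc A B d)) Z f"
  unfolding coker_pc_def
  using continuous_map_from_quotient_topology[of "prod_topology (cover_top A) (sub_top B)" Z f
      "\<lambda>(x, y). d x \<otimes>\<^bsub>cover B\<^esub> y"] assms
  by (simp add: case_prod_unfold)

text \<open>The enlarged subgroup is the image of the Polish group \<open>cover A\<close> times
  \<open>sub_set B\<close> under (x, y) \<mapsto> d x y. This map is continuous into the cover of B,
  hence has a closed kernel, and the theorem on Polish quotients applies.\<close>

theorem polish_cover_group_coker_pc:
  assumes A: "polish_cover_group A" and B: "polish_cover_group B"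
    and d: "d \<in> hom (cover A) (cover B)" "continuous_map (cover_top A) (cover_top B) d"
  shows "polish_cover_group (coker_pc A B d)"
proof -
  interpret A: comm_group "cover A" using A by (rule polish_cover_groupD)
  interpret B: comm_group "cover B" using B by (rule polish_cover_groupD)
  interpret d: group_hom "cover A" "cover B" d by unfold_locales (rule d)
  note A' = polish_cover_groupD[OF A] and B' = polish_cover_groupD[OF B]
  let ?S = "(cover B)\<lparr>carrier := sub_set B\<rparr>"
  let ?G = "cover A \<times>\<times> ?S"
  let ?P = "prod_topology (cover_top A) (sub_top B)"
  let ?q = "\<lambda>(x, y). d x \<otimes>\<^bsub>cover B\<^esub> y"
  have P: "polish_abelian_group ?G ?P"
    using A'(1) B'(3) by (rule polish_abelian_group_DirProd)
  have sB: "y \<in> carrier (cover B)" if "y \<in> sub_set B" for y using that B'(7) by blast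
  have q: "?q \<in> hom ?G (cover B)"
    by (rule homI) (auto simp: sB B.m_ac)
  interpret q: group_hom ?G "cover B" ?q
    using polish_abelian_group_comm[OF P] q by (simp add: group_hom_def group_hom_axioms_def comm_group_def)
  have qc: "continuous_map ?P (cover_top B) ?q"
  proof -
    have "continuous_map ?P (cover_top B) (\<lambda>p. d (fst p) \<otimes>\<^bsub>cover B\<^esub> snd p)"
      using continuous_map_compose[OF continuous_map_fst d(2)] continuous_map_compose[OF continuous_map_snd B'(4)]
      by (intro polish_abelian_group_mult_compose[OF B'(1)]) (simp_all add: o_def)
    then show ?thesis by (simp add: case_prod_unfold)
  qed
  have Haus: "Hausdorff_space (cover_top B)"
    using polish_abelian_group_cm[OF B'(1)] by (simp add: completely_metrizable_imp_metrizable_space metrizable_imp_Hausdorff_space)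
  have "closedin ?P {p \<in> topspace ?P. ?q p = \<one>\<^bsub>cover B\<^esub>}"
    by (rule closedin_continuous_maps_eq[OF Haus qc]) (simp add: B'(6))
  then have "closedin ?P {p \<in> carrier ?G. ?q p = \<one>\<^bsub>cover B\<^esub>}"
    using polish_abelian_group_topspace[OF P] by simp
  then have pol: "polish_abelian_group ((cover B)\<lparr>carrier := ?q ` carrier ?G\<rparr>) (quotient_topology ?P ?q)"
    using P B'(5) q by (intro polish_abelian_group_quotient)
  have ts: "topspace (quotient_topology ?P ?q) = ?q ` carrier ?G"
    using polish_abelian_group_topspace[OF P] by (simp add: topspace_quotient_topology)
  have "subgroup (?q ` carrier ?G) (cover B)" by (rule q.img_is_subgroup)
  moreover have "continuous_map (quotient_topology ?P ?q) (cover_top B) (\<lambda>x. x)"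
    by (rule continuous_map_from_quotient_topology) (use qc in simp)
  ultimately show ?thesis
    unfolding polish_cover_group_def using pol B'(1) ts by (simp add: coker_pc_def)
qed

lemma hom_free_simps:
  "cover (hom_free I G) = product_group I (\<lambda>_. cover G)"
  "cover_top (hom_free I G) = product_topology (\<lambda>_. cover_top G) I"
  "sub_top (hom_free I G) = product_topology (\<lambda>_. sub_top G) I"
  by (simp_all add: hom_free_def)

theorem polish_cover_group_hom_free:
  assumes G: "polish_cover_group G" and I: "countable I"
  shows "polish_cover_group (hom_free I G)"
proof -
  interpret G: comm_group "cover G" using G by (rule polish_cover_groupD)
  note G' = polish_cover_groupD[OF G]
  have eq: "(product_group I (\<lambda>_. cover G))\<lparr>carrier := I \<rightarrow>\<^sub>E sub_set G\<rparr>
      = product_group I (\<lambda>_. (cover G)\<lparr>carrier := sub_set G\<rparr>)"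
    by (simp add: product_group_def)
  have "subgroup (I \<rightarrow>\<^sub>E sub_set G) (product_group I (\<lambda>_. cover G))"
    using G'(2) by (subst PiE_subgroup_product_group) auto
  moreover have "continuous_map (product_topology (\<lambda>_. sub_top G) I) (product_topology (\<lambda>_. cover_top G) I) (\<lambda>x. x)"
    unfolding continuous_map_componentwise
    using continuous_map_compose[OF continuous_map_product_projection[where X="\<lambda>_. sub_top G" and I=I] G'(4)]
    by (auto simp: o_def PiE_def)
  ultimately show ?thesis
    unfolding polish_cover_group_def hom_free_simps
    using polish_abelian_group_product[OF I G'(1)] polish_abelian_group_product[OF I G'(3)] by (simp add: eq)
qed

section \<open>A criterion for split exact sequences\<close>

lemma cover_hom_sub:
  assumes "continuous_map (sub_top A) (sub_top B) f"
  shows "f ` sub_set A \<subseteq> sub_set B"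
  using assms by (auto simp: continuous_map_def)

lemma pc_map_eq_sub_set_iff:
  assumes B: "polish_cover_group B" and C: "polish_cover_group C" and p: "cover_hom B C p"
    and x: "x \<in> carrier (cover B)"
  shows "pc_map C p (coset_of B x) = sub_set C \<longleftrightarrow> p x \<in> sub_set C"
proof -
  interpret C: comm_group "cover C" using C by (rule polish_cover_groupD)
  have h: "p \<in> hom (cover B) (cover C)" "p ` sub_set B \<subseteq> sub_set C"
    using p by (auto simp: cover_hom_def)
  have px: "p x \<in> carrier (cover C)" using h(1) x by (auto simp: hom_def)
  have "coset_of C \<one>\<^bsub>cover C\<^esub> = sub_set C"
    using polish_cover_groupD(7)[OF C] by (rule C.coset_mult_one)
  then have "pc_map C p (coset_of B x) = sub_set C \<longleftrightarrow> coset_of C (p x) = coset_of C \<one>\<^bsub>cover C\<^esub>"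
    by (simp add: pc_map_coset_of[OF B C h x])
  then show ?thesis using px by (simp add: coset_of_eq_iff[OF C])
qed

text \<open>No bare injectivity or surjectivity has to be proved: r inverts i on the kernel of p,
  and s inverts p on the cokernel of i, both modulo the subgroups. The topology of the kernel sees p
  as a map into \<open>sub_top C\<close>, hence the two continuity conditions: \<open>psub\<close>
  makes the kernel a group with a Polish cover, \<open>pi_cont\<close> makes i continuous into
  it.\<close>

theorem pc_split_exactI:
  assumes A: "polish_cover_group A" and B: "polish_cover_group B" and C: "polish_cover_group C"
    and i: "cover_hom A B i" and p: "cover_hom B C p" and r: "cover_hom B A r" and s: "cover_hom C B s"
    and psub: "continuous_map (sub_top B) (sub_top C) p"
    and pi: "\<And>x. x \<in> carrier (cover A) \<Longrightarrow> p (i x) \<in> sub_set C"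
    and pi_cont: "continuous_map (cover_top A) (sub_top C) (\<lambda>x. p (i x))"
    and ri: "\<And>x. x \<in> carrier (cover A) \<Longrightarrow> coset_of A (r (i x)) = coset_of A x"
    and ps: "\<And>z. z \<in> carrier (cover C) \<Longrightarrow> coset_of C (p (s z)) = coset_of C z"
    and mid: "\<And>y. y \<in> carrier (cover B) \<Longrightarrow> p y \<in> sub_set C \<Longrightarrow> coset_of B (i (r y)) = coset_of B y"
  shows "pc_short_exact A B C (pc_map B i) (pc_map C p) \<and> pc_splits B C (pc_map C p)"
proof -
  interpret A: comm_group "cover A" using A by (rule polish_cover_groupD)
  interpret B: comm_group "cover B" using B by (rule polish_cover_groupD)
  interpret C: comm_group "cover C" using C by (rule polish_cover_groupD)
  note A' = polish_cover_groupD[OF A] and B' = polish_cover_groupD[OF B] and C' = polish_cover_groupD[OF C]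
  have hi: "i \<in> hom (cover A) (cover B)" "i ` sub_set A \<subseteq> sub_set B" "continuous_map (cover_top A) (cover_top B) i"
    and hp: "p \<in> hom (cover B) (cover C)" "p ` sub_set B \<subseteq> sub_set C" "continuous_map (cover_top B) (cover_top C) p"
    and hr: "r \<in> hom (cover B) (cover A)" "r ` sub_set B \<subseteq> sub_set A" "continuous_map (cover_top B) (cover_top A) r"
    and hs: "s \<in> hom (cover C) (cover B)" "s ` sub_set C \<subseteq> sub_set B" "continuous_map (cover_top C) (cover_top B) s"
    using i p r s by (auto simp: cover_hom_def)
  interpret i: group_hom "cover A" "cover B" i by unfold_locales (rule hi)
  interpret p: group_hom "cover B" "cover C" p by unfold_locales (rule hp)
  interpret r: group_hom "cover B" "cover A" r by unfold_locales (rule hr)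
  interpret s: group_hom "cover C" "cover B" s by unfold_locales (rule hs)
  define K where "K = kernel_pc B C p"
  have K: "polish_cover_group K"
    unfolding K_def using B C hp(1,3) psub by (rule polish_cover_group_kernel_pc)
  have K_simps: "carrier (cover K) = {x \<in> carrier (cover B). p x \<in> sub_set C}"
    "mult (cover K) = mult (cover B)" "\<one>\<^bsub>cover K\<^esub> = \<one>\<^bsub>cover B\<^esub>" "sub_top K = sub_top B"
    by (simp_all add: K_def kernel_pc_simps)
  have K_id: "continuous_map (cover_top K) (cover_top B) (\<lambda>x. x)"
    unfolding K_def by (rule continuous_map_from_kernel_pc)
  have K_coset: "sub_set B #>\<^bsub>cover K\<^esub> x = coset_of B x" for x
    by (simp add: K_simps r_coset_def)
  have iK: "cover_hom A K i"
    unfolding cover_hom_def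
  proof (intro conjI)
    show "i \<in> hom (cover A) (cover K)"
      using hi(1) pi by (auto simp: hom_def K_simps)
    show "continuous_map (cover_top A) (cover_top K) i"
      unfolding K_def using hi(3) pi_cont A'(6) by (intro continuous_map_into_kernel_pc) auto
  qed (use hi in \<open>simp add: K_simps\<close>)
  have rK: "cover_hom K A r"
    unfolding cover_hom_def
  proof (intro conjI)
    show "r \<in> hom (cover K) (cover A)" using hr(1) by (auto simp: hom_def K_simps)
    show "continuous_map (cover_top K) (cover_top A) r"
      using continuous_map_compose[OF K_id hr(3)] by (simp add: o_def)
  qed (use hr in \<open>simp add: K_simps\<close>)
  have iso: "pc_map K i \<in> pc_iso A K"
    by (rule pc_map_iso[OF A K iK rK]) (simp_all add: ri mid K_coset K_simps)
  have "pc_map K i = pc_map B i" by (simp add: quot_map_def K_coset K_simps fun_eq_iff)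
  with iso have iso: "pc_map B i \<in> pc_iso A K" by simp
  have kernel: "is_pc_kernel A B C (pc_map B i) (pc_map C p)"
    unfolding is_pc_kernel_def
  proof (intro exI[of _ K] conjI)
    have "{x \<in> carrier (cover B). p x \<in> sub_set C} =
        {x \<in> carrier (cover B). pc_map C p (coset_of B x) = sub_set C}"
      using pc_map_eq_sub_set_iff[OF B C p] by blast
    then show "cover K = (cover B)\<lparr>carrier := {x \<in> carrier (cover B). pc_map C p (coset_of B x) = sub_set C}\<rparr>"
      by (simp add: K_def kernel_pc_def Let_def)
  qed (use K K_id K_simps iso in auto)
  \<comment> \<open>The union of the cosets in the image of i is the kernel of p, so the Polish
    topology constructed for K also serves for the subgroup of the cokernel.\<close>
  define Q where "Q = \<lparr>cover = cover B, cover_top = cover_top B, sub_top = cover_top K\<rparr>"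
  have Q_simps: "cover Q = cover B" "cover_top Q = cover_top B" "sub_top Q = cover_top K"
    by (simp_all add: Q_def)
  have subQ: "sub_set Q = {x \<in> carrier (cover B). p x \<in> sub_set C}"
    using polish_cover_groupD(6)[OF K] by (simp add: Q_simps K_simps)
  have Kcarr: "cover K = (cover B)\<lparr>carrier := sub_set Q\<rparr>"
    unfolding subQ by (simp add: K_def kernel_pc_def Let_def)
  have Q: "polish_cover_group Q"
    unfolding polish_cover_group_def
  proof (intro conjI)
    show "subgroup (sub_set Q) (cover Q)"
      unfolding subQ Q_simps(1)
    proof (rule B.subgroupI)
      show "{x \<in> carrier (cover B). p x \<in> sub_set C} \<noteq> {}"
        using subgroup.one_closed[OF C'(2)] p.hom_one B.one_closed by (metis (mono_tags, lifting) empty_iff mem_Collect_eq)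
    qed (auto simp: subgroup.m_inv_closed[OF C'(2)] subgroup.m_closed[OF C'(2)])
    show "polish_abelian_group ((cover Q)\<lparr>carrier := sub_set Q\<rparr>) (sub_top Q)"
      using polish_cover_groupD(1)[OF K] Kcarr by (simp only: Q_simps)
  qed (use B' K_id in \<open>simp_all add: Q_simps\<close>)
  have pQ: "cover_hom Q C p"
    unfolding cover_hom_def using hp(1,3) by (auto simp: Q_simps(1,2) subQ)
  have sQ: "cover_hom C Q s"
    unfolding cover_hom_def using hs hp(2) B'(7) C'(7) by (auto simp: Q_simps(1,2) subQ)
  \<comment> \<open>By \<open>ps\<close>, p does not distinguish y from s (p y) modulo the subgroup
    of C; their difference therefore lies in the subgroup of Q.\<close>
  have Qmid: "coset_of Q (s (p y)) = coset_of Q y" if y: "y \<in> carrier (cover B)" for y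
  proof -
    have "coset_of C (p (s (p y))) = coset_of C (p y)" using y by (intro ps) simp
    then have "p (s (p y)) \<otimes>\<^bsub>cover C\<^esub> inv\<^bsub>cover C\<^esub> p y \<in> sub_set C"
      using y by (simp add: coset_of_eq_iff[OF C])
    then have "s (p y) \<otimes>\<^bsub>cover B\<^esub> inv\<^bsub>cover B\<^esub> y \<in> sub_set Q"
      using y by (simp add: subQ)
    then show ?thesis using coset_of_eq_iff[OF Q, of "s (p y)" y] y by (simp add: Q_simps(1))
  qed
  have isoQ: "pc_map C p \<in> pc_iso Q C"
    by (rule pc_map_iso[OF Q C pQ sQ]) (use Qmid ps in \<open>simp_all add: Q_simps(1)\<close>)
  \<comment> \<open>If p y is trivial, then y shares a coset with i (r y), by \<open>mid\<close>;
    conversely p (i x) is trivial by \<open>pi\<close>.\<close>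
  have union: "sub_set Q = \<Union> (pc_map B i ` carrier (quot A))"
  proof
    show "sub_set Q \<subseteq> \<Union> (pc_map B i ` carrier (quot A))"
    proof
      fix y assume "y \<in> sub_set Q"
      then have y: "y \<in> carrier (cover B)" "p y \<in> sub_set C" by (auto simp: subQ)
      have "y \<in> coset_of B y" using y(1) B'(2) by (rule B.rcos_self)
      also have "coset_of B y = coset_of B (i (r y))" using mid[OF y] by simp
      also have "\<dots> = pc_map B i (coset_of A (r y))"
        using y by (simp add: pc_map_coset_of[OF A B hi(1,2)])
      finally show "y \<in> \<Union> (pc_map B i ` carrier (quot A))"
        using coset_of_mem_quot[of "r y" A] y by auto
    qed
    show "\<Union> (pc_map B i ` carrier (quot A)) \<subseteq> sub_set Q"
    proof
      fix y assume "y \<in> \<Union> (pc_map B i ` carrier (quot A))"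
      then obtain x where x: "x \<in> carrier (cover A)" "y \<in> coset_of B (i x)"
        by (auto simp: carrier_quot pc_map_coset_of[OF A B hi(1,2)])
      then obtain n where n: "n \<in> sub_set B" "y = n \<otimes>\<^bsub>cover B\<^esub> i x" by (auto simp: r_coset_def)
      have "n \<in> carrier (cover B)" using n(1) B'(7) by blast
      then show "y \<in> sub_set Q"
        using n x(1) pi[OF x(1)] hp(2) subgroup.m_closed[OF C'(2)] by (auto simp: subQ)
    qed
  qed
  have cokernel: "is_pc_cokernel A B C (pc_map B i) (pc_map C p)"
    unfolding is_pc_cokernel_def
  proof (intro exI[of _ Q] conjI bexI[of _ "pc_map C p"] ballI)
    fix x assume x: "x \<in> carrier (cover B)"
    have hpQ: "p \<in> hom (cover Q) (cover C)" "p ` sub_set Q \<subseteq> sub_set C" using pQ by (auto simp: cover_hom_def)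
    show "pc_map C p (coset_of B x) = pc_map C p (coset_of Q x)"
      using x pc_map_coset_of[OF B C hp(1,2) x] pc_map_coset_of[OF Q C hpQ, of x] by (simp add: Q_simps(1))
  qed (use Q union isoQ in \<open>simp_all add: Q_simps(1,2)\<close>)
  have "pc_splits B C (pc_map C p)"
    unfolding pc_splits_def
  proof (intro bexI[of _ "pc_map B s"] ballI)
    show "pc_map B s \<in> pc_mor C B" using C B s by (rule pc_map_mor)
    show "pc_map C p (pc_map B s c) = c" if "c \<in> carrier (quot C)" for c
      using that by (auto simp: carrier_quot pc_map_coset_of[OF C B hs(1,2)] pc_map_coset_of[OF B C hp(1,2)] ps)
  qed
  then show ?thesis
    unfolding pc_short_exact_def
    using A B C pc_map_mor[OF A B i] pc_map_mor[OF B C p] kernel cokernel by blast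
qed

section \<open>Free abelian groups\<close>

lemma hom_frag_keys:
  "f \<in> hom (free_Abelian_group J) (free_Abelian_group I) \<Longrightarrow> Poly_Mapping.keys c \<subseteq> J \<Longrightarrow>
   Poly_Mapping.keys (f c) \<subseteq> I"
  by (auto simp: hom_def Pi_iff)

lemma hom_frag_zero:
  "f \<in> hom (free_Abelian_group J) (free_Abelian_group I) \<Longrightarrow> f 0 = 0"
  using hom_frag_diff[of f J I 0 0] by simp

lemma frag_extend_in_hom:
  assumes "\<And>j. j \<in> J \<Longrightarrow> Poly_Mapping.keys (b j) \<subseteq> I"
  shows "frag_extend b \<in> hom (free_Abelian_group J) (free_Abelian_group I)"
proof (rule homI)
  fix c assume c: "c \<in> carrier (free_Abelian_group J)"
  then have "(\<Union>j \<in> Poly_Mapping.keys c. Poly_Mapping.keys (b j)) \<subseteq> I" using assms by auto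
  then show "frag_extend b c \<in> carrier (free_Abelian_group I)"
    using keys_frag_extend[of b c] by auto
qed (simp add: frag_extend_add)

text \<open>Members of \<open>hom\<close> are constrained on the carrier only, hence the condition
  on the keys of c, here and in the lemmas around.\<close>

lemma hom_frag_eqI:
  assumes f: "f \<in> hom (free_Abelian_group J) (free_Abelian_group I)"
    and g: "g \<in> hom (free_Abelian_group J) (free_Abelian_group I)"
    and eq: "\<And>j. j \<in> J \<Longrightarrow> f (frag_of j) = g (frag_of j)" and c: "Poly_Mapping.keys c \<subseteq> J"
  shows "f c = g c"
  by (rule free_Abelian_group_induct[OF c])
     (simp_all add: hom_frag_zero[OF f] hom_frag_zero[OF g] hom_frag_diff[OF f] hom_frag_diff[OF g] eq)

lemma hom_frag_cmul:
  assumes f: "f \<in> hom (free_Abelian_group J) (free_Abelian_group I)" and c: "Poly_Mapping.keys c \<subseteq> J"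
  shows "f (frag_cmul m c) = frag_cmul m (f c)"
proof (induction m rule: int_induct[where k=0])
  case (step1 i)
  then show ?case using c hom_frag_add[OF f, of "frag_cmul i c" c] keys_cmul[of i c]
    by (simp add: frag_cmul_distrib)
next
  case (step2 i)
  have "frag_cmul (i - 1) c = frag_cmul i c - c" "frag_cmul (i - 1) (f c) = frag_cmul i (f c) - f c"
    by (simp_all add: frag_cmul_distrib diff_conv_add_uminus del: add_uminus_conv_diff)
  then show ?case using step2 c hom_frag_diff[OF f, of "frag_cmul i c" c] keys_cmul[of i c] by auto
qed (simp add: hom_frag_zero[OF f])

lemma hom_frag_comp:
  "f \<in> hom (free_Abelian_group J) (free_Abelian_group I) \<Longrightarrow> g \<in> hom (free_Abelian_group K) (free_Abelian_group J) \<Longrightarrow>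
   (\<lambda>x. f (g x)) \<in> hom (free_Abelian_group K) (free_Abelian_group I)"
  by (auto simp: hom_def Pi_iff dest: subsetD)

lemma hom_frag_diff_fun:
  assumes "f \<in> hom (free_Abelian_group J) (free_Abelian_group I)" "g \<in> hom (free_Abelian_group J) (free_Abelian_group I)"
  shows "(\<lambda>x. f x - g x) \<in> hom (free_Abelian_group J) (free_Abelian_group I)"
proof (rule homI)
  fix x assume "x \<in> carrier (free_Abelian_group J)"
  then show "f x - g x \<in> carrier (free_Abelian_group I)"
    using hom_frag_keys[OF assms(1), of x] hom_frag_keys[OF assms(2), of x] keys_diff[of "f x" "g x"] by auto
qed (use hom_frag_add[OF assms(1)] hom_frag_add[OF assms(2)] in \<open>auto simp: algebra_simps\<close>)

lemma hom_frag_id: "(\<lambda>x. x) \<in> hom (free_Abelian_group J) (free_Abelian_group J)"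
  by (simp add: hom_def)

text \<open>Free groups are projective. The map \<psi> is a homomorphism on a subgroup S only,
  because one of its instances is the passage from cocycles to cohomology classes.\<close>

lemma hom_frag_lift:
  assumes S: "subgroup S (free_Abelian_group I)" and H: "group H"
    and \<psi>: "\<psi> \<in> hom ((free_Abelian_group I)\<lparr>carrier := S\<rparr>) H"
    and \<phi>: "\<phi> \<in> hom (free_Abelian_group J) H" and im: "\<And>j. j \<in> J \<Longrightarrow> \<phi> (frag_of j) \<in> \<psi> ` S"
  obtains f where "f \<in> hom (free_Abelian_group J) (free_Abelian_group I)"
    "\<And>c. Poly_Mapping.keys c \<subseteq> J \<Longrightarrow> f c \<in> S \<and> \<psi> (f c) = \<phi> c"
proof -
  have "\<forall>j\<in>J. \<exists>b. b \<in> S \<and> \<psi> b = \<phi> (frag_of j)" using im by force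
  from bchoice[OF this] obtain b where b: "\<forall>j\<in>J. b j \<in> S \<and> \<psi> (b j) = \<phi> (frag_of j)" ..
  let ?S = "(free_Abelian_group I)\<lparr>carrier := S\<rparr>"
  have SI: "S \<subseteq> carrier (free_Abelian_group I)" using S by (rule subgroup.subset)
  have f: "frag_extend b \<in> hom (free_Abelian_group J) (free_Abelian_group I)"
  proof (rule frag_extend_in_hom)
    fix j assume "j \<in> J"
    then have "b j \<in> carrier (free_Abelian_group I)" using b SI by blast
    then show "Poly_Mapping.keys (b j) \<subseteq> I" by simp
  qed
  have gS: "group ?S" by (rule group.subgroup_imp_group[OF group_free_Abelian_group S])
  interpret \<psi>: group_hom ?S H \<psi> using gS H \<psi> by (simp add: group_hom_def group_hom_axioms_def)
  interpret \<phi>: group_hom "free_Abelian_group J" H \<phi> using H \<phi> by (simp add: group_hom_def group_hom_axioms_def)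
  have diffS: "x - y \<in> S \<and> \<psi> (x - y) = \<psi> x \<otimes>\<^bsub>H\<^esub> inv\<^bsub>H\<^esub> \<psi> y" if x: "x \<in> S" and y: "y \<in> S" for x y
  proof -
    have iy: "inv\<^bsub>?S\<^esub> y = - y"
      using group.m_inv_consistent[OF group_free_Abelian_group S y] y SI by auto
    have "- y \<in> S" using subgroup.m_inv_closed[OF S y] y SI by auto
    moreover have "x \<otimes>\<^bsub>free_Abelian_group I\<^esub> (- y) \<in> S" using subgroup.m_closed[OF S x \<open>- y \<in> S\<close>] .
    ultimately show ?thesis
      using \<psi>.hom_mult[of x "- y"] \<psi>.hom_inv[of y] x y by (simp add: iy)
  qed
  have "frag_extend b c \<in> S \<and> \<psi> (frag_extend b c) = \<phi> c" if "Poly_Mapping.keys c \<subseteq> J" for c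
  proof (rule free_Abelian_group_induct[OF that])
    show "frag_extend b 0 \<in> S \<and> \<psi> (frag_extend b 0) = \<phi> 0"
      using subgroup.one_closed[OF S] \<psi>.hom_one \<phi>.hom_one by simp
    show "frag_extend b (x - y) \<in> S \<and> \<psi> (frag_extend b (x - y)) = \<phi> (x - y)"
      if "Poly_Mapping.keys x \<subseteq> J" "Poly_Mapping.keys y \<subseteq> J" "frag_extend b x \<in> S \<and> \<psi> (frag_extend b x) = \<phi> x"
        "frag_extend b y \<in> S \<and> \<psi> (frag_extend b y) = \<phi> y" for x y
      using that diffS[of "frag_extend b x" "frag_extend b y"] \<phi>.hom_mult[of x "- y"] \<phi>.hom_inv[of y]
      by (simp add: frag_extend_diff)
    show "frag_extend b (frag_of j) \<in> S \<and> \<psi> (frag_extend b (frag_of j)) = \<phi> (frag_of j)" if "j \<in> J" for j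
      using b that by simp
  qed
  with f show thesis by (rule that)
qed

text \<open>The least positive member divides all others, by division with remainder. It will be
  applied to leading coefficients.\<close>

lemma int_subgroup_generator:
  fixes L :: "int set"
  assumes diff: "\<And>a b. a \<in> L \<Longrightarrow> b \<in> L \<Longrightarrow> a - b \<in> L" and ex: "\<exists>a \<in> L. a \<noteq> 0"
  obtains g where "g \<in> L" "g \<noteq> 0" "\<And>a. a \<in> L \<Longrightarrow> g dvd a"
proof -
  have zero: "0 \<in> L" using ex diff[of a a for a] by force
  have neg: "- a \<in> L" if "a \<in> L" for a using diff[OF zero that] by simp
  have add: "a + b \<in> L" if "a \<in> L" "b \<in> L" for a b using diff[OF that(1) neg[OF that(2)]] by simp
  have nmul: "int n * a \<in> L" if "a \<in> L" for a n
    using that by (induction n) (auto simp: zero add algebra_simps)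
  have mul: "m * a \<in> L" if "a \<in> L" for a m
    using nmul[OF that, of "nat m"] neg[OF nmul[OF that, of "nat (- m)"]] by (cases "m \<ge> 0") auto
  define P where "P n \<longleftrightarrow> 0 < n \<and> int n \<in> L" for n
  obtain a where "a \<in> L" "a \<noteq> 0" using ex by blast
  then have "P (nat \<bar>a\<bar>)" using neg[of a] by (auto simp: P_def abs_if)
  then have P: "P (LEAST n. P n)" by (rule LeastI)
  define g where "g = int (LEAST n. P n)"
  have g: "g \<in> L" "0 < g" using P by (auto simp: P_def g_def)
  have "g dvd a" if a: "a \<in> L" for a
  proof (rule ccontr)
    assume "\<not> g dvd a"
    then have "a mod g \<noteq> 0" by (simp add: dvd_eq_mod_eq_0)
    moreover have "a mod g = a - (a div g) * g" by (simp add: minus_div_mult_eq_mod)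
    then have "a mod g \<in> L" using diff[OF a mul[OF g(1)]] by simp
    moreover have "0 \<le> a mod g" "a mod g < g" using g(2) by auto
    ultimately have "P (nat (a mod g))" "nat (a mod g) < (LEAST n. P n)" by (auto simp: P_def g_def)
    then show False using not_less_Least by blast
  qed
  then show thesis using that[of g] g by auto
qed

text \<open>
  The image of \<open>d\<close> is free on elements with pairwise distinct leading positions, each with a
  leading coefficient generating the ideal of all leading coefficients at its position.
\<close>

theorem ex_retraction_onto_kernel:
  assumes d: "d \<in> hom (free_Abelian_group I) (free_Abelian_group J)" and J: "countable J"
  obtains pr where "pr \<in> hom (free_Abelian_group I) (free_Abelian_group I)"
    "\<And>x. Poly_Mapping.keys x \<subseteq> I \<Longrightarrow> d (pr x) = 0"
    "\<And>x. Poly_Mapping.keys x \<subseteq> I \<Longrightarrow> d x = 0 \<Longrightarrow> pr x = x"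
proof -
  obtain idx :: "'b \<Rightarrow> nat" where idx: "inj_on idx J" using J by (auto simp: countable_def)
  have dk: "Poly_Mapping.keys (d x) \<subseteq> J" if "Poly_Mapping.keys x \<subseteq> I" for x
    using hom_frag_keys[OF d that] .
  \<comment> \<open>The enumeration \<open>idx\<close> orders the positions. D k collects the
    elements whose image reaches no further than position k, and L k the coefficients that occur
    there.\<close>
  define D where "D k = {x. Poly_Mapping.keys x \<subseteq> I \<and> (\<forall>j \<in> Poly_Mapping.keys (d x). idx j \<le> idx k)}" for k
  define L where "L k = (\<lambda>x. Poly_Mapping.lookup (d x) k) ` D k" for k
  define K where "K = {k \<in> J. \<exists>a \<in> L k. a \<noteq> 0}"
  have D_diff: "x - y \<in> D k" if "x \<in> D k" "y \<in> D k" for x y k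
  proof -
    have x: "Poly_Mapping.keys x \<subseteq> I" "\<forall>j \<in> Poly_Mapping.keys (d x). idx j \<le> idx k"
      and y: "Poly_Mapping.keys y \<subseteq> I" "\<forall>j \<in> Poly_Mapping.keys (d y). idx j \<le> idx k"
      using that by (auto simp: D_def)
    have "Poly_Mapping.keys (x - y) \<subseteq> I" using keys_diff[of x y] x y by auto
    moreover have "\<forall>j \<in> Poly_Mapping.keys (d (x - y)). idx j \<le> idx k"
      using hom_frag_diff[OF d x(1) y(1)] keys_diff[of "d x" "d y"] x(2) y(2) by auto
    ultimately show ?thesis by (simp add: D_def)
  qed
  have L_diff: "a - b \<in> L k" if ab: "a \<in> L k" "b \<in> L k" for a b k
  proof -
    obtain x y where x: "x \<in> D k" "a = Poly_Mapping.lookup (d x) k" and y: "y \<in> D k" "b = Poly_Mapping.lookup (d y) k"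
      using ab by (auto simp: L_def)
    have "a - b = Poly_Mapping.lookup (d (x - y)) k"
      using x y hom_frag_diff[OF d, of x y] by (simp add: D_def lookup_minus)
    then show ?thesis using D_diff[OF x(1) y(1)] by (auto simp: L_def)
  qed
  have "\<forall>k \<in> K. \<exists>x. x \<in> D k \<and> Poly_Mapping.lookup (d x) k \<noteq> 0 \<and> (\<forall>a \<in> L k. Poly_Mapping.lookup (d x) k dvd a)"
  proof
    fix k assume "k \<in> K"
    then have "\<exists>a \<in> L k. a \<noteq> 0" by (simp add: K_def)
    then obtain g where "g \<in> L k" "g \<noteq> 0" "\<And>a. a \<in> L k \<Longrightarrow> g dvd a"
      using int_subgroup_generator[of "L k"] L_diff by metis
    then show "\<exists>x. x \<in> D k \<and> Poly_Mapping.lookup (d x) k \<noteq> 0 \<and> (\<forall>a \<in> L k. Poly_Mapping.lookup (d x) k dvd a)"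
      by (auto simp: L_def)
  qed
  from bchoice[OF this] obtain x where x: "\<forall>k \<in> K. x k \<in> D k \<and> Poly_Mapping.lookup (d (x k)) k \<noteq> 0 \<and>
      (\<forall>a \<in> L k. Poly_Mapping.lookup (d (x k)) k dvd a)" ..
  have xI: "Poly_Mapping.keys (x k) \<subseteq> I" if "k \<in> K" for k using x that by (auto simp: D_def)
  define h where "h = frag_extend x"
  have h: "h \<in> hom (free_Abelian_group K) (free_Abelian_group I)"
    unfolding h_def by (rule frag_extend_in_hom) (use xI in auto)
  have hI: "Poly_Mapping.keys (h c) \<subseteq> I" if "Poly_Mapping.keys c \<subseteq> K" for c
    using hom_frag_keys[OF h that] .
  have dh: "d (h c) = frag_extend (\<lambda>k. d (x k)) c" if "Poly_Mapping.keys c \<subseteq> K" for c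
    by (rule hom_frag_eqI[OF hom_frag_comp[OF d h] _ _ that])
       (auto intro!: frag_extend_in_hom dk dest: xI simp: h_def)
  \<comment> \<open>Elimination: subtract from y the multiple of x k that cancels the coefficient of
    d y at its last position k. The bound n on the positions then decreases.\<close>
  have surj: "\<exists>c. Poly_Mapping.keys c \<subseteq> K \<and> d (h c) = d y"
    if "Poly_Mapping.keys y \<subseteq> I" "\<forall>j \<in> Poly_Mapping.keys (d y). idx j < n" for y n
    using that
  proof (induction n arbitrary: y)
    case 0
    then have "d y = 0" by auto
    then show ?case using hom_frag_zero[OF d] hom_frag_zero[OF h] by (intro exI[of _ 0]) simp
  next
    case (Suc n)
    show ?case
    proof (cases "\<exists>k \<in> Poly_Mapping.keys (d y). idx k = n")
      case True
      then obtain k where k: "k \<in> Poly_Mapping.keys (d y)" "idx k = n" by blast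
      have yD: "y \<in> D k" using Suc.prems k by (auto simp: D_def less_Suc_eq_le)
      then have yL: "Poly_Mapping.lookup (d y) k \<in> L k" by (auto simp: L_def)
      moreover have "Poly_Mapping.lookup (d y) k \<noteq> 0" using k(1) by (simp add: in_keys_iff)
      moreover have "k \<in> J" using k(1) dk Suc.prems(1) by blast
      ultimately have kK: "k \<in> K" by (auto simp: K_def)
      have xD: "x k \<in> D k" using x kK by blast
      have "Poly_Mapping.lookup (d (x k)) k dvd Poly_Mapping.lookup (d y) k" using x kK yL by blast
      then obtain m where m: "Poly_Mapping.lookup (d y) k = m * Poly_Mapping.lookup (d (x k)) k"
        by (metis dvdE mult.commute)
      define z where "z = y - frag_cmul m (x k)"
      have mx: "Poly_Mapping.keys (frag_cmul m (x k)) \<subseteq> I" using keys_cmul[of m "x k"] xI[OF kK] by auto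
      have dz: "d z = d y - frag_cmul m (d (x k))"
        unfolding z_def using hom_frag_diff[OF d Suc.prems(1) mx] hom_frag_cmul[OF d xI[OF kK]] by simp
      have zI: "Poly_Mapping.keys z \<subseteq> I" using keys_diff[of y "frag_cmul m (x k)"] mx Suc.prems(1) by (auto simp: z_def)
      have "idx j < n" if j: "j \<in> Poly_Mapping.keys (d z)" for j
      proof -
        have "j \<in> Poly_Mapping.keys (d y) \<or> j \<in> Poly_Mapping.keys (d (x k))"
          using j keys_diff[of "d y" "frag_cmul m (d (x k))"] keys_cmul[of m "d (x k)"] by (auto simp: dz)
        then have "idx j \<le> n" using yD xD k(2) by (auto simp: D_def)
        moreover have "j \<noteq> k"
          using j m by (auto simp: in_keys_iff dz lookup_minus)
        then have "idx j \<noteq> n"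
          using idx k(2) \<open>k \<in> J\<close> dk[OF zI] j by (auto simp: inj_on_def)
        ultimately show ?thesis by simp
      qed
      then obtain c where c: "Poly_Mapping.keys c \<subseteq> K" "d (h c) = d z" using Suc.IH[OF zI] by blast
      let ?c = "c + frag_cmul m (frag_of k)"
      have mk: "Poly_Mapping.keys (frag_cmul m (frag_of k)) \<subseteq> K" using keys_cmul[of m "frag_of k"] kK by auto
      have "Poly_Mapping.keys ?c \<subseteq> K" using keys_add[of c "frag_cmul m (frag_of k)"] c(1) mk by auto
      moreover have "h ?c = h c + frag_cmul m (x k)"
        by (simp add: h_def frag_extend_add frag_extend_cmul)
      then have "d (h ?c) = d y"
        using hom_frag_add[OF d hI[OF c(1)] mx] hom_frag_cmul[OF d xI[OF kK]] c(2) dz by simp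
      ultimately show ?thesis by blast
    next
      case False
      then have "\<forall>j \<in> Poly_Mapping.keys (d y). idx j < n" using Suc.prems(2) less_Suc_eq by blast
      then show ?thesis using Suc.IH Suc.prems(1) by blast
    qed
  qed
  have ex: "\<exists>c. Poly_Mapping.keys c \<subseteq> K \<and> d (h c) = d y" if "Poly_Mapping.keys y \<subseteq> I" for y
  proof (rule surj[OF that])
    show "\<forall>j \<in> Poly_Mapping.keys (d y). idx j < Suc (Max (idx ` Poly_Mapping.keys (d y)))"
      by (simp add: less_Suc_eq_le)
  qed
  \<comment> \<open>Among the d (x j) with j a key of c only the one with the last j = k reaches
    position k, and its coefficient there is nonzero.\<close>
  have inj0: "c = 0" if c: "Poly_Mapping.keys c \<subseteq> K" "d (h c) = 0" for c
  proof (rule ccontr)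
    assume "c \<noteq> 0"
    then have ne: "Poly_Mapping.keys c \<noteq> {}" by simp
    let ?M = "Max (idx ` Poly_Mapping.keys c)"
    have "?M \<in> idx ` Poly_Mapping.keys c" using ne by (intro Max_in) auto
    then obtain k where k: "k \<in> Poly_Mapping.keys c" "idx k = ?M" by auto
    have kmax: "idx j \<le> idx k" if "j \<in> Poly_Mapping.keys c" for j
      using that k(2) by simp
    have kK: "k \<in> K" using k(1) c(1) by blast
    have "Poly_Mapping.lookup (d (h c)) k =
        (\<Sum>j \<in> Poly_Mapping.keys c. Poly_Mapping.lookup c j * Poly_Mapping.lookup (d (x j)) k)"
      by (simp add: dh[OF c(1)] frag_extend_def lookup_sum)
    also have "\<dots> = (\<Sum>j \<in> {k}. Poly_Mapping.lookup c j * Poly_Mapping.lookup (d (x j)) k)"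
    proof (rule sum.mono_neutral_right)
      show "\<forall>j \<in> Poly_Mapping.keys c - {k}. Poly_Mapping.lookup c j * Poly_Mapping.lookup (d (x j)) k = 0"
      proof
        fix j assume j: "j \<in> Poly_Mapping.keys c - {k}"
        then have "j \<in> K" using c(1) by blast
        then have jJ: "j \<in> J" "k \<in> J" using kK by (auto simp: K_def)
        then have "idx j \<noteq> idx k" using idx j by (auto simp: inj_on_def)
        then have "idx j < idx k" using kmax[of j] j by auto
        moreover have "\<forall>i \<in> Poly_Mapping.keys (d (x j)). idx i \<le> idx j"
          using x \<open>j \<in> K\<close> by (auto simp: D_def)
        ultimately have "k \<notin> Poly_Mapping.keys (d (x j))" by fastforce
        then show "Poly_Mapping.lookup c j * Poly_Mapping.lookup (d (x j)) k = 0" by (simp add: in_keys_iff)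
      qed
    qed (use k in auto)
    finally have "Poly_Mapping.lookup c k * Poly_Mapping.lookup (d (x k)) k = 0" using c(2) by simp
    then show False using x kK k(1) by (auto simp: in_keys_iff)
  qed
  have inj: "b = c" if b: "Poly_Mapping.keys b \<subseteq> K" and c: "Poly_Mapping.keys c \<subseteq> K" and eq: "d (h b) = d (h c)" for b c
  proof -
    have "Poly_Mapping.keys (b - c) \<subseteq> K" using keys_diff[of b c] b c by auto
    moreover have "d (h (b - c)) = 0"
      using hom_frag_diff[OF d hI[OF b] hI[OF c]] eq by (simp add: hom_frag_diff[OF h b c])
    ultimately show ?thesis using inj0[of "b - c"] by simp
  qed
  define s where "s y = (SOME c. Poly_Mapping.keys c \<subseteq> K \<and> d (h c) = d y)" for y
  have s: "Poly_Mapping.keys (s y) \<subseteq> K" "d (h (s y)) = d y" if "Poly_Mapping.keys y \<subseteq> I" for y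
    using someI_ex[OF ex[OF that]] by (auto simp: s_def)
  \<comment> \<open>h (s y) is the component of y in the complement spanned by the x k. It has the
    same image as y, and it is additive in y because s y is determined by d y.\<close>
  define pr where "pr y = y - h (s y)" for y
  show thesis
  proof
    show "pr \<in> hom (free_Abelian_group I) (free_Abelian_group I)"
    proof (rule homI)
      fix y assume y: "y \<in> carrier (free_Abelian_group I)"
      then show "pr y \<in> carrier (free_Abelian_group I)"
        using keys_diff[of y "h (s y)"] hI[OF s(1), of y] by (auto simp: pr_def)
      fix z assume z: "z \<in> carrier (free_Abelian_group I)"
      have yI: "Poly_Mapping.keys y \<subseteq> I" and zI: "Poly_Mapping.keys z \<subseteq> I" using y z by auto
      have yzI: "Poly_Mapping.keys (y + z) \<subseteq> I" using keys_add[of y z] yI zI by auto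
      have K': "Poly_Mapping.keys (s y + s z) \<subseteq> K" using keys_add[of "s y" "s z"] s(1)[OF yI] s(1)[OF zI] by auto
      have "d (h (s y + s z)) = d (y + z)"
        using hom_frag_add[OF d hI[OF s(1)[OF yI]] hI[OF s(1)[OF zI]]] s(2)[OF yI] s(2)[OF zI]
        by (simp add: hom_frag_add[OF h s(1)[OF yI] s(1)[OF zI]] hom_frag_add[OF d yI zI])
      then have "s (y + z) = s y + s z"
        using inj[OF s(1)[OF yzI] K'] s(2)[OF yzI] by simp
      then show "pr (y \<otimes>\<^bsub>free_Abelian_group I\<^esub> z) = pr y \<otimes>\<^bsub>free_Abelian_group I\<^esub> pr z"
        by (simp add: pr_def hom_frag_add[OF h s(1)[OF yI] s(1)[OF zI]])
    qed
    show "d (pr y) = 0" if "Poly_Mapping.keys y \<subseteq> I" for y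
      using hom_frag_diff[OF d that hI[OF s(1)[OF that]]] s(2)[OF that] by (simp add: pr_def)
    show "pr y = y" if "Poly_Mapping.keys y \<subseteq> I" "d y = 0" for y
      using inj0[OF s(1)[OF that(1)]] s(2)[OF that(1)] that(2) hom_frag_zero[OF h] by (simp add: pr_def)
  qed
qed

section \<open>Dual maps\<close>

text \<open>The value at c of the homomorphism from the free group to G that sends each generator i
  to x i. In these terms \<open>dual_map\<close> is composition with f.\<close>

definition frag_eval :: "('g, 'm) monoid_scheme \<Rightarrow> ('i \<Rightarrow> 'g) \<Rightarrow> ('i \<Rightarrow>\<^sub>0 int) \<Rightarrow> 'g" where
  "frag_eval G x c = finprod G (\<lambda>i. x i [^]\<^bsub>G\<^esub> Poly_Mapping.lookup c i) (Poly_Mapping.keys c)"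

lemma dual_map_eq: "dual_map G J f x = (\<lambda>j\<in>J. frag_eval (cover G) x (f (frag_of j)))"
  by (simp add: dual_map_def frag_eval_def)

context comm_group
begin

lemma frag_eval_superset:
  assumes x: "x \<in> I \<rightarrow> carrier G" and S: "finite S" "Poly_Mapping.keys c \<subseteq> S" "S \<subseteq> I"
  shows "frag_eval G x c = finprod G (\<lambda>i. x i [^] Poly_Mapping.lookup c i) S"
  unfolding frag_eval_def
proof (rule finprod_mono_neutral_cong_left[OF S(1,2)])
  show "x i [^] Poly_Mapping.lookup c i = \<one>" if "i \<in> S - Poly_Mapping.keys c" for i
    using that by (simp add: in_keys_iff)
  show "(\<lambda>i. x i [^] Poly_Mapping.lookup c i) \<in> S \<rightarrow> carrier G"
    using x S(3) by (auto intro!: int_pow_closed)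
qed simp

lemma frag_eval_closed:
  assumes "x \<in> I \<rightarrow> carrier G" "Poly_Mapping.keys c \<subseteq> I"
  shows "frag_eval G x c \<in> carrier G"
  unfolding frag_eval_def using assms by (intro finprod_closed) (auto intro!: int_pow_closed)

lemma frag_eval_zero [simp]: "frag_eval G x 0 = \<one>"
  by (simp add: frag_eval_def)

lemma frag_eval_frag_of:
  assumes "x i \<in> carrier G"
  shows "frag_eval G x (frag_of i) = x i"
  using assms by (simp add: frag_eval_def finprod_singleton_swap int_pow_1)

lemma frag_eval_add:
  assumes x: "x \<in> I \<rightarrow> carrier G" and c: "Poly_Mapping.keys b \<subseteq> I" "Poly_Mapping.keys c \<subseteq> I"
  shows "frag_eval G x (b + c) = frag_eval G x b \<otimes> frag_eval G x c"
proof -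
  let ?S = "Poly_Mapping.keys b \<union> Poly_Mapping.keys c"
  have S: "finite ?S" "?S \<subseteq> I" using c by auto
  have xS: "x i \<in> carrier G" if "i \<in> ?S" for i using that S(2) x by auto
  have "frag_eval G x (b + c) = finprod G (\<lambda>i. x i [^] Poly_Mapping.lookup (b + c) i) ?S"
    using x S keys_add[of b c] by (intro frag_eval_superset[where I=I]) auto
  also have "\<dots> = finprod G (\<lambda>i. x i [^] Poly_Mapping.lookup b i \<otimes> x i [^] Poly_Mapping.lookup c i) ?S"
    using xS by (intro finprod_cong') (auto simp: lookup_add int_pow_mult intro!: int_pow_closed)
  also have "\<dots> = finprod G (\<lambda>i. x i [^] Poly_Mapping.lookup b i) ?S \<otimes> finprod G (\<lambda>i. x i [^] Poly_Mapping.lookup c i) ?S"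
    using xS by (intro finprod_multf) (auto intro!: int_pow_closed)
  also have "\<dots> = frag_eval G x b \<otimes> frag_eval G x c"
    using frag_eval_superset[OF x S(1) _ S(2), of b] frag_eval_superset[OF x S(1) _ S(2), of c] by simp
  finally show ?thesis .
qed

lemma frag_eval_hom:
  assumes "x \<in> I \<rightarrow> carrier G"
  shows "frag_eval G x \<in> hom (free_Abelian_group I) G"
  by (rule homI) (use assms in \<open>simp_all add: frag_eval_add[where I=I] frag_eval_closed[where I=I]\<close>)

lemma frag_eval_minus:
  assumes x: "x \<in> I \<rightarrow> carrier G" and c: "Poly_Mapping.keys c \<subseteq> I"
  shows "frag_eval G x (- c) = inv (frag_eval G x c)"
proof -
  interpret h: group_hom "free_Abelian_group I" G "frag_eval G x"
    using frag_eval_hom[OF x] by (simp add: group_hom_def group_hom_axioms_def)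
  show ?thesis using h.hom_inv[of c] c by simp
qed

lemma frag_eval_diff:
  assumes x: "x \<in> I \<rightarrow> carrier G" and c: "Poly_Mapping.keys b \<subseteq> I" "Poly_Mapping.keys c \<subseteq> I"
  shows "frag_eval G x (b - c) = frag_eval G x b \<otimes> inv (frag_eval G x c)"
  using frag_eval_add[OF x, of b "- c"] frag_eval_minus[OF x c(2)] c by simp

lemma frag_eval_mult:
  assumes x: "x \<in> I \<rightarrow> carrier G" and y: "y \<in> I \<rightarrow> carrier G" and c: "Poly_Mapping.keys c \<subseteq> I"
  shows "frag_eval G (\<lambda>i\<in>I. x i \<otimes> y i) c = frag_eval G x c \<otimes> frag_eval G y c"
proof -
  have "frag_eval G (\<lambda>i\<in>I. x i \<otimes> y i) c =
      finprod G (\<lambda>i. x i [^] Poly_Mapping.lookup c i \<otimes> y i [^] Poly_Mapping.lookup c i) (Poly_Mapping.keys c)"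
    unfolding frag_eval_def using x y c
    by (intro finprod_cong') (auto simp: subset_iff int_pow_distrib Pi_iff intro!: int_pow_closed m_closed)
  also have "\<dots> = frag_eval G x c \<otimes> frag_eval G y c"
    unfolding frag_eval_def using x y c by (intro finprod_multf) (auto simp: subset_iff Pi_iff intro!: int_pow_closed)
  finally show ?thesis .
qed

lemma frag_eval_subgroup:
  assumes N: "subgroup N G" and x: "\<And>i. i \<in> Poly_Mapping.keys c \<Longrightarrow> x i \<in> N"
  shows "frag_eval G x c \<in> N"
proof -
  have NG: "N \<subseteq> carrier G" using N by (rule subgroup.subset)
  have "finprod G (\<lambda>i. x i [^] Poly_Mapping.lookup c i) S \<in> N" if "finite S" "S \<subseteq> Poly_Mapping.keys c" for S
    using that
  proof (induction S rule: finite_induct)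
    case (insert i S)
    have "x i [^] Poly_Mapping.lookup c i \<in> N" if "i \<in> Poly_Mapping.keys c" for i
      using subgroup_int_pow_closed[OF N x[OF that]] .
    then show ?case using insert NG
      by (subst finprod_insert) (auto intro!: subgroup.m_closed[OF N])
  qed (simp add: subgroup.one_closed[OF N])
  then show ?thesis unfolding frag_eval_def by simp
qed

text \<open>Composition with f, on values: both sides are homomorphisms in c that agree on the
  generators.\<close>

lemma frag_eval_dual:
  assumes x: "x \<in> I \<rightarrow> carrier G" and f: "f \<in> hom (free_Abelian_group J) (free_Abelian_group I)"
    and c: "Poly_Mapping.keys c \<subseteq> J"
  shows "frag_eval G (\<lambda>j\<in>J. frag_eval G x (f (frag_of j))) c = frag_eval G x (f c)"
proof -
  have fk: "Poly_Mapping.keys (f b) \<subseteq> I" if "Poly_Mapping.keys b \<subseteq> J" for b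
    using f that by (auto simp: hom_def Pi_iff)
  let ?y = "\<lambda>j\<in>J. frag_eval G x (f (frag_of j))"
  have y: "?y \<in> J \<rightarrow> carrier G"
    using frag_eval_closed[OF x fk] by simp
  show ?thesis
  proof (rule free_Abelian_group_induct[OF c])
    show "frag_eval G ?y 0 = frag_eval G x (f 0)"
      using hom_frag_diff[OF f, of 0 0] by simp
    show "frag_eval G ?y (a - b) = frag_eval G x (f (a - b))"
      if "Poly_Mapping.keys a \<subseteq> J" "Poly_Mapping.keys b \<subseteq> J"
        "frag_eval G ?y a = frag_eval G x (f a)" "frag_eval G ?y b = frag_eval G x (f b)" for a b
      using that frag_eval_diff[OF y, of a b] frag_eval_diff[OF x fk fk, of a b] hom_frag_diff[OF f, of a b]
      by simp
    show "frag_eval G ?y (frag_of j) = frag_eval G x (f (frag_of j))" if "j \<in> J" for j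
      using that frag_eval_frag_of[of ?y j] frag_eval_closed[OF x fk, of "frag_of j"] by simp
  qed
qed

end

text \<open>The topology lives on a subgroup N while powers are formed in G. With N the whole group
  or the Polishable subgroup this covers both topologies of a group with a Polish cover.\<close>

lemma continuous_map_int_pow:
  fixes G :: "'g monoid" (structure)
  assumes G: "comm_group G" and N: "subgroup N G" and T: "polish_abelian_group (G\<lparr>carrier := N\<rparr>) T"
  shows "continuous_map T T (\<lambda>x. x [^] (n::int))"
proof -
  interpret comm_group G by (rule G)
  have ts: "topspace T = N" using polish_abelian_group_topspace[OF T] by simp
  have N1: "\<one> \<in> N" using N by (rule subgroup.one_closed)
  have npow: "x [^] (k::nat) \<in> N" if "x \<in> N" for x k
    using that N1 by (induction k) (simp_all add: subgroup.m_closed[OF N])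
  have nat: "continuous_map T T (\<lambda>x. x [^] (k::nat))" for k
  proof (induction k)
    case (Suc k)
    show ?case
      using polish_abelian_group_mult_compose[OF T Suc continuous_map_id[unfolded id_def]] by simp
  qed (simp add: ts N1)
  have neg: "continuous_map T T (\<lambda>x. inv (x [^] (k::nat)))" for k
    using polish_abelian_group_inv_compose[OF T nat[of k]]
    by (rule continuous_map_eq) (simp add: ts inv_sub[OF G N] npow)
  show ?thesis
  proof (cases "n < 0")
    case True
    then have "x [^] n = inv (x [^] Int.nat (- n))" for x
      by (subst int_pow_def2) (rule if_P)
    then show ?thesis using neg[of "Int.nat (- n)"] by (simp only:)
  next
    case False
    then have "x [^] n = x [^] Int.nat n" for x
      by (subst int_pow_def2) (rule if_not_P)
    then show ?thesis using nat[of "Int.nat n"] by (simp only:)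
  qed
qed

lemma continuous_map_frag_eval:
  fixes G :: "'g monoid" (structure)
  assumes G: "comm_group G" and N: "subgroup N G" and T: "polish_abelian_group (G\<lparr>carrier := N\<rparr>) T"
    and c: "Poly_Mapping.keys c \<subseteq> I"
  shows "continuous_map (product_topology (\<lambda>_. T) I) T (\<lambda>x. frag_eval G x c)"
proof -
  interpret comm_group G by (rule G)
  let ?P = "product_topology (\<lambda>_. T) I"
  have ts: "topspace T = N" using polish_abelian_group_topspace[OF T] by simp
  have NG: "N \<subseteq> carrier G" using N by (rule subgroup.subset)
  have pow: "continuous_map ?P T (\<lambda>x. x i [^] Poly_Mapping.lookup c i)" if "i \<in> I" for i
    using continuous_map_compose[OF continuous_map_product_projection[OF that, of "\<lambda>_. T"] continuous_map_int_pow[OF G N T]]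
    by (simp add: o_def)
  have "continuous_map ?P T (\<lambda>x. finprod G (\<lambda>i. x i [^] Poly_Mapping.lookup c i) S)"
    if "finite S" "S \<subseteq> I" for S
    using that
  proof (induction S rule: finite_induct)
    case empty
    then show ?case using subgroup.one_closed[OF N] by (simp add: ts)
  next
    case (insert i S)
    then have "continuous_map ?P T (\<lambda>x. x i [^] Poly_Mapping.lookup c i \<otimes>\<^bsub>G\<lparr>carrier := N\<rparr>\<^esub> finprod G (\<lambda>i. x i [^] Poly_Mapping.lookup c i) S)"
      by (intro polish_abelian_group_mult_compose[OF T] pow) auto
    then show ?case
      by (rule continuous_map_eq)
         (use insert NG in \<open>auto simp: ts PiE_def Pi_def subset_iff intro!: finprod_insert[symmetric] int_pow_closed\<close>)
  qed
  then show ?thesis using c by (simp add: frag_eval_def)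
qed

lemma frag_eval_dual_map:
  assumes G: "polish_cover_group G" and f: "f \<in> hom (free_Abelian_group J) (free_Abelian_group I)"
    and x: "x \<in> carrier (cover (hom_free I G))" and c: "Poly_Mapping.keys c \<subseteq> J"
  shows "frag_eval (cover G) (dual_map G J f x) c = frag_eval (cover G) x (f c)"
proof -
  interpret comm_group "cover G" using G by (rule polish_cover_groupD)
  show ?thesis
    unfolding dual_map_eq using x by (intro frag_eval_dual[where I=I] f c) (auto simp: hom_free_simps)
qed

lemma dual_map_sub:
  assumes G: "polish_cover_group G" and f: "f \<in> hom (free_Abelian_group J) (free_Abelian_group I)"
    and x: "x \<in> sub_set (hom_free I G)"
  shows "dual_map G J f x \<in> sub_set (hom_free J G)"
proof -
  interpret comm_group "cover G" using G by (rule polish_cover_groupD)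
  have "frag_eval (cover G) x (f (frag_of j)) \<in> sub_set G" if "j \<in> J" for j
    using hom_frag_keys[OF f, of "frag_of j"] that x
    by (intro frag_eval_subgroup polish_cover_groupD(2)[OF G]) (auto simp: hom_free_simps)
  then show ?thesis by (auto simp: hom_free_simps dual_map_eq)
qed

lemma dual_map_hom:
  assumes G: "polish_cover_group G" and f: "f \<in> hom (free_Abelian_group J) (free_Abelian_group I)"
  shows "dual_map G J f \<in> hom (cover (hom_free I G)) (cover (hom_free J G))"
proof -
  interpret comm_group "cover G" using G by (rule polish_cover_groupD)
  have k: "Poly_Mapping.keys (f (frag_of j)) \<subseteq> I" if "j \<in> J" for j
    using hom_frag_keys[OF f, of "frag_of j"] that by simp
  show ?thesis
    by (rule homI)
       (auto simp: hom_free_simps dual_map_eq PiE_iff frag_eval_closed[where I=I, OF _ k]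
          intro!: restrict_ext frag_eval_mult[OF _ _ k])
qed

lemma dual_map_continuous:
  assumes G: "polish_cover_group G" and f: "f \<in> hom (free_Abelian_group J) (free_Abelian_group I)"
  shows "continuous_map (cover_top (hom_free I G)) (cover_top (hom_free J G)) (dual_map G J f)"
    and "continuous_map (sub_top (hom_free I G)) (sub_top (hom_free J G)) (dual_map G J f)"
proof -
  interpret comm_group "cover G" using G by (rule polish_cover_groupD)
  note G' = polish_cover_groupD[OF G]
  have k: "Poly_Mapping.keys (f (frag_of j)) \<subseteq> I" if "j \<in> J" for j
    using hom_frag_keys[OF f, of "frag_of j"] that by simp
  have "continuous_map (product_topology (\<lambda>_. cover_top G) I) (cover_top G) (\<lambda>x. frag_eval (cover G) x c)"
    if "Poly_Mapping.keys c \<subseteq> I" for c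
    using continuous_map_frag_eval[OF G'(5) subgroup_self _ that] G'(1) by simp
  then show "continuous_map (cover_top (hom_free I G)) (cover_top (hom_free J G)) (dual_map G J f)"
    unfolding hom_free_simps dual_map_eq continuous_map_componentwise
    using k by (auto intro!: continuous_map_eq[where f="\<lambda>x. frag_eval (cover G) x (f (frag_of _))"])
  have "continuous_map (product_topology (\<lambda>_. sub_top G) I) (sub_top G) (\<lambda>x. frag_eval (cover G) x c)"
    if "Poly_Mapping.keys c \<subseteq> I" for c
    using continuous_map_frag_eval[OF G'(5,2,3) that] .
  then show "continuous_map (sub_top (hom_free I G)) (sub_top (hom_free J G)) (dual_map G J f)"
    unfolding hom_free_simps dual_map_eq continuous_map_componentwise
    using k by (auto intro!: continuous_map_eq[where f="\<lambda>x. frag_eval (cover G) x (f (frag_of _))"])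
qed

text \<open>Contravariance. The composite is displayed as a family of values, so that an identity
  between matrices can be applied generator by generator.\<close>

lemma dual_map_comp:
  assumes G: "polish_cover_group G" and f: "f \<in> hom (free_Abelian_group J) (free_Abelian_group I)"
    and g: "g \<in> hom (free_Abelian_group K) (free_Abelian_group J)"
    and x: "x \<in> carrier (cover (hom_free I G))"
  shows "dual_map G K g (dual_map G J f x) = (\<lambda>k\<in>K. frag_eval (cover G) x (f (g (frag_of k))))"
  using hom_frag_keys[OF g, of "frag_of _"]
  by (auto simp: dual_map_eq[of G K] frag_eval_dual_map[OF G f x])

section \<open>Universal coefficients for complexes of countable free groups\<close>

text \<open>All congruences below have this shape, with s an explicit error term.\<close>

lemma coset_of_eqI:
  assumes A: "polish_cover_group A" and s: "s \<in> sub_set A" and y: "y \<in> carrier (cover A)"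
    and eq: "x = s \<otimes>\<^bsub>cover A\<^esub> y"
  shows "coset_of A x = coset_of A y"
proof -
  interpret comm_group "cover A" using A by (rule polish_cover_groupD)
  have sc: "s \<in> carrier (cover A)" using s polish_cover_groupD(7)[OF A] by blast
  have "x \<otimes>\<^bsub>cover A\<^esub> inv\<^bsub>cover A\<^esub> y = s" using sc y by (simp add: eq m_assoc)
  then show ?thesis using sc y s by (simp add: eq coset_of_eq_iff[OF A])
qed

text \<open>
  The groups on \<open>I0\<close>, \<open>I1\<close>, \<open>I2\<close> are the cochains in degrees \<open>n - 1\<close>, \<open>n\<close>, \<open>n + 1\<close>, and \<open>R\<close>, \<open>R'\<close> resolve
  the cohomology in degrees \<open>n\<close>, \<open>n + 1\<close>.  The pairs \<open>(\<gamma>, \<alpha>)\<close> and \<open>(\<epsilon>, \<sigma>)\<close> compare \<open>R\<close> with the resolution of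
  the cohomology by cochains and cocycles, and \<open>\<tau>\<close>, \<open>e\<close> are homotopies from \<open>\<sigma> \<alpha>\<close> and \<open>\<alpha> \<sigma>\<close> to the
  identity; the primed maps, with \<open>\<kappa>\<close> in place of \<open>\<epsilon>\<close>, do the same for \<open>R'\<close>.
\<close>

locale split_universal_coefficients =
  fixes G :: "'g cover_group" and I0 I1 I2 :: "'b set"
    and d0 d1 :: "('b \<Rightarrow>\<^sub>0 int) \<Rightarrow> ('b \<Rightarrow>\<^sub>0 int)"
    and R :: "('i, 'j, 'c) resolution" and R' :: "('k, 'l, 'e) resolution"
    and \<alpha> :: "('i \<Rightarrow>\<^sub>0 int) \<Rightarrow> ('b \<Rightarrow>\<^sub>0 int)" and \<sigma> :: "('b \<Rightarrow>\<^sub>0 int) \<Rightarrow> ('i \<Rightarrow>\<^sub>0 int)"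
    and \<gamma> :: "('j \<Rightarrow>\<^sub>0 int) \<Rightarrow> ('b \<Rightarrow>\<^sub>0 int)" and \<epsilon> :: "('b \<Rightarrow>\<^sub>0 int) \<Rightarrow> ('j \<Rightarrow>\<^sub>0 int)"
    and \<tau> :: "('i \<Rightarrow>\<^sub>0 int) \<Rightarrow> ('j \<Rightarrow>\<^sub>0 int)" and e :: "('b \<Rightarrow>\<^sub>0 int) \<Rightarrow> ('b \<Rightarrow>\<^sub>0 int)"
    and \<alpha>' :: "('k \<Rightarrow>\<^sub>0 int) \<Rightarrow> ('b \<Rightarrow>\<^sub>0 int)" and \<sigma>' :: "('b \<Rightarrow>\<^sub>0 int) \<Rightarrow> ('k \<Rightarrow>\<^sub>0 int)"
    and \<gamma>' :: "('l \<Rightarrow>\<^sub>0 int) \<Rightarrow> ('b \<Rightarrow>\<^sub>0 int)" and \<kappa> :: "('b \<Rightarrow>\<^sub>0 int) \<Rightarrow> ('l \<Rightarrow>\<^sub>0 int)"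
    and \<tau>' :: "('k \<Rightarrow>\<^sub>0 int) \<Rightarrow> ('l \<Rightarrow>\<^sub>0 int)" and e' :: "('b \<Rightarrow>\<^sub>0 int) \<Rightarrow> ('b \<Rightarrow>\<^sub>0 int)"
  assumes G: "polish_cover_group G"
    and countable: "countable I0" "countable I1" "countable I2" "countable (gens R)" "countable (rels R)"
      "countable (gens R')" "countable (rels R')"
    and d0: "d0 \<in> hom (free_Abelian_group I0) (free_Abelian_group I1)"
    and d1: "d1 \<in> hom (free_Abelian_group I1) (free_Abelian_group I2)"
    and rel: "rel_map R \<in> hom (free_Abelian_group (rels R)) (free_Abelian_group (gens R))"
    and rel': "rel_map R' \<in> hom (free_Abelian_group (rels R')) (free_Abelian_group (gens R'))"
    and \<alpha>: "\<alpha> \<in> hom (free_Abelian_group (gens R)) (free_Abelian_group I1)"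
    and \<sigma>: "\<sigma> \<in> hom (free_Abelian_group I1) (free_Abelian_group (gens R))"
    and \<gamma>: "\<gamma> \<in> hom (free_Abelian_group (rels R)) (free_Abelian_group I0)"
    and \<epsilon>: "\<epsilon> \<in> hom (free_Abelian_group I0) (free_Abelian_group (rels R))"
    and \<tau>: "\<tau> \<in> hom (free_Abelian_group (gens R)) (free_Abelian_group (rels R))"
    and e: "e \<in> hom (free_Abelian_group I1) (free_Abelian_group I0)"
    and \<alpha>': "\<alpha>' \<in> hom (free_Abelian_group (gens R')) (free_Abelian_group I2)"
    and \<sigma>': "\<sigma>' \<in> hom (free_Abelian_group I2) (free_Abelian_group (gens R'))"
    and \<gamma>': "\<gamma>' \<in> hom (free_Abelian_group (rels R')) (free_Abelian_group I1)"
    and \<kappa>: "\<kappa> \<in> hom (free_Abelian_group I1) (free_Abelian_group (rels R'))"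
    and \<tau>': "\<tau>' \<in> hom (free_Abelian_group (gens R')) (free_Abelian_group (rels R'))"
    and e': "e' \<in> hom (free_Abelian_group I2) (free_Abelian_group I1)"
    and inj': "inj_on (rel_map R') (carrier (free_Abelian_group (rels R')))"
    and d1_d0: "\<And>y. Poly_Mapping.keys y \<subseteq> I0 \<Longrightarrow> d1 (d0 y) = 0"
    and d1_\<alpha>: "\<And>c. Poly_Mapping.keys c \<subseteq> gens R \<Longrightarrow> d1 (\<alpha> c) = 0"
    and d0_\<gamma>: "\<And>c. Poly_Mapping.keys c \<subseteq> rels R \<Longrightarrow> d0 (\<gamma> c) = \<alpha> (rel_map R c)"
    and rel_\<epsilon>: "\<And>y. Poly_Mapping.keys y \<subseteq> I0 \<Longrightarrow> rel_map R (\<epsilon> y) = \<sigma> (d0 y)"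
    and \<sigma>_\<alpha>: "\<And>c. Poly_Mapping.keys c \<subseteq> gens R \<Longrightarrow> \<sigma> (\<alpha> c) = rel_map R (\<tau> c) + c"
    and cocycle_split: "\<And>z. Poly_Mapping.keys z \<subseteq> I1 \<Longrightarrow> d1 z = 0 \<Longrightarrow> z = \<alpha> (\<sigma> z) + d0 (e z)"
    and d1_\<gamma>': "\<And>c. Poly_Mapping.keys c \<subseteq> rels R' \<Longrightarrow> d1 (\<gamma>' c) = \<alpha>' (rel_map R' c)"
    and rel_\<kappa>: "\<And>y. Poly_Mapping.keys y \<subseteq> I1 \<Longrightarrow> rel_map R' (\<kappa> y) = \<sigma>' (d1 y)"
    and \<sigma>'_\<alpha>': "\<And>c. Poly_Mapping.keys c \<subseteq> gens R' \<Longrightarrow> \<sigma>' (\<alpha>' c) = rel_map R' (\<tau>' c) + c"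
    and coboundary_split: "\<And>y. Poly_Mapping.keys y \<subseteq> I1 \<Longrightarrow> d1 y = \<alpha>' (\<sigma>' (d1 y)) + d1 (e' (d1 y))"
begin

abbreviation ev where "ev \<equiv> frag_eval (cover G)"
abbreviation mult_G (infixl "\<cdot>" 70) where "x \<cdot> y \<equiv> x \<otimes>\<^bsub>cover G\<^esub> y"
abbreviation Cyc where "Cyc \<equiv> kernel_pc (hom_free I1 G) (hom_free I0 G) (dual_map G I0 d0)"
abbreviation Hlg where "Hlg \<equiv> coker_pc (hom_free I2 G) Cyc (dual_map G I1 d1)"

sublocale G: comm_group "cover G" using G by (rule polish_cover_groupD)

lemmas G' = polish_cover_groupD[OF G]

lemma sub_G: "m \<in> sub_set G \<Longrightarrow> m \<in> carrier (cover G)"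
  using G'(7) by blast

lemma inj0: "Poly_Mapping.keys a \<subseteq> rels R' \<Longrightarrow> Poly_Mapping.keys b \<subseteq> rels R' \<Longrightarrow> rel_map R' a = rel_map R' b \<Longrightarrow> a = b"
  using inj' by (auto simp: inj_on_def)

lemma \<kappa>_cocycle: "Poly_Mapping.keys z \<subseteq> I1 \<Longrightarrow> d1 z = 0 \<Longrightarrow> \<kappa> z = 0"
  using rel_\<kappa>[of z] hom_frag_zero[OF \<sigma>'] hom_frag_zero[OF rel'] hom_frag_keys[OF \<kappa>, of z]
  by (intro inj0) auto

text \<open>Apply the injective \<open>rel_map R'\<close>. Then \<kappa> becomes \<sigma>' d1, and
  d1 \<gamma>' becomes \<alpha>' on relations, where \<tau>' compares \<sigma>' \<alpha>' with the
  identity.\<close>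

lemma \<kappa>_\<gamma>': "Poly_Mapping.keys c \<subseteq> rels R' \<Longrightarrow> \<kappa> (\<gamma>' c) = \<tau>' (rel_map R' c) + c"
proof (rule inj0)
  assume c: "Poly_Mapping.keys c \<subseteq> rels R'"
  have k: "Poly_Mapping.keys (rel_map R' c) \<subseteq> gens R'" "Poly_Mapping.keys (\<gamma>' c) \<subseteq> I1"
    using hom_frag_keys[OF rel' c] hom_frag_keys[OF \<gamma>' c] by auto
  have t: "Poly_Mapping.keys (\<tau>' (rel_map R' c)) \<subseteq> rels R'" using hom_frag_keys[OF \<tau>' k(1)] .
  show "Poly_Mapping.keys (\<kappa> (\<gamma>' c)) \<subseteq> rels R'" using hom_frag_keys[OF \<kappa> k(2)] .
  show "Poly_Mapping.keys (\<tau>' (rel_map R' c) + c) \<subseteq> rels R'" using keys_add[of "\<tau>' (rel_map R' c)" c] t c by auto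
  show "rel_map R' (\<kappa> (\<gamma>' c)) = rel_map R' (\<tau>' (rel_map R' c) + c)"
    using rel_\<kappa>[OF k(2)] d1_\<gamma>'[OF c] \<sigma>'_\<alpha>'[OF k(1)] hom_frag_add[OF rel' t c] by simp
qed

lemma d1_d0_frag: "b \<in> I0 \<Longrightarrow> d1 (d0 (frag_of b)) = 0"
  using d1_d0[of "frag_of b"] by simp

lemma hom_free_carrier: "x \<in> carrier (cover (hom_free I G)) \<longleftrightarrow> x \<in> I \<rightarrow>\<^sub>E carrier (cover G)"
  by (simp add: hom_free_simps)

lemma hom_free_sub: "x \<in> sub_set (hom_free I G) \<longleftrightarrow> x \<in> I \<rightarrow>\<^sub>E sub_set G"
  by (simp add: hom_free_simps)

lemma hom_free_mult: "x \<otimes>\<^bsub>cover (hom_free I G)\<^esub> y = (\<lambda>i\<in>I. x i \<cdot> y i)"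
  by (simp add: hom_free_simps)

lemma polish_hom_free: "polish_cover_group (hom_free I0 G)" "polish_cover_group (hom_free I1 G)"
  "polish_cover_group (hom_free I2 G)" "polish_cover_group (hom_free (gens R) G)"
  "polish_cover_group (hom_free (rels R) G)" "polish_cover_group (hom_free (gens R') G)"
  "polish_cover_group (hom_free (rels R') G)"
  by (intro polish_cover_group_hom_free G countable)+

lemma polish_Cyc: "polish_cover_group Cyc"
  by (intro polish_cover_group_kernel_pc polish_hom_free dual_map_hom dual_map_continuous G d0)

lemma polish_Hom: "polish_cover_group (Hom_pc R G)"
  unfolding Hom_pc_def
  by (intro polish_cover_group_kernel_pc polish_hom_free dual_map_hom dual_map_continuous G rel)

lemma polish_Ext: "polish_cover_group (Ext_pc R' G)"
  unfolding Ext_pc_def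
  by (intro polish_cover_group_coker_pc polish_hom_free dual_map_hom dual_map_continuous G rel')

lemma one_in_sub: "(\<lambda>i\<in>I. \<one>\<^bsub>cover G\<^esub>) \<in> sub_set (hom_free I G)"
  using subgroup.one_closed[OF G'(2)] by (auto simp: hom_free_sub)

text \<open>Dual maps composing to zero are constant, hence continuous into the subgroup topology.\<close>

lemma dual_comp_zero:
  assumes f: "f \<in> hom (free_Abelian_group J) (free_Abelian_group I)" and g: "g \<in> hom (free_Abelian_group K) (free_Abelian_group J)"
    and fg: "\<And>k. k \<in> K \<Longrightarrow> f (g (frag_of k)) = 0"
  shows "x \<in> carrier (cover (hom_free I G)) \<Longrightarrow> dual_map G K g (dual_map G J f x) = (\<lambda>k\<in>K. \<one>\<^bsub>cover G\<^esub>)"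
    and "countable I \<Longrightarrow> continuous_map (cover_top (hom_free I G)) (sub_top (hom_free K G)) (\<lambda>x. dual_map G K g (dual_map G J f x))"
proof -
  show 1: "dual_map G K g (dual_map G J f x) = (\<lambda>k\<in>K. \<one>\<^bsub>cover G\<^esub>)" if "x \<in> carrier (cover (hom_free I G))" for x
    using fg by (auto simp: dual_map_comp[OF G f g that])
  assume I: "countable I"
  have "continuous_map (cover_top (hom_free I G)) (sub_top (hom_free K G)) (\<lambda>x. (\<lambda>k\<in>K. \<one>\<^bsub>cover G\<^esub>))"
    by (simp add: one_in_sub)
  then show "continuous_map (cover_top (hom_free I G)) (sub_top (hom_free K G)) (\<lambda>x. dual_map G K g (dual_map G J f x))"
    by (rule continuous_map_eq) (simp add: 1 polish_cover_groupD(6)[OF polish_cover_group_hom_free[OF G I]])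
qed

text \<open>The topology of \<open>Cyc\<close> records a chain together with its boundary, and on
  the image of such a dual map the boundary is constantly trivial. The instances are d1 and
  \<kappa>.\<close>

lemma dual_into_Cyc:
  assumes f: "f \<in> hom (free_Abelian_group I1) (free_Abelian_group I)" and I: "countable I"
    and f0: "\<And>b. b \<in> I0 \<Longrightarrow> f (d0 (frag_of b)) = 0"
  shows "dual_map G I1 f \<in> hom (cover (hom_free I G)) (cover Cyc)"
    and "continuous_map (cover_top (hom_free I G)) (cover_top Cyc) (dual_map G I1 f)"
proof -
  have "dual_map G I0 d0 (dual_map G I1 f x) \<in> sub_set (hom_free I0 G)" if "x \<in> carrier (cover (hom_free I G))" for x
    using dual_comp_zero(1)[OF f d0 f0 that] by (simp only: one_in_sub)
  then show "dual_map G I1 f \<in> hom (cover (hom_free I G)) (cover Cyc)"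
    using dual_map_hom[OF G f] by (auto simp: hom_def kernel_pc_simps Pi_iff)
  have "dual_map G I1 f x \<in> carrier (cover (hom_free I1 G))" if "x \<in> topspace (cover_top (hom_free I G))" for x
    using dual_map_hom[OF G f] that polish_cover_groupD(6)[OF polish_cover_group_hom_free[OF G I]]
    by (auto simp: hom_def Pi_iff)
  then show "continuous_map (cover_top (hom_free I G)) (cover_top Cyc) (dual_map G I1 f)"
    by (intro continuous_map_into_kernel_pc dual_map_continuous(1)[OF G f] dual_comp_zero(2)[OF f d0 f0 I])
qed

lemma polish_Hlg: "polish_cover_group Hlg"
  by (intro polish_cover_group_coker_pc polish_hom_free polish_Cyc dual_into_Cyc d1 countable d1_d0_frag)

lemma Hlg_carrier: "x \<in> carrier (cover Hlg) \<longleftrightarrow>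
    x \<in> carrier (cover (hom_free I1 G)) \<and> dual_map G I0 d0 x \<in> sub_set (hom_free I0 G)"
  by (simp add: coker_pc_simps kernel_pc_simps)

lemma Hlg_mult: "mult (cover Hlg) = mult (cover (hom_free I1 G))"
  by (simp add: coker_pc_simps kernel_pc_simps)

lemma Hlg_sub: "u \<in> sub_set Hlg \<longleftrightarrow> (\<exists>y \<in> carrier (cover (hom_free I2 G)). \<exists>z \<in> sub_set (hom_free I1 G).
    u = dual_map G I1 d1 y \<otimes>\<^bsub>cover (hom_free I1 G)\<^esub> z)"
  using polish_cover_groupD(6)[OF polish_hom_free(3)]
  by (auto simp: sub_set_coker_pc kernel_pc_simps image_iff)

lemma Ext_carrier: "carrier (cover (Ext_pc R' G)) = carrier (cover (hom_free (rels R') G))"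
  and Ext_mult: "mult (cover (Ext_pc R' G)) = mult (cover (hom_free (rels R') G))"
  by (simp_all add: Ext_pc_def coker_pc_simps)

lemma Ext_sub: "u \<in> sub_set (Ext_pc R' G) \<longleftrightarrow> (\<exists>y \<in> carrier (cover (hom_free (gens R') G)).
    \<exists>z \<in> sub_set (hom_free (rels R') G). u = dual_map G (rels R') (rel_map R') y \<otimes>\<^bsub>cover (hom_free (rels R') G)\<^esub> z)"
  using polish_cover_groupD(6)[OF polish_hom_free(6)]
  by (auto simp: Ext_pc_def sub_set_coker_pc image_iff)

lemma Hom_carrier: "x \<in> carrier (cover (Hom_pc R G)) \<longleftrightarrow>
    x \<in> carrier (cover (hom_free (gens R) G)) \<and> dual_map G (rels R) (rel_map R) x \<in> sub_set (hom_free (rels R) G)"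
  and Hom_mult: "mult (cover (Hom_pc R G)) = mult (cover (hom_free (gens R) G))"
  and Hom_sub: "sub_set (Hom_pc R G) = sub_set (hom_free (gens R) G)"
  by (simp_all add: Hom_pc_def kernel_pc_simps)

lemma ev_sub:
  assumes f: "f \<in> hom (free_Abelian_group J) (free_Abelian_group I)"
    and x: "x \<in> carrier (cover (hom_free I G))" "dual_map G J f x \<in> sub_set (hom_free J G)"
    and c: "Poly_Mapping.keys c \<subseteq> J"
  shows "ev x (f c) \<in> sub_set G"
proof -
  have "ev (dual_map G J f x) c \<in> sub_set G"
    using x(2) c by (intro G.frag_eval_subgroup[OF G'(2)]) (auto simp: hom_free_sub)
  then show ?thesis using frag_eval_dual_map[OF G f x(1) c] by simp
qed

lemma dual_hom:
  assumes f: "f \<in> hom (free_Abelian_group J) (free_Abelian_group I)"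
    and "x \<in> carrier (cover (hom_free I G))"
  shows "dual_map G J f x \<in> carrier (cover (hom_free J G))"
  using dual_map_hom[OF G f] assms(2) by (auto simp: hom_def)

lemma dual_mult:
  assumes f: "f \<in> hom (free_Abelian_group J) (free_Abelian_group I)"
    and "x \<in> carrier (cover (hom_free I G))" "y \<in> carrier (cover (hom_free I G))"
  shows "dual_map G J f (x \<otimes>\<^bsub>cover (hom_free I G)\<^esub> y) = dual_map G J f x \<otimes>\<^bsub>cover (hom_free J G)\<^esub> dual_map G J f y"
  using dual_map_hom[OF G f] assms(2,3) by (auto simp: hom_def)

lemma sub_carrier: "z \<in> sub_set (hom_free I G) \<Longrightarrow> z \<in> carrier (cover (hom_free I G))"
  using sub_G by (auto simp: hom_free_sub hom_free_carrier PiE_iff)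

lemma dual_square:
  assumes f: "f \<in> hom (free_Abelian_group J) (free_Abelian_group I)" and g: "g \<in> hom (free_Abelian_group K) (free_Abelian_group J)"
    and f': "f' \<in> hom (free_Abelian_group L) (free_Abelian_group I)" and g': "g' \<in> hom (free_Abelian_group K) (free_Abelian_group L)"
    and eq: "\<And>k. k \<in> K \<Longrightarrow> f (g (frag_of k)) = f' (g' (frag_of k))"
    and x: "x \<in> carrier (cover (hom_free I G))"
  shows "dual_map G K g (dual_map G J f x) = dual_map G K g' (dual_map G L f' x)"
  unfolding dual_map_comp[OF G f g x] dual_map_comp[OF G f' g' x] using eq by auto

end

section \<open>The dual matrices as morphisms between Ext, homology and Hom\<close>

context split_universal_coefficients
begin

text \<open>\<kappa> vanishes on coboundaries, so its dual has cycles as values. By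
  \<open>rel_\<kappa>\<close>, whatever is restricted from the generators of R' goes to a boundary,
  namely that of its image under the dual of \<sigma>'.\<close>

lemma cover_hom_\<kappa>: "cover_hom (Ext_pc R' G) Hlg (dual_map G I1 \<kappa>)"
proof -
  have \<kappa>0: "\<kappa> (d0 (frag_of b)) = 0" if "b \<in> I0" for b
    using \<kappa>_cocycle[of "d0 (frag_of b)"] hom_frag_keys[OF d0, of "frag_of b"] d1_d0_frag[OF that] that by simp
  have "dual_map G I1 \<kappa> u \<in> sub_set Hlg" if "u \<in> sub_set (Ext_pc R' G)" for u
  proof -
    obtain y z where y: "y \<in> carrier (cover (hom_free (gens R') G))" and z: "z \<in> sub_set (hom_free (rels R') G)"
      and u: "u = dual_map G (rels R') (rel_map R') y \<otimes>\<^bsub>cover (hom_free (rels R') G)\<^esub> z"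
      using \<open>u \<in> _\<close> unfolding Ext_sub by blast
    have "dual_map G I1 \<kappa> u = dual_map G I1 \<kappa> (dual_map G (rels R') (rel_map R') y)
        \<otimes>\<^bsub>cover (hom_free I1 G)\<^esub> dual_map G I1 \<kappa> z"
      unfolding u by (intro dual_mult \<kappa> dual_hom[OF rel'] y sub_carrier z)
    also have "dual_map G I1 \<kappa> (dual_map G (rels R') (rel_map R') y) = dual_map G I1 d1 (dual_map G I2 \<sigma>' y)"
      by (intro dual_square[OF rel' \<kappa> \<sigma>' d1] rel_\<kappa> y) simp
    finally show ?thesis
      unfolding Hlg_sub using dual_hom[OF \<sigma>' y] dual_map_sub[OF G \<kappa> z] by blast
  qed
  then show ?thesis
    unfolding cover_hom_def
    using dual_into_Cyc[OF \<kappa> countable(7) \<kappa>0] by (auto simp: Ext_pc_def coker_pc_simps)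
qed

text \<open>By \<open>d1_\<gamma>'\<close> the dual of \<gamma>' sends a boundary to something
  restricted from the generators of R', which is trivial in Ext.\<close>

lemma cover_hom_\<gamma>': "cover_hom Hlg (Ext_pc R' G) (dual_map G (rels R') \<gamma>')"
proof -
  have "dual_map G (rels R') \<gamma>' u \<in> sub_set (Ext_pc R' G)" if "u \<in> sub_set Hlg" for u
  proof -
    obtain y z where y: "y \<in> carrier (cover (hom_free I2 G))" and z: "z \<in> sub_set (hom_free I1 G)"
      and u: "u = dual_map G I1 d1 y \<otimes>\<^bsub>cover (hom_free I1 G)\<^esub> z"
      using \<open>u \<in> _\<close> unfolding Hlg_sub by blast
    have "dual_map G (rels R') \<gamma>' u = dual_map G (rels R') \<gamma>' (dual_map G I1 d1 y)
        \<otimes>\<^bsub>cover (hom_free (rels R') G)\<^esub> dual_map G (rels R') \<gamma>' z"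
      unfolding u by (intro dual_mult \<gamma>' dual_hom[OF d1] y sub_carrier z)
    also have "dual_map G (rels R') \<gamma>' (dual_map G I1 d1 y) = dual_map G (rels R') (rel_map R') (dual_map G (gens R') \<alpha>' y)"
      by (intro dual_square[OF d1 \<gamma>' \<alpha>' rel'] d1_\<gamma>' y) simp
    finally show ?thesis
      unfolding Ext_sub using dual_hom[OF \<alpha>' y] dual_map_sub[OF G \<gamma>' z] by blast
  qed
  moreover have "dual_map G (rels R') \<gamma>' \<in> hom (cover Hlg) (cover (Ext_pc R' G))"
    using dual_map_hom[OF G \<gamma>'] by (auto simp: hom_def Ext_carrier Ext_mult Hlg_mult Hlg_carrier)
  moreover have "continuous_map (cover_top Hlg) (cover_top (Ext_pc R' G)) (dual_map G (rels R') \<gamma>')"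
    using continuous_map_compose[OF continuous_map_from_kernel_pc(1) dual_map_continuous(1)[OF G \<gamma>']]
    by (simp add: o_def Ext_pc_def coker_pc_simps)
  ultimately show ?thesis unfolding cover_hom_def by blast
qed

lemma dual_\<alpha>_Hom:
  assumes "x \<in> carrier (cover (hom_free I1 G))"
  shows "dual_map G (rels R) (rel_map R) (dual_map G (gens R) \<alpha> x) = dual_map G (rels R) \<gamma> (dual_map G I0 d0 x)"
  by (intro dual_square[OF \<alpha> rel d0 \<gamma>] d0_\<gamma>[symmetric] assms) simp

lemma dual_\<sigma>_Cyc:
  assumes "x \<in> carrier (cover (hom_free (gens R) G))"
  shows "dual_map G I0 d0 (dual_map G I1 \<sigma> x) = dual_map G I0 \<epsilon> (dual_map G (rels R) (rel_map R) x)"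
  by (intro dual_square[OF \<sigma> d0 rel \<epsilon>] rel_\<epsilon>[symmetric] assms) simp

text \<open>Continuity out of a quotient topology can be tested on pairs of a chain and an element
  of the old subgroup. The boundary of the chain is evaluated on cocycles and contributes nothing,
  as d1 \<alpha> = 0; the other part is a dual map.\<close>

lemma continuous_sub_\<alpha>: "continuous_map (sub_top Hlg) (sub_top (Hom_pc R G)) (dual_map G (gens R) \<alpha>)"
proof (rule continuous_map_from_sub_coker_pc)
  have H: "sub_top Cyc = sub_top (hom_free I1 G)" "sub_top (Hom_pc R G) = sub_top (hom_free (gens R) G)"
    by (simp_all add: kernel_pc_simps Hom_pc_def)
  have zero: "dual_map G (gens R) \<alpha> (dual_map G I1 d1 y) = (\<lambda>k\<in>gens R. \<one>\<^bsub>cover G\<^esub>)"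
    if "y \<in> carrier (cover (hom_free I2 G))" for y
    using that by (intro dual_comp_zero(1)[OF d1 \<alpha>] d1_\<alpha>) simp
  have "continuous_map (prod_topology (cover_top (hom_free I2 G)) (sub_top Cyc)) (sub_top (Hom_pc R G))
      (\<lambda>p. dual_map G (gens R) \<alpha> (snd p))"
    unfolding H using continuous_map_compose[OF continuous_map_snd dual_map_continuous(2)[OF G \<alpha>]] by (simp add: o_def)
  then show "continuous_map (prod_topology (cover_top (hom_free I2 G)) (sub_top Cyc)) (sub_top (Hom_pc R G))
      (\<lambda>(x, y). dual_map G (gens R) \<alpha> (dual_map G I1 d1 x \<otimes>\<^bsub>cover Cyc\<^esub> y))"
  proof (rule continuous_map_eq)
    fix p assume "p \<in> topspace (prod_topology (cover_top (hom_free I2 G)) (sub_top Cyc))"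
    then have p: "fst p \<in> carrier (cover (hom_free I2 G))" "snd p \<in> sub_set (hom_free I1 G)"
      by (simp_all only: topspace_prod_topology mem_Times_iff H polish_cover_groupD(6)[OF polish_hom_free(3)])
    have d: "dual_map G (gens R) \<alpha> (snd p) \<in> carrier (cover (hom_free (gens R) G))"
      by (intro dual_hom[OF \<alpha>] sub_carrier p)
    have "dual_map G (gens R) \<alpha> (dual_map G I1 d1 (fst p) \<otimes>\<^bsub>cover Cyc\<^esub> snd p) =
        dual_map G (gens R) \<alpha> (dual_map G I1 d1 (fst p)) \<otimes>\<^bsub>cover (hom_free (gens R) G)\<^esub> dual_map G (gens R) \<alpha> (snd p)"
      unfolding kernel_pc_simps by (intro dual_mult[OF \<alpha>] dual_hom[OF d1] sub_carrier p)
    also have "\<dots> = dual_map G (gens R) \<alpha> (snd p)"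
      unfolding zero[OF p(1)] hom_free_mult using d by (auto simp: hom_free_carrier PiE_iff extensional_def)
    finally show "dual_map G (gens R) \<alpha> (snd p) =
        (case p of (x, y) \<Rightarrow> dual_map G (gens R) \<alpha> (dual_map G I1 d1 x \<otimes>\<^bsub>cover Cyc\<^esub> y))"
      by (simp add: case_prod_unfold)
  qed
qed

text \<open>By \<open>d0_\<gamma>\<close>, \<alpha> of a relation is a coboundary, and there a cycle
  takes values in the subgroup. The same identity gives continuity into the topology of
  \<open>Hom_pc\<close>, which records the values on relations.\<close>

lemma cover_hom_\<alpha>: "cover_hom Hlg (Hom_pc R G) (dual_map G (gens R) \<alpha>)"
proof -
  have carr: "dual_map G (gens R) \<alpha> x \<in> carrier (cover (Hom_pc R G))" if "x \<in> carrier (cover Hlg)" for x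
    using that dual_hom[OF \<alpha>, of x] dual_\<alpha>_Hom[of x] dual_map_sub[OF G \<gamma>]
    by (auto simp: Hom_carrier Hlg_carrier)
  have "dual_map G (gens R) \<alpha> \<in> hom (cover Hlg) (cover (Hom_pc R G))"
    using carr by (intro homI) (auto simp: Hom_mult Hlg_mult Hlg_carrier dual_mult[OF \<alpha>])
  moreover have "continuous_map (cover_top Hlg) (cover_top (Hom_pc R G)) (dual_map G (gens R) \<alpha>)"
    unfolding Hom_pc_def
  proof (rule continuous_map_into_kernel_pc)
    have ts: "topspace (cover_top Hlg) = carrier (cover Hlg)"
      by (rule polish_cover_groupD(6)[OF polish_Hlg])
    show "continuous_map (cover_top Hlg) (cover_top (hom_free (gens R) G)) (dual_map G (gens R) \<alpha>)"
      using continuous_map_compose[OF continuous_map_from_kernel_pc(1) dual_map_continuous(1)[OF G \<alpha>]]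
      by (simp add: o_def coker_pc_simps)
    have "continuous_map (cover_top Hlg) (sub_top (hom_free (rels R) G)) (\<lambda>x. dual_map G (rels R) \<gamma> (dual_map G I0 d0 x))"
      using continuous_map_compose[OF continuous_map_from_kernel_pc(2) dual_map_continuous(2)[OF G \<gamma>]]
      by (simp add: o_def coker_pc_simps)
    then show "continuous_map (cover_top Hlg) (sub_top (hom_free (rels R) G))
        (\<lambda>x. dual_map G (rels R) (rel_map R) (dual_map G (gens R) \<alpha> x))"
      by (rule continuous_map_eq) (simp add: ts Hlg_carrier dual_\<alpha>_Hom)
    show "dual_map G (gens R) \<alpha> x \<in> carrier (cover (hom_free (gens R) G))" if "x \<in> topspace (cover_top Hlg)" for x
      using that by (intro dual_hom[OF \<alpha>]) (simp add: ts Hlg_carrier)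
  qed
  ultimately show ?thesis
    unfolding cover_hom_def using cover_hom_sub[OF continuous_sub_\<alpha>] by blast
qed

text \<open>By \<open>rel_\<epsilon>\<close>, \<sigma> of a coboundary is a relation, and there a
  member of Hom takes values in the subgroup. Hence the dual of \<sigma> has cycles as values, and
  it is continuous into the topology of cycles.\<close>

lemma cover_hom_\<sigma>: "cover_hom (Hom_pc R G) Hlg (dual_map G I1 \<sigma>)"
proof -
  have carr: "dual_map G I1 \<sigma> x \<in> carrier (cover Hlg)" if "x \<in> carrier (cover (Hom_pc R G))" for x
    using that dual_hom[OF \<sigma>, of x] dual_\<sigma>_Cyc[of x] dual_map_sub[OF G \<epsilon>]
    by (auto simp: Hom_carrier Hlg_carrier)
  have "dual_map G I1 \<sigma> \<in> hom (cover (Hom_pc R G)) (cover Hlg)"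
    using carr by (intro homI) (auto simp: Hom_mult Hlg_mult Hom_carrier dual_mult[OF \<sigma>])
  moreover have "continuous_map (cover_top (Hom_pc R G)) (cover_top Hlg) (dual_map G I1 \<sigma>)"
    unfolding coker_pc_simps
  proof (rule continuous_map_into_kernel_pc)
    have ts: "topspace (cover_top (Hom_pc R G)) = carrier (cover (Hom_pc R G))"
      by (rule polish_cover_groupD(6)[OF polish_Hom])
    show "continuous_map (cover_top (Hom_pc R G)) (cover_top (hom_free I1 G)) (dual_map G I1 \<sigma>)"
      using continuous_map_compose[OF continuous_map_from_kernel_pc(1) dual_map_continuous(1)[OF G \<sigma>]]
      by (simp add: o_def Hom_pc_def)
    have "continuous_map (cover_top (Hom_pc R G)) (sub_top (hom_free I0 G))
        (\<lambda>x. dual_map G I0 \<epsilon> (dual_map G (rels R) (rel_map R) x))"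
      using continuous_map_compose[OF continuous_map_from_kernel_pc(2) dual_map_continuous(2)[OF G \<epsilon>]]
      by (simp add: o_def Hom_pc_def)
    then show "continuous_map (cover_top (Hom_pc R G)) (sub_top (hom_free I0 G)) (\<lambda>x. dual_map G I0 d0 (dual_map G I1 \<sigma> x))"
      by (rule continuous_map_eq) (simp add: ts Hom_carrier dual_\<sigma>_Cyc)
    show "dual_map G I1 \<sigma> x \<in> carrier (cover (hom_free I1 G))" if "x \<in> topspace (cover_top (Hom_pc R G))" for x
      using that by (intro dual_hom[OF \<sigma>]) (simp add: ts Hom_carrier)
  qed
  moreover have "dual_map G I1 \<sigma> z \<in> sub_set Hlg" if "z \<in> sub_set (Hom_pc R G)" for z
  proof -
    have z: "dual_map G I1 \<sigma> z \<in> sub_set (hom_free I1 G)"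
      using that unfolding Hom_sub by (rule dual_map_sub[OF G \<sigma>])
    show ?thesis
      unfolding Hlg_sub
    proof (rule bexI[of _ "\<one>\<^bsub>cover (hom_free I2 G)\<^esub>"], rule bexI[OF _ z])
      interpret h: group_hom "cover (hom_free I2 G)" "cover (hom_free I1 G)" "dual_map G I1 d1"
        using dual_map_hom[OF G d1] polish_cover_groupD(5)[OF polish_hom_free(2)] polish_cover_groupD(5)[OF polish_hom_free(3)]
        by (simp add: group_hom_def group_hom_axioms_def comm_group_def)
      show "\<one>\<^bsub>cover (hom_free I2 G)\<^esub> \<in> carrier (cover (hom_free I2 G))" by simp
      show "dual_map G I1 \<sigma> z = dual_map G I1 d1 \<one>\<^bsub>cover (hom_free I2 G)\<^esub> \<otimes>\<^bsub>cover (hom_free I1 G)\<^esub> dual_map G I1 \<sigma> z"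
        using sub_carrier[OF z] h.H.l_one by (simp only: h.hom_one)
    qed
  qed
  ultimately show ?thesis unfolding cover_hom_def by blast
qed

text \<open>\<kappa> \<gamma>' differs from the identity by \<tau>' after \<open>rel_map R'\<close>.
  The dual of this is restricted from the generators of R', hence trivial in Ext.\<close>

lemma retraction_\<iota>:
  assumes x: "x \<in> carrier (cover (Ext_pc R' G))"
  shows "coset_of (Ext_pc R' G) (dual_map G (rels R') \<gamma>' (dual_map G I1 \<kappa> x)) = coset_of (Ext_pc R' G) x"
proof (rule coset_of_eqI[OF polish_Ext _ x])
  have x': "x \<in> carrier (cover (hom_free (rels R') G))" using x by (simp add: Ext_carrier)
  have xf: "x \<in> rels R' \<rightarrow> carrier (cover G)" using x' by (auto simp: hom_free_carrier)
  let ?u = "dual_map G (rels R') (rel_map R') (dual_map G (gens R') \<tau>' x)"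
  have u: "?u \<in> carrier (cover (hom_free (rels R') G))" by (intro dual_hom[OF rel'] dual_hom[OF \<tau>'] x')
  have "?u = ?u \<otimes>\<^bsub>cover (hom_free (rels R') G)\<^esub> (\<lambda>i\<in>rels R'. \<one>\<^bsub>cover G\<^esub>)"
    using u unfolding hom_free_mult by (auto simp: hom_free_carrier PiE_iff extensional_def)
  then show "?u \<in> sub_set (Ext_pc R' G)"
    unfolding Ext_sub using one_in_sub dual_hom[OF \<tau>' x'] by blast
  show "dual_map G (rels R') \<gamma>' (dual_map G I1 \<kappa> x) = ?u \<otimes>\<^bsub>cover (Ext_pc R' G)\<^esub> x"
    unfolding Ext_mult hom_free_mult dual_map_comp[OF G \<kappa> \<gamma>' x'] dual_map_comp[OF G \<tau>' rel' x']
  proof (rule restrict_ext)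
    fix k assume k: "k \<in> rels R'"
    have "\<kappa> (\<gamma>' (frag_of k)) = \<tau>' (rel_map R' (frag_of k)) + frag_of k"
      using k by (intro \<kappa>_\<gamma>') simp
    moreover have "Poly_Mapping.keys (\<tau>' (rel_map R' (frag_of k))) \<subseteq> rels R'"
      using k by (intro hom_frag_keys[OF \<tau>'] hom_frag_keys[OF rel']) simp
    ultimately show "ev x (\<kappa> (\<gamma>' (frag_of k))) = (\<lambda>k\<in>rels R'. ev x (\<tau>' (rel_map R' (frag_of k)))) k \<cdot> x k"
      using k G.frag_eval_add[OF xf, of "\<tau>' (rel_map R' (frag_of k))" "frag_of k"] G.frag_eval_frag_of[of x k, OF funcset_mem[OF xf k]] by simp
  qed
qed

text \<open>\<sigma> \<alpha> differs from the identity by \<open>rel_map R\<close> after \<tau>,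
  dually by values on relations, which for a member of Hom lie in the subgroup.\<close>

lemma section_\<pi>:
  assumes z: "z \<in> carrier (cover (Hom_pc R G))"
  shows "coset_of (Hom_pc R G) (dual_map G (gens R) \<alpha> (dual_map G I1 \<sigma> z)) = coset_of (Hom_pc R G) z"
proof (rule coset_of_eqI[OF polish_Hom _ z])
  have z': "z \<in> carrier (cover (hom_free (gens R) G))" using z by (simp add: Hom_carrier)
  have zf: "z \<in> gens R \<rightarrow> carrier (cover G)" using z' by (auto simp: hom_free_carrier)
  let ?u = "dual_map G (gens R) \<tau> (dual_map G (rels R) (rel_map R) z)"
  show "?u \<in> sub_set (Hom_pc R G)"
    unfolding Hom_sub using z by (intro dual_map_sub[OF G \<tau>]) (simp add: Hom_carrier)
  show "dual_map G (gens R) \<alpha> (dual_map G I1 \<sigma> z) = ?u \<otimes>\<^bsub>cover (Hom_pc R G)\<^esub> z"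
    unfolding Hom_mult hom_free_mult dual_map_comp[OF G \<sigma> \<alpha> z'] dual_map_comp[OF G rel \<tau> z']
  proof (rule restrict_ext)
    fix k assume k: "k \<in> gens R"
    have "\<sigma> (\<alpha> (frag_of k)) = rel_map R (\<tau> (frag_of k)) + frag_of k"
      using k by (intro \<sigma>_\<alpha>) simp
    moreover have "Poly_Mapping.keys (rel_map R (\<tau> (frag_of k))) \<subseteq> gens R"
      using k by (intro hom_frag_keys[OF \<tau>] hom_frag_keys[OF rel]) simp
    ultimately show "ev z (\<sigma> (\<alpha> (frag_of k))) = (\<lambda>k\<in>gens R. ev z (rel_map R (\<tau> (frag_of k)))) k \<cdot> z k"
      using k G.frag_eval_add[OF zf, of "rel_map R (\<tau> (frag_of k))" "frag_of k"] G.frag_eval_frag_of[of z k, OF funcset_mem[OF zf k]] by simp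
  qed
qed

text \<open>
  With \<open>\<mu> = 1 - \<gamma>' \<kappa> - e' d1\<close>, which takes values in the cocycles, the identity of the cochains is
  \<open>\<gamma>' \<kappa> + e' d1 + \<alpha> \<sigma> \<mu> + d0 e \<mu>\<close>; the last two terms only contribute values in the subgroup.
\<close>

lemma middle_exact:
  assumes x: "x \<in> carrier (cover Hlg)" and px: "dual_map G (gens R) \<alpha> x \<in> sub_set (Hom_pc R G)"
  shows "coset_of Hlg (dual_map G I1 \<kappa> (dual_map G (rels R') \<gamma>' x)) = coset_of Hlg x"
proof (rule coset_of_eqI[OF polish_Hlg, symmetric])
  have x': "x \<in> carrier (cover (hom_free I1 G))" and dx: "dual_map G I0 d0 x \<in> sub_set (hom_free I0 G)"
    using x by (auto simp: Hlg_carrier)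
  have xf: "x \<in> I1 \<rightarrow> carrier (cover G)" using x' by (auto simp: hom_free_carrier)
  have N\<alpha>: "ev x (\<alpha> c) \<in> sub_set G" if "Poly_Mapping.keys c \<subseteq> gens R" for c
    using ev_sub[OF \<alpha> x' _ that] px by (simp add: Hom_sub)
  have Nd0: "ev x (d0 y) \<in> sub_set G" if "Poly_Mapping.keys y \<subseteq> I0" for y
    using ev_sub[OF d0 x' dx that] .
  define \<mu> where "\<mu> y = y - \<gamma>' (\<kappa> y) - e' (d1 y)" for y
  let ?m = "\<lambda>b\<in>I1. ev x (\<alpha> (\<sigma> (\<mu> (frag_of b)))) \<cdot> ev x (d0 (e (\<mu> (frag_of b))))"
  let ?u = "dual_map G I1 d1 (dual_map G I2 e' x) \<otimes>\<^bsub>cover (hom_free I1 G)\<^esub> ?m"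
  have keys: "Poly_Mapping.keys (\<gamma>' (\<kappa> y)) \<subseteq> I1" "Poly_Mapping.keys (e' (d1 y)) \<subseteq> I1" "Poly_Mapping.keys (\<mu> y) \<subseteq> I1"
    if "Poly_Mapping.keys y \<subseteq> I1" for y
  proof -
    show 1: "Poly_Mapping.keys (\<gamma>' (\<kappa> y)) \<subseteq> I1" by (intro hom_frag_keys[OF \<gamma>'] hom_frag_keys[OF \<kappa>] that)
    show 2: "Poly_Mapping.keys (e' (d1 y)) \<subseteq> I1" by (intro hom_frag_keys[OF e'] hom_frag_keys[OF d1] that)
    show "Poly_Mapping.keys (\<mu> y) \<subseteq> I1"
      unfolding \<mu>_def using keys_diff[of "y - \<gamma>' (\<kappa> y)" "e' (d1 y)"] keys_diff[of y "\<gamma>' (\<kappa> y)"] 1 2 that by blast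
  qed
  \<comment> \<open>As d1 \<gamma>' \<kappa> is \<alpha>' \<sigma>' d1, this is
    \<open>coboundary_split\<close> rearranged.\<close>
  have d1\<mu>: "d1 (\<mu> y) = 0" if y: "Poly_Mapping.keys y \<subseteq> I1" for y
  proof -
    have "Poly_Mapping.keys (y - \<gamma>' (\<kappa> y)) \<subseteq> I1" using keys_diff[of y "\<gamma>' (\<kappa> y)"] keys(1)[OF y] y by blast
    then have "d1 (\<mu> y) = d1 y - d1 (\<gamma>' (\<kappa> y)) - d1 (e' (d1 y))"
      unfolding \<mu>_def using hom_frag_diff[OF d1 _ keys(2)[OF y]] hom_frag_diff[OF d1 y keys(1)[OF y]] by simp
    also have "d1 (\<gamma>' (\<kappa> y)) = \<alpha>' (\<sigma>' (d1 y))"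
      using d1_\<gamma>'[OF hom_frag_keys[OF \<kappa> y]] rel_\<kappa>[OF y] by simp
    finally show ?thesis using coboundary_split[OF y] by (simp add: algebra_simps)
  qed
  have \<sigma>\<mu>: "Poly_Mapping.keys (\<sigma> (\<mu> (frag_of b))) \<subseteq> gens R" "Poly_Mapping.keys (e (\<mu> (frag_of b))) \<subseteq> I0" if "b \<in> I1" for b
    using hom_frag_keys[OF \<sigma> keys(3)] hom_frag_keys[OF e keys(3)] that by simp_all
  have m: "?m \<in> sub_set (hom_free I1 G)"
    using N\<alpha>[OF \<sigma>\<mu>(1)] Nd0[OF \<sigma>\<mu>(2)] subgroup.m_closed[OF G'(2)] by (auto simp: hom_free_sub)
  have e'x: "dual_map G I2 e' x \<in> carrier (cover (hom_free I2 G))" by (rule dual_hom[OF e' x'])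
  show "?u \<in> sub_set Hlg" unfolding Hlg_sub using m e'x by blast
  have "dual_map G (rels R') \<gamma>' x \<in> carrier (cover (Ext_pc R' G))"
    unfolding Ext_carrier by (rule dual_hom[OF \<gamma>' x'])
  then show "dual_map G I1 \<kappa> (dual_map G (rels R') \<gamma>' x) \<in> carrier (cover Hlg)"
    using cover_hom_\<kappa> by (auto simp: cover_hom_def hom_def)
  show "x = ?u \<otimes>\<^bsub>cover Hlg\<^esub> dual_map G I1 \<kappa> (dual_map G (rels R') \<gamma>' x)"
    unfolding Hlg_mult hom_free_mult dual_map_comp[OF G \<gamma>' \<kappa> x'] dual_map_comp[OF G e' d1 x']
  proof (rule extensionalityI[of _ I1])
    show "x \<in> extensional I1" using x' by (simp add: hom_free_carrier PiE_iff)
    fix b assume b: "b \<in> I1"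
    let ?b = "frag_of b"
    have bI: "Poly_Mapping.keys ?b \<subseteq> I1" using b by simp
    note kb = keys[OF bI]
    let ?A = "\<alpha> (\<sigma> (\<mu> ?b))" and ?D = "d0 (e (\<mu> ?b))"
    have AI: "Poly_Mapping.keys ?A \<subseteq> I1" "Poly_Mapping.keys ?D \<subseteq> I1"
      using hom_frag_keys[OF \<alpha> \<sigma>\<mu>(1)[OF b]] hom_frag_keys[OF d0 \<sigma>\<mu>(2)[OF b]] by auto
    have \<mu>: "\<mu> ?b = ?A + ?D" by (rule cocycle_split[OF kb(3) d1\<mu>[OF bI]])
    have c: "ev x ?A \<in> carrier (cover G)" "ev x ?D \<in> carrier (cover G)"
      "ev x (e' (d1 ?b)) \<in> carrier (cover G)" "ev x (\<gamma>' (\<kappa> ?b)) \<in> carrier (cover G)"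
      using G.frag_eval_closed[OF xf] AI kb by auto
    have "?b = (e' (d1 ?b) + \<mu> ?b) + \<gamma>' (\<kappa> ?b)" by (simp add: \<mu>_def)
    then have "ev x ?b = ev x ((e' (d1 ?b) + \<mu> ?b) + \<gamma>' (\<kappa> ?b))" by (rule arg_cong)
    also have "\<dots> = ev x (e' (d1 ?b) + \<mu> ?b) \<cdot> ev x (\<gamma>' (\<kappa> ?b))"
      by (intro G.frag_eval_add[OF xf] subset_trans[OF keys_add] Un_least kb)
    also have "ev x (e' (d1 ?b) + \<mu> ?b) = ev x (e' (d1 ?b)) \<cdot> ev x (\<mu> ?b)"
      by (intro G.frag_eval_add[OF xf] kb)
    also have "ev x (\<mu> ?b) = ev x ?A \<cdot> ev x ?D"
      by (rule trans[OF arg_cong[OF \<mu>, of "ev x"] G.frag_eval_add[OF xf AI]])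
    finally have "ev x ?b = ev x (e' (d1 ?b)) \<cdot> (ev x ?A \<cdot> ev x ?D) \<cdot> ev x (\<gamma>' (\<kappa> ?b))" .
    moreover have "ev x ?b = x b" using xf b by (intro G.frag_eval_frag_of) auto
    ultimately show "x b = (\<lambda>i\<in>I1. (\<lambda>i\<in>I1. (\<lambda>k\<in>I1. ev x (e' (d1 (frag_of k)))) i \<cdot> ?m i) i \<cdot>
        (\<lambda>k\<in>I1. ev x (\<gamma>' (\<kappa> (frag_of k)))) i) b"
      using b by simp
  qed simp
qed

theorem split_exact:
  "pc_short_exact (Ext_pc R' G) Hlg (Hom_pc R G) (pc_map Hlg (dual_map G I1 \<kappa>)) (pc_map (Hom_pc R G) (dual_map G (gens R) \<alpha>)) \<and>
   pc_splits Hlg (Hom_pc R G) (pc_map (Hom_pc R G) (dual_map G (gens R) \<alpha>))"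
proof (rule pc_split_exactI[OF polish_Ext polish_Hlg polish_Hom cover_hom_\<kappa> cover_hom_\<alpha> cover_hom_\<gamma>' cover_hom_\<sigma>
        continuous_sub_\<alpha>])
  \<comment> \<open>\<alpha> has cocycles as values, and \<kappa> kills them.\<close>
  have 0: "\<kappa> (\<alpha> (frag_of g)) = 0" if "g \<in> gens R" for g
    using \<kappa>_cocycle[of "\<alpha> (frag_of g)"] hom_frag_keys[OF \<alpha>, of "frag_of g"] d1_\<alpha>[of "frag_of g"] that by simp
  show "dual_map G (gens R) \<alpha> (dual_map G I1 \<kappa> x) \<in> sub_set (Hom_pc R G)"
    if "x \<in> carrier (cover (Ext_pc R' G))" for x
    using dual_comp_zero(1)[OF \<kappa> \<alpha> 0, of x] that by (simp only: Hom_sub Ext_carrier one_in_sub)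
  show "continuous_map (cover_top (Ext_pc R' G)) (sub_top (Hom_pc R G)) (\<lambda>x. dual_map G (gens R) \<alpha> (dual_map G I1 \<kappa> x))"
    using dual_comp_zero(2)[OF \<kappa> \<alpha> 0 countable(7)] by (simp add: Ext_pc_def Hom_pc_def coker_pc_simps kernel_pc_simps)
qed (simp_all only: retraction_\<iota> section_\<pi> middle_exact)

end

section \<open>Cohomology of free complexes and the choice of the comparison matrices\<close>

definition free_cochain_complex :: "'b free_complex \<Rightarrow> bool" where
  "free_cochain_complex C \<longleftrightarrow> (\<forall>n. countable (basis C n) \<and>
     diff C n \<in> hom (free_Abelian_group (basis C n)) (free_Abelian_group (basis C (n + 1))) \<and>
     (\<forall>x. Poly_Mapping.keys x \<subseteq> basis C n \<longrightarrow> diff C (n + 1) (diff C n x) = 0))"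

lemma free_cochain_complexD:
  assumes "free_cochain_complex C"
  shows "countable (basis C n)"
    "diff C n \<in> hom (free_Abelian_group (basis C n)) (free_Abelian_group (basis C (n + 1)))"
    "diff C (n - 1) \<in> hom (free_Abelian_group (basis C (n - 1))) (free_Abelian_group (basis C n))"
    "Poly_Mapping.keys x \<subseteq> basis C n \<Longrightarrow> diff C (n + 1) (diff C n x) = 0"
    "Poly_Mapping.keys x \<subseteq> basis C (n - 1) \<Longrightarrow> diff C n (diff C (n - 1) x) = 0"
proof -
  have 1: "countable (basis C n)"
    "diff C n \<in> hom (free_Abelian_group (basis C n)) (free_Abelian_group (basis C (n + 1)))"
    "Poly_Mapping.keys x \<subseteq> basis C n \<Longrightarrow> diff C (n + 1) (diff C n x) = 0" for n x
    using assms by (auto simp: free_cochain_complex_def)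
  show "countable (basis C n)"
    "diff C n \<in> hom (free_Abelian_group (basis C n)) (free_Abelian_group (basis C (n + 1)))"
    "Poly_Mapping.keys x \<subseteq> basis C n \<Longrightarrow> diff C (n + 1) (diff C n x) = 0"
    by (fact 1)+
  show "diff C (n - 1) \<in> hom (free_Abelian_group (basis C (n - 1))) (free_Abelian_group (basis C n))"
    using 1(2)[of "n - 1"] by simp
  show "Poly_Mapping.keys x \<subseteq> basis C (n - 1) \<Longrightarrow> diff C n (diff C (n - 1) x) = 0"
    using 1(3)[of x "n - 1"] by simp
qed

lemma cocycles_iff: "z \<in> cocycles C n \<longleftrightarrow> Poly_Mapping.keys z \<subseteq> basis C n \<and> diff C n z = 0"
  by (simp add: cocycles_def kernel_def)

lemma coboundaries_iff: "z \<in> coboundaries C n \<longleftrightarrow> (\<exists>y. Poly_Mapping.keys y \<subseteq> basis C (n - 1) \<and> z = diff C (n - 1) y)"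
  by (simp add: coboundaries_def image_iff Bex_def)

lemma diff_mem_coboundaries: "Poly_Mapping.keys y \<subseteq> basis C (n - 1) \<Longrightarrow> diff C (n - 1) y \<in> coboundaries C n"
  by (simp add: coboundaries_def)

abbreviation coh_class :: "'b free_complex \<Rightarrow> int \<Rightarrow> ('b \<Rightarrow>\<^sub>0 int) \<Rightarrow> ('b \<Rightarrow>\<^sub>0 int) set" where
  "coh_class C n z \<equiv> coboundaries C n #>\<^bsub>free_Abelian_group (basis C n)\<^esub> z"

lemma mem_coh_class: "w \<in> coh_class C n z \<longleftrightarrow> w - z \<in> coboundaries C n"
  by (force simp: r_coset_def)

lemma coboundaries_subset_cocycles:
  assumes "free_cochain_complex C" "z \<in> coboundaries C n"
  shows "z \<in> cocycles C n"
proof -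
  obtain y where y: "Poly_Mapping.keys y \<subseteq> basis C (n - 1)" "z = diff C (n - 1) y"
    using assms(2) by (auto simp: coboundaries_iff)
  then show ?thesis
    using free_cochain_complexD(5)[OF assms(1) y(1)] hom_frag_keys[OF free_cochain_complexD(3)[OF assms(1)] y(1)]
    by (simp add: cocycles_iff)
qed

lemma coboundaries_zero: "free_cochain_complex C \<Longrightarrow> 0 \<in> coboundaries C n"
  unfolding coboundaries_iff using hom_frag_zero[OF free_cochain_complexD(3)[of C n]] by (intro exI[of _ 0]) simp

lemma coboundaries_diff:
  assumes C: "free_cochain_complex C" and "z \<in> coboundaries C n" "w \<in> coboundaries C n"
  shows "z - w \<in> coboundaries C n"
proof -
  obtain x y where x: "Poly_Mapping.keys x \<subseteq> basis C (n - 1)" "z = diff C (n - 1) x"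
    and y: "Poly_Mapping.keys y \<subseteq> basis C (n - 1)" "w = diff C (n - 1) y"
    using assms(2,3) by (auto simp: coboundaries_iff)
  have "Poly_Mapping.keys (x - y) \<subseteq> basis C (n - 1)" using keys_diff[of x y] x y by blast
  moreover have "z - w = diff C (n - 1) (x - y)"
    using hom_frag_diff[OF free_cochain_complexD(3)[OF C] x(1) y(1)] x y by simp
  ultimately show ?thesis unfolding coboundaries_iff by blast
qed

lemma coh_class_eq_iff:
  assumes C: "free_cochain_complex C"
  shows "coh_class C n z = coh_class C n w \<longleftrightarrow> z - w \<in> coboundaries C n"
proof
  assume "coh_class C n z = coh_class C n w"
  moreover have "z \<in> coh_class C n z" using coboundaries_zero[OF C] by (simp add: mem_coh_class)
  ultimately have "z \<in> coh_class C n w" by simp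
  then show "z - w \<in> coboundaries C n" by (simp only: mem_coh_class)
next
  assume zw: "z - w \<in> coboundaries C n"
  have "w - z \<in> coboundaries C n" using coboundaries_diff[OF C coboundaries_zero[OF C] zw] by simp
  have "u - z \<in> coboundaries C n \<longleftrightarrow> u - w \<in> coboundaries C n" for u
    using coboundaries_diff[OF C, of "u - w" n "z - w"] coboundaries_diff[OF C, of "u - z" n "w - z"] zw
      \<open>w - z \<in> coboundaries C n\<close> by auto
  then show "coh_class C n z = coh_class C n w" by (simp add: set_eq_iff mem_coh_class)
qed

lemma subgroup_cocycles:
  assumes C: "free_cochain_complex C"
  shows "subgroup (cocycles C n) (free_Abelian_group (basis C n))"
proof -
  interpret group_hom "free_Abelian_group (basis C n)" "free_Abelian_group (basis C (n + 1))" "diff C n"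
    using free_cochain_complexD(2)[OF C] by (simp add: group_hom_def group_hom_axioms_def)
  show ?thesis unfolding cocycles_def by (rule subgroup_kernel)
qed

lemma cohomology_group:
  assumes C: "free_cochain_complex C"
  shows "group (cohomology C n)"
    and "coh_class C n \<in> hom ((free_Abelian_group (basis C n))\<lparr>carrier := cocycles C n\<rparr>) (cohomology C n)"
    and "carrier (cohomology C n) = coh_class C n ` cocycles C n"
    and "\<one>\<^bsub>cohomology C n\<^esub> = coh_class C n 0"
proof -
  let ?F = "free_Abelian_group (basis C n)"
  let ?Z = "?F\<lparr>carrier := cocycles C n\<rparr>"
  interpret F: comm_group ?F by (rule abelian_free_Abelian_group)
  note sub = subgroup_cocycles[OF C, of n]
  interpret Z: comm_group ?Z
    by (rule group.group_comm_groupI[OF F.subgroup_imp_group[OF sub]]) (simp add: add.commute)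
  interpret d: group_hom "free_Abelian_group (basis C (n - 1))" ?F "diff C (n - 1)"
    using free_cochain_complexD(3)[OF C] by (simp add: group_hom_def group_hom_axioms_def)
  have "subgroup (coboundaries C n) ?F"
    unfolding coboundaries_def by (rule d.img_is_subgroup)
  then have "subgroup (coboundaries C n) ?Z"
    using F.subgroup_incl[OF _ sub] coboundaries_subset_cocycles[OF C] by blast
  then have n: "coboundaries C n \<lhd> ?Z" by (rule Z.subgroup_imp_normal)
  interpret N: normal "coboundaries C n" ?Z by (rule n)
  have cos: "coboundaries C n #>\<^bsub>?Z\<^esub> z = coh_class C n z" for z by (simp add: r_coset_def)
  show "group (cohomology C n)" unfolding cohomology_def by (rule N.factorgroup_is_group)
  show "coh_class C n \<in> hom ?Z (cohomology C n)"
    unfolding cohomology_def using N.r_coset_hom_Mod by (simp only: cos)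
  show "carrier (cohomology C n) = coh_class C n ` cocycles C n"
    unfolding cohomology_def by (auto simp: FactGroup_def RCOSETS_def cos)
  have "coh_class C n 0 = coboundaries C n" by (auto simp: mem_coh_class)
  then show "\<one>\<^bsub>cohomology C n\<^esub> = coh_class C n 0" by (simp add: cohomology_def FactGroup_def)
qed

lemma coh_class_eq_one_iff:
  assumes C: "free_cochain_complex C"
  shows "coh_class C n z = \<one>\<^bsub>cohomology C n\<^esub> \<longleftrightarrow> z \<in> coboundaries C n"
  using coh_class_eq_iff[OF C, of n z 0] by (simp add: cohomology_group(4)[OF C])

lemma free_resolutionD:
  assumes "free_resolution H R"
  shows "countable (gens R)" "countable (rels R)"
    "rel_map R \<in> hom (free_Abelian_group (rels R)) (free_Abelian_group (gens R))"
    "augm R \<in> hom (free_Abelian_group (gens R)) H"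
    "inj_on (rel_map R) (carrier (free_Abelian_group (rels R)))"
    "Poly_Mapping.keys x \<subseteq> gens R \<Longrightarrow> augm R x = \<one>\<^bsub>H\<^esub> \<Longrightarrow> x \<in> rel_map R ` carrier (free_Abelian_group (rels R))"
    "Poly_Mapping.keys y \<subseteq> rels R \<Longrightarrow> augm R (rel_map R y) = \<one>\<^bsub>H\<^esub>"
    "augm R ` carrier (free_Abelian_group (gens R)) = carrier H"
proof -
  have ker: "kernel (free_Abelian_group (gens R)) H (augm R) = rel_map R ` carrier (free_Abelian_group (rels R))"
    using assms by (simp add: free_resolution_def)
  show "Poly_Mapping.keys x \<subseteq> gens R \<Longrightarrow> augm R x = \<one>\<^bsub>H\<^esub> \<Longrightarrow> x \<in> rel_map R ` carrier (free_Abelian_group (rels R))"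
    unfolding ker[symmetric] by (simp add: kernel_def)
  assume "Poly_Mapping.keys y \<subseteq> rels R"
  then have "rel_map R y \<in> kernel (free_Abelian_group (gens R)) H (augm R)" unfolding ker by simp
  then show "augm R (rel_map R y) = \<one>\<^bsub>H\<^esub>" by (simp add: kernel_def)
qed (use assms in \<open>simp_all add: free_resolution_def\<close>)

text \<open>Projectivity for \<psi> between free groups; in its uses \<psi> is a differential or the
  map of relations of a resolution.\<close>

lemma hom_frag_factor:
  assumes \<psi>: "\<psi> \<in> hom (free_Abelian_group I) (free_Abelian_group K)"
    and \<phi>: "\<phi> \<in> hom (free_Abelian_group J) (free_Abelian_group K)"
    and im: "\<And>j. j \<in> J \<Longrightarrow> \<phi> (frag_of j) \<in> \<psi> ` carrier (free_Abelian_group I)"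
  shows "\<exists>f \<in> hom (free_Abelian_group J) (free_Abelian_group I). \<forall>c. Poly_Mapping.keys c \<subseteq> J \<longrightarrow> \<psi> (f c) = \<phi> c"
proof -
  have eq: "(free_Abelian_group I)\<lparr>carrier := carrier (free_Abelian_group I)\<rparr> = free_Abelian_group I" by simp
  obtain f where "f \<in> hom (free_Abelian_group J) (free_Abelian_group I)"
    "\<And>c. Poly_Mapping.keys c \<subseteq> J \<Longrightarrow> f c \<in> carrier (free_Abelian_group I) \<and> \<psi> (f c) = \<phi> c"
    using hom_frag_lift[of "carrier (free_Abelian_group I)" I "free_Abelian_group K" \<psi> \<phi> J]
      group.subgroup_self[OF group_free_Abelian_group] \<psi> \<phi> im unfolding eq by (metis group_free_Abelian_group)
  then show ?thesis by blast
qed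

text \<open>The sequence in degree n is made from \<alpha> in degree n and \<kappa> in degree n + 1,
  and \<sigma> ties \<kappa> to the cohomology. These matrices are fixed once for each space and
  degree. The homotopies between them do not enter the morphisms and may be chosen anew in each
  proof.\<close>

definition uct_choice :: "'b free_complex \<Rightarrow> int \<Rightarrow> ('i, 'j, ('b \<Rightarrow>\<^sub>0 int) set) resolution \<Rightarrow>
    (('i \<Rightarrow>\<^sub>0 int) \<Rightarrow> ('b \<Rightarrow>\<^sub>0 int)) \<Rightarrow> (('b \<Rightarrow>\<^sub>0 int) \<Rightarrow> ('i \<Rightarrow>\<^sub>0 int)) \<Rightarrow> (('b \<Rightarrow>\<^sub>0 int) \<Rightarrow> ('j \<Rightarrow>\<^sub>0 int)) \<Rightarrow> bool" where
  "uct_choice C n R \<alpha> \<sigma> \<kappa> \<longleftrightarrow>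
     \<alpha> \<in> hom (free_Abelian_group (gens R)) (free_Abelian_group (basis C n)) \<and>
     \<sigma> \<in> hom (free_Abelian_group (basis C n)) (free_Abelian_group (gens R)) \<and>
     \<kappa> \<in> hom (free_Abelian_group (basis C (n - 1))) (free_Abelian_group (rels R)) \<and>
     (\<forall>c. Poly_Mapping.keys c \<subseteq> gens R \<longrightarrow> \<alpha> c \<in> cocycles C n \<and> coh_class C n (\<alpha> c) = augm R c) \<and>
     (\<forall>z \<in> cocycles C n. augm R (\<sigma> z) = coh_class C n z) \<and>
     (\<forall>y. Poly_Mapping.keys y \<subseteq> basis C (n - 1) \<longrightarrow> rel_map R (\<kappa> y) = \<sigma> (diff C (n - 1) y))"

lemma uct_choiceD:
  assumes "uct_choice C n R \<alpha> \<sigma> \<kappa>"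
  shows "\<alpha> \<in> hom (free_Abelian_group (gens R)) (free_Abelian_group (basis C n))"
    "\<sigma> \<in> hom (free_Abelian_group (basis C n)) (free_Abelian_group (gens R))"
    "\<kappa> \<in> hom (free_Abelian_group (basis C (n - 1))) (free_Abelian_group (rels R))"
    "Poly_Mapping.keys c \<subseteq> gens R \<Longrightarrow> \<alpha> c \<in> cocycles C n"
    "Poly_Mapping.keys c \<subseteq> gens R \<Longrightarrow> coh_class C n (\<alpha> c) = augm R c"
    "z \<in> cocycles C n \<Longrightarrow> augm R (\<sigma> z) = coh_class C n z"
    "Poly_Mapping.keys y \<subseteq> basis C (n - 1) \<Longrightarrow> rel_map R (\<kappa> y) = \<sigma> (diff C (n - 1) y)"
  using assms by (auto simp: uct_choice_def)

lemma ex_cocycle_retraction: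
  assumes C: "free_cochain_complex C"
  shows "\<exists>pr \<in> hom (free_Abelian_group (basis C n)) (free_Abelian_group (basis C n)).
     (\<forall>x. Poly_Mapping.keys x \<subseteq> basis C n \<longrightarrow> pr x \<in> cocycles C n) \<and> (\<forall>z \<in> cocycles C n. pr z = z)"
proof -
  obtain pr where pr: "pr \<in> hom (free_Abelian_group (basis C n)) (free_Abelian_group (basis C n))"
    "\<And>x. Poly_Mapping.keys x \<subseteq> basis C n \<Longrightarrow> diff C n (pr x) = 0"
    "\<And>x. Poly_Mapping.keys x \<subseteq> basis C n \<Longrightarrow> diff C n x = 0 \<Longrightarrow> pr x = x"
    using ex_retraction_onto_kernel[OF free_cochain_complexD(2,1)[OF C]] by metis
  then show ?thesis using hom_frag_keys[OF pr(1)] by (intro bexI[OF _ pr(1)]) (auto simp: cocycles_iff)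
qed

text \<open>Projectivity, three times. \<alpha> picks cocycles for the generators. \<sigma> has to
  be a matrix on all cochains while only cocycles have classes, so the retraction \<open>pr\<close>
  is applied first; this is the unnatural choice. \<kappa> exists because \<sigma> sends
  coboundaries to elements that vanish in cohomology, which are relations.\<close>

lemma ex_uct_choice:
  assumes C: "free_cochain_complex C" and R: "free_resolution (cohomology C n) R"
  shows "\<exists>\<alpha> \<sigma> \<kappa>. uct_choice C n R \<alpha> \<sigma> \<kappa>"
proof -
  note R' = free_resolutionD[OF R] and H = cohomology_group[OF C, of n]
  let ?F = "free_Abelian_group (basis C n)"
  let ?Z = "?F\<lparr>carrier := cocycles C n\<rparr>"
  have "augm R (frag_of g) \<in> coh_class C n ` cocycles C n" if "g \<in> gens R" for g
  proof -
    have "augm R (frag_of g) \<in> augm R ` carrier (free_Abelian_group (gens R))" using that by (intro imageI) simp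
    then show ?thesis by (simp only: R'(8) H(3))
  qed
  then obtain \<alpha> where \<alpha>: "\<alpha> \<in> hom (free_Abelian_group (gens R)) ?F"
    "\<And>c. Poly_Mapping.keys c \<subseteq> gens R \<Longrightarrow> \<alpha> c \<in> cocycles C n \<and> coh_class C n (\<alpha> c) = augm R c"
    using hom_frag_lift[OF subgroup_cocycles[OF C] H(1) H(2) R'(4)] by metis
  obtain pr where pr: "pr \<in> hom ?F ?F" "\<And>x. Poly_Mapping.keys x \<subseteq> basis C n \<Longrightarrow> pr x \<in> cocycles C n"
    "\<And>z. z \<in> cocycles C n \<Longrightarrow> pr z = z"
    using ex_cocycle_retraction[OF C, of n] by blast
  have "pr \<in> hom ?F ?Z" using pr(1,2) by (auto simp: hom_def)
  from hom_compose[OF this H(2)] have \<phi>: "(\<lambda>z. coh_class C n (pr z)) \<in> hom ?F (cohomology C n)" by (simp add: o_def)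
  have aug: "augm R \<in> hom ((free_Abelian_group (gens R))\<lparr>carrier := carrier (free_Abelian_group (gens R))\<rparr>) (cohomology C n)"
    using R'(4) by simp
  have "coh_class C n (pr (frag_of b)) \<in> augm R ` carrier (free_Abelian_group (gens R))" if "b \<in> basis C n" for b
    unfolding R'(8) H(3) using pr(2)[of "frag_of b"] that by simp
  then obtain \<sigma> where \<sigma>: "\<sigma> \<in> hom ?F (free_Abelian_group (gens R))"
    "\<And>z. Poly_Mapping.keys z \<subseteq> basis C n \<Longrightarrow> augm R (\<sigma> z) = coh_class C n (pr z)"
    using hom_frag_lift[OF group.subgroup_self[OF group_free_Abelian_group] H(1) aug \<phi>] by metis
  have \<sigma>Z: "augm R (\<sigma> z) = coh_class C n z" if "z \<in> cocycles C n" for z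
    using \<sigma>(2)[of z] pr(3)[OF that] that by (simp add: cocycles_iff)
  note d = free_cochain_complexD(3)[OF C, of n]
  have "\<sigma> (diff C (n - 1) (frag_of b)) \<in> rel_map R ` carrier (free_Abelian_group (rels R))" if b: "b \<in> basis C (n - 1)" for b
  proof (rule R'(6))
    have db: "diff C (n - 1) (frag_of b) \<in> coboundaries C n" using b by (intro diff_mem_coboundaries) simp
    show "Poly_Mapping.keys (\<sigma> (diff C (n - 1) (frag_of b))) \<subseteq> gens R"
      using b by (intro hom_frag_keys[OF \<sigma>(1)] hom_frag_keys[OF d]) simp
    show "augm R (\<sigma> (diff C (n - 1) (frag_of b))) = \<one>\<^bsub>cohomology C n\<^esub>"
      using \<sigma>Z[OF coboundaries_subset_cocycles[OF C db]] db coh_class_eq_one_iff[OF C] by simp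
  qed
  then obtain \<kappa> where "\<kappa> \<in> hom (free_Abelian_group (basis C (n - 1))) (free_Abelian_group (rels R))"
    "\<forall>y. Poly_Mapping.keys y \<subseteq> basis C (n - 1) \<longrightarrow> rel_map R (\<kappa> y) = \<sigma> (diff C (n - 1) y)"
    using hom_frag_factor[OF R'(3) hom_frag_comp[OF \<sigma>(1) d]] by blast
  then show ?thesis
    unfolding uct_choice_def using \<alpha> \<sigma>(1) \<sigma>Z by (intro exI[of _ \<alpha>] exI[of _ \<sigma>] exI[of _ \<kappa>]) blast
qed

text \<open>Each map lifts something that is trivial in cohomology: \<alpha> of a relation, \<sigma>
  \<alpha> minus the identity, and the identity minus \<alpha> \<sigma>. The last is known for
  cocycles only, so e is built on all cochains with the help of a retraction onto them.\<close>

lemma uct_choice_maps: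
  assumes C: "free_cochain_complex C" and R: "free_resolution (cohomology C n) R"
    and u: "uct_choice C n R \<alpha> \<sigma> \<kappa>"
  obtains \<gamma> \<tau> e where
    "\<gamma> \<in> hom (free_Abelian_group (rels R)) (free_Abelian_group (basis C (n - 1)))"
    "\<tau> \<in> hom (free_Abelian_group (gens R)) (free_Abelian_group (rels R))"
    "e \<in> hom (free_Abelian_group (basis C n)) (free_Abelian_group (basis C (n - 1)))"
    "\<And>c. Poly_Mapping.keys c \<subseteq> rels R \<Longrightarrow> diff C (n - 1) (\<gamma> c) = \<alpha> (rel_map R c)"
    "\<And>c. Poly_Mapping.keys c \<subseteq> gens R \<Longrightarrow> \<sigma> (\<alpha> c) = rel_map R (\<tau> c) + c"
    "\<And>z. z \<in> cocycles C n \<Longrightarrow> z = \<alpha> (\<sigma> z) + diff C (n - 1) (e z)"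
proof -
  note R' = free_resolutionD[OF R] and H = cohomology_group[OF C, of n] and u' = uct_choiceD[OF u]
  note d = free_cochain_complexD(3)[OF C, of n]
  interpret aug: group_hom "free_Abelian_group (gens R)" "cohomology C n" "augm R"
    using R'(4) H(1) by (simp add: group_hom_def group_hom_axioms_def)
  have cob: "coboundaries C n = diff C (n - 1) ` carrier (free_Abelian_group (basis C (n - 1)))"
    by (simp add: coboundaries_def)
  have "\<alpha> (rel_map R (frag_of k)) \<in> coboundaries C n" if "k \<in> rels R" for k
  proof -
    have k: "Poly_Mapping.keys (frag_of k) \<subseteq> rels R" using that by simp
    have "coh_class C n (\<alpha> (rel_map R (frag_of k))) = \<one>\<^bsub>cohomology C n\<^esub>"
      using u'(5)[OF hom_frag_keys[OF R'(3) k]] R'(7)[OF k] by simp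
    then show ?thesis by (simp only: coh_class_eq_one_iff[OF C])
  qed
  then obtain \<gamma> where \<gamma>: "\<gamma> \<in> hom (free_Abelian_group (rels R)) (free_Abelian_group (basis C (n - 1)))"
    "\<forall>c. Poly_Mapping.keys c \<subseteq> rels R \<longrightarrow> diff C (n - 1) (\<gamma> c) = \<alpha> (rel_map R c)"
    using hom_frag_factor[OF d hom_frag_comp[OF u'(1) R'(3)]] cob by blast
  have "\<sigma> (\<alpha> (frag_of g)) - frag_of g \<in> rel_map R ` carrier (free_Abelian_group (rels R))" if "g \<in> gens R" for g
  proof (rule R'(6))
    have g: "Poly_Mapping.keys (frag_of g) \<subseteq> gens R" using that by simp
    have sg: "Poly_Mapping.keys (\<sigma> (\<alpha> (frag_of g))) \<subseteq> gens R" by (intro hom_frag_keys[OF u'(2)] hom_frag_keys[OF u'(1)] g)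
    show "Poly_Mapping.keys (\<sigma> (\<alpha> (frag_of g)) - frag_of g) \<subseteq> gens R"
      using keys_diff[of "\<sigma> (\<alpha> (frag_of g))" "frag_of g"] sg g by blast
    have "augm R (\<sigma> (\<alpha> (frag_of g))) = augm R (frag_of g)" using u'(6)[OF u'(4)[OF g]] u'(5)[OF g] by simp
    then show "augm R (\<sigma> (\<alpha> (frag_of g)) - frag_of g) = \<one>\<^bsub>cohomology C n\<^esub>"
      using aug.hom_mult[of "\<sigma> (\<alpha> (frag_of g))" "- frag_of g"] aug.hom_inv[of "frag_of g"] sg g
        aug.hom_closed[of "frag_of g"] by simp
  qed
  then obtain \<tau> where \<tau>: "\<tau> \<in> hom (free_Abelian_group (gens R)) (free_Abelian_group (rels R))"
    "\<forall>c. Poly_Mapping.keys c \<subseteq> gens R \<longrightarrow> rel_map R (\<tau> c) = \<sigma> (\<alpha> c) - c"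
    using hom_frag_factor[OF R'(3) hom_frag_diff_fun[OF hom_frag_comp[OF u'(2,1)] hom_frag_id]] by blast
  obtain pr where pr: "pr \<in> hom (free_Abelian_group (basis C n)) (free_Abelian_group (basis C n))"
    "\<And>x. Poly_Mapping.keys x \<subseteq> basis C n \<Longrightarrow> pr x \<in> cocycles C n" "\<And>z. z \<in> cocycles C n \<Longrightarrow> pr z = z"
    using ex_cocycle_retraction[OF C, of n] by blast
  have "pr (frag_of b) - \<alpha> (\<sigma> (pr (frag_of b))) \<in> coboundaries C n" if "b \<in> basis C n" for b
  proof -
    have z: "pr (frag_of b) \<in> cocycles C n" using pr(2)[of "frag_of b"] that by simp
    then have "Poly_Mapping.keys (\<sigma> (pr (frag_of b))) \<subseteq> gens R"
      by (intro hom_frag_keys[OF u'(2)]) (simp add: cocycles_iff)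
    then have "coh_class C n (pr (frag_of b)) = coh_class C n (\<alpha> (\<sigma> (pr (frag_of b))))"
      using u'(5) u'(6)[OF z] by simp
    then show ?thesis by (simp only: coh_class_eq_iff[OF C])
  qed
  then obtain e where e: "e \<in> hom (free_Abelian_group (basis C n)) (free_Abelian_group (basis C (n - 1)))"
    "\<forall>z. Poly_Mapping.keys z \<subseteq> basis C n \<longrightarrow> diff C (n - 1) (e z) = pr z - \<alpha> (\<sigma> (pr z))"
    using hom_frag_factor[OF d hom_frag_diff_fun[OF pr(1) hom_frag_comp[OF u'(1) hom_frag_comp[OF u'(2) pr(1)]]]] cob by blast
  show thesis
  proof (rule that[OF \<gamma>(1) \<tau>(1) e(1)])
    show "z = \<alpha> (\<sigma> z) + diff C (n - 1) (e z)" if "z \<in> cocycles C n" for z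
      using e(2) pr(3)[OF that] that by (simp add: cocycles_iff)
  qed (use \<gamma>(2) \<tau>(2) in auto)
qed

text \<open>The sequence in degree n uses the choices in degrees n and n + 1.
  \<open>coboundary_split\<close> is the splitting of cocycles in degree n + 1, taken at
  coboundaries.\<close>

lemma uct_choice_split:
  assumes G: "polish_cover_group G" and C: "free_cochain_complex C"
    and R: "free_resolution (cohomology C n) R" and R': "free_resolution (cohomology C (n + 1)) R'"
    and u: "uct_choice C n R \<alpha> \<sigma> \<epsilon>" and u': "uct_choice C (n + 1) R' \<alpha>' \<sigma>' \<kappa>"
  shows "\<exists>\<gamma> \<tau> e \<gamma>' \<tau>' e'. split_universal_coefficients G (basis C (n - 1)) (basis C n) (basis C (n + 1))
    (diff C (n - 1)) (diff C n) R R' \<alpha> \<sigma> \<gamma> \<epsilon> \<tau> e \<alpha>' \<sigma>' \<gamma>' \<kappa> \<tau>' e'"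
proof -
  obtain \<gamma> \<tau> e where 1: "\<gamma> \<in> hom (free_Abelian_group (rels R)) (free_Abelian_group (basis C (n - 1)))"
    "\<tau> \<in> hom (free_Abelian_group (gens R)) (free_Abelian_group (rels R))"
    "e \<in> hom (free_Abelian_group (basis C n)) (free_Abelian_group (basis C (n - 1)))"
    "\<And>c. Poly_Mapping.keys c \<subseteq> rels R \<Longrightarrow> diff C (n - 1) (\<gamma> c) = \<alpha> (rel_map R c)"
    "\<And>c. Poly_Mapping.keys c \<subseteq> gens R \<Longrightarrow> \<sigma> (\<alpha> c) = rel_map R (\<tau> c) + c"
    "\<And>z. z \<in> cocycles C n \<Longrightarrow> z = \<alpha> (\<sigma> z) + diff C (n - 1) (e z)"
    using uct_choice_maps[OF C R u] by blast
  obtain \<gamma>' \<tau>' e' where 2: "\<gamma>' \<in> hom (free_Abelian_group (rels R')) (free_Abelian_group (basis C (n + 1 - 1)))"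
    "\<tau>' \<in> hom (free_Abelian_group (gens R')) (free_Abelian_group (rels R'))"
    "e' \<in> hom (free_Abelian_group (basis C (n + 1))) (free_Abelian_group (basis C (n + 1 - 1)))"
    "\<And>c. Poly_Mapping.keys c \<subseteq> rels R' \<Longrightarrow> diff C (n + 1 - 1) (\<gamma>' c) = \<alpha>' (rel_map R' c)"
    "\<And>c. Poly_Mapping.keys c \<subseteq> gens R' \<Longrightarrow> \<sigma>' (\<alpha>' c) = rel_map R' (\<tau>' c) + c"
    "\<And>z. z \<in> cocycles C (n + 1) \<Longrightarrow> z = \<alpha>' (\<sigma>' z) + diff C (n + 1 - 1) (e' z)"
    using uct_choice_maps[OF C R' u'] by blast
  note C' = free_cochain_complexD[OF C] and RD = free_resolutionD[OF R] and RD' = free_resolutionD[OF R']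
    and uD = uct_choiceD[OF u] and uD' = uct_choiceD[OF u']
  have d: "diff C n y \<in> cocycles C (n + 1)" if "Poly_Mapping.keys y \<subseteq> basis C n" for y
    using hom_frag_keys[OF C'(2) that] C'(4)[OF that] by (simp add: cocycles_iff)
  have "split_universal_coefficients G (basis C (n - 1)) (basis C n) (basis C (n + 1))
    (diff C (n - 1)) (diff C n) R R' \<alpha> \<sigma> \<gamma> \<epsilon> \<tau> e \<alpha>' \<sigma>' \<gamma>' \<kappa> \<tau>' e'"
  proof unfold_locales
    show "diff C n (\<alpha> c) = 0" if "Poly_Mapping.keys c \<subseteq> gens R" for c
      using uD(4)[OF that] by (simp add: cocycles_iff)
    show "z = \<alpha> (\<sigma> z) + diff C (n - 1) (e z)" if "Poly_Mapping.keys z \<subseteq> basis C n" "diff C n z = 0" for z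
      using that by (intro 1(6)) (simp add: cocycles_iff)
    show "diff C n y = \<alpha>' (\<sigma>' (diff C n y)) + diff C n (e' (diff C n y))" if "Poly_Mapping.keys y \<subseteq> basis C n" for y
      using 2(6)[OF d[OF that]] by simp
  qed (use G C' RD RD' uD uD' 1 2 in simp_all)
  then show ?thesis by blast
qed

section \<open>Naturality with respect to cochain maps\<close>

definition cochain_hom :: "'a free_complex \<Rightarrow> 'b free_complex \<Rightarrow> (int \<Rightarrow> ('a \<Rightarrow>\<^sub>0 int) \<Rightarrow> ('b \<Rightarrow>\<^sub>0 int)) \<Rightarrow> bool" where
  "cochain_hom D C \<Phi> \<longleftrightarrow> (\<forall>n. \<Phi> n \<in> hom (free_Abelian_group (basis D n)) (free_Abelian_group (basis C n)) \<and>
     (\<forall>x. Poly_Mapping.keys x \<subseteq> basis D n \<longrightarrow> diff C n (\<Phi> n x) = \<Phi> (n + 1) (diff D n x)))"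

lemma cochain_homD:
  assumes "cochain_hom D C \<Phi>"
  shows "\<Phi> n \<in> hom (free_Abelian_group (basis D n)) (free_Abelian_group (basis C n))"
    "Poly_Mapping.keys x \<subseteq> basis D n \<Longrightarrow> diff C n (\<Phi> n x) = \<Phi> (n + 1) (diff D n x)"
    "Poly_Mapping.keys x \<subseteq> basis D (n - 1) \<Longrightarrow> diff C (n - 1) (\<Phi> (n - 1) x) = \<Phi> n (diff D (n - 1) x)"
proof -
  have 1: "Poly_Mapping.keys x \<subseteq> basis D n \<Longrightarrow> diff C n (\<Phi> n x) = \<Phi> (n + 1) (diff D n x)" for n x
    using assms by (simp add: cochain_hom_def)
  show "Poly_Mapping.keys x \<subseteq> basis D n \<Longrightarrow> diff C n (\<Phi> n x) = \<Phi> (n + 1) (diff D n x)" by (rule 1)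
  show "Poly_Mapping.keys x \<subseteq> basis D (n - 1) \<Longrightarrow> diff C (n - 1) (\<Phi> (n - 1) x) = \<Phi> n (diff D (n - 1) x)"
    using 1[of x "n - 1"] by simp
qed (use assms in \<open>simp add: cochain_hom_def\<close>)

lemma cochain_hom_cocycles:
  assumes "cochain_hom D C \<Phi>" "z \<in> cocycles D n"
  shows "\<Phi> n z \<in> cocycles C n"
  using assms(2) cochain_homD(2)[OF assms(1), of z n] hom_frag_keys[OF cochain_homD(1)[OF assms(1)], of z n]
    hom_frag_zero[OF cochain_homD(1)[OF assms(1), of "n + 1"]]
  by (simp add: cocycles_iff)

lemma cohomology_map_class:
  assumes C: "free_cochain_complex C" and D: "free_cochain_complex D" and \<Phi>: "cochain_hom D C \<Phi>"
    and z: "z \<in> cocycles D n"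
  shows "cohomology_map C n (\<Phi> n) (coh_class D n z) = coh_class C n (\<Phi> n z)"
proof -
  note \<Phi>D = cochain_homD[OF \<Phi>]
  have "coh_class C n (\<Phi> n w) = coh_class C n (\<Phi> n z)" if w: "w \<in> coh_class D n z" for w
  proof -
    obtain y where y: "Poly_Mapping.keys y \<subseteq> basis D (n - 1)" "w - z = diff D (n - 1) y"
      using w unfolding mem_coh_class coboundaries_iff by blast
    have zk: "Poly_Mapping.keys z \<subseteq> basis D n" using z by (simp add: cocycles_iff)
    have yk: "Poly_Mapping.keys (diff D (n - 1) y) \<subseteq> basis D n"
      using hom_frag_keys[OF free_cochain_complexD(3)[OF D] y(1)] .
    have "w = diff D (n - 1) y + z" using y(2) by (simp add: algebra_simps)
    then have "\<Phi> n w - \<Phi> n z = \<Phi> n (diff D (n - 1) y)"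
      using hom_frag_add[OF \<Phi>D(1) yk zk] by simp
    also have "\<dots> = diff C (n - 1) (\<Phi> (n - 1) y)" using \<Phi>D(3)[OF y(1)] by simp
    finally have "\<Phi> n w - \<Phi> n z \<in> coboundaries C n"
      using diff_mem_coboundaries[OF hom_frag_keys[OF \<Phi>D(1) y(1)]] by simp
    then show ?thesis by (simp only: coh_class_eq_iff[OF C])
  qed
  moreover have "z \<in> coh_class D n z" using coboundaries_zero[OF D] by (simp add: mem_coh_class)
  ultimately show ?thesis unfolding cohomology_map_def quot_map_def by blast
qed

lemma homology_pc_eq:
  "homology_pc C G n =
   coker_pc (hom_free (basis C (n + 1)) G)
     (kernel_pc (hom_free (basis C n) G) (hom_free (basis C (n - 1)) G) (dual_map G (basis C (n - 1)) (diff C (n - 1))))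
     (dual_map G (basis C n) (diff C n))"
  by (simp add: homology_pc_def chain_group_pc_def boundary_pc_def)

text \<open>For a continuous map from X to Y, the complexes C and D are the cochains of X and of Y,
  hence the direction of \<Phi>. Of the comparison matrices the Greek ones belong to C and the Latin
  ones to D, while u, v and u', v' lift the maps in cohomology to the given resolutions.\<close>

locale uct_naturality =
  fixes G :: "'g cover_group" and C :: "'b free_complex" and D :: "'a free_complex"
    and \<Phi> :: "int \<Rightarrow> ('a \<Rightarrow>\<^sub>0 int) \<Rightarrow> ('b \<Rightarrow>\<^sub>0 int)" and n :: int
    and R :: "('i, 'j, ('b \<Rightarrow>\<^sub>0 int) set) resolution" and R' :: "('i, 'j, ('b \<Rightarrow>\<^sub>0 int) set) resolution"
    and S :: "('k, 'l, ('a \<Rightarrow>\<^sub>0 int) set) resolution" and S' :: "('k, 'l, ('a \<Rightarrow>\<^sub>0 int) set) resolution"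
    and \<alpha> \<sigma> \<epsilon> \<alpha>' \<sigma>' \<kappa> a s k a' s' k' u v u' v'
  assumes G: "polish_cover_group G" and C: "free_cochain_complex C" and D: "free_cochain_complex D"
    and \<Phi>: "cochain_hom D C \<Phi>"
    and R: "free_resolution (cohomology C n) R" and R': "free_resolution (cohomology C (n + 1)) R'"
    and S: "free_resolution (cohomology D n) S" and S': "free_resolution (cohomology D (n + 1)) S'"
    and CR: "uct_choice C n R \<alpha> \<sigma> \<epsilon>" and CR': "uct_choice C (n + 1) R' \<alpha>' \<sigma>' \<kappa>"
    and DS: "uct_choice D n S a s k" and DS': "uct_choice D (n + 1) S' a' s' k'"
    and lift: "resolution_lift S R (cohomology_map C n (\<Phi> n)) u v"
    and lift': "resolution_lift S' R' (cohomology_map C (n + 1) (\<Phi> (n + 1))) u' v'"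
begin

lemmas CD = free_cochain_complexD[OF C] and DD = free_cochain_complexD[OF D]
  and RD = free_resolutionD[OF R] and RD' = free_resolutionD[OF R']
  and SD = free_resolutionD[OF S] and SD' = free_resolutionD[OF S']
  and CRD = uct_choiceD[OF CR] and CRD' = uct_choiceD[OF CR'] and DSD = uct_choiceD[OF DS] and DSD' = uct_choiceD[OF DS']
  and \<Phi>D = cochain_homD[OF \<Phi>]

lemma liftD:
  "u \<in> hom (free_Abelian_group (gens S)) (free_Abelian_group (gens R))"
  "v \<in> hom (free_Abelian_group (rels S)) (free_Abelian_group (rels R))"
  "Poly_Mapping.keys x \<subseteq> gens S \<Longrightarrow> augm R (u x) = cohomology_map C n (\<Phi> n) (augm S x)"
  "Poly_Mapping.keys y \<subseteq> rels S \<Longrightarrow> rel_map R (v y) = u (rel_map S y)"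
  "u' \<in> hom (free_Abelian_group (gens S')) (free_Abelian_group (gens R'))"
  "v' \<in> hom (free_Abelian_group (rels S')) (free_Abelian_group (rels R'))"
  "Poly_Mapping.keys x \<subseteq> gens S' \<Longrightarrow> augm R' (u' x) = cohomology_map C (n + 1) (\<Phi> (n + 1)) (augm S' x)"
  "Poly_Mapping.keys y \<subseteq> rels S' \<Longrightarrow> rel_map R' (v' y) = u' (rel_map S' y)"
  using lift lift' by (simp_all add: resolution_lift_def)

lemma \<kappa>_hom: "\<kappa> \<in> hom (free_Abelian_group (basis C n)) (free_Abelian_group (rels R'))"
  and k'_hom: "k' \<in> hom (free_Abelian_group (basis D n)) (free_Abelian_group (rels S'))"
  using CRD'(3) DSD'(3) by simp_all

text \<open>On each generator \<Phi> a and \<alpha> u represent the same class, so they differ by a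
  coboundary. Cycles send coboundaries into the subgroup, which makes the square with Hom
  commute.\<close>

lemma ex_\<omega>: "\<exists>\<omega> \<in> hom (free_Abelian_group (gens S)) (free_Abelian_group (basis C (n - 1))).
    \<forall>c. Poly_Mapping.keys c \<subseteq> gens S \<longrightarrow> diff C (n - 1) (\<omega> c) = \<Phi> n (a c) - \<alpha> (u c)"
proof (rule hom_frag_factor[OF CD(3) hom_frag_diff_fun[OF hom_frag_comp[OF \<Phi>D(1) DSD(1)] hom_frag_comp[OF CRD(1) liftD(1)]]])
  fix g assume "g \<in> gens S"
  then have g: "Poly_Mapping.keys (frag_of g) \<subseteq> gens S" by simp
  have "coh_class C n (\<Phi> n (a (frag_of g))) = cohomology_map C n (\<Phi> n) (augm S (frag_of g))"
    using cohomology_map_class[OF C D \<Phi> DSD(4)[OF g]] DSD(5)[OF g] by simp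
  also have "\<dots> = coh_class C n (\<alpha> (u (frag_of g)))"
    using CRD(5)[OF hom_frag_keys[OF liftD(1) g]] liftD(3)[OF g] by simp
  finally have "\<Phi> n (a (frag_of g)) - \<alpha> (u (frag_of g)) \<in> coboundaries C n" by (simp only: coh_class_eq_iff[OF C])
  then show "\<Phi> n (a (frag_of g)) - \<alpha> (u (frag_of g)) \<in> diff C (n - 1) ` carrier (free_Abelian_group (basis C (n - 1)))"
    by (simp only: coboundaries_def)
qed

text \<open>On cocycles \<sigma>' \<Phi> and u' s' have the same class and differ by relations; the
  retraction \<open>pr\<close> extends \<omega> from there to all cochains. At coboundaries the
  injective \<open>rel_map R'\<close> can be cancelled, so \<kappa> \<Phi> and v' k' differ by a map
  that factors through the differential, dually by a boundary.\<close>

lemma ex_\<omega>': "\<exists>\<omega> \<in> hom (free_Abelian_group (basis D (n + 1))) (free_Abelian_group (rels R')).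
    \<forall>y. Poly_Mapping.keys y \<subseteq> basis D n \<longrightarrow> \<kappa> (\<Phi> n y) = \<omega> (diff D n y) + v' (k' y)"
proof -
  obtain pr where pr: "pr \<in> hom (free_Abelian_group (basis D (n + 1))) (free_Abelian_group (basis D (n + 1)))"
    "\<And>x. Poly_Mapping.keys x \<subseteq> basis D (n + 1) \<Longrightarrow> pr x \<in> cocycles D (n + 1)" "\<And>z. z \<in> cocycles D (n + 1) \<Longrightarrow> pr z = z"
    using ex_cocycle_retraction[OF D, of "n + 1"] by blast
  interpret aug: group_hom "free_Abelian_group (gens R')" "cohomology C (n + 1)" "augm R'"
    using RD'(4) cohomology_group(1)[OF C] by (simp add: group_hom_def group_hom_axioms_def)
  have "\<exists>\<omega> \<in> hom (free_Abelian_group (basis D (n + 1))) (free_Abelian_group (rels R')).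
      \<forall>z. Poly_Mapping.keys z \<subseteq> basis D (n + 1) \<longrightarrow> rel_map R' (\<omega> z) = \<sigma>' (\<Phi> (n + 1) (pr z)) - u' (s' (pr z))"
  proof (rule hom_frag_factor[OF RD'(3) hom_frag_diff_fun[OF
          hom_frag_comp[OF CRD'(2) hom_frag_comp[OF \<Phi>D(1) pr(1)]] hom_frag_comp[OF liftD(5) hom_frag_comp[OF DSD'(2) pr(1)]]]])
    fix b assume "b \<in> basis D (n + 1)"
    then have b: "Poly_Mapping.keys (frag_of b) \<subseteq> basis D (n + 1)" by simp
    let ?z = "pr (frag_of b)"
    have z: "?z \<in> cocycles D (n + 1)" and zk: "Poly_Mapping.keys ?z \<subseteq> basis D (n + 1)"
      using pr(2)[OF b] by (simp_all add: cocycles_iff)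
    let ?x = "\<sigma>' (\<Phi> (n + 1) ?z)" and ?y = "u' (s' ?z)"
    have xk: "Poly_Mapping.keys ?x \<subseteq> gens R'" by (intro hom_frag_keys[OF CRD'(2)] hom_frag_keys[OF \<Phi>D(1)] zk)
    have sk: "Poly_Mapping.keys (s' ?z) \<subseteq> gens S'" by (intro hom_frag_keys[OF DSD'(2)] zk)
    have yk: "Poly_Mapping.keys ?y \<subseteq> gens R'" by (intro hom_frag_keys[OF liftD(5)] sk)
    have "augm R' ?x = coh_class C (n + 1) (\<Phi> (n + 1) ?z)"
      by (intro CRD'(6) cochain_hom_cocycles[OF \<Phi>] z)
    also have "\<dots> = cohomology_map C (n + 1) (\<Phi> (n + 1)) (coh_class D (n + 1) ?z)"
      using cohomology_map_class[OF C D \<Phi> z] by simp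
    also have "\<dots> = augm R' ?y" using liftD(7)[OF sk] DSD'(6)[OF z] by simp
    finally have eq: "augm R' ?x = augm R' ?y" .
    show "?x - ?y \<in> rel_map R' ` carrier (free_Abelian_group (rels R'))"
    proof (rule RD'(6))
      show "Poly_Mapping.keys (?x - ?y) \<subseteq> gens R'" using keys_diff[of ?x ?y] xk yk by blast
      show "augm R' (?x - ?y) = \<one>\<^bsub>cohomology C (n + 1)\<^esub>"
        using aug.hom_mult[of ?x "- ?y"] aug.hom_inv[of ?y] xk yk eq aug.hom_closed[of ?y] by simp
    qed
  qed
  then obtain \<omega> where \<omega>: "\<omega> \<in> hom (free_Abelian_group (basis D (n + 1))) (free_Abelian_group (rels R'))"
    "\<And>z. Poly_Mapping.keys z \<subseteq> basis D (n + 1) \<Longrightarrow> rel_map R' (\<omega> z) = \<sigma>' (\<Phi> (n + 1) (pr z)) - u' (s' (pr z))"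
    by blast
  have "\<kappa> (\<Phi> n y) = \<omega> (diff D n y) + v' (k' y)" if y: "Poly_Mapping.keys y \<subseteq> basis D n" for y
  proof -
    have dyk: "Poly_Mapping.keys (diff D n y) \<subseteq> basis D (n + 1)" by (rule hom_frag_keys[OF DD(2) y])
    have dy: "diff D n y \<in> cocycles D (n + 1)" using dyk DD(4)[OF y] by (simp add: cocycles_iff)
    have ky: "Poly_Mapping.keys (k' y) \<subseteq> rels S'" by (rule hom_frag_keys[OF k'_hom y])
    have keys: "Poly_Mapping.keys (\<omega> (diff D n y)) \<subseteq> rels R'" "Poly_Mapping.keys (v' (k' y)) \<subseteq> rels R'"
      "Poly_Mapping.keys (\<Phi> n y) \<subseteq> basis C n"
      by (rule hom_frag_keys[OF \<omega>(1) dyk], rule hom_frag_keys[OF liftD(6) ky], rule hom_frag_keys[OF \<Phi>D(1) y])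
    have "rel_map R' (\<kappa> (\<Phi> n y)) = \<sigma>' (\<Phi> (n + 1) (diff D n y))"
      using CRD'(7)[of "\<Phi> n y"] keys(3) \<Phi>D(2)[OF y] by simp
    moreover have "rel_map R' (v' (k' y)) = u' (s' (diff D n y))"
      using liftD(8)[OF ky] DSD'(7)[of y] y by simp
    moreover have "rel_map R' (\<omega> (diff D n y)) = \<sigma>' (\<Phi> (n + 1) (diff D n y)) - u' (s' (diff D n y))"
      using \<omega>(2)[OF dyk] pr(3)[OF dy] by simp
    ultimately have "rel_map R' (\<kappa> (\<Phi> n y)) = rel_map R' (\<omega> (diff D n y) + v' (k' y))"
      using hom_frag_add[OF RD'(3) keys(1,2)] by simp
    moreover have "Poly_Mapping.keys (\<omega> (diff D n y) + v' (k' y)) \<subseteq> rels R'"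
      using keys_add[of "\<omega> (diff D n y)" "v' (k' y)"] keys by blast
    ultimately show ?thesis
      using RD'(5) hom_frag_keys[OF \<kappa>_hom keys(3)] by (auto simp: inj_on_def)
  qed
  with \<omega>(1) show ?thesis by blast
qed

abbreviation HC where "HC \<equiv> homology_pc C G n"
abbreviation HD where "HD \<equiv> homology_pc D G n"

theorem naturality:
  shows "c \<in> carrier (quot (Ext_pc R' G)) \<Longrightarrow>
      pc_map HD (dual_map G (basis D n) (\<Phi> n)) (pc_map HC (dual_map G (basis C n) \<kappa>) c) =
      pc_map HD (dual_map G (basis D n) k') (pc_map (Ext_pc S' G) (dual_map G (rels S') v') c)" (is "_ \<Longrightarrow> ?I")
    and "c' \<in> carrier (quot HC) \<Longrightarrow>
      pc_map (Hom_pc S G) (dual_map G (gens S) a) (pc_map HD (dual_map G (basis D n) (\<Phi> n)) c') =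
      pc_map (Hom_pc S G) (dual_map G (gens S) u) (pc_map (Hom_pc R G) (dual_map G (gens R) \<alpha>) c')" (is "_ \<Longrightarrow> ?P")
proof -
  \<comment> \<open>The auxiliary maps obtained here are arbitrary. The two interpretations are
    wanted for the Polish covers and for the facts about \<kappa>, k', \<alpha> and a.\<close>
  obtain \<gamma> \<tau> e \<gamma>' \<tau>' e' where "split_universal_coefficients G (basis C (n - 1)) (basis C n) (basis C (n + 1))
    (diff C (n - 1)) (diff C n) R R' \<alpha> \<sigma> \<gamma> \<epsilon> \<tau> e \<alpha>' \<sigma>' \<gamma>' \<kappa> \<tau>' e'"
    using uct_choice_split[OF G C R R' CR CR'] by blast
  then interpret X: split_universal_coefficients G "basis C (n - 1)" "basis C n" "basis C (n + 1)"
    "diff C (n - 1)" "diff C n" R R' \<alpha> \<sigma> \<gamma> \<epsilon> \<tau> e \<alpha>' \<sigma>' \<gamma>' \<kappa> \<tau>' e' .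
  obtain g t b g' t' b' where "split_universal_coefficients G (basis D (n - 1)) (basis D n) (basis D (n + 1))
    (diff D (n - 1)) (diff D n) S S' a s g k t b a' s' g' k' t' b'"
    using uct_choice_split[OF G D S S' DS DS'] by blast
  then interpret Y: split_universal_coefficients G "basis D (n - 1)" "basis D n" "basis D (n + 1)"
    "diff D (n - 1)" "diff D n" S S' a s g k t b a' s' g' k' t' b' .
  have HC: "HC = X.Hlg" and HD: "HD = Y.Hlg" by (rule homology_pc_eq)+
  let ?\<Phi> = "dual_map G (basis D n) (\<Phi> n)"
  have \<Phi>1: "?\<Phi> \<in> hom (cover X.Hlg) (cover Y.Hlg)"
  proof (rule homI)
    fix x assume x: "x \<in> carrier (cover X.Hlg)"
    have x': "x \<in> carrier (cover (hom_free (basis C n) G))" using x by (simp only: X.Hlg_carrier)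
    have "dual_map G (basis D (n - 1)) (diff D (n - 1)) (?\<Phi> x) =
        dual_map G (basis D (n - 1)) (\<Phi> (n - 1)) (dual_map G (basis C (n - 1)) (diff C (n - 1)) x)"
      by (intro X.dual_square[OF \<Phi>D(1) DD(3) CD(3) \<Phi>D(1)] \<Phi>D(3)[symmetric] x') simp
    also have "\<dots> \<in> sub_set (hom_free (basis D (n - 1)) G)"
      using x by (intro dual_map_sub[OF G \<Phi>D(1)]) (simp only: X.Hlg_carrier)
    finally show "?\<Phi> x \<in> carrier (cover Y.Hlg)"
      using X.dual_hom[OF \<Phi>D(1) x'] by (simp only: Y.Hlg_carrier)
    fix y assume "y \<in> carrier (cover X.Hlg)"
    then have y': "y \<in> carrier (cover (hom_free (basis C n) G))" by (simp only: X.Hlg_carrier)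
    show "?\<Phi> (x \<otimes>\<^bsub>cover X.Hlg\<^esub> y) = ?\<Phi> x \<otimes>\<^bsub>cover Y.Hlg\<^esub> ?\<Phi> y"
      unfolding X.Hlg_mult Y.Hlg_mult by (rule X.dual_mult[OF \<Phi>D(1) x' y'])
  qed
  have \<Phi>2: "?\<Phi> ` sub_set X.Hlg \<subseteq> sub_set Y.Hlg"
  proof
    fix w assume "w \<in> ?\<Phi> ` sub_set X.Hlg"
    then obtain y z where y: "y \<in> carrier (cover (hom_free (basis C (n + 1)) G))" and z: "z \<in> sub_set (hom_free (basis C n) G)"
      and w: "w = ?\<Phi> (dual_map G (basis C n) (diff C n) y \<otimes>\<^bsub>cover (hom_free (basis C n) G)\<^esub> z)"
      unfolding image_iff Bex_def X.Hlg_sub by blast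
    have "w = ?\<Phi> (dual_map G (basis C n) (diff C n) y) \<otimes>\<^bsub>cover (hom_free (basis D n) G)\<^esub> ?\<Phi> z"
      unfolding w by (intro X.dual_mult[OF \<Phi>D(1)] X.dual_hom[OF CD(2)] X.sub_carrier y z)
    also have "?\<Phi> (dual_map G (basis C n) (diff C n) y) =
        dual_map G (basis D n) (diff D n) (dual_map G (basis D (n + 1)) (\<Phi> (n + 1)) y)"
      by (intro X.dual_square[OF CD(2) \<Phi>D(1) \<Phi>D(1) DD(2)] \<Phi>D(2) y) simp
    finally show "w \<in> sub_set Y.Hlg"
      unfolding Y.Hlg_sub using X.dual_hom[OF \<Phi>D(1) y] dual_map_sub[OF G \<Phi>D(1) z] by blast
  qed
  note \<kappa>12 = X.cover_hom_\<kappa>[unfolded cover_hom_def] and k12 = Y.cover_hom_\<kappa>[unfolded cover_hom_def]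
    and \<alpha>12 = X.cover_hom_\<alpha>[unfolded cover_hom_def] and a12 = Y.cover_hom_\<alpha>[unfolded cover_hom_def]
  show ?I if c: "c \<in> carrier (quot (Ext_pc R' G))"
  proof -
    obtain x where xE: "x \<in> carrier (cover (Ext_pc R' G))" and cx: "c = coset_of (Ext_pc R' G) x"
      using c by (auto simp: carrier_quot)
    have x: "x \<in> carrier (cover (hom_free (rels R') G))" using xE by (simp only: X.Ext_carrier)
    have xf: "x \<in> rels R' \<rightarrow> carrier (cover G)" using x by (auto simp: X.hom_free_carrier)
    have v1: "dual_map G (rels S') v' \<in> hom (cover (Ext_pc R' G)) (cover (Ext_pc S' G))"
      using dual_map_hom[OF G liftD(6)] by (auto simp: hom_def X.Ext_carrier X.Ext_mult Y.Ext_carrier Y.Ext_mult)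
    have v2: "dual_map G (rels S') v' ` sub_set (Ext_pc R' G) \<subseteq> sub_set (Ext_pc S' G)"
    proof
      fix w assume "w \<in> dual_map G (rels S') v' ` sub_set (Ext_pc R' G)"
      then obtain y z where y: "y \<in> carrier (cover (hom_free (gens R') G))" and z: "z \<in> sub_set (hom_free (rels R') G)"
        and w: "w = dual_map G (rels S') v' (dual_map G (rels R') (rel_map R') y \<otimes>\<^bsub>cover (hom_free (rels R') G)\<^esub> z)"
        unfolding image_iff Bex_def X.Ext_sub by blast
      have "w = dual_map G (rels S') v' (dual_map G (rels R') (rel_map R') y)
          \<otimes>\<^bsub>cover (hom_free (rels S') G)\<^esub> dual_map G (rels S') v' z"
        unfolding w by (intro X.dual_mult[OF liftD(6)] X.dual_hom[OF RD'(3)] X.sub_carrier y z)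
      also have "dual_map G (rels S') v' (dual_map G (rels R') (rel_map R') y) =
          dual_map G (rels S') (rel_map S') (dual_map G (gens S') u' y)"
        by (intro X.dual_square[OF RD'(3) liftD(6) liftD(5) SD'(3)] liftD(8) y) simp
      finally show "w \<in> sub_set (Ext_pc S' G)"
        unfolding Y.Ext_sub using X.dual_hom[OF liftD(5) y] dual_map_sub[OF G liftD(6) z] by blast
    qed
    obtain \<omega> where \<omega>: "\<omega> \<in> hom (free_Abelian_group (basis D (n + 1))) (free_Abelian_group (rels R'))"
      "\<And>y. Poly_Mapping.keys y \<subseteq> basis D n \<Longrightarrow> \<kappa> (\<Phi> n y) = \<omega> (diff D n y) + v' (k' y)"
      using ex_\<omega>' by blast
    \<comment> \<open>The defect of the first square: the boundary of the chain dual to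
      \<omega>.\<close>
    let ?w = "dual_map G (basis D n) (diff D n) (dual_map G (basis D (n + 1)) \<omega> x)"
    have vx: "dual_map G (rels S') v' x \<in> carrier (cover (Ext_pc S' G))"
      using v1 xE by (auto simp: hom_def)
    have \<kappa>x: "dual_map G (basis C n) \<kappa> x \<in> carrier (cover X.Hlg)"
      using \<kappa>12 xE by (auto simp: hom_def)
    have kvx: "dual_map G (basis D n) k' (dual_map G (rels S') v' x) \<in> carrier (cover Y.Hlg)"
      using k12 vx by (auto simp: hom_def)
    have "coset_of Y.Hlg (?\<Phi> (dual_map G (basis C n) \<kappa> x)) =
        coset_of Y.Hlg (dual_map G (basis D n) k' (dual_map G (rels S') v' x))"
    proof (rule coset_of_eqI[OF Y.polish_Hlg _ kvx])
      have w: "?w \<in> carrier (cover (hom_free (basis D n) G))"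
        by (intro X.dual_hom[OF DD(2)] X.dual_hom[OF \<omega>(1)] x)
      have "?w = ?w \<otimes>\<^bsub>cover (hom_free (basis D n) G)\<^esub> (\<lambda>i\<in>basis D n. \<one>\<^bsub>cover G\<^esub>)"
        using w unfolding X.hom_free_mult by (auto simp: X.hom_free_carrier PiE_iff extensional_def)
      then show "?w \<in> sub_set Y.Hlg"
        unfolding Y.Hlg_sub using X.one_in_sub X.dual_hom[OF \<omega>(1) x] by blast
      show "?\<Phi> (dual_map G (basis C n) \<kappa> x) = ?w \<otimes>\<^bsub>cover Y.Hlg\<^esub> dual_map G (basis D n) k' (dual_map G (rels S') v' x)"
        unfolding Y.Hlg_mult X.hom_free_mult dual_map_comp[OF G \<kappa>_hom \<Phi>D(1) x]
          dual_map_comp[OF G \<omega>(1) DD(2) x] dual_map_comp[OF G liftD(6) k'_hom x]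
      proof (rule restrict_ext)
        fix i assume i: "i \<in> basis D n"
        then have ik: "Poly_Mapping.keys (frag_of i) \<subseteq> basis D n" by simp
        have "X.ev x (\<kappa> (\<Phi> n (frag_of i))) = X.ev x (\<omega> (diff D n (frag_of i)) + v' (k' (frag_of i)))"
          using \<omega>(2)[OF ik] by simp
        also have "\<dots> = X.ev x (\<omega> (diff D n (frag_of i))) \<otimes>\<^bsub>cover G\<^esub> X.ev x (v' (k' (frag_of i)))"
          by (intro X.G.frag_eval_add[OF xf] hom_frag_keys[OF \<omega>(1)] hom_frag_keys[OF DD(2)]
              hom_frag_keys[OF liftD(6)] hom_frag_keys[OF k'_hom] ik)
        finally show "X.ev x (\<kappa> (\<Phi> n (frag_of i))) =
            (\<lambda>k\<in>basis D n. X.ev x (\<omega> (diff D n (frag_of k)))) i \<otimes>\<^bsub>cover G\<^esub>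
            (\<lambda>k\<in>basis D n. X.ev x (v' (k' (frag_of k)))) i"
          using i by simp
      qed
    qed
    then show ?I
      unfolding cx HC HD using \<kappa>12 k12
      by (simp only: pc_map_coset_of[OF X.polish_Ext X.polish_Hlg _ _ xE] pc_map_coset_of[OF X.polish_Hlg Y.polish_Hlg \<Phi>1 \<Phi>2 \<kappa>x]
        pc_map_coset_of[OF X.polish_Ext Y.polish_Ext v1 v2 xE] pc_map_coset_of[OF Y.polish_Ext Y.polish_Hlg _ _ vx])
  qed
  show ?P if c': "c' \<in> carrier (quot HC)"
  proof -
    obtain x where xH: "x \<in> carrier (cover X.Hlg)" and cx: "c' = coset_of X.Hlg x"
      using c' unfolding HC by (auto simp only: carrier_quot)
    have x: "x \<in> carrier (cover (hom_free (basis C n) G))"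
      and dx: "dual_map G (basis C (n - 1)) (diff C (n - 1)) x \<in> sub_set (hom_free (basis C (n - 1)) G)"
      using xH by (simp_all only: X.Hlg_carrier)
    have xf: "x \<in> basis C n \<rightarrow> carrier (cover G)" using x by (auto simp: X.hom_free_carrier)
    have u1: "dual_map G (gens S) u \<in> hom (cover (Hom_pc R G)) (cover (Hom_pc S G))"
    proof (rule homI)
      fix z assume z: "z \<in> carrier (cover (Hom_pc R G))"
      have z': "z \<in> carrier (cover (hom_free (gens R) G))" using z by (simp only: X.Hom_carrier)
      have "dual_map G (rels S) (rel_map S) (dual_map G (gens S) u z) =
          dual_map G (rels S) v (dual_map G (rels R) (rel_map R) z)"
        by (intro X.dual_square[OF liftD(1) SD(3) RD(3) liftD(2)] liftD(4)[symmetric] z') simp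
      also have "\<dots> \<in> sub_set (hom_free (rels S) G)"
        using z by (intro dual_map_sub[OF G liftD(2)]) (simp only: X.Hom_carrier)
      finally show "dual_map G (gens S) u z \<in> carrier (cover (Hom_pc S G))"
        using X.dual_hom[OF liftD(1) z'] by (simp only: Y.Hom_carrier)
      fix y assume "y \<in> carrier (cover (Hom_pc R G))"
      then have y': "y \<in> carrier (cover (hom_free (gens R) G))" by (simp only: X.Hom_carrier)
      show "dual_map G (gens S) u (z \<otimes>\<^bsub>cover (Hom_pc R G)\<^esub> y) =
          dual_map G (gens S) u z \<otimes>\<^bsub>cover (Hom_pc S G)\<^esub> dual_map G (gens S) u y"
        unfolding X.Hom_mult Y.Hom_mult by (rule X.dual_mult[OF liftD(1) z' y'])
    qed
    have u2: "dual_map G (gens S) u ` sub_set (Hom_pc R G) \<subseteq> sub_set (Hom_pc S G)"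
      unfolding X.Hom_sub Y.Hom_sub using dual_map_sub[OF G liftD(1)] by blast
    obtain \<omega> where \<omega>: "\<omega> \<in> hom (free_Abelian_group (gens S)) (free_Abelian_group (basis C (n - 1)))"
      "\<And>c. Poly_Mapping.keys c \<subseteq> gens S \<Longrightarrow> diff C (n - 1) (\<omega> c) = \<Phi> n (a c) - \<alpha> (u c)"
      using ex_\<omega> by blast
    \<comment> \<open>The defect of the second square: \<omega> evaluated on the boundary of a
      cycle, whose values lie in the subgroup.\<close>
    let ?w = "dual_map G (gens S) \<omega> (dual_map G (basis C (n - 1)) (diff C (n - 1)) x)"
    have \<Phi>x: "?\<Phi> x \<in> carrier (cover Y.Hlg)" using \<Phi>1 xH by (auto simp: hom_def)
    have \<alpha>x: "dual_map G (gens R) \<alpha> x \<in> carrier (cover (Hom_pc R G))" using \<alpha>12 xH by (auto simp: hom_def)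
    have u\<alpha>x: "dual_map G (gens S) u (dual_map G (gens R) \<alpha> x) \<in> carrier (cover (Hom_pc S G))"
      using u1 \<alpha>x by (auto simp: hom_def)
    have "coset_of (Hom_pc S G) (dual_map G (gens S) a (?\<Phi> x)) =
        coset_of (Hom_pc S G) (dual_map G (gens S) u (dual_map G (gens R) \<alpha> x))"
    proof (rule coset_of_eqI[OF Y.polish_Hom _ u\<alpha>x])
      show "?w \<in> sub_set (Hom_pc S G)"
        unfolding Y.Hom_sub by (rule dual_map_sub[OF G \<omega>(1) dx])
      show "dual_map G (gens S) a (?\<Phi> x) = ?w \<otimes>\<^bsub>cover (Hom_pc S G)\<^esub> dual_map G (gens S) u (dual_map G (gens R) \<alpha> x)"
        unfolding Y.Hom_mult X.hom_free_mult dual_map_comp[OF G \<Phi>D(1) DSD(1) x]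
          dual_map_comp[OF G CD(3) \<omega>(1) x] dual_map_comp[OF G CRD(1) liftD(1) x]
      proof (rule restrict_ext)
        fix i assume i: "i \<in> gens S"
        then have ik: "Poly_Mapping.keys (frag_of i) \<subseteq> gens S" by simp
        have "X.ev x (\<Phi> n (a (frag_of i))) = X.ev x (diff C (n - 1) (\<omega> (frag_of i)) + \<alpha> (u (frag_of i)))"
          using \<omega>(2)[OF ik] by simp
        also have "\<dots> = X.ev x (diff C (n - 1) (\<omega> (frag_of i))) \<otimes>\<^bsub>cover G\<^esub> X.ev x (\<alpha> (u (frag_of i)))"
          by (intro X.G.frag_eval_add[OF xf] hom_frag_keys[OF CD(3)] hom_frag_keys[OF \<omega>(1)]
              hom_frag_keys[OF CRD(1)] hom_frag_keys[OF liftD(1)] ik)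
        finally show "X.ev x (\<Phi> n (a (frag_of i))) =
            (\<lambda>k\<in>gens S. X.ev x (diff C (n - 1) (\<omega> (frag_of k)))) i \<otimes>\<^bsub>cover G\<^esub>
            (\<lambda>k\<in>gens S. X.ev x (\<alpha> (u (frag_of k)))) i"
          using i by simp
      qed
    qed
    then show ?P
      unfolding cx HC HD using \<alpha>12 a12
      by (simp only: pc_map_coset_of[OF X.polish_Hlg X.polish_Hom _ _ xH] pc_map_coset_of[OF X.polish_Hlg Y.polish_Hlg \<Phi>1 \<Phi>2 xH]
        pc_map_coset_of[OF Y.polish_Hlg Y.polish_Hom _ _ \<Phi>x] pc_map_coset_of[OF X.polish_Hom Y.polish_Hom u1 u2 \<alpha>x])
  qed
qed

end

section \<open>Simplicial cochains and the prism operator\<close>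

definition face :: "nat \<Rightarrow> 'v list \<Rightarrow> 'v list" where
  "face i s = take i s @ drop (Suc i) s"

lemma length_face: "i < length s \<Longrightarrow> length (face i s) = length s - 1"
  by (simp add: face_def)

lemma nth_face: "i < length s \<Longrightarrow> k < length s - 1 \<Longrightarrow> face i s ! k = s ! (if k < i then k else Suc k)"
  by (auto simp: face_def nth_append min_def)

lemma set_face: "set (face i s) \<subseteq> set s"
  by (auto simp: face_def dest: in_set_takeD in_set_dropD)

lemma map_face: "map r (face i s) = face i (map r s)"
  by (simp add: face_def take_map drop_map)

lemma face_face:
  assumes "i \<le> j" "Suc j < length s"
  shows "face j (face i s) = face i (face (Suc j) s)"
  using assms by (intro nth_equalityI) (auto simp: nth_face length_face)

text \<open>The j-th simplex in the standard triangulation of the prism over s: vertex j occurs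
  twice, under a at the bottom and under b at the top.\<close>

definition prism :: "('v \<Rightarrow> 'w) \<Rightarrow> ('v \<Rightarrow> 'w) \<Rightarrow> nat \<Rightarrow> 'v list \<Rightarrow> 'w list" where
  "prism a b j s = map a (take (Suc j) s) @ map b (drop j s)"

lemma length_prism: "j < length s \<Longrightarrow> length (prism a b j s) = Suc (length s)"
  by (simp add: prism_def)

lemma nth_prism: "j < length s \<Longrightarrow> k < Suc (length s) \<Longrightarrow>
   prism a b j s ! k = (if k \<le> j then a (s ! k) else b (s ! (k - 1)))"
  by (cases "k = Suc j") (auto simp: prism_def nth_append min_def)

lemma set_prism: "set (prism a b j s) \<subseteq> a ` set s \<union> b ` set s"
  by (auto simp: prism_def dest: in_set_takeD in_set_dropD)

lemma face_prism_less:
  assumes "i < j" "j < length s"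
  shows "face i (prism a b j s) = prism a b (j - 1) (face i s)"
  using assms by (intro nth_equalityI) (auto simp: nth_face length_face nth_prism length_prism)

lemma face_prism_greater:
  assumes "Suc j < i" "i \<le> length s"
  shows "face i (prism a b j s) = prism a b j (face (i - 1) s)"
  using assms by (intro nth_equalityI) (auto simp: nth_face length_face nth_prism length_prism)

text \<open>The inner walls of the triangulated prism: face j + 1 of simplex j is also face j + 1 of
  simplex j + 1.\<close>

lemma face_prism_eq: "j < length s \<Longrightarrow> face j (prism a b j s) = map a (take j s) @ map b (drop j s)"
  and face_prism_Suc: "j < length s \<Longrightarrow> face (Suc j) (prism a b j s) = map a (take (Suc j) s) @ map b (drop (Suc j) s)"
  by (auto intro!: nth_equalityI simp: nth_face length_face nth_prism length_prism nth_append min_def)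

text \<open>By \<open>face_face\<close> the terms cancel in pairs: (i, j) with i \<le> j against (j
  + 1, i), which has the opposite sign.\<close>

lemma sum_face_face:
  fixes f :: "'v list \<Rightarrow> int"
  shows "(\<Sum>i<length s. (-1) ^ i * (\<Sum>j<length s - 1. (-1) ^ j * f (face j (face i s)))) = 0"
proof -
  let ?m = "length s"
  let ?t = "\<lambda>(i, j). (-1) ^ i * ((-1) ^ j * f (face j (face i s)))"
  let ?A = "{(i, j). i < ?m \<and> j < ?m - 1 \<and> j < i}" and ?B = "{(i, j). i < ?m \<and> j < ?m - 1 \<and> i \<le> j}"
  have fin: "finite ?A" "finite ?B"
    by (rule finite_subset[of _ "{..<?m} \<times> {..<?m}"], auto)+
  have "(\<Sum>i<?m. (-1) ^ i * (\<Sum>j<?m - 1. (-1) ^ j * f (face j (face i s)))) = sum ?t ({..<?m} \<times> {..<?m - 1})"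
    by (simp add: sum_distrib_left sum.cartesian_product)
  also have "{..<?m} \<times> {..<?m - 1} = ?A \<union> ?B" by auto
  also have "sum ?t (?A \<union> ?B) = sum ?t ?A + sum ?t ?B"
    by (rule sum.union_disjoint[OF fin]) auto
  also have "sum ?t ?B = sum (\<lambda>p. - ?t p) ?A"
    by (rule sum.reindex_bij_witness[of _ "\<lambda>(i, j). (j, i - 1)" "\<lambda>(i, j). (Suc j, i)"])
       (auto simp: face_face)
  finally show ?thesis by (simp add: sum_negf)
qed

lemma minus_one_power_pred: "0 < n \<Longrightarrow> (- 1 :: int) ^ (n - Suc 0) = - ((- 1) ^ n)"
  by (cases n) auto

text \<open>The faces i < j and i > j + 1 of simplex j are prisms over faces of s and cancel the
  first sum. The faces j and j + 1 are shared by neighbours, so that they telescope to the two ends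
  of the prism: s under b, and s under a.\<close>

lemma sum_prism:
  fixes f :: "'w list \<Rightarrow> int"
  shows "(\<Sum>i<length s. (-1) ^ i * (\<Sum>j<length s - 1. (-1) ^ j * f (prism a b j (face i s)))) +
     (\<Sum>j<length s. (-1) ^ j * (\<Sum>i<Suc (length s). (-1) ^ i * f (face i (prism a b j s)))) =
     f (map b s) - f (map a s)"
proof -
  let ?m = "length s"
  let ?u = "\<lambda>(i, j). (-1) ^ i * ((-1) ^ j * f (prism a b j (face i s)))"
  let ?v = "\<lambda>(j, i). (-1) ^ j * ((-1) ^ i * f (face i (prism a b j s)))"
  define Q where "Q j = f (map a (take j s) @ map b (drop j s))" for j
  let ?A = "{(i, j). i < ?m \<and> j < ?m - 1 \<and> j < i}" and ?B = "{(i, j). i < ?m \<and> j < ?m - 1 \<and> i \<le> j}"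
  let ?L = "{(j, i). j < ?m \<and> i < j}" and ?R = "{(j, i). j < ?m \<and> Suc j < i \<and> i \<le> ?m}"
  let ?D = "(\<lambda>j. (j, j)) ` {..<?m}" and ?E = "(\<lambda>j. (j, Suc j)) ` {..<?m}"
  have fin: "finite ?A" "finite ?B" "finite ?L" "finite ?R" "finite ?D" "finite ?E"
    by (rule finite_subset[of _ "{..<Suc ?m} \<times> {..<Suc ?m}"], auto)+
  have "(\<Sum>i<?m. (-1) ^ i * (\<Sum>j<?m - 1. (-1) ^ j * f (prism a b j (face i s)))) = sum ?u ({..<?m} \<times> {..<?m - 1})"
    by (simp add: sum_distrib_left sum.cartesian_product)
  also have "{..<?m} \<times> {..<?m - 1} = ?A \<union> ?B" by auto
  also have "sum ?u (?A \<union> ?B) = sum ?u ?A + sum ?u ?B"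
    by (rule sum.union_disjoint[OF fin(1,2)]) auto
  finally have 1: "(\<Sum>i<?m. (-1) ^ i * (\<Sum>j<?m - 1. (-1) ^ j * f (prism a b j (face i s)))) = sum ?u ?A + sum ?u ?B" .
  have "(\<Sum>j<?m. (-1) ^ j * (\<Sum>i<Suc ?m. (-1) ^ i * f (face i (prism a b j s)))) = sum ?v ({..<?m} \<times> {..<Suc ?m})"
    by (simp add: sum_distrib_left sum.cartesian_product del: sum.lessThan_Suc)
  also have "{..<?m} \<times> {..<Suc ?m} = (?L \<union> ?R) \<union> (?D \<union> ?E)"
  proof (rule Set.set_eqI)
    fix p :: "nat \<times> nat"
    show "p \<in> {..<?m} \<times> {..<Suc ?m} \<longleftrightarrow> p \<in> (?L \<union> ?R) \<union> (?D \<union> ?E)"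
      by (cases p) (auto simp: image_iff)
  qed
  also have "sum ?v ((?L \<union> ?R) \<union> (?D \<union> ?E)) = sum ?v (?L \<union> ?R) + sum ?v (?D \<union> ?E)"
    by (rule sum.union_disjoint, (simp only: finite_Un fin simp_thms)+) auto
  also have "sum ?v (?L \<union> ?R) = sum ?v ?L + sum ?v ?R"
    by (rule sum.union_disjoint, (simp only: finite_Un fin simp_thms)+) auto
  also have "sum ?v (?D \<union> ?E) = sum ?v ?D + sum ?v ?E"
    by (rule sum.union_disjoint, (simp only: finite_Un fin simp_thms)+) auto
  also have "sum ?v ?D = (\<Sum>j<?m. Q j)"
    by (subst sum.reindex) (auto simp: inj_on_def Q_def face_prism_eq simp flip: mult.assoc power_add intro!: sum.cong)
  also have "sum ?v ?E = (\<Sum>j<?m. - Q (Suc j))"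
    by (subst sum.reindex) (auto simp: inj_on_def Q_def face_prism_Suc simp flip: mult.assoc power_add intro!: sum.cong)
  also have "sum ?v ?L = sum (\<lambda>p. - ?u p) ?B"
    by (rule sum.reindex_bij_witness[of _ "\<lambda>(i, j). (Suc j, i)" "\<lambda>(j, i). (i, j - 1)"])
       (auto simp: face_prism_less minus_one_power_pred)
  also have "sum ?v ?R = sum (\<lambda>p. - ?u p) ?A"
    by (rule sum.reindex_bij_witness[of _ "\<lambda>(i, j). (j, Suc i)" "\<lambda>(j, i). (i - 1, j)"])
       (auto simp: face_prism_greater minus_one_power_pred)
  finally have 2: "(\<Sum>j<?m. (-1) ^ j * (\<Sum>i<Suc ?m. (-1) ^ i * f (face i (prism a b j s)))) =
      sum (\<lambda>p. - ?u p) ?B + sum (\<lambda>p. - ?u p) ?A + ((\<Sum>j<?m. Q j) + (\<Sum>j<?m. - Q (Suc j)))" .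
  have "(\<Sum>j<?m. Q j) + (\<Sum>j<?m. - Q (Suc j)) = (\<Sum>j<?m. Q j - Q (Suc j))"
    by (simp add: sum.distrib sum_subtractf sum_negf)
  also have "\<dots> = Q 0 - Q ?m" by (rule sum_lessThan_telescope')
  finally have "(\<Sum>j<?m. Q j) + (\<Sum>j<?m. - Q (Suc j)) = f (map b s) - f (map a s)" by (simp add: Q_def)
  with 1 2 show ?thesis by (simp add: sum_negf)
qed

section \<open>Cochains of finite simplicial complexes\<close>

definition finite_complex :: "'v set set \<Rightarrow> bool" where
  "finite_complex K \<longleftrightarrow> finite (\<Union>K) \<and> {} \<notin> K \<and> (\<forall>\<sigma> \<in> K. \<forall>\<tau>. \<tau> \<subseteq> \<sigma> \<longrightarrow> \<tau> \<noteq> {} \<longrightarrow> \<tau> \<in> K)"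

lemma finite_ordered_simplices:
  assumes "finite_complex K"
  shows "finite (ordered_simplices K n)"
proof -
  have "ordered_simplices K n \<subseteq> {s. set s \<subseteq> \<Union>K \<and> length s = nat (n + 1)}"
    by (auto simp: ordered_simplices_def)
  then show ?thesis
    using finite_lists_length_eq[of "\<Union>K" "nat (n + 1)"] assms by (auto simp: finite_complex_def intro: finite_subset)
qed

lemma lookup_cochain_of:
  assumes K: "finite_complex K"
  shows "Poly_Mapping.lookup (cochain_of K n val) s = (if s \<in> ordered_simplices K n then val s else 0)"
proof -
  have "Poly_Mapping.lookup (cochain_of K n val) s = (\<Sum>t \<in> ordered_simplices K n. if t = s then val t else 0)"
    unfolding cochain_of_def lookup_sum by (intro sum.cong) (auto simp: lookup_single when_def)
  then show ?thesis using finite_ordered_simplices[OF K, of n] by simp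
qed

lemma keys_cochain_of:
  assumes "finite_complex K"
  shows "Poly_Mapping.keys (cochain_of K n val) \<subseteq> ordered_simplices K n"
  by (auto simp: in_keys_iff lookup_cochain_of[OF assms] split: if_splits)

lemma cochain_of_add: "cochain_of K n (\<lambda>s. u s + v s) = cochain_of K n u + cochain_of K n v"
  by (simp add: cochain_of_def frag_cmul_distrib sum.distrib)

text \<open>The face of a vertex is the empty list. It is not a simplex because {} is excluded from
  K, so there is nothing in degree -1 and the complex is not augmented.\<close>

lemma lookup_Nil:
  assumes "finite_complex K" "Poly_Mapping.keys f \<subseteq> ordered_simplices K n"
  shows "Poly_Mapping.lookup f [] = 0"
  using assms by (auto simp: finite_complex_def ordered_simplices_def in_keys_iff)

lemma face_ordered_simplices:
  assumes K: "finite_complex K" and s: "s \<in> ordered_simplices K (n + 1)" "i < length s" "face i s \<noteq> []"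
  shows "face i s \<in> ordered_simplices K n"
proof -
  have "set (face i s) \<in> K"
    using K s set_face[of i s] unfolding finite_complex_def ordered_simplices_def by (metis (mono_tags, lifting) mem_Collect_eq set_empty)
  then show ?thesis using s length_face[OF s(2)] by (simp add: ordered_simplices_def)
qed

text \<open>The condition on \<open>[]\<close> takes care of faces of vertices. For the differential
  and the prism operator it holds as the value is an empty sum, for pullbacks by
  \<open>lookup_Nil\<close>.\<close>

lemma lookup_cochain_of_face:
  assumes K: "finite_complex K" and s: "s \<in> ordered_simplices K (n + 1)" "i < length s" and val: "val [] = 0"
  shows "Poly_Mapping.lookup (cochain_of K n val) (face i s) = val (face i s)"
  using face_ordered_simplices[OF K s] lookup_Nil[OF K keys_cochain_of[OF K], of n val] val
  by (cases "face i s = []") (simp_all add: lookup_cochain_of[OF K])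

lemma cochain_complex_simps:
  "basis (cochain_complex K) = ordered_simplices K"
  "diff (cochain_complex K) n f = cochain_of K (n + 1) (\<lambda>s. \<Sum>i<length s. (-1) ^ i * Poly_Mapping.lookup f (face i s))"
  by (simp_all add: cochain_complex_def face_def)

lemma cochain_diff_hom:
  assumes K: "finite_complex K"
  shows "diff (cochain_complex K) n \<in> hom (free_Abelian_group (ordered_simplices K n)) (free_Abelian_group (ordered_simplices K (n + 1)))"
  by (rule homI)
     (auto simp: cochain_complex_simps lookup_add sum.distrib distrib_left cochain_of_add dest: subsetD[OF keys_cochain_of[OF K]])

lemma cochain_diff_diff:
  assumes K: "finite_complex K"
  shows "diff (cochain_complex K) (n + 1) (diff (cochain_complex K) n f) = 0"
proof (rule poly_mapping_eqI)
  fix s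
  let ?val = "\<lambda>s. \<Sum>i<length s. (-1) ^ i * Poly_Mapping.lookup f (face i s)"
  have "(\<Sum>i<length s. (-1) ^ i * Poly_Mapping.lookup (cochain_of K (n + 1) ?val) (face i s)) = 0"
    if s: "s \<in> ordered_simplices K (n + 1 + 1)"
  proof -
    have "(\<Sum>i<length s. (-1) ^ i * Poly_Mapping.lookup (cochain_of K (n + 1) ?val) (face i s)) =
        (\<Sum>i<length s. (-1) ^ i * (\<Sum>j<length s - 1. (-1) ^ j * Poly_Mapping.lookup f (face j (face i s))))"
      using lookup_cochain_of_face[OF K s, of _ ?val] by (intro sum.cong) (simp_all add: length_face)
    also have "\<dots> = 0" by (rule sum_face_face)
    finally show ?thesis .
  qed
  then show "Poly_Mapping.lookup (diff (cochain_complex K) (n + 1) (diff (cochain_complex K) n f)) s = Poly_Mapping.lookup 0 s"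
    by (simp add: cochain_complex_simps lookup_cochain_of[OF K])
qed

definition simplicial_map :: "'v set set \<Rightarrow> 'w set set \<Rightarrow> ('v \<Rightarrow> 'w) \<Rightarrow> bool" where
  "simplicial_map K L r \<longleftrightarrow> (\<forall>\<sigma> \<in> K. r ` \<sigma> \<in> L)"

lemma simplicial_map_ordered:
  "simplicial_map K L r \<Longrightarrow> s \<in> ordered_simplices K n \<Longrightarrow> map r s \<in> ordered_simplices L n"
  by (auto simp: simplicial_map_def ordered_simplices_def)

text \<open>\<open>cochain_of\<close> cuts the support down to simplices of K, so the source may be
  free on any I.\<close>

lemma cochain_pullback_hom:
  assumes K: "finite_complex K"
  shows "cochain_pullback K n r \<in> hom (free_Abelian_group I) (free_Abelian_group (ordered_simplices K n))"
  by (rule homI)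
     (auto simp: cochain_pullback_def lookup_add cochain_of_add dest: subsetD[OF keys_cochain_of[OF K]])

lemma cochain_diff_pullback:
  assumes K: "finite_complex K" and L: "finite_complex L" and r: "simplicial_map K L r"
    and f: "Poly_Mapping.keys f \<subseteq> ordered_simplices L n"
  shows "diff (cochain_complex K) n (cochain_pullback K n r f) = cochain_pullback K (n + 1) r (diff (cochain_complex L) n f)"
proof (rule poly_mapping_eqI)
  fix s
  have "(\<Sum>i<length s. (-1) ^ i * Poly_Mapping.lookup (cochain_of K n (\<lambda>s. Poly_Mapping.lookup f (map r s))) (face i s)) =
      (\<Sum>i<length s. (-1) ^ i * Poly_Mapping.lookup f (face i (map r s)))" if s: "s \<in> ordered_simplices K (n + 1)"
    using lookup_cochain_of_face[OF K s, of _ "\<lambda>s. Poly_Mapping.lookup f (map r s)"] lookup_Nil[OF L f]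
    by (intro sum.cong) (simp_all add: map_face)
  then show "Poly_Mapping.lookup (diff (cochain_complex K) n (cochain_pullback K n r f)) s =
      Poly_Mapping.lookup (cochain_pullback K (n + 1) r (diff (cochain_complex L) n f)) s"
    using simplicial_map_ordered[OF r, of s "n + 1"]
    by (simp add: cochain_complex_simps cochain_pullback_def lookup_cochain_of[OF K] lookup_cochain_of[OF L])
qed

lemma cochain_pullback_comp:
  assumes K: "finite_complex K" and L: "finite_complex L" and r: "simplicial_map K L r"
  shows "cochain_pullback K n r (cochain_pullback L n q f) = cochain_pullback K n (\<lambda>v. q (r v)) f"
proof (rule poly_mapping_eqI)
  fix s
  show "Poly_Mapping.lookup (cochain_pullback K n r (cochain_pullback L n q f)) s =
      Poly_Mapping.lookup (cochain_pullback K n (\<lambda>v. q (r v)) f) s"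
    using simplicial_map_ordered[OF r, of s n]
    by (simp add: cochain_pullback_def lookup_cochain_of[OF K] lookup_cochain_of[OF L] o_def)
qed

lemma cochain_prism_eq:
  "cochain_prism K n a b f = cochain_of K n (\<lambda>s. \<Sum>i<length s. (-1) ^ i * Poly_Mapping.lookup f (prism a b i s))"
  by (simp add: cochain_prism_def prism_def)

lemma cochain_prism_hom:
  assumes K: "finite_complex K"
  shows "cochain_prism K n a b \<in> hom (free_Abelian_group I) (free_Abelian_group (ordered_simplices K n))"
  by (rule homI)
     (auto simp: cochain_prism_eq lookup_add sum.distrib distrib_left cochain_of_add dest: subsetD[OF keys_cochain_of[OF K]])

lemma prism_ordered_simplices:
  assumes L: "finite_complex L" and ab: "\<And>\<sigma>. \<sigma> \<in> K \<Longrightarrow> a ` \<sigma> \<union> b ` \<sigma> \<in> L"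
    and s: "s \<in> ordered_simplices K n" "j < length s"
  shows "prism a b j s \<in> ordered_simplices L (n + 1)"
proof -
  have "prism a b j s \<noteq> []" using length_prism[OF s(2), of a b] by auto
  then have "set (prism a b j s) \<in> L"
    using L ab[of "set s"] s(1) set_prism[of a b j s] unfolding finite_complex_def ordered_simplices_def
    by (metis (mono_tags, lifting) mem_Collect_eq set_empty)
  then show ?thesis using s length_prism[OF s(2), of a b] by (simp add: ordered_simplices_def)
qed

text \<open>Contiguity, in the form that the images of \<sigma> under a and b together make a
  simplex of L, turns every prism list into a simplex of L. The differential of L can then be read
  off there, and the identity is \<open>sum_prism\<close> at each simplex of K.\<close>

theorem cochain_prism_homotopy:
  assumes K: "finite_complex K" and L: "finite_complex L" and ab: "\<And>\<sigma>. \<sigma> \<in> K \<Longrightarrow> a ` \<sigma> \<union> b ` \<sigma> \<in> L"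
  shows "diff (cochain_complex K) n (cochain_prism K n a b f) +
     cochain_prism K (n + 1) a b (diff (cochain_complex L) (n + 1) f) =
     cochain_pullback K (n + 1) b f - cochain_pullback K (n + 1) a f"
proof (rule poly_mapping_eqI)
  fix s
  let ?val = "\<lambda>s. \<Sum>j<length s. (-1) ^ j * Poly_Mapping.lookup f (prism a b j s)"
  let ?val' = "\<lambda>s. \<Sum>i<length s. (-1) ^ i * Poly_Mapping.lookup f (face i s)"
  have "(\<Sum>i<length s. (-1) ^ i * Poly_Mapping.lookup (cochain_of K n ?val) (face i s)) +
      (\<Sum>j<length s. (-1) ^ j * Poly_Mapping.lookup (cochain_of L (n + 1 + 1) ?val') (prism a b j s)) =
      Poly_Mapping.lookup f (map b s) - Poly_Mapping.lookup f (map a s)" if s: "s \<in> ordered_simplices K (n + 1)"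
  proof -
    have "(\<Sum>i<length s. (-1) ^ i * Poly_Mapping.lookup (cochain_of K n ?val) (face i s)) =
        (\<Sum>i<length s. (-1) ^ i * (\<Sum>j<length s - 1. (-1) ^ j * Poly_Mapping.lookup f (prism a b j (face i s))))"
      using lookup_cochain_of_face[OF K s, of _ ?val] by (intro sum.cong) (simp_all add: length_face)
    moreover have "(\<Sum>j<length s. (-1) ^ j * Poly_Mapping.lookup (cochain_of L (n + 1 + 1) ?val') (prism a b j s)) =
        (\<Sum>j<length s. (-1) ^ j * (\<Sum>i<Suc (length s). (-1) ^ i * Poly_Mapping.lookup f (face i (prism a b j s))))"
      using prism_ordered_simplices[OF L ab s]
      by (intro sum.cong) (simp_all add: lookup_cochain_of[OF L] length_prism del: sum.lessThan_Suc)
    ultimately show ?thesis using sum_prism[where s=s and f="Poly_Mapping.lookup f" and a=a and b=b] by simp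
  qed
  then show "Poly_Mapping.lookup (diff (cochain_complex K) n (cochain_prism K n a b f) +
     cochain_prism K (n + 1) a b (diff (cochain_complex L) (n + 1) f)) s =
     Poly_Mapping.lookup (cochain_pullback K (n + 1) b f - cochain_pullback K (n + 1) a f) s"
    by (simp add: cochain_complex_simps cochain_prism_eq cochain_pullback_def lookup_add lookup_minus
        lookup_cochain_of[OF K] del: sum.lessThan_Suc)
qed

section \<open>Homotopy colimits\<close>

lemma sgn_pow_Suc: "sgn_pow (n + 1) = - sgn_pow n"
  by (simp add: sgn_pow_def)

lemma frag_cmul_diff2: "frag_cmul c (a - b) = frag_cmul c a - frag_cmul c b"
  by (rule poly_mapping_eqI) (simp add: lookup_minus algebra_simps)

lemma frag_cmul_neg: "frag_cmul (- c) a = - frag_cmul c a"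
  by (rule poly_mapping_eqI) simp

lemma hocolim_basis: "basis (hocolim A \<eta>) n =
    (\<Union>l. Between l ` basis (A l) (n + 1)) \<union> (\<Union>l. At l ` basis (A l) n)"
  by (simp add: hocolim_def)

locale telescope =
  fixes A :: "nat \<Rightarrow> 'b free_complex" and \<eta> :: "nat \<Rightarrow> int \<Rightarrow> ('b \<Rightarrow>\<^sub>0 int) \<Rightarrow> ('b \<Rightarrow>\<^sub>0 int)"
  assumes complexes: "free_cochain_complex (A l)" and maps: "cochain_hom (A l) (A (Suc l)) (\<eta> l)"
begin

abbreviation H where "H \<equiv> hocolim A \<eta>"

lemmas AD = free_cochain_complexD[OF complexes] and \<eta>D = cochain_homD[OF maps]

lemma at_hom: "at_elem l \<in> hom (free_Abelian_group (basis (A l) n)) (free_Abelian_group (basis H n))"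
  by (rule frag_extend_in_hom) (auto simp: hocolim_basis)

lemma between_hom: "between_elem l \<in> hom (free_Abelian_group (basis (A l) (n + 1))) (free_Abelian_group (basis H n))"
  by (rule frag_extend_in_hom) (auto simp: hocolim_basis)

lemma diff_frag:
  "diff H n (frag_of (At l z)) = at_elem l (diff (A l) n (frag_of z))"
  "diff H n (frag_of (Between l w)) = between_elem l (diff (A l) (n + 1) (frag_of w)) +
     frag_cmul (sgn_pow n) (at_elem l (frag_of w) - at_elem (Suc l) (\<eta> l (n + 1) (frag_of w)))"
  by (simp_all add: hocolim_def)

lemma diff_diff: "diff H n (x - y) = diff H n x - diff H n y"
  and diff_add: "diff H n (x + y) = diff H n x + diff H n y"
  and diff_cmul: "diff H n (frag_cmul c x) = frag_cmul c (diff H n x)"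
  and diff_zero: "diff H n 0 = 0"
  and diff_sum: "finite I \<Longrightarrow> diff H n (sum g I) = (\<Sum>i\<in>I. diff H n (g i))"
  by (simp_all add: hocolim_def frag_extend_diff frag_extend_add frag_extend_cmul frag_extend_sum o_def)

lemma diff_at:
  assumes "Poly_Mapping.keys x \<subseteq> basis (A l) n"
  shows "diff H n (at_elem l x) = at_elem l (diff (A l) n x)"
  by (rule free_Abelian_group_induct[OF assms])
     (simp_all add: frag_extend_diff diff_diff diff_zero hom_frag_zero[OF AD(2)] hom_frag_diff[OF AD(2)] diff_frag)

lemma diff_between:
  assumes "Poly_Mapping.keys w \<subseteq> basis (A l) (n + 1)"
  shows "diff H n (between_elem l w) = between_elem l (diff (A l) (n + 1) w) +
     frag_cmul (sgn_pow n) (at_elem l w - at_elem (Suc l) (\<eta> l (n + 1) w))"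
proof (rule free_Abelian_group_induct[OF assms])
  fix x y assume "Poly_Mapping.keys x \<subseteq> basis (A l) (n + 1)" "Poly_Mapping.keys y \<subseteq> basis (A l) (n + 1)"
    "diff H n (between_elem l x) = between_elem l (diff (A l) (n + 1) x) +
     frag_cmul (sgn_pow n) (at_elem l x - at_elem (Suc l) (\<eta> l (n + 1) x))"
    "diff H n (between_elem l y) = between_elem l (diff (A l) (n + 1) y) +
     frag_cmul (sgn_pow n) (at_elem l y - at_elem (Suc l) (\<eta> l (n + 1) y))"
  then show "diff H n (between_elem l (x - y)) = between_elem l (diff (A l) (n + 1) (x - y)) +
     frag_cmul (sgn_pow n) (at_elem l (x - y) - at_elem (Suc l) (\<eta> l (n + 1) (x - y)))"
    by (simp add: frag_extend_diff diff_diff hom_frag_diff[OF AD(2)] hom_frag_diff[OF \<eta>D(1)] frag_cmul_diff2)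
qed (simp_all add: diff_zero hom_frag_zero[OF AD(2)] hom_frag_zero[OF \<eta>D(1)] diff_frag)

lemma diff_keys_frag:
  assumes "c \<in> basis H n"
  shows "Poly_Mapping.keys (diff H n (frag_of c)) \<subseteq> basis H (n + 1)"
proof (cases c)
  case (At l z)
  with assms have z: "Poly_Mapping.keys (frag_of z) \<subseteq> basis (A l) n" by (auto simp: hocolim_basis)
  show ?thesis
    unfolding At diff_frag by (intro hom_frag_keys[OF at_hom] hom_frag_keys[OF AD(2)] z)
next
  case (Between l w)
  with assms have w: "Poly_Mapping.keys (frag_of w) \<subseteq> basis (A l) (n + 1)" by (auto simp: hocolim_basis)
  have 1: "Poly_Mapping.keys (between_elem l (diff (A l) (n + 1) (frag_of w))) \<subseteq> basis H (n + 1)"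
    by (intro hom_frag_keys[OF between_hom] hom_frag_keys[OF AD(2)] w)
  have 2: "Poly_Mapping.keys (at_elem l (frag_of w)) \<subseteq> basis H (n + 1)"
    "Poly_Mapping.keys (at_elem (Suc l) (\<eta> l (n + 1) (frag_of w))) \<subseteq> basis H (n + 1)"
    by (intro hom_frag_keys[OF at_hom] hom_frag_keys[OF \<eta>D(1)] w)+
  show ?thesis
    unfolding Between diff_frag
    by (intro subset_trans[OF keys_add] subset_trans[OF keys_cmul] subset_trans[OF keys_diff] Un_least 1 2)
qed

lemma diff_hom: "diff H n \<in> hom (free_Abelian_group (basis H n)) (free_Abelian_group (basis H (n + 1)))"
proof -
  have "diff H n = frag_extend (\<lambda>c. diff H n (frag_of c))" by (simp add: hocolim_def)
  moreover have "frag_extend (\<lambda>c. diff H n (frag_of c)) \<in> hom (free_Abelian_group (basis H n)) (free_Abelian_group (basis H (n + 1)))"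
    by (rule frag_extend_in_hom) (rule diff_keys_frag)
  ultimately show ?thesis by simp
qed

lemma diff_comp_frag:
  assumes "c \<in> basis H n"
  shows "diff H (n + 1) (diff H n (frag_of c)) = 0"
proof (cases c)
  case (At l z)
  with assms have z: "Poly_Mapping.keys (frag_of z) \<subseteq> basis (A l) n" by (auto simp: hocolim_basis)
  show ?thesis
    unfolding At diff_frag diff_at[OF hom_frag_keys[OF AD(2) z]] by (simp add: AD(4)[OF z])
next
  case (Between l w)
  with assms have w: "Poly_Mapping.keys (frag_of w) \<subseteq> basis (A l) (n + 1)" by (auto simp: hocolim_basis)
  have dw: "Poly_Mapping.keys (diff (A l) (n + 1) (frag_of w)) \<subseteq> basis (A l) (n + 1 + 1)"
    by (rule hom_frag_keys[OF AD(2) w])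
  have \<eta>w: "Poly_Mapping.keys (\<eta> l (n + 1) (frag_of w)) \<subseteq> basis (A (Suc l)) (n + 1)"
    by (rule hom_frag_keys[OF \<eta>D(1) w])
  have "diff H (n + 1) (diff H n (frag_of c)) =
      between_elem l (diff (A l) (n + 1 + 1) (diff (A l) (n + 1) (frag_of w))) +
      frag_cmul (sgn_pow (n + 1)) (at_elem l (diff (A l) (n + 1) (frag_of w)) -
        at_elem (Suc l) (\<eta> l (n + 1 + 1) (diff (A l) (n + 1) (frag_of w)))) +
      frag_cmul (sgn_pow n) (at_elem l (diff (A l) (n + 1) (frag_of w)) -
        at_elem (Suc l) (diff (A (Suc l)) (n + 1) (\<eta> l (n + 1) (frag_of w))))"
    by (simp only: Between diff_frag(2) diff_add diff_cmul diff_diff diff_between[OF dw] diff_at[OF w] diff_at[OF \<eta>w])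
  \<comment> \<open>The two middle terms are opposite because \<open>sgn_pow\<close> changes sign
    with the degree, once \<eta> has been moved past the differential.\<close>
  also have "\<dots> = 0"
    by (simp only: AD(4)[OF w] \<eta>D(2)[OF w] sgn_pow_Suc frag_cmul_neg frag_extend_0 add_0_left ab_left_minus)
  finally show ?thesis .
qed

theorem free_cochain_complex_hocolim: "free_cochain_complex H"
  unfolding free_cochain_complex_def
proof (intro allI conjI impI)
  fix n
  show "countable (basis H n)" using AD(1) by (simp add: hocolim_basis)
  show "diff H n \<in> hom (free_Abelian_group (basis H n)) (free_Abelian_group (basis H (n + 1)))" by (rule diff_hom)
  fix x :: "'b tel \<Rightarrow>\<^sub>0 int" assume "Poly_Mapping.keys x \<subseteq> basis H n"
  then show "diff H (n + 1) (diff H n x) = 0"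
    by (rule free_Abelian_group_induct) (simp_all add: diff_zero diff_diff diff_comp_frag)
qed

end

section \<open>Maps between telescopes\<close>

text \<open>A map of telescopes along a reindexing k of the stages. Stage m of B maps to the stages
  k m + d of A up to k (m + 1), in strict compatibility with \<eta>. At the last of them it meets
  the map from stage m + 1 only up to the homotopy h.\<close>

locale telescope_map =
  A: telescope A \<eta> + B: telescope B \<theta>
  for A :: "nat \<Rightarrow> 'a free_complex" and \<eta> and B :: "nat \<Rightarrow> 'b free_complex" and \<theta> +
  fixes k :: "nat \<Rightarrow> nat" and p :: "nat \<Rightarrow> nat \<Rightarrow> int \<Rightarrow> ('b \<Rightarrow>\<^sub>0 int) \<Rightarrow> ('a \<Rightarrow>\<^sub>0 int)"
    and h :: "nat \<Rightarrow> int \<Rightarrow> ('b \<Rightarrow>\<^sub>0 int) \<Rightarrow> ('a \<Rightarrow>\<^sub>0 int)"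
  assumes mono: "k m \<le> k (Suc m)"
    and p: "d \<le> k (Suc m) - k m \<Longrightarrow> cochain_hom (B m) (A (k m + d)) (p m d)"
    and p_Suc: "d < k (Suc m) - k m \<Longrightarrow> Poly_Mapping.keys x \<subseteq> basis (B m) n \<Longrightarrow> \<eta> (k m + d) n (p m d n x) = p m (Suc d) n x"
    and h: "h m n \<in> hom (free_Abelian_group (basis (B m) (n + 1))) (free_Abelian_group (basis (A (k (Suc m))) n))"
    and homotopy: "Poly_Mapping.keys w \<subseteq> basis (B m) (n + 1) \<Longrightarrow>
      diff (A (k (Suc m))) n (h m n w) + h m (n + 1) (diff (B m) (n + 1) w) =
      p (Suc m) 0 (n + 1) (\<theta> m (n + 1) w) - p m (k (Suc m) - k m) (n + 1) w"
begin

definition tmap :: "int \<Rightarrow> ('b tel \<Rightarrow>\<^sub>0 int) \<Rightarrow> ('a tel \<Rightarrow>\<^sub>0 int)" where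
  "tmap n = frag_extend (\<lambda>c. case c of
       At m z \<Rightarrow> at_elem (k m) (p m 0 n (frag_of z))
     | Between m w \<Rightarrow> (\<Sum>d<k (Suc m) - k m. between_elem (k m + d) (p m d (n + 1) (frag_of w))) +
         frag_cmul (sgn_pow (n + 1)) (at_elem (k (Suc m)) (h m n (frag_of w))))"

lemmas pD = cochain_homD[OF p]

lemma p0D:
  "p m 0 n \<in> hom (free_Abelian_group (basis (B m) n)) (free_Abelian_group (basis (A (k m)) n))"
  "Poly_Mapping.keys x \<subseteq> basis (B m) n \<Longrightarrow> diff (A (k m)) n (p m 0 n x) = p m 0 (n + 1) (diff (B m) n x)"
  using pD(1)[of 0 m n] pD(2)[of 0 m x n] by simp_all

lemma tmap_frag:
  "tmap n (frag_of (At m z)) = at_elem (k m) (p m 0 n (frag_of z))"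
  "tmap n (frag_of (Between m w)) = (\<Sum>d<k (Suc m) - k m. between_elem (k m + d) (p m d (n + 1) (frag_of w))) +
     frag_cmul (sgn_pow (n + 1)) (at_elem (k (Suc m)) (h m n (frag_of w)))"
  by (simp_all add: tmap_def)

lemma tmap_linear: "tmap n (x - y) = tmap n x - tmap n y" "tmap n (x + y) = tmap n x + tmap n y"
  "tmap n (frag_cmul c x) = frag_cmul c (tmap n x)" "tmap n 0 = 0"
  by (simp_all add: tmap_def frag_extend_diff frag_extend_add frag_extend_cmul)

lemma tmap_at:
  assumes "Poly_Mapping.keys x \<subseteq> basis (B m) n"
  shows "tmap n (at_elem m x) = at_elem (k m) (p m 0 n x)"
  by (rule free_Abelian_group_induct[OF assms])
     (simp_all add: frag_extend_diff tmap_linear hom_frag_zero[OF p0D(1)] hom_frag_diff[OF p0D(1)] tmap_frag)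

lemma tmap_between:
  assumes "Poly_Mapping.keys w \<subseteq> basis (B m) (n + 1)"
  shows "tmap n (between_elem m w) = (\<Sum>d<k (Suc m) - k m. between_elem (k m + d) (p m d (n + 1) w)) +
     frag_cmul (sgn_pow (n + 1)) (at_elem (k (Suc m)) (h m n w))"
proof (rule free_Abelian_group_induct[OF assms])
  have "p m d (n + 1) 0 = 0" if "d < k (Suc m) - k m" for d
    using hom_frag_zero[OF pD(1)] that by simp
  then show "tmap n (between_elem m 0) = (\<Sum>d<k (Suc m) - k m. between_elem (k m + d) (p m d (n + 1) 0)) +
     frag_cmul (sgn_pow (n + 1)) (at_elem (k (Suc m)) (h m n 0))"
    by (simp add: tmap_linear hom_frag_zero[OF h])
next
  fix x y assume xy: "Poly_Mapping.keys x \<subseteq> basis (B m) (n + 1)" "Poly_Mapping.keys y \<subseteq> basis (B m) (n + 1)"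
    and eqs: "tmap n (between_elem m x) = (\<Sum>d<k (Suc m) - k m. between_elem (k m + d) (p m d (n + 1) x)) +
     frag_cmul (sgn_pow (n + 1)) (at_elem (k (Suc m)) (h m n x))"
    "tmap n (between_elem m y) = (\<Sum>d<k (Suc m) - k m. between_elem (k m + d) (p m d (n + 1) y)) +
     frag_cmul (sgn_pow (n + 1)) (at_elem (k (Suc m)) (h m n y))"
  have "p m d (n + 1) (x - y) = p m d (n + 1) x - p m d (n + 1) y" if "d < k (Suc m) - k m" for d
    using hom_frag_diff[OF pD(1) xy] that by simp
  then show "tmap n (between_elem m (x - y)) = (\<Sum>d<k (Suc m) - k m. between_elem (k m + d) (p m d (n + 1) (x - y))) +
     frag_cmul (sgn_pow (n + 1)) (at_elem (k (Suc m)) (h m n (x - y)))"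
    using eqs hom_frag_diff[OF h xy]
    by (simp add: frag_extend_diff tmap_linear sum_subtractf frag_cmul_diff2)
qed (simp add: tmap_frag)

lemma tmap_hom: "tmap n \<in> hom (free_Abelian_group (basis B.H n)) (free_Abelian_group (basis A.H n))"
proof -
  have keys: "Poly_Mapping.keys (tmap n (frag_of c)) \<subseteq> basis A.H n" if c: "c \<in> basis B.H n" for c
  proof (cases c)
    case (At m z)
    with c have z: "Poly_Mapping.keys (frag_of z) \<subseteq> basis (B m) n" by (auto simp: hocolim_basis)
    show ?thesis unfolding At tmap_frag by (intro hom_frag_keys[OF A.at_hom] hom_frag_keys[OF p0D(1)] z)
  next
    case (Between m w)
    with c have w: "Poly_Mapping.keys (frag_of w) \<subseteq> basis (B m) (n + 1)" by (auto simp: hocolim_basis)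
    have "Poly_Mapping.keys (between_elem (k m + d) (p m d (n + 1) (frag_of w))) \<subseteq> basis A.H n"
      if "d < k (Suc m) - k m" for d
      by (rule hom_frag_keys[OF A.between_hom hom_frag_keys[OF pD(1) w]]) (use that in simp)
    then have 1: "Poly_Mapping.keys (\<Sum>d<k (Suc m) - k m. between_elem (k m + d) (p m d (n + 1) (frag_of w))) \<subseteq> basis A.H n"
      using sum_closed_free_Abelian_group[of "{..<k (Suc m) - k m}"
          "\<lambda>d. between_elem (k m + d) (p m d (n + 1) (frag_of w))" "basis A.H n"] by simp
    have 2: "Poly_Mapping.keys (at_elem (k (Suc m)) (h m n (frag_of w))) \<subseteq> basis A.H n"
      by (intro hom_frag_keys[OF A.at_hom] hom_frag_keys[OF h] w)
    show ?thesis
      unfolding Between tmap_frag by (intro subset_trans[OF keys_add] subset_trans[OF keys_cmul] Un_least 1 2)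
  qed
  have "tmap n = frag_extend (\<lambda>c. tmap n (frag_of c))" by (simp add: tmap_def)
  moreover have "frag_extend (\<lambda>c. tmap n (frag_of c)) \<in> hom (free_Abelian_group (basis B.H n)) (free_Abelian_group (basis A.H n))"
    by (rule frag_extend_in_hom) (rule keys)
  ultimately show ?thesis by simp
qed

text \<open>Along the segment from k m to k (m + 1) the ends of the single pieces telescope. The end
  left over at k (m + 1) comes from stage m, whereas the differential of B asks for the one from
  stage m + 1; the summand with h in \<open>tmap\<close> pays for the exchange.\<close>

lemma tmap_chain_between:
  assumes w: "Poly_Mapping.keys w \<subseteq> basis (B m) (n + 1)"
  shows "diff A.H n (tmap n (between_elem m w)) = tmap (n + 1) (diff B.H n (between_elem m w))"
proof -
  let ?D = "k (Suc m) - k m"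
  define T where "T d = at_elem (k m + d) (p m d (n + 1) w)" for d
  let ?dw = "diff (B m) (n + 1) w"
  have dw: "Poly_Mapping.keys ?dw \<subseteq> basis (B m) (n + 1 + 1)" by (rule hom_frag_keys[OF B.AD(2) w])
  have \<theta>w: "Poly_Mapping.keys (\<theta> m (n + 1) w) \<subseteq> basis (B (Suc m)) (n + 1)" by (rule hom_frag_keys[OF B.\<eta>D(1) w])
  have hw: "Poly_Mapping.keys (h m n w) \<subseteq> basis (A (k (Suc m))) n" by (rule hom_frag_keys[OF h w])
  have step: "diff A.H n (between_elem (k m + d) (p m d (n + 1) w)) =
      between_elem (k m + d) (p m d (n + 1 + 1) ?dw) + frag_cmul (sgn_pow n) (T d - T (Suc d))"
    if d: "d < ?D" for d
  proof -
    have pw: "Poly_Mapping.keys (p m d (n + 1) w) \<subseteq> basis (A (k m + d)) (n + 1)"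
      by (rule hom_frag_keys[OF pD(1) w]) (use d in simp)
    show ?thesis
      using A.diff_between[OF pw] pD(2)[OF _ w, of d] p_Suc[OF d w] d by (simp add: T_def)
  qed
  have "diff A.H n (tmap n (between_elem m w)) =
      (\<Sum>d<?D. diff A.H n (between_elem (k m + d) (p m d (n + 1) w))) +
      frag_cmul (sgn_pow (n + 1)) (at_elem (k (Suc m)) (diff (A (k (Suc m))) n (h m n w)))"
    unfolding tmap_between[OF w] A.diff_add A.diff_cmul A.diff_at[OF hw] by (simp add: A.diff_sum)
  also have "(\<Sum>d<?D. diff A.H n (between_elem (k m + d) (p m d (n + 1) w))) =
      (\<Sum>d<?D. between_elem (k m + d) (p m d (n + 1 + 1) ?dw)) + frag_cmul (sgn_pow n) (T 0 - T ?D)"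
    by (simp add: step sum.distrib sum_lessThan_telescope' flip: frag_cmul_sum)
  also have "T ?D = at_elem (k (Suc m)) (p m ?D (n + 1) w)" using mono[of m] by (simp add: T_def)
  also have "p m ?D (n + 1) w = p (Suc m) 0 (n + 1) (\<theta> m (n + 1) w) - (diff (A (k (Suc m))) n (h m n w) + h m (n + 1) ?dw)"
    using homotopy[OF w] by (simp add: algebra_simps)
  finally have 1: "diff A.H n (tmap n (between_elem m w)) =
      (\<Sum>d<?D. between_elem (k m + d) (p m d (n + 1 + 1) ?dw)) +
      frag_cmul (sgn_pow n) (T 0 - at_elem (k (Suc m)) (p (Suc m) 0 (n + 1) (\<theta> m (n + 1) w))
        + at_elem (k (Suc m)) (h m (n + 1) ?dw))"
    by (simp add: frag_extend_diff frag_extend_add sgn_pow_Suc frag_cmul_neg frag_cmul_diff2 frag_cmul_distrib2 del: minus_frag_cmul)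
  have 2: "tmap (n + 1) (diff B.H n (between_elem m w)) =
      (\<Sum>d<?D. between_elem (k m + d) (p m d (n + 1 + 1) ?dw)) +
      frag_cmul (sgn_pow (n + 1 + 1)) (at_elem (k (Suc m)) (h m (n + 1) ?dw)) +
      frag_cmul (sgn_pow n) (T 0 - at_elem (k (Suc m)) (p (Suc m) 0 (n + 1) (\<theta> m (n + 1) w)))"
    unfolding B.diff_between[OF w] tmap_linear tmap_between[OF dw] tmap_at[OF w] tmap_at[OF \<theta>w] by (simp add: T_def)
  have 3: "sgn_pow (n + 1 + 1) = sgn_pow n" by (simp add: sgn_pow_def)
  show ?thesis
    unfolding 1 2 3 frag_cmul_distrib2 by (simp only: add_ac)
qed

theorem cochain_hom_tmap: "cochain_hom B.H A.H tmap"
  unfolding cochain_hom_def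
proof (intro allI conjI impI)
  fix n
  show "tmap n \<in> hom (free_Abelian_group (basis B.H n)) (free_Abelian_group (basis A.H n))" by (rule tmap_hom)
  fix x :: "'b tel \<Rightarrow>\<^sub>0 int" assume "Poly_Mapping.keys x \<subseteq> basis B.H n"
  then show "diff A.H n (tmap n x) = tmap (n + 1) (diff B.H n x)"
  proof (rule free_Abelian_group_induct)
    show "diff A.H n (tmap n 0) = tmap (n + 1) (diff B.H n 0)" by (simp add: A.diff_zero B.diff_zero tmap_linear)
    show "diff A.H n (tmap n (x - y)) = tmap (n + 1) (diff B.H n (x - y))"
      if "diff A.H n (tmap n x) = tmap (n + 1) (diff B.H n x)" "diff A.H n (tmap n y) = tmap (n + 1) (diff B.H n y)" for x y
      using that by (simp add: A.diff_diff B.diff_diff tmap_linear)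
    fix c assume c: "c \<in> basis B.H n"
    show "diff A.H n (tmap n (frag_of c)) = tmap (n + 1) (diff B.H n (frag_of c))"
    proof (cases c)
      case (At m z)
      with c have z: "Poly_Mapping.keys (frag_of z) \<subseteq> basis (B m) n" by (auto simp: hocolim_basis)
      show ?thesis
        unfolding At tmap_frag B.diff_frag A.diff_at[OF hom_frag_keys[OF p0D(1) z]] p0D(2)[OF z]
          tmap_at[OF hom_frag_keys[OF B.AD(2) z]] ..
    next
      case (Between m w)
      with c have w: "Poly_Mapping.keys (frag_of w) \<subseteq> basis (B m) (n + 1)" by (auto simp: hocolim_basis)
      show ?thesis using tmap_chain_between[OF w] by (simp add: Between)
    qed
  qed
qed

end

section \<open>Cochains of compact metrizable spaces\<close>

lemma finite_complex_nerve:
  assumes "finite U"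
  shows "finite_complex (nerve U)"
  unfolding finite_complex_def
proof (intro conjI ballI allI impI)
  show "finite (\<Union>(nerve U))" by (rule finite_subset[OF _ assms]) (auto simp: nerve_def)
  show "{} \<notin> nerve U" by (simp add: nerve_def)
  fix \<sigma> \<tau> assume "\<sigma> \<in> nerve U" "\<tau> \<subseteq> \<sigma>" "\<tau> \<noteq> {}"
  then show "\<tau> \<in> nerve U" unfolding nerve_def using Inter_anti_mono[of \<tau> \<sigma>] by (auto intro: finite_subset)
qed

text \<open>One point serves for all: if x lies in every member of \<sigma>, then f x lies in every
  r u and every q u. With r = q this says that r is simplicial, and in general that r and q are
  contiguous.\<close>

lemma nerve_image_Un:
  assumes \<sigma>: "\<sigma> \<in> nerve U" and r: "\<And>u. u \<in> U \<Longrightarrow> r u \<in> V \<and> f ` u \<subseteq> r u" and q: "\<And>u. u \<in> U \<Longrightarrow> q u \<in> V \<and> f ` u \<subseteq> q u"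
  shows "r ` \<sigma> \<union> q ` \<sigma> \<in> nerve V"
proof -
  have s: "\<sigma> \<subseteq> U" "finite \<sigma>" "\<sigma> \<noteq> {}" using \<sigma> by (auto simp: nerve_def)
  obtain x where x: "x \<in> \<Inter>\<sigma>" using \<sigma> by (auto simp: nerve_def)
  have "f x \<in> v" if v: "v \<in> r ` \<sigma> \<union> q ` \<sigma>" for v
  proof -
    obtain u where u: "u \<in> \<sigma>" "v = r u \<or> v = q u" using v by auto
    then have "f x \<in> f ` u" using x by auto
    then show ?thesis using u s(1) r[of u] q[of u] by blast
  qed
  then have "\<Inter>(r ` \<sigma> \<union> q ` \<sigma>) \<noteq> {}" by blast
  moreover have "r ` \<sigma> \<union> q ` \<sigma> \<subseteq> V" using s(1) r q by blast
  ultimately show ?thesis unfolding nerve_def using s(2,3) by simp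
qed

lemma simplicial_map_nerve:
  assumes "\<And>u. u \<in> U \<Longrightarrow> r u \<in> V \<and> f ` u \<subseteq> r u"
  shows "simplicial_map (nerve U) (nerve V) r"
  unfolding simplicial_map_def using nerve_image_Un[where r=r and q=r and f=f and V=V and U=U] assms by simp

lemma free_cochain_complex_cochain_complex:
  assumes "finite_complex K"
  shows "free_cochain_complex (cochain_complex K)"
  unfolding free_cochain_complex_def
  using cochain_diff_hom[OF assms] cochain_diff_diff[OF assms] countable_finite[OF finite_ordered_simplices[OF assms]]
  by (simp add: cochain_complex_simps(1))

lemma cochain_hom_pullback:
  assumes "finite_complex K" "finite_complex L" "simplicial_map K L r"
  shows "cochain_hom (cochain_complex L) (cochain_complex K) (\<lambda>n. cochain_pullback K n r)"
  unfolding cochain_hom_def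
  by (simp add: cochain_complex_simps(1) cochain_pullback_hom[OF assms(1)] cochain_diff_pullback[OF assms])

lemma compact_metrizable_presentedD:
  assumes "compact_metrizable_presented X"
  shows "finite_complex (nerve (covers X m))"
    "u \<in> covers X (Suc m) \<Longrightarrow> refine X m u \<in> covers X m \<and> u \<subseteq> refine X m u"
    "simplicial_map (nerve (covers X (Suc m))) (nerve (covers X m)) (refine X m)"
    "free_resolution (cohomology (cochains X) n) (res X n)"
proof -
  have r: "u \<in> covers X (Suc m) \<Longrightarrow> refine X m u \<in> covers X m \<and> u \<subseteq> refine X m u" for u
    using assms by (simp add: compact_metrizable_presented_def)
  then show "u \<in> covers X (Suc m) \<Longrightarrow> refine X m u \<in> covers X m \<and> u \<subseteq> refine X m u" .
  show "simplicial_map (nerve (covers X (Suc m))) (nerve (covers X m)) (refine X m)"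
    using r by (intro simplicial_map_nerve[where f="\<lambda>x. x"]) simp
  have "finite_open_cover (sp X) (covers X m)"
    using assms by (simp add: compact_metrizable_presented_def)
  then show "finite_complex (nerve (covers X m))"
    by (intro finite_complex_nerve) (simp add: finite_open_cover_def)
  show "free_resolution (cohomology (cochains X) n) (res X n)"
    using assms by (simp add: compact_metrizable_presented_def Cech_cohomology_def)
qed

lemma telescope_cochains:
  assumes "compact_metrizable_presented X"
  shows "telescope (\<lambda>m. cochain_complex (nerve (covers X m)))
    (\<lambda>m n. cochain_pullback (nerve (covers X (Suc m))) n (refine X m))"
  by unfold_locales
     (intro free_cochain_complex_cochain_complex cochain_hom_pullback compact_metrizable_presentedD[OF assms])+

lemma free_cochain_complex_cochains:
  assumes "compact_metrizable_presented X"
  shows "free_cochain_complex (cochains X)"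
  unfolding cochains_def by (rule telescope.free_cochain_complex_hocolim[OF telescope_cochains[OF assms]])

lemma refine_by_covers:
  assumes X: "compact_metrizable_presented X" and "u \<in> covers X (l + d)"
  shows "refine_by (refine X) l d u \<in> covers X l \<and> u \<subseteq> refine_by (refine X) l d u"
  using assms(2)
proof (induction d arbitrary: u)
  case (Suc d)
  have "refine X (l + d) u \<in> covers X (l + d)" "u \<subseteq> refine X (l + d) u"
    using compact_metrizable_presentedD(2)[OF X, of u "l + d"] Suc.prems by simp_all
  then show ?case using Suc.IH[of "refine X (l + d) u"] by auto
qed simp

text \<open>The vertex maps q m d are \<phi> m after refinement in X, so they commute strictly with
  the refinement maps of X. At level k (m + 1), q m and \<open>refine Y m\<close> after \<phi> (m +
  1) both send u to a member of \<open>covers Y m\<close> that contains the image of u; hence they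
  are contiguous, and the prism operator supplies the homotopy.\<close>

theorem cochain_hom_cochain_map:
  assumes X: "compact_metrizable_presented X" and Y: "compact_metrizable_presented Y" and f: "cover_map X Y f k \<phi>"
  shows "cochain_hom (cochains Y) (cochains X) (cochain_map X Y k \<phi>)"
proof -
  let ?KX = "\<lambda>m. nerve (covers X m)" and ?KY = "\<lambda>m. nerve (covers Y m)"
  note XD = compact_metrizable_presentedD[OF X] and YD = compact_metrizable_presentedD[OF Y]
  have mono: "k m \<le> k (Suc m)" for m using f by (simp add: cover_map_def mono_def)
  have \<phi>: "\<phi> m u \<in> covers Y m \<and> f ` u \<subseteq> \<phi> m u" if "u \<in> covers X (k m)" for m u
    using f that by (simp add: cover_map_def)
  define q where "q m d u = \<phi> m (refine_by (refine X) (k m) d u)" for m d u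
  have q: "q m d u \<in> covers Y m \<and> f ` u \<subseteq> q m d u" if "u \<in> covers X (k m + d)" for m d u
  proof -
    have r: "refine_by (refine X) (k m) d u \<in> covers X (k m)" "u \<subseteq> refine_by (refine X) (k m) d u"
      using refine_by_covers[OF X that] by simp_all
    then show ?thesis using \<phi>[OF r(1)] image_mono[OF r(2), of f] by (auto simp: q_def)
  qed
  have q_fun: "q = (\<lambda>m d u. \<phi> m (refine_by (refine X) (k m) d u))"
    by (simp add: q_def fun_eq_iff)
  have q0: "q m 0 = \<phi> m" and qS: "q m (Suc d) = (\<lambda>u. q m d (refine X (k m + d) u))" for m d
    by (simp_all add: q_def fun_eq_iff)
  have qs: "simplicial_map (?KX (k m + d)) (?KY m) (q m d)" for m d
    by (rule simplicial_map_nerve[where f=f]) (rule q)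
  have \<phi>s: "simplicial_map (?KX (k m)) (?KY m) (\<phi> m)" for m
    by (rule simplicial_map_nerve[where f=f]) (rule \<phi>)
  let ?b = "\<lambda>m u. refine Y m (\<phi> (Suc m) u)"
  have b: "?b m u \<in> covers Y m \<and> f ` u \<subseteq> ?b m u" if "u \<in> covers X (k (Suc m))" for m u
    using \<phi>[OF that] YD(2)[of "\<phi> (Suc m) u" m] by auto
  have D: "k m + (k (Suc m) - k m) = k (Suc m)" for m using mono[of m] by simp
  interpret T: telescope_map "\<lambda>m. cochain_complex (?KX m)" "\<lambda>m n. cochain_pullback (?KX (Suc m)) n (refine X m)"
    "\<lambda>m. cochain_complex (?KY m)" "\<lambda>m n. cochain_pullback (?KY (Suc m)) n (refine Y m)" k
    "\<lambda>m d n. cochain_pullback (?KX (k m + d)) n (q m d)"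
    "\<lambda>m n. cochain_prism (?KX (k (Suc m))) n (q m (k (Suc m) - k m)) (?b m)"
  proof (intro telescope_map.intro telescope_map_axioms.intro telescope_cochains X Y)
    show "k m \<le> k (Suc m)" for m by (rule mono)
    show "cochain_hom (cochain_complex (?KY m)) (cochain_complex (?KX (k m + d))) (\<lambda>n. cochain_pullback (?KX (k m + d)) n (q m d))"
      for m d by (intro cochain_hom_pullback XD YD qs)
    show "cochain_pullback (?KX (Suc (k m + d))) n (refine X (k m + d)) (cochain_pullback (?KX (k m + d)) n (q m d) x) =
        cochain_pullback (?KX (k m + Suc d)) n (q m (Suc d)) x" for m d n x
      using cochain_pullback_comp[OF XD(1) XD(1) XD(3), of "k m + d" n "q m d" x] by (simp add: qS)
    show "cochain_prism (?KX (k (Suc m))) n (q m (k (Suc m) - k m)) (?b m)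
        \<in> hom (free_Abelian_group (basis (cochain_complex (?KY m)) (n + 1)))
            (free_Abelian_group (basis (cochain_complex (?KX (k (Suc m)))) n))" for m n
      unfolding cochain_complex_simps(1) by (rule cochain_prism_hom[OF XD(1)])
    show "diff (cochain_complex (?KX (k (Suc m)))) n (cochain_prism (?KX (k (Suc m))) n (q m (k (Suc m) - k m)) (?b m) w) +
        cochain_prism (?KX (k (Suc m))) (n + 1) (q m (k (Suc m) - k m)) (?b m) (diff (cochain_complex (?KY m)) (n + 1) w) =
        cochain_pullback (?KX (k (Suc m) + 0)) (n + 1) (q (Suc m) 0) (cochain_pullback (?KY (Suc m)) (n + 1) (refine Y m) w) -
        cochain_pullback (?KX (k m + (k (Suc m) - k m))) (n + 1) (q m (k (Suc m) - k m)) w" for m n w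
    proof -
      have "cochain_pullback (?KX (k (Suc m) + 0)) (n + 1) (q (Suc m) 0) (cochain_pullback (?KY (Suc m)) (n + 1) (refine Y m) w) =
          cochain_pullback (?KX (k (Suc m))) (n + 1) (?b m) w"
        using cochain_pullback_comp[OF XD(1) YD(1) \<phi>s, of "Suc m" "n + 1" "refine Y m" w] by (simp add: q0)
      moreover have "q m (k (Suc m) - k m) ` \<sigma> \<union> ?b m ` \<sigma> \<in> ?KY m" if "\<sigma> \<in> ?KX (k (Suc m))" for \<sigma>
        using that by (rule nerve_image_Un[where f=f]) (use q[of _ m "k (Suc m) - k m"] b D[of m] in simp_all)
      ultimately show ?thesis
        unfolding D using cochain_prism_homotopy[OF XD(1) YD(1), of "k (Suc m)"] by metis
    qed
  qed
  have "cochain_map X Y k \<phi> = T.tmap"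
    unfolding fun_eq_iff cochain_map_def T.tmap_def by (simp add: q_fun)
  then show ?thesis
    using T.cochain_hom_tmap by (simp add: cochains_def)
qed

theorem theorem7p1:
  fixes G :: "'g cover_group"
  assumes "polish_cover_group G"
  shows "\<exists>(\<iota> :: ('a, 'i, 'j) presented_space \<Rightarrow> int \<Rightarrow> ('j \<Rightarrow> 'g) set \<Rightarrow> ('a set list tel \<Rightarrow> 'g) set)
          (\<pi> :: ('a, 'i, 'j) presented_space \<Rightarrow> int \<Rightarrow> ('a set list tel \<Rightarrow> 'g) set \<Rightarrow> ('i \<Rightarrow> 'g) set).
    (\<forall>X n. compact_metrizable_presented X \<longrightarrow>
       pc_short_exact (Ext_pc (res X (n + 1)) G) (Steenrod_homology X G n) (Hom_pc (res X n) G)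
         (\<iota> X n) (\<pi> X n) \<and>
       pc_splits (Steenrod_homology X G n) (Hom_pc (res X n) G) (\<pi> X n)) \<and>
    (\<forall>X Y f k \<phi> n \<alpha> \<beta> \<alpha>' \<beta>'.
       compact_metrizable_presented X \<longrightarrow> compact_metrizable_presented Y \<longrightarrow>
       continuous_map (sp X) (sp Y) f \<longrightarrow> cover_map X Y f k \<phi> \<longrightarrow>
       resolution_lift (res Y n) (res X n)
         (cohomology_map (cochains X) n (cochain_map X Y k \<phi> n)) \<alpha> \<beta> \<longrightarrow>
       resolution_lift (res Y (n + 1)) (res X (n + 1))
         (cohomology_map (cochains X) (n + 1) (cochain_map X Y k \<phi> (n + 1))) \<alpha>' \<beta>' \<longrightarrow>
       (\<forall>c \<in> carrier (quot (Ext_pc (res X (n + 1)) G)).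
          homology_map (cochains Y) G n (cochain_map X Y k \<phi> n) (\<iota> X n c) =
          \<iota> Y n (Ext_map (res X (n + 1)) (res Y (n + 1)) G \<beta>' c)) \<and>
       (\<forall>c \<in> carrier (quot (Steenrod_homology X G n)).
          \<pi> Y n (homology_map (cochains Y) G n (cochain_map X Y k \<phi> n) c) =
          Hom_map (res X n) (res Y n) G \<alpha> (\<pi> X n c)))"
proof -
  \<comment> \<open>The choice depends on the space and the degree alone and is made before any map
    is given, as one family of morphisms has to be natural for all maps.\<close>
  define ch where "ch X n = (SOME t. uct_choice (cochains X) n (res X n) (fst t) (fst (snd t)) (snd (snd t)))"
    for X :: "('a, 'i, 'j) presented_space" and n
  define a where "a X n = fst (ch X n)" for X :: "('a, 'i, 'j) presented_space" and n
  define s where "s X n = fst (snd (ch X n))" for X :: "('a, 'i, 'j) presented_space" and n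
  define \<kappa> where "\<kappa> X n = snd (snd (ch X n))" for X :: "('a, 'i, 'j) presented_space" and n
  have choice: "uct_choice (cochains X) n (res X n) (a X n) (s X n) (\<kappa> X n)"
    if X: "compact_metrizable_presented X" for X :: "('a, 'i, 'j) presented_space" and n
  proof -
    have "\<exists>t. uct_choice (cochains X) n (res X n) (fst t) (fst (snd t)) (snd (snd t))"
      using ex_uct_choice[OF free_cochain_complex_cochains[OF X] compact_metrizable_presentedD(4)[OF X]]
      by (metis fst_conv snd_conv)
    from someI_ex[OF this] show ?thesis unfolding ch_def a_def s_def \<kappa>_def .
  qed
  \<comment> \<open>Degree n + 1, because Ext is taken of the cohomology one degree up; this
    \<kappa> starts from the cochains of degree n.\<close>
  define \<iota> where "\<iota> X n = pc_map (homology_pc (cochains X) G n) (dual_map G (basis (cochains X) n) (\<kappa> X (n + 1)))"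
    for X :: "('a, 'i, 'j) presented_space" and n
  define \<pi> where "\<pi> X n = pc_map (Hom_pc (res X n) G) (dual_map G (gens (res X n)) (a X n))"
    for X :: "('a, 'i, 'j) presented_space" and n
  show ?thesis
  proof (intro exI[of _ \<iota>] exI[of _ \<pi>] conjI allI impI ballI)
    fix X :: "('a, 'i, 'j) presented_space" and n
    assume X: "compact_metrizable_presented X"
    obtain \<gamma> \<tau> e \<gamma>' \<tau>' e' where "split_universal_coefficients G (basis (cochains X) (n - 1)) (basis (cochains X) n)
      (basis (cochains X) (n + 1)) (diff (cochains X) (n - 1)) (diff (cochains X) n) (res X n) (res X (n + 1))
      (a X n) (s X n) \<gamma> (\<kappa> X n) \<tau> e (a X (n + 1)) (s X (n + 1)) \<gamma>' (\<kappa> X (n + 1)) \<tau>' e'"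
      using uct_choice_split[OF assms free_cochain_complex_cochains[OF X] compact_metrizable_presentedD(4)[OF X]
          compact_metrizable_presentedD(4)[OF X] choice[OF X] choice[OF X]] by blast
    from split_universal_coefficients.split_exact[OF this]
    show "pc_short_exact (Ext_pc (res X (n + 1)) G) (Steenrod_homology X G n) (Hom_pc (res X n) G) (\<iota> X n) (\<pi> X n)"
      and "pc_splits (Steenrod_homology X G n) (Hom_pc (res X n) G) (\<pi> X n)"
      unfolding Steenrod_homology_def \<iota>_def \<pi>_def homology_pc_eq by simp_all
  next
    fix X Y :: "('a, 'i, 'j) presented_space" and f k \<phi> n \<alpha> \<beta> \<alpha>' \<beta>'
    assume X: "compact_metrizable_presented X" and Y: "compact_metrizable_presented Y" and f: "cover_map X Y f k \<phi>"
      and l: "resolution_lift (res Y n) (res X n) (cohomology_map (cochains X) n (cochain_map X Y k \<phi> n)) \<alpha> \<beta>"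
      and l': "resolution_lift (res Y (n + 1)) (res X (n + 1))
         (cohomology_map (cochains X) (n + 1) (cochain_map X Y k \<phi> (n + 1))) \<alpha>' \<beta>'"
    interpret uct_naturality G "cochains X" "cochains Y" "cochain_map X Y k \<phi>" n "res X n" "res X (n + 1)"
      "res Y n" "res Y (n + 1)" "a X n" "s X n" "\<kappa> X n" "a X (n + 1)" "s X (n + 1)" "\<kappa> X (n + 1)"
      "a Y n" "s Y n" "\<kappa> Y n" "a Y (n + 1)" "s Y (n + 1)" "\<kappa> Y (n + 1)" \<alpha> \<beta> \<alpha>' \<beta>'
      by (intro uct_naturality.intro assms free_cochain_complex_cochains X Y cochain_hom_cochain_map[OF X Y f]
          compact_metrizable_presentedD(4) choice l l')
    show "homology_map (cochains Y) G n (cochain_map X Y k \<phi> n) (\<iota> X n c) =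
        \<iota> Y n (Ext_map (res X (n + 1)) (res Y (n + 1)) G \<beta>' c)"
      if "c \<in> carrier (quot (Ext_pc (res X (n + 1)) G))" for c
      unfolding homology_map_def Ext_map_def \<iota>_def by (rule naturality(1)[OF that])
    show "\<pi> Y n (homology_map (cochains Y) G n (cochain_map X Y k \<phi> n) c) =
        Hom_map (res X n) (res Y n) G \<alpha> (\<pi> X n c)"
      if "c \<in> carrier (quot (Steenrod_homology X G n))" for c
      unfolding homology_map_def Hom_map_def \<pi>_def using that unfolding Steenrod_homology_def by (rule naturality(2))
  qed
qed

end
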